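(* Let $E$ be a finite directed graph with no sources and let $(G,E)$ be a countable self-similar bundle of abelian groups. Then the singular ideal $J$ of $C^*_r(\mathcal G_{(G,E)})$ vanishes if and only if the algebraic singular ideal $J_{\mathbb C}$ of $\mathbb C\mathcal G_{(G,E)}$ vanishes.
   Context: Graphs. $E=(E^0,E^1,\mathbf r,\mathbf s)$ is a finite directed graph in which every vertex $v$ satisfies $\mathbf r^{-1}(v)\neq\emptyset$ (no sources). A path $p=e_1\cdots e_n$ satisfies $\mathbf s(e_i)=\mathbf r(e_{i+1})$; $\mathbf r(p)=\mathbf r(e_1)$, $\mathbf s(p)=\mathbf s(e_n)$; vertices are the paths of length $0$. $E^*$ is the set of finite paths, $E^\omega$ the set of infinite paths $e_1e_2\cdots$; $pE^*$, $pE^\omega$ are the paths with prefix $p$. Self-similar bundle of abelian groups. $G$ is a (discrete) groupoid with unit space $E^0$ which is the union of its isotropy groups $(G)_v$, $v\in E^0$, each of which is abelian; the identity of $(G)_v$ is $v$. Each $(G)_v$ acts on $vE^*$ by length-preserving bijections, and for every $e\in E^1$ and $g\in (G)_{\mathbf r(e)}$ there is a section $g|_e\in (G)_{\mathbf s(e)}$ (so $\mathbf s(g(e))=\mathbf s(e)$) with $g(ep)=g(e)\,g|_e(p)$ for all $p\in\mathbf s(e)E^*$; sections are part of the structure, satisfy $(gh)|_e=g|_{h(e)}h|_e$ and $v|_e=\mathbf s(e)$ for $v=\mathbf r(e)$, and extend to paths by $g|_{ep}=(g|_e)|_p$. The action need not be faithful. It extends to $E^\omega$. Inverse semigroup and ample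 groupoid. $S=S_{(G,E)}$ is the inverse semigroup with zero generated by $E^0\cup E^1\cup\{e^*:e\in E^1\}\cup G\cup\{0\}$, with the multiplication of $G$ (undefined products being $0$; $g^*=g^{-1}$, $v^*=v$) and relations $e\,\mathbf s(e)=\mathbf r(e)e=e$ and correspondingly for $e^*$; $uv=0$ for distinct vertices; $e^*f=0$ for distinct edges; $e^*e=\mathbf s(e)$; $ge=g(e)\,g|_e$. Its nonzero elements are uniquely of the form $pgq^*$ with $p,q\in E^*$, $\mathbf s(p)=\mathbf s(q)$, $g\in (G)_{\mathbf s(p)}$. It acts by partial bijections $pgq^*:qE^\omega\to pE^\omega$, $qw\mapsto p\,g(w)$. The ample groupoid $\mathcal G=\mathcal G_{(G,E)}$ has unit space $E^\omega$ (topology generated by the sets $pE^\omega$, $p\in E^*$) and consists of germs $[s,w]$, where $s=pgq^*\in S\setminus\{0\}$, $w\in qE^\omega$, and $[s,w]=[t,z]$ iff $w=z$ and $sx=tx$ in $S$ for some finite prefix $x$ of $w$; $[s,t(w)][t,w]=[st,w]$, $[s,w]^{-1}=[s^*,s(w)]$, source $w$, range $s(w)$; the topology is the quotient of the topology on the pairs $(s,w)$ with $S$ discrete. Algebras. $\mathbb C\mathcal G$ is the complex Steinberg algebra: the convolution algebra spanned by indicator functions of compact open bisections. $C^*_r(\mathcal G)$ is its completion in the reduced norm; its elements are regarded as functions $\mathcal G\to\mathbb C$ via Renault's $j$-map, $j(a)(\gamma)=\langle \lambda_{x}(a)\delta_{x},\delta_\gamma\rangle$ with $x$ the source of $\gamma$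 (identified with the unit at $x$) and $\lambda_x$ the left regular representation on $\ell^2$ of the source fibre of $x$. For a function $f$, $\operatorname{supp}(f)=\{\gamma:f(\gamma)\neq0\}$ (strict support). $J=\{f\in C^*_r(\mathcal G):\operatorname{int}(\operatorname{supp} f)=\emptyset\}$ and $J_{\mathbb C}=\{f\in\mathbb C\mathcal G:\operatorname{int}(\operatorname{supp} f)=\emptyset\}$. *)

theory Defs
  imports
    "HOL-Analysis.Analysis"
    "HOL-Algebra.Group_Action"
    "HOL-Library.Stream"
    "HOL-Library.Countable_Set"
    "Graph_Theory.Graph_Theory"
begin

text \<open>
  An edge \<open>e\<close> has source \<open>tail E e\<close> and range \<open>head E e\<close>. A finite path \<open>e\<^sub>1\<dots>e\<^sub>n\<close> is read
  from range to source, that is, the source of \<open>e\<^sub>i\<close> is the range of \<open>e\<^sub>i\<^sub>+\<^sub>1\<close>; hence its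
  reversal is an arc walk from the source of the path to its range. A path is stored as its
  edge list, and the vertex that the empty list stands for is always supplied separately.

  A groupoid which is the union of its isotropy groups is the same thing as a family of groups
  indexed by the unit space; the fibre \<open>(G)\<^sub>v\<close> is \<open>G v\<close>, its elements enter below only together
  with their index \<open>v\<close>, and the unit \<open>v\<close> is \<open>\<one>\<^bsub>G v\<^esub>\<close>. The action of \<open>g \<in> (G)\<^sub>v\<close> on \<open>vE\<^sup>*\<close> is \<open>act v g\<close>
  and the section \<open>g|\<^sub>e\<close> is \<open>sec g e\<close>.
\<close>

definition paths_to :: "('v, 'e) pre_digraph \<Rightarrow> 'v \<Rightarrow> 'e list set" where
  "paths_to E v = {p. \<exists>u. pre_digraph.awalk E u (rev p) v}"

definition paths_from :: "('v, 'e) pre_digraph \<Rightarrow> 'v \<Rightarrow> 'e list set" where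
  "paths_from E u = {p. \<exists>v. pre_digraph.awalk E u (rev p) v}"

locale self_similar_bundle = wf_digraph E
  for E :: "('v, 'e) pre_digraph" (structure) +
  fixes G :: "'v \<Rightarrow> 'g monoid"
    and act :: "'v \<Rightarrow> 'g \<Rightarrow> 'e list \<Rightarrow> 'e list"
    and sec :: "'g \<Rightarrow> 'e \<Rightarrow> 'g"
  assumes fibre_group: "v \<in> verts E \<Longrightarrow> comm_group (G v)"
    and action: "v \<in> verts E \<Longrightarrow> group_action (G v) (paths_to E v) (act v)"
    and length_act: "\<lbrakk>v \<in> verts E; g \<in> carrier (G v); p \<in> paths_to E v\<rbrakk>
      \<Longrightarrow> length (act v g p) = length p"
    and sec_closed: "\<lbrakk>e \<in> arcs E; g \<in> carrier (G (head E e))\<rbrakk>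
      \<Longrightarrow> sec g e \<in> carrier (G (tail E e))"
    and source_act: "\<lbrakk>e \<in> arcs E; g \<in> carrier (G (head E e))\<rbrakk>
      \<Longrightarrow> tail E (hd (act (head E e) g [e])) = tail E e"
    and act_Cons: "\<lbrakk>e \<in> arcs E; g \<in> carrier (G (head E e)); p \<in> paths_to E (tail E e)\<rbrakk>
      \<Longrightarrow> act (head E e) g (e # p) = act (head E e) g [e] @ act (tail E e) (sec g e) p"
    and sec_mult: "\<lbrakk>e \<in> arcs E; g \<in> carrier (G (head E e)); h \<in> carrier (G (head E e))\<rbrakk>
      \<Longrightarrow> sec (g \<otimes>\<^bsub>G (head E e)\<^esub> h) e
        = sec g (hd (act (head E e) h [e])) \<otimes>\<^bsub>G (tail E e)\<^esub> sec h e"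
    and sec_one: "e \<in> arcs E \<Longrightarrow> sec \<one>\<^bsub>G (head E e)\<^esub> e = \<one>\<^bsub>G (tail E e)\<^esub>"


text \<open>
  Generators of the inverse semigroup. The vertices are the units of the groupoid, so the
  generator \<open>v\<close> is \<open>Elt v \<one>\<^bsub>G v\<^esub>\<close>.
\<close>

datatype ('v, 'e, 'g) gen = Zero | Edge 'e | Edge_star 'e | Elt 'v 'g

type_synonym ('v, 'e, 'g) word = "('v, 'e, 'g) gen list"
type_synonym ('v, 'e, 'g) germ = "(('v, 'e, 'g) word set \<times> 'e stream) set"
type_synonym ('v, 'e, 'g) vec = "('v, 'e, 'g) germ \<Rightarrow> complex"
type_synonym ('v, 'e, 'g) op_family =
  "'e stream \<Rightarrow> ('v, 'e, 'g) vec \<Rightarrow> ('v, 'e, 'g) vec"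

context self_similar_bundle
begin

definition edge_act :: "'g \<Rightarrow> 'e \<Rightarrow> 'e" where
  "edge_act g e = hd (act (head E e) g [e])"

definition inf_paths :: "'e stream set" where
  "inf_paths = {w. \<forall>n. w !! n \<in> arcs E \<and> tail E (w !! n) = head E (w !! Suc n)}"

definition inf_range :: "'e stream \<Rightarrow> 'v" where
  "inf_range w = head E (shd w)"

definition cylinder :: "'v \<Rightarrow> 'e list \<Rightarrow> 'e stream set" where
  "cylinder v p = {w \<in> inf_paths. inf_range w = v \<and> stake (length p) w = p}"

definition inf_path_top :: "'e stream topology" where
  "inf_path_top = topology_generated_by {cylinder v p | v p. v \<in> verts E \<and> p \<in> paths_to E v}"

text \<open>
  The extension of the action to infinite paths: the first \<open>n\<close> edges of \<open>g(w)\<close> are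
  obtained by applying \<open>g\<close> to the first \<open>n\<close> edges of \<open>w\<close>. (\<open>siterate Suc 0\<close> is \<open>0, 1, 2, \<dots>\<close>.)
\<close>

definition inf_act :: "'v \<Rightarrow> 'g \<Rightarrow> 'e stream \<Rightarrow> 'e stream" where
  "inf_act v g w = smap (\<lambda>n. act v g (stake (Suc n) w) ! n) (siterate Suc 0)"


subsection \<open>The inverse semigroup\<close>

definition gens :: "('v, 'e, 'g) gen set" where
  "gens = {Zero} \<union> Edge ` arcs E \<union> Edge_star ` arcs E
    \<union> {Elt v g | v g. v \<in> verts E \<and> g \<in> carrier (G v)}"

definition words :: "('v, 'e, 'g) word set" where
  "words = {x. x \<noteq> [] \<and> set x \<subseteq> gens}"

abbreviation Vert :: "'v \<Rightarrow> ('v, 'e, 'g) gen" where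
  "Vert v \<equiv> Elt v \<one>\<^bsub>G v\<^esub>"

primrec gen_star :: "('v, 'e, 'g) gen \<Rightarrow> ('v, 'e, 'g) gen" where
  "gen_star Zero = Zero"
| "gen_star (Edge e) = Edge_star e"
| "gen_star (Edge_star e) = Edge e"
| "gen_star (Elt v g) = Elt v (inv\<^bsub>G v\<^esub> g)"

definition word_star :: "('v, 'e, 'g) word \<Rightarrow> ('v, 'e, 'g) word" where
  "word_star x = rev (map gen_star x)"

text \<open>
  The least congruence on the free semigroup with involution which contains the defining
  relations and has an inverse semigroup with zero as its quotient. The rules \<open>regular\<close>
  and \<open>idem_commute\<close> are the laws of inverse semigroups.
\<close>

inductive word_cong :: "('v, 'e, 'g) word \<Rightarrow> ('v, 'e, 'g) word \<Rightarrow> bool"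
  (infix \<open>\<bumpeq>\<close> 50) where
  refl: "x \<in> words \<Longrightarrow> x \<bumpeq> x"
| sym: "x \<bumpeq> y \<Longrightarrow> y \<bumpeq> x"
| trans: "x \<bumpeq> y \<Longrightarrow> y \<bumpeq> z \<Longrightarrow> x \<bumpeq> z"
| mult: "x \<bumpeq> y \<Longrightarrow> x' \<bumpeq> y' \<Longrightarrow> x @ x' \<bumpeq> y @ y'"
| star: "x \<bumpeq> y \<Longrightarrow> word_star x \<bumpeq> word_star y"
| regular: "x \<in> words \<Longrightarrow> x @ word_star x @ x \<bumpeq> x"
| idem_commute: "x \<in> words \<Longrightarrow> y \<in> words \<Longrightarrow>
    x @ word_star x @ y @ word_star y \<bumpeq> y @ word_star y @ x @ word_star x"
| zero_left: "a \<in> gens \<Longrightarrow> [Zero, a] \<bumpeq> [Zero]"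
| zero_right: "a \<in> gens \<Longrightarrow> [a, Zero] \<bumpeq> [Zero]"
| elt_mult: "v \<in> verts E \<Longrightarrow> g \<in> carrier (G v) \<Longrightarrow> h \<in> carrier (G v) \<Longrightarrow>
    [Elt v g, Elt v h] \<bumpeq> [Elt v (g \<otimes>\<^bsub>G v\<^esub> h)]"
| elt_undefined: "u \<in> verts E \<Longrightarrow> v \<in> verts E \<Longrightarrow> u \<noteq> v \<Longrightarrow>
    g \<in> carrier (G u) \<Longrightarrow> h \<in> carrier (G v) \<Longrightarrow> [Elt u g, Elt v h] \<bumpeq> [Zero]"
| edge_source: "e \<in> arcs E \<Longrightarrow> [Edge e, Vert (tail E e)] \<bumpeq> [Edge e]"
| edge_range: "e \<in> arcs E \<Longrightarrow> [Vert (head E e), Edge e] \<bumpeq> [Edge e]"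
| star_source: "e \<in> arcs E \<Longrightarrow> [Vert (tail E e), Edge_star e] \<bumpeq> [Edge_star e]"
| star_range: "e \<in> arcs E \<Longrightarrow> [Edge_star e, Vert (head E e)] \<bumpeq> [Edge_star e]"
| star_edge_distinct: "e \<in> arcs E \<Longrightarrow> f \<in> arcs E \<Longrightarrow> e \<noteq> f \<Longrightarrow> [Edge_star e, Edge f] \<bumpeq> [Zero]"
| star_edge: "e \<in> arcs E \<Longrightarrow> [Edge_star e, Edge e] \<bumpeq> [Vert (tail E e)]"
| elt_edge: "e \<in> arcs E \<Longrightarrow> g \<in> carrier (G (head E e)) \<Longrightarrow>
    [Elt (head E e) g, Edge e] \<bumpeq> [Edge (edge_act g e), Elt (tail E e) (sec g e)]"

definition cls :: "('v, 'e, 'g) word \<Rightarrow> ('v, 'e, 'g) word set" where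
  "cls x = {y. x \<bumpeq> y}"

definition Sgp :: "('v, 'e, 'g) word set set" where
  "Sgp = cls ` words"

definition S_zero :: "('v, 'e, 'g) word set" where
  "S_zero = cls [Zero]"

definition S_mult :: "('v, 'e, 'g) word set \<Rightarrow> ('v, 'e, 'g) word set \<Rightarrow> ('v, 'e, 'g) word set" where
  "S_mult s t = {z. \<exists>x\<in>s. \<exists>y\<in>t. x @ y \<bumpeq> z}"

definition S_star :: "('v, 'e, 'g) word set \<Rightarrow> ('v, 'e, 'g) word set" where
  "S_star s = {z. \<exists>x\<in>s. word_star x \<bumpeq> z}"

text \<open>
  The element \<open>p g q\<^sup>*\<close> with \<open>p\<close>, \<open>q\<close> paths of source \<open>v\<close> and \<open>g \<in> (G)\<^sub>v\<close>.
\<close>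

definition pgq :: "'v \<Rightarrow> 'e list \<Rightarrow> 'g \<Rightarrow> 'e list \<Rightarrow> ('v, 'e, 'g) word set" where
  "pgq v p g q = cls (map Edge p @ [Elt v g] @ map Edge_star (rev q))"

text \<open>
  The prefix of length \<open>n\<close> of an infinite path as an element of \<open>Sgp\<close>. The leading vertex makes
  the prefix of length \<open>0\<close> the range of the path and is absorbed otherwise.
\<close>

definition prefix_elt :: "nat \<Rightarrow> 'e stream \<Rightarrow> ('v, 'e, 'g) word set" where
  "prefix_elt n w = cls (Vert (inf_range w) # map Edge (stake n w))"

text \<open>The partial bijection \<open>p g q\<^sup>* : qw \<mapsto> p g(w)\<close> of the space of infinite paths, as a graph.\<close>

definition S_rel :: "('v, 'e, 'g) word set \<Rightarrow> 'e stream \<Rightarrow> 'e stream \<Rightarrow> bool" where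
  "S_rel s w z \<longleftrightarrow> (\<exists>v p g q w'. v \<in> verts E \<and> p \<in> paths_from E v \<and> q \<in> paths_from E v
     \<and> g \<in> carrier (G v) \<and> w' \<in> inf_paths \<and> inf_range w' = v
     \<and> s = pgq v p g q \<and> w = q @- w' \<and> z = p @- inf_act v g w')"

definition S_dom :: "('v, 'e, 'g) word set \<Rightarrow> 'e stream set" where
  "S_dom s = {w. \<exists>z. S_rel s w z}"

definition S_app :: "('v, 'e, 'g) word set \<Rightarrow> 'e stream \<Rightarrow> 'e stream" where
  "S_app s w = (THE z. S_rel s w z)"


subsection \<open>The groupoid of germs\<close>

definition germ_pairs :: "(('v, 'e, 'g) word set \<times> 'e stream) set" where
  "germ_pairs = {(s, w). s \<in> Sgp - {S_zero} \<and> w \<in> S_dom s}"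

definition germ_rel ::
  "((('v, 'e, 'g) word set \<times> 'e stream) \<times> (('v, 'e, 'g) word set \<times> 'e stream)) set" where
  "germ_rel = {((s, w), (t, z)). (s, w) \<in> germ_pairs \<and> (t, z) \<in> germ_pairs \<and> w = z
     \<and> (\<exists>n. S_mult s (prefix_elt n w) = S_mult t (prefix_elt n w))}"

definition germ_of :: "('v, 'e, 'g) word set \<Rightarrow> 'e stream \<Rightarrow> ('v, 'e, 'g) germ" where
  "germ_of s w = germ_rel `` {(s, w)}"

definition germs :: "('v, 'e, 'g) germ set" where
  "germs = germ_pairs // germ_rel"

definition germ_source :: "('v, 'e, 'g) germ \<Rightarrow> 'e stream" where
  "germ_source \<gamma> = (THE w. \<exists>s. (s, w) \<in> \<gamma>)"

definition germ_mult :: "('v, 'e, 'g) germ \<Rightarrow> ('v, 'e, 'g) germ \<Rightarrow> ('v, 'e, 'g) germ" where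
  "germ_mult \<gamma> \<delta> =
     (THE \<eta>. \<exists>s t w. (t, w) \<in> \<delta> \<and> (s, S_app t w) \<in> \<gamma> \<and> \<eta> = germ_of (S_mult s t) w)"

definition germ_inv :: "('v, 'e, 'g) germ \<Rightarrow> ('v, 'e, 'g) germ" where
  "germ_inv \<gamma> = (THE \<eta>. \<exists>s w. (s, w) \<in> \<gamma> \<and> \<eta> = germ_of (S_star s) (S_app s w))"

definition germ_range :: "('v, 'e, 'g) germ \<Rightarrow> 'e stream" where
  "germ_range \<gamma> = (THE z. \<exists>s w. (s, w) \<in> \<gamma> \<and> z = S_app s w)"

definition germ_unit :: "'e stream \<Rightarrow> ('v, 'e, 'g) germ" where
  "germ_unit w = germ_of (cls [Vert (inf_range w)]) w"

definition germ_pair_top :: "(('v, 'e, 'g) word set \<times> 'e stream) topology" where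
  "germ_pair_top = subtopology (prod_topology (discrete_topology Sgp) inf_path_top) germ_pairs"

text \<open>The quotient topology.\<close>

definition germ_top :: "('v, 'e, 'g) germ topology" where
  "germ_top = topology (\<lambda>U. U \<subseteq> germs
     \<and> openin germ_pair_top {(s, w). (s, w) \<in> germ_pairs \<and> germ_of s w \<in> U})"

lemma openin_germ_top:
  "openin germ_top U \<longleftrightarrow> U \<subseteq> germs
     \<and> openin germ_pair_top {(s, w). (s, w) \<in> germ_pairs \<and> germ_of s w \<in> U}"
proof -
  let ?P = "\<lambda>U. {(s, w). (s, w) \<in> germ_pairs \<and> germ_of s w \<in> U}"
  have "istopology (\<lambda>U. U \<subseteq> germs \<and> openin germ_pair_top (?P U))"
    unfolding istopology_def
  proof (intro conjI allI impI)
    fix U V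
    assume "U \<subseteq> germs \<and> openin germ_pair_top (?P U)"
      and "V \<subseteq> germs \<and> openin germ_pair_top (?P V)"
    moreover have "?P (U \<inter> V) = ?P U \<inter> ?P V" by auto
    ultimately show "U \<inter> V \<subseteq> germs" "openin germ_pair_top (?P (U \<inter> V))"
      by auto
  next
    fix \<U>
    assume *: "\<forall>U\<in>\<U>. U \<subseteq> germs \<and> openin germ_pair_top (?P U)"
    then show "\<Union>\<U> \<subseteq> germs" by blast
    have "?P (\<Union>\<U>) = (\<Union>U\<in>\<U>. ?P U)" by auto
    with * show "openin germ_pair_top (?P (\<Union>\<U>))"
      by (auto intro!: openin_Union)
  qed
  then show ?thesis
    unfolding germ_top_def by simp
qed


subsection \<open>The Steinberg algebra\<close>

definition compact_open_bisection :: "('v, 'e, 'g) germ set \<Rightarrow> bool" where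
  "compact_open_bisection B \<longleftrightarrow> compactin germ_top B \<and> openin germ_top B
     \<and> inj_on germ_source B \<and> inj_on germ_range B"

definition steinberg :: "('v, 'e, 'g) vec set" where
  "steinberg = {\<lambda>\<gamma>. \<Sum>B\<in>F. c B * indicator B \<gamma> | F c.
     finite F \<and> (\<forall>B\<in>F. compact_open_bisection B)}"

definition supp :: "('v, 'e, 'g) vec \<Rightarrow> ('v, 'e, 'g) germ set" where
  "supp f = {\<gamma> \<in> germs. f \<gamma> \<noteq> 0}"

definition alg_singular_ideal :: "('v, 'e, 'g) vec set" where
  "alg_singular_ideal = {f \<in> steinberg. germ_top interior_of supp f = {}}"


subsection \<open>The reduced C*-algebra\<close>

definition fibre :: "'e stream \<Rightarrow> ('v, 'e, 'g) germ set" where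
  "fibre x = {\<gamma> \<in> germs. germ_source \<gamma> = x}"

text \<open>The Hilbert space \<open>\<ell>\<^sup>2\<close> of a source fibre; its vectors are extended by \<open>0\<close> off the fibre.\<close>

definition l2 :: "'e stream \<Rightarrow> ('v, 'e, 'g) vec set" where
  "l2 x = {\<xi>. (\<forall>\<beta>. \<beta> \<notin> fibre x \<longrightarrow> \<xi> \<beta> = 0) \<and> (\<lambda>\<beta>. (cmod (\<xi> \<beta>))\<^sup>2) summable_on fibre x}"

definition l2_inner :: "'e stream \<Rightarrow> ('v, 'e, 'g) vec \<Rightarrow> ('v, 'e, 'g) vec \<Rightarrow> complex" where
  "l2_inner x \<xi> \<eta> = (\<Sum>\<^sub>\<infinity>\<beta>\<in>fibre x. \<xi> \<beta> * cnj (\<eta> \<beta>))"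

definition l2_norm :: "'e stream \<Rightarrow> ('v, 'e, 'g) vec \<Rightarrow> real" where
  "l2_norm x \<xi> = sqrt (\<Sum>\<^sub>\<infinity>\<beta>\<in>fibre x. (cmod (\<xi> \<beta>))\<^sup>2)"

definition delta :: "('v, 'e, 'g) germ \<Rightarrow> ('v, 'e, 'g) vec" where
  "delta \<gamma> = (\<lambda>\<beta>. if \<beta> = \<gamma> then 1 else 0)"

text \<open>
  Left convolution by \<open>f\<close> on the source fibre of \<open>x\<close>, and the family \<open>(\<lambda>\<^sub>x(f))\<^sub>x\<close> of all left
  regular representations.
\<close>

definition reg :: "('v, 'e, 'g) vec \<Rightarrow> 'e stream \<Rightarrow> ('v, 'e, 'g) vec \<Rightarrow> ('v, 'e, 'g) vec" where
  "reg f x \<xi> = (\<lambda>\<gamma>. if \<gamma> \<in> fibre x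
     then \<Sum>\<^sub>\<infinity>\<beta>\<in>fibre x. f (germ_mult \<gamma> (germ_inv \<beta>)) * \<xi> \<beta> else 0)"

definition reg_family :: "('v, 'e, 'g) vec \<Rightarrow> ('v, 'e, 'g) op_family" where
  "reg_family f = (\<lambda>x\<in>inf_paths. \<lambda>\<xi>\<in>l2 x. reg f x \<xi>)"

text \<open>
  The relation \<open>sup\<^sub>x \<parallel>T\<^sub>x - T'\<^sub>x\<parallel> \<le> C\<close> of operator norms. On the families \<open>(\<lambda>\<^sub>x(f))\<^sub>x\<close> this supremum
  is the reduced norm of \<open>f - f'\<close>.
\<close>

definition dist_le :: "('v, 'e, 'g) op_family \<Rightarrow> ('v, 'e, 'g) op_family \<Rightarrow> real \<Rightarrow> bool" where
  "dist_le T T' C \<longleftrightarrow>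
     (\<forall>x\<in>inf_paths. \<forall>\<xi>\<in>l2 x. l2_norm x (\<lambda>\<beta>. T x \<xi> \<beta> - T' x \<xi> \<beta>) \<le> C * l2_norm x \<xi>)"

definition zero_family :: "('v, 'e, 'g) op_family" where
  "zero_family = (\<lambda>x\<in>inf_paths. \<lambda>\<xi>\<in>l2 x. \<lambda>_. 0)"

definition bounded_families :: "('v, 'e, 'g) op_family set" where
  "bounded_families = {T \<in> (\<Pi>\<^sub>E x\<in>inf_paths. l2 x \<rightarrow>\<^sub>E l2 x).
     (\<forall>x\<in>inf_paths. \<forall>\<xi>\<in>l2 x. \<forall>\<eta>\<in>l2 x. T x (\<lambda>\<beta>. \<xi> \<beta> + \<eta> \<beta>) = (\<lambda>\<beta>. T x \<xi> \<beta> + T x \<eta> \<beta>))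
     \<and> (\<forall>x\<in>inf_paths. \<forall>\<xi>\<in>l2 x. \<forall>c. T x (\<lambda>\<beta>. c * \<xi> \<beta>) = (\<lambda>\<beta>. c * T x \<xi> \<beta>))
     \<and> (\<exists>C. dist_le T zero_family C)}"

text \<open>
  The completion of the Steinberg algebra in the reduced norm, as the closure of its image
  under the isometric embedding \<open>f \<mapsto> (\<lambda>\<^sub>x(f))\<^sub>x\<close>.
\<close>

definition Cstar_red :: "('v, 'e, 'g) op_family set" where
  "Cstar_red = {T \<in> bounded_families. \<forall>\<epsilon>>0. \<exists>f\<in>steinberg. dist_le T (reg_family f) \<epsilon>}"

definition j_map :: "('v, 'e, 'g) op_family \<Rightarrow> ('v, 'e, 'g) vec" where
  "j_map T \<gamma> = (let x = germ_source \<gamma> in l2_inner x (T x (delta (germ_unit x))) (delta \<gamma>))"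

definition singular_ideal :: "('v, 'e, 'g) op_family set" where
  "singular_ideal = {T \<in> Cstar_red. germ_top interior_of supp (j_map T) = {}}"

end

end

theory Submission
  imports Defs "HOL-Algebra.FiniteProduct" "HOL-Real_Asymp.Real_Asymp"
begin

text \<open>
  A singular function of the Steinberg algebra is, as an operator, a singular element of the
  reduced C*-algebra with the same values (\<open>alg_singular_imp_singular\<close>). The content is the
  converse: a nonzero singular operator \<open>T\<close> yields a nonzero singular function.

  Let \<open>j(T)\<close> be nonzero at the germ \<open>\<gamma>\<close> of a word \<open>t\<close> at \<open>x\<close>, let \<open>\<epsilon>\<close> be a third of the modulus of
  this value and \<open>b\<close> an element of the Steinberg algebra with \<open>\<parallel>T - b\<parallel> \<le> \<epsilon>\<close>, so that
  \<open>\<bar>b(\<gamma>)\<bar> \<ge> 2\<epsilon>\<close>. Close to \<open>x\<close>, and on the germs of \<open>t p g p\<^sup>*\<close> where \<open>p\<close> is a long prefix of \<open>x\<close> and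
  \<open>g\<close> fixes the remaining tail, \<open>b\<close> looks like an element \<open>\<phi> = \<Sum> c\<^sub>i a\<^sub>i\<close> of the group ring of the
  abelian group at the source of \<open>p\<close> (\<open>steinberg_near_point\<close>). Let \<open>N\<close> be the subgroup of those \<open>g\<close>
  for which \<open>p g p\<^sup>*\<close> has a trivial germ at \<open>x\<close>. Then \<open>b(\<gamma>)\<close> is the sum of the \<open>c\<^sub>i\<close> with \<open>a\<^sub>i \<in> N\<close>,
  and there is a character \<open>\<psi>\<close>, trivial on \<open>N\<close>, with \<open>\<bar>\<psi>(\<phi>)\<bar> \<ge> \<bar>b(\<gamma>)\<bar>\<close> (\<open>dominating_character\<close>).

  Call a path generic if equality of the germs of any two words is constant near it. As there are
  only countably many words, generic paths are dense (\<open>generic_dense\<close>). The function of a singular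
  operator vanishes over generic paths (\<open>singular_vanishes_over_generic\<close>), and conversely an element
  of the Steinberg algebra that vanishes over all generic paths is singular (\<open>alg_singularI\<close>).

  For a generic path \<open>y\<close> close to \<open>x\<close> let \<open>X\<close> be the subgroup of those \<open>g\<close> for which \<open>p g p\<^sup>*\<close> has a
  trivial germ at \<open>y\<close>. Because \<open>T\<close> vanishes over \<open>y\<close>, convolution with \<open>\<phi>\<close> modulo \<open>X\<close> has norm at most
  \<open>\<epsilon>\<close>. If \<open>\<psi>\<close> were trivial on the part of \<open>X\<close> that is visible in \<open>\<phi>\<^sup>k\<close>, then \<open>\<bar>\<psi>(\<phi>)\<bar>\<^sup>k\<close> would be at
  most the \<open>\<ell>\<^sup>1\<close>-norm of \<open>\<phi>\<^sup>k\<close> modulo \<open>X\<close>, hence at most \<open>\<epsilon>\<^sup>k\<close> times the square root of the size of the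
  support of \<open>\<phi>\<^sup>k\<close>. In an abelian group this size grows polynomially in \<open>k\<close>, which contradicts
  \<open>\<bar>\<psi>(\<phi>)\<bar> \<ge> 2\<epsilon>\<close> for a suitable \<open>k\<close> (\<open>generic_character_bound\<close>). So there is a finite set \<open>Q\<close> of group
  elements with \<open>\<psi>(q) \<noteq> 1\<close> which meets \<open>X\<close> for every generic \<open>y\<close> near \<open>x\<close>. The product of the factors
  \<open>1 - q\<close>, spread over a small cylinder around \<open>x\<close>, vanishes over every generic path since one factor
  does, so it is singular; and it is nonzero since \<open>\<psi>\<close> maps it to \<open>\<Prod> (1 - \<psi>(q))\<close>
  (\<open>product_on_cylinder\<close>).

  Computations with germs rest on a faithful representation of the inverse semigroup by partial
  injections (\<open>word_cong_iff_word_rel\<close>).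
\<close>

section \<open>Characters of subgroups of abelian groups\<close>

text \<open>
  Multiplication by a primitive \<open>m\<close>-th root of unity permutes the roots of \<open>z\<^sup>m = c\<close> and multiplies
  the sum by a factor other than \<open>1\<close>.
\<close>

lemma sum_roots_powi_eq_0:
  fixes c :: complex and k :: int
  assumes m: "m > 0" and k: "\<not> int m dvd k"
  shows "(\<Sum>z | z ^ m = c. z powi k) = 0"
proof -
  define \<omega> where "\<omega> = cis (2 * pi / real m)"
  have \<omega>0: "\<omega> \<noteq> 0" by (simp add: \<omega>_def)
  have "\<omega> ^ m = cis (real m * (2 * pi / real m))" unfolding \<omega>_def by (rule Complex.DeMoivre)
  also have "\<dots> = cis (2 * pi)" using m by simp
  finally have \<omega>m: "\<omega> ^ m = 1" by simp
  have "\<omega> powi k = cis (of_int k * (2 * pi / real m))"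
    unfolding \<omega>_def by (rule cis_power_int)
  moreover have "cis (of_int k * (2 * pi / real m)) \<noteq> 1"
  proof
    assume "cis (of_int k * (2 * pi / real m)) = 1"
    then have "cos (of_int k * (2 * pi / real m)) = 1" by (metis cis.simps(1) one_complex.simps(1))
    then obtain n :: int where "of_int k * (2 * pi / real m) = of_int n * 2 * pi"
      using cos_one_2pi_int by (auto simp: mult.commute)
    then have "real_of_int k = real_of_int n * real m" using m by (simp add: field_simps)
    then have "k = n * int m" by (metis of_int_eq_iff of_int_mult of_int_of_nat_eq)
    then show False using k by simp
  qed
  ultimately have ne: "\<omega> powi k \<noteq> 1" by simp
  have bij: "bij_betw (\<lambda>z. \<omega> * z) {z. z ^ m = c} {z. z ^ m = c}"
    using \<omega>m \<omega>0 by (intro bij_betwI[where g = "\<lambda>z. z / \<omega>"]) (auto simp: power_mult_distrib power_divide)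
  have "(\<Sum>z | z ^ m = c. z powi k) = (\<Sum>z | z ^ m = c. (\<omega> * z) powi k)"
    using sum.reindex_bij_betw[OF bij, of "\<lambda>z. z powi k"] by simp
  also have "\<dots> = \<omega> powi k * (\<Sum>z | z ^ m = c. z powi k)"
    by (simp add: power_int_mult_distrib sum_distrib_left)
  finally show ?thesis using ne by simp
qed

lemma exists_large_term:
  fixes f :: "'i \<Rightarrow> complex"
  assumes "finite Z" "Z \<noteq> {}" "(\<Sum>z\<in>Z. f z) = of_nat (card Z) * s"
  shows "\<exists>z\<in>Z. cmod s \<le> cmod (f z)"
proof (rule ccontr)
  assume "\<not> ?thesis"
  then have "(\<Sum>z\<in>Z. cmod (f z)) < (\<Sum>z\<in>Z. cmod s)" using assms by (intro sum_strict_mono) auto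
  moreover have "cmod (\<Sum>z\<in>Z. f z) \<le> (\<Sum>z\<in>Z. cmod (f z))" by (rule norm_sum)
  ultimately show False using assms by (simp add: norm_mult)
qed

lemma sum_over_classes:
  fixes c :: "'i \<Rightarrow> complex"
  assumes "finite I"
  shows "(\<Sum>i\<in>I. c i * \<phi> (e i)) = (\<Sum>\<eta>\<in>e ` I. \<phi> \<eta> * (\<Sum>i\<in>I. if e i = \<eta> then c i else 0))"
proof -
  have "(\<Sum>i\<in>I. c i * \<phi> (e i)) = (\<Sum>\<eta>\<in>e ` I. \<Sum>i\<in>{i\<in>I. e i = \<eta>}. c i * \<phi> (e i))"
    by (rule sum.image_gen[OF assms])
  also have "\<dots> = (\<Sum>\<eta>\<in>e ` I. \<phi> \<eta> * (\<Sum>i\<in>I. if e i = \<eta> then c i else 0))"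
  proof (rule sum.cong[OF refl])
    fix \<eta>
    have "(\<Sum>i\<in>{i\<in>I. e i = \<eta>}. c i * \<phi> (e i)) = (\<Sum>i\<in>I. if e i = \<eta> then c i * \<phi> (e i) else 0)"
      by (rule sum.inter_filter[OF assms])
    also have "\<dots> = (\<Sum>i\<in>I. \<phi> \<eta> * (if e i = \<eta> then c i else 0))" by (rule sum.cong) auto
    also have "\<dots> = \<phi> \<eta> * (\<Sum>i\<in>I. if e i = \<eta> then c i else 0)"
      by (rule sum_distrib_left[symmetric])
    finally show "(\<Sum>i\<in>{i\<in>I. e i = \<eta>}. c i * \<phi> (e i)) = \<phi> \<eta> * (\<Sum>i\<in>I. if e i = \<eta> then c i else 0)" .
  qed
  finally show ?thesis .
qed

text \<open>
  A function \<open>\<psi>\<close> that is constant on the fibres of \<open>e\<close> is a function \<open>u\<close> of \<open>e\<close>.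
\<close>

lemma sum_by_classes:
  fixes c \<psi> :: "'i \<Rightarrow> complex"
  assumes "finite I" and "\<And>i j. i \<in> I \<Longrightarrow> j \<in> I \<Longrightarrow> e i = e j \<Longrightarrow> \<psi> i = \<psi> j"
    and "\<And>i. i \<in> I \<Longrightarrow> cmod (\<psi> i) = 1"
  obtains u where "\<And>\<eta>. \<eta> \<in> e ` I \<Longrightarrow> cmod (u \<eta>) = 1"
    "(\<Sum>i\<in>I. c i * \<psi> i) = (\<Sum>\<eta>\<in>e ` I. u \<eta> * (\<Sum>i\<in>I. if e i = \<eta> then c i else 0))"
proof -
  define u where "u \<eta> = \<psi> (SOME i. i \<in> I \<and> e i = \<eta>)" for \<eta>
  have u: "u (e i) = \<psi> i" if "i \<in> I" for i
  proof -
    have "(SOME j. j \<in> I \<and> e j = e i) \<in> I \<and> e (SOME j. j \<in> I \<and> e j = e i) = e i"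
      by (rule someI[of _ i]) (use that in auto)
    then show ?thesis using assms(2) that unfolding u_def by blast
  qed
  have "(\<Sum>i\<in>I. c i * \<psi> i) = (\<Sum>i\<in>I. c i * u (e i))" using u by (intro sum.cong) auto
  also note sum_over_classes[OF assms(1), of c u e]
  finally have eq: "(\<Sum>i\<in>I. c i * \<psi> i) = (\<Sum>\<eta>\<in>e ` I. u \<eta> * (\<Sum>i\<in>I. if e i = \<eta> then c i else 0))" .
  show thesis by (rule that[OF _ eq]) (use u assms(3) in auto)
qed

definition words_of :: "'i set \<Rightarrow> nat \<Rightarrow> 'i list set" where
  "words_of F k = {u. set u \<subseteq> F \<and> length u = k}"

lemma finite_words_of: "finite F \<Longrightarrow> finite (words_of F k)"
  unfolding words_of_def by (rule finite_lists_length_eq)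

lemma words_of_0: "words_of F 0 = {[]}" by (auto simp: words_of_def)

lemma sum_words_of_Suc:
  fixes f :: "'i list \<Rightarrow> complex"
  shows "(\<Sum>u\<in>words_of F (Suc k). f u) = (\<Sum>i\<in>F. \<Sum>u\<in>words_of F k. f (i # u))"
proof -
  have "bij_betw (\<lambda>(i, u). i # u) (F \<times> words_of F k) (words_of F (Suc k))"
    by (rule bij_betwI[where g = "\<lambda>u. (hd u, tl u)"]) (auto simp: words_of_def length_Suc_conv)
  from sum.reindex_bij_betw[OF this, of f] show ?thesis
    by (simp add: sum.cartesian_product case_prod_beta)
qed

context comm_group
begin

text \<open>
  Characters of subgroups are total functions of which only the values on the subgroup are constrained;
  extending a character means changing it off the subgroup.
\<close>

definition unit_character :: "'a set \<Rightarrow> ('a \<Rightarrow> complex) \<Rightarrow> bool" where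
  "unit_character H \<psi> \<longleftrightarrow> subgroup H G \<and> (\<forall>h\<in>H. \<forall>k\<in>H. \<psi> (h \<otimes> k) = \<psi> h * \<psi> k) \<and> (\<forall>h\<in>H. cmod (\<psi> h) = 1)"

lemma unit_character_one: "unit_character H \<psi> \<Longrightarrow> \<psi> \<one> = 1"
proof -
  assume a: "unit_character H \<psi>"
  then have "\<one> \<in> H" using subgroup.one_closed by (auto simp: unit_character_def)
  then have "\<psi> \<one> = \<psi> \<one> * \<psi> \<one>" "\<psi> \<one> \<noteq> 0" using a unfolding unit_character_def by (metis l_one one_closed, force)
  then show ?thesis by simp
qed

lemma unit_character_int_pow:
  fixes k :: int
  assumes a: "unit_character H \<psi>" and h: "h \<in> H"
  shows "h [^] k \<in> H \<and> \<psi> (h [^] k) = \<psi> h powi k"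
proof -
  have sub: "subgroup H G" using a by (simp add: unit_character_def)
  have hc: "h \<in> carrier G" using subgroup.mem_carrier[OF sub h] .
  have ne: "\<psi> x \<noteq> 0" if "x \<in> H" for x using a that by (force simp: unit_character_def)
  have nat: "h [^] n \<in> H \<and> \<psi> (h [^] n) = \<psi> h ^ n" for n :: nat
  proof (induction n)
    case 0
    then show ?case using unit_character_one[OF a] subgroup.one_closed[OF sub] by simp
  next
    case (Suc n)
    then show ?case using a h subgroup.m_closed[OF sub] by (simp add: unit_character_def)
  qed
  show ?thesis
  proof (cases "k \<ge> 0")
    case True
    have "h [^] k = h [^] nat k" using pow_nat[OF True] by (rule sym)
    moreover have "\<psi> h powi k = \<psi> h ^ nat k" using True by (simp add: power_int_def)
    ultimately show ?thesis using nat by metis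
  next
    case False
    have i: "inv (h [^] nat (-k)) \<in> H" using nat subgroup.m_inv_closed[OF sub] by blast
    have "\<psi> (inv (h [^] nat (-k))) * \<psi> (h [^] nat (-k)) = \<psi> (inv (h [^] nat (-k)) \<otimes> h [^] nat (-k))"
      using a i nat by (simp add: unit_character_def)
    also have "\<dots> = 1" using hc unit_character_one[OF a] by simp
    finally have "\<psi> (inv (h [^] nat (-k))) = inverse (\<psi> h ^ nat (-k))"
      using nat[of "nat (-k)"] inverse_unique[of "\<psi> h ^ nat (-k)" "\<psi> (inv (h [^] nat (-k)))"] by (simp add: mult.commute)
    moreover have "h [^] k = inv (h [^] nat (-k))" using False unfolding int_pow_def2[of G h k] by simp
    moreover have "\<psi> h powi k = inverse (\<psi> h ^ nat (-k))"
      using False by (simp add: power_int_def power_inverse)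
    ultimately show ?thesis using i by simp
  qed
qed

lemma extend_subgroup_by:
  assumes sub: "subgroup H G" and g: "g \<in> carrier G"
  shows "subgroup {h \<otimes> g [^] (k::int) | h k. h \<in> H} G" (is "subgroup ?K G")
proof (rule subgroupI)
  show "?K \<subseteq> carrier G" using subgroup.mem_carrier[OF sub] g by auto
  show "?K \<noteq> {}" using subgroup.one_closed[OF sub] by auto
next
  fix a assume "a \<in> ?K"
  then obtain h and k :: int where a: "a = h \<otimes> g [^] k" "h \<in> H" by blast
  have hc: "h \<in> carrier G" using subgroup.mem_carrier[OF sub a(2)] .
  have "inv a = inv h \<otimes> g [^] (-k)" using a hc g by (simp add: inv_mult int_pow_neg)
  then show "inv a \<in> ?K" using subgroup.m_inv_closed[OF sub a(2)] by blast
next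
  fix a b assume "a \<in> ?K" "b \<in> ?K"
  then obtain h h' and k k' :: int where a: "a = h \<otimes> g [^] k" "h \<in> H" "b = h' \<otimes> g [^] k'" "h' \<in> H" by blast
  have hc: "h \<in> carrier G" "h' \<in> carrier G" using subgroup.mem_carrier[OF sub] a by auto
  have "a \<otimes> b = (h \<otimes> h') \<otimes> (g [^] k \<otimes> g [^] k')" using a hc g by (simp add: m_ac)
  also have "\<dots> = (h \<otimes> h') \<otimes> g [^] (k + k')" using g by (simp add: int_pow_mult)
  finally show "a \<otimes> b \<in> ?K" using subgroup.m_closed[OF sub a(2,4)] by blast
qed

text \<open>
  The value proposed for \<open>h \<otimes> g [^] k\<close> does not depend on the choice of \<open>h\<close> and \<open>k\<close>, because two
  representations of one element differ by a power of \<open>g\<close> that lies in \<open>H\<close>, where \<open>z\<close> is consistent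
  with \<open>\<psi>\<close>.
\<close>

lemma unit_character_extend_value:
  fixes z :: complex
  assumes a: "unit_character H \<psi>" and g: "g \<in> carrier G" and z: "cmod z = 1"
    and adm: "\<And>k::int. g [^] k \<in> H \<Longrightarrow> \<psi> (g [^] k) = z powi k"
  obtains \<psi>' where "unit_character {h \<otimes> g [^] (k::int) | h k. h \<in> H} \<psi>'"
    "\<And>h k. h \<in> H \<Longrightarrow> \<psi>' (h \<otimes> g [^] (k::int)) = \<psi> h * z powi k"
proof -
  have sub: "subgroup H G" using a by (simp add: unit_character_def)
  note hc = subgroup.mem_carrier[OF sub]
  have z0: "z \<noteq> 0" using z by auto
  define f where "f b = (SOME hk. fst hk \<in> H \<and> b = fst hk \<otimes> g [^] (snd hk :: int))" for b
  define \<psi>' where "\<psi>' b = \<psi> (fst (f b)) * z powi (snd (f b))" for b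
  have eq: "\<psi>' (h \<otimes> g [^] k) = \<psi> h * z powi k" if h: "h \<in> H" for h and k :: int
  proof -
    let ?b = "h \<otimes> g [^] k"
    have "fst (f ?b) \<in> H \<and> ?b = fst (f ?b) \<otimes> g [^] (snd (f ?b))"
      unfolding f_def by (rule someI[of _ "(h, k)"]) (use h in simp)
    then obtain h' l where hl: "f ?b = (h', l)" "h' \<in> H" "h \<otimes> g [^] k = h' \<otimes> g [^] l" by (metis prod.collapse)
    have "g [^] k \<otimes> g [^] (-k) = \<one>" using int_pow_mult[OF g, of k "-k"] by simp
    then have "h = h \<otimes> g [^] k \<otimes> g [^] (-k)" using hc h g by (simp add: m_assoc)
    then have "inv h' \<otimes> h = inv h' \<otimes> (h \<otimes> g [^] k \<otimes> g [^] (-k))" by simp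
    also have "\<dots> = g [^] l \<otimes> g [^] (-k)"
      unfolding hl(3) using hc h hl(2) g by (simp add: m_assoc[symmetric])
    also have "\<dots> = g [^] (l - k)" using g by (simp add: int_pow_mult[symmetric])
    finally have e: "inv h' \<otimes> h = g [^] (l - k)" .
    have in_H: "inv h' \<otimes> h \<in> H" using hl h subgroup.m_closed[OF sub] subgroup.m_inv_closed[OF sub] by blast
    have "h = h' \<otimes> (inv h' \<otimes> h)" using hc h hl(2) by (simp add: m_assoc[symmetric])
    then have "\<psi> h = \<psi> h' * \<psi> (inv h' \<otimes> h)" using a hl(2) in_H unfolding unit_character_def by metis
    also have "\<psi> (inv h' \<otimes> h) = z powi (l - k)" using adm in_H e by simp
    finally show ?thesis using z0 by (simp add: \<psi>'_def hl(1) power_int_diff)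
  qed
  have "unit_character {h \<otimes> g [^] (k::int) | h k. h \<in> H} \<psi>'"
    unfolding unit_character_def
  proof (intro conjI ballI)
    show "subgroup {h \<otimes> g [^] (k::int) | h k. h \<in> H} G" by (rule extend_subgroup_by[OF sub g])
  next
    fix x y assume "x \<in> {h \<otimes> g [^] (k::int) | h k. h \<in> H}" "y \<in> {h \<otimes> g [^] (k::int) | h k. h \<in> H}"
    then obtain h h' and k k' :: int where x: "x = h \<otimes> g [^] k" "h \<in> H" "y = h' \<otimes> g [^] k'" "h' \<in> H" by blast
    have "x \<otimes> y = (h \<otimes> h') \<otimes> (g [^] k \<otimes> g [^] k')" using x hc g by (simp add: m_ac)
    also have "\<dots> = (h \<otimes> h') \<otimes> g [^] (k + k')" using g by (simp add: int_pow_mult)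
    finally have "\<psi>' (x \<otimes> y) = \<psi> (h \<otimes> h') * z powi (k + k')" using eq subgroup.m_closed[OF sub x(2,4)] by simp
    then show "\<psi>' (x \<otimes> y) = \<psi>' x * \<psi>' y"
      using x eq a z0 by (simp add: unit_character_def power_int_add)
  next
    fix x assume "x \<in> {h \<otimes> g [^] (k::int) | h k. h \<in> H}"
    then obtain h and k :: int where "x = h \<otimes> g [^] k" "h \<in> H" by blast
    then show "cmod (\<psi>' x) = 1" using eq a z by (simp add: unit_character_def norm_mult norm_power_int)
  qed
  then show thesis using that eq by blast
qed

text \<open>
  The extensions to \<open>g\<close> by all roots \<open>z\<close> of an equation \<open>z\<^sup>m = w\<close> are averaged. If some positive power
  of \<open>g\<close> lies in \<open>H\<close>, then \<open>m\<close> is the least such exponent and \<open>w = \<psi> (g [^] m)\<close>; otherwise \<open>w = 1\<close> and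
  \<open>m\<close> exceeds every exponent of \<open>g\<close> that occurs in the \<open>x i\<close>. In either case the average of the extended
  characters is \<open>0\<close> at each \<open>x i\<close> outside \<open>H\<close>, so the average of the extended sums is the sum over \<open>H\<close>,
  and one of them is at least as large.
\<close>

lemma unit_character_extend:
  fixes c :: "'i \<Rightarrow> complex"
  assumes a: "unit_character H \<psi>" and g: "g \<in> carrier G" and I: "finite I"
  obtains H' \<psi>' where "unit_character H' \<psi>'" "H \<subseteq> H'" "g \<in> H'" "\<And>h. h \<in> H \<Longrightarrow> \<psi>' h = \<psi> h"
    "cmod (\<Sum>i\<in>{i\<in>I. x i \<in> H}. c i * \<psi> (x i)) \<le> cmod (\<Sum>i\<in>{i\<in>I. x i \<in> H'}. c i * \<psi>' (x i))"
proof -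
  have sub: "subgroup H G" using a by (simp add: unit_character_def)
  note hc = subgroup.mem_carrier[OF sub]
  let ?H = "{h \<otimes> g [^] (k::int) | h k. h \<in> H}"
  define ex where "ex i = (SOME hk. fst hk \<in> H \<and> x i = fst hk \<otimes> g [^] (snd hk :: int))" for i
  have ex: "fst (ex i) \<in> H \<and> x i = fst (ex i) \<otimes> g [^] (snd (ex i))" if xi: "x i \<in> ?H" for i
  proof -
    obtain h and k :: int where "h \<in> H" "x i = h \<otimes> g [^] k" using xi by blast
    then have "\<exists>hk. fst hk \<in> H \<and> x i = fst hk \<otimes> g [^] (snd hk :: int)" by (intro exI[of _ "(h, k)"]) simp
    then show ?thesis unfolding ex_def by (rule someI_ex)
  qed
  have "\<exists>m>0. \<exists>w. cmod w = 1 \<and> (\<forall>z k. z ^ m = w \<longrightarrow> g [^] (k::int) \<in> H \<longrightarrow> \<psi> (g [^] k) = z powi k)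
    \<and> (\<forall>i\<in>I. x i \<in> ?H - H \<longrightarrow> \<not> int m dvd snd (ex i))"
  proof (cases "\<exists>m::nat. m > 0 \<and> g [^] m \<in> H")
    case True
    define m where "m = (LEAST m::nat. m > 0 \<and> g [^] m \<in> H)"
    have m: "m > 0" "g [^] m \<in> H" using LeastI_ex[of "\<lambda>m. m > 0 \<and> g [^] m \<in> H"] True by (auto simp: m_def)
    have least: "\<not> (0 < n \<and> n < m \<and> g [^] n \<in> H)" for n :: nat
      using not_less_Least[of n "\<lambda>m. m > 0 \<and> g [^] m \<in> H"] by (auto simp: m_def)
    have mp: "g [^] (int m * q) \<in> H \<and> \<psi> (g [^] (int m * q)) = \<psi> (g [^] m) powi q" for q :: int
    proof -
      have "g [^] (int m * q) = (g [^] m) [^] q" using g by (simp add: int_pow_pow int_pow_int flip: int_pow_int)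
      then show ?thesis using unit_character_int_pow[OF a m(2), of q] by simp
    qed
    have dvd: "int m dvd k" if k: "g [^] k \<in> H" for k :: int
    proof (rule ccontr)
      assume nd: "\<not> int m dvd k"
      define r where "r = nat (k mod int m)"
      have r: "int r = k mod int m" using m by (simp add: r_def)
      have "0 < k mod int m" using nd m by (metis dvd_eq_mod_eq_0 of_nat_0_less_iff order_le_less pos_mod_sign)
      then have r0: "0 < r" using r by linarith
      have "int r < int m" unfolding r using m by simp
      then have rm: "r < m" by simp
      have "k = int m * (k div int m) + int r" using r by simp
      then have "g [^] int r = g [^] (k + int m * (- (k div int m)))" by (metis add_diff_cancel_left' diff_conv_add_uminus mult_minus_right)
      also have "\<dots> = g [^] k \<otimes> g [^] (int m * (- (k div int m)))" by (rule int_pow_mult[OF g])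
      also have "\<dots> \<in> H" using k mp subgroup.m_closed[OF sub] by blast
      finally have "g [^] r \<in> H" by (simp add: int_pow_int)
      then show False using least r0 rm by blast
    qed
    show ?thesis
    proof (intro exI[of _ m] conjI exI[of _ "\<psi> (g [^] m)"] allI impI ballI)
      show "0 < m" "cmod (\<psi> (g [^] m)) = 1" using m a by (auto simp: unit_character_def)
      fix z and k :: int assume z: "z ^ m = \<psi> (g [^] m)" and k: "g [^] k \<in> H"
      obtain q where q: "k = int m * q" using dvd[OF k] by (auto elim: dvdE)
      have "z powi k = (z powi int m) powi q" unfolding q by (rule power_int_mult)
      then show "\<psi> (g [^] k) = z powi k" using mp[of q] z q by simp
    next
      fix i assume i: "i \<in> I" "x i \<in> ?H - H"
      show "\<not> int m dvd snd (ex i)"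
      proof
        assume "int m dvd snd (ex i)"
        then have "g [^] snd (ex i) \<in> H" using mp by (auto elim!: dvdE)
        then have "fst (ex i) \<otimes> g [^] snd (ex i) \<in> H" using ex[of i] i subgroup.m_closed[OF sub] by blast
        then show False using ex[of i] i by auto
      qed
    qed
  next
    case False
    \<comment> \<open>Now only the exponent \<open>0\<close> is divisible by \<open>m\<close> among the exponents of \<open>g\<close> in the \<open>x i\<close>.\<close>
    define m where "m = Suc (\<Sum>i\<in>I. nat \<bar>snd (ex i)\<bar>)"
    have lt: "\<bar>snd (ex i)\<bar> < int m" if "i \<in> I" for i
    proof -
      have "nat \<bar>snd (ex i)\<bar> \<le> (\<Sum>i\<in>I. nat \<bar>snd (ex i)\<bar>)" using that I by (intro member_le_sum) auto
      then have "nat \<bar>snd (ex i)\<bar> < m" by (simp add: m_def)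
      then show ?thesis by (simp add: nat_less_iff)
    qed
    have zero: "k = 0" if k: "g [^] k \<in> H" for k :: int
    proof (rule ccontr)
      assume "k \<noteq> 0"
      have "g [^] nat \<bar>k\<bar> \<in> H"
      proof (cases "k \<ge> 0")
        case True
        then have "g [^] nat \<bar>k\<bar> = g [^] k" using pow_nat[OF True] by simp
        then show ?thesis using k by metis
      next
        case False
        then have "g [^] k = inv (g [^] nat \<bar>k\<bar>)" unfolding int_pow_def2[of G g k] by simp
        then show ?thesis using subgroup.m_inv_closed[OF sub k] g by simp
      qed
      moreover have "nat \<bar>k\<bar> > 0" using \<open>k \<noteq> 0\<close> by simp
      ultimately show False using False by blast
    qed
    show ?thesis
    proof (intro exI[of _ m] conjI exI[of _ 1] allI impI ballI)
      show "0 < m" by (simp add: m_def)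
      show "cmod 1 = 1" by simp
      fix z and k :: int assume k: "g [^] k \<in> H"
      show "\<psi> (g [^] k) = z powi k" using zero[OF k] unit_character_one[OF a] by simp
    next
      fix i assume i: "i \<in> I" "x i \<in> ?H - H"
      have "snd (ex i) \<noteq> 0"
      proof
        assume "snd (ex i) = 0"
        then have "x i = fst (ex i)" "fst (ex i) \<in> H" using ex[of i] i hc by auto
        then show False using i by simp
      qed
      then show "\<not> int m dvd snd (ex i)" using lt[OF i(1)] zdvd_not_zless[of "\<bar>snd (ex i)\<bar>" "int m"] by auto
    qed
  qed
  then obtain m w where m: "m > 0" and w: "cmod w = 1"
    and adm: "\<And>z k. z ^ m = w \<Longrightarrow> g [^] (k::int) \<in> H \<Longrightarrow> \<psi> (g [^] k) = z powi k"
    and nd: "\<And>i. i \<in> I \<Longrightarrow> x i \<in> ?H - H \<Longrightarrow> \<not> int m dvd snd (ex i)" by blast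
  define Z where "Z = {z. z ^ m = w}"
  have w0: "w \<noteq> 0" using w by auto
  have cardZ: "card Z = m" unfolding Z_def using card_nth_roots[OF w0 m] .
  have Z: "finite Z" "Z \<noteq> {}" using cardZ m card_ge_0_finite[of Z] by auto
  have Zc: "cmod z = 1" if "z \<in> Z" for z
  proof -
    have "z ^ m = w" using that by (simp add: Z_def)
    then have "cmod z ^ m = 1 ^ m" using w by (simp flip: norm_power)
    then show ?thesis using power_eq_imp_eq_base[of "cmod z" m 1] m by simp
  qed
  have "\<exists>\<psi>'. unit_character ?H \<psi>' \<and> (\<forall>h k. h \<in> H \<longrightarrow> \<psi>' (h \<otimes> g [^] (k::int)) = \<psi> h * z powi k)" if z: "z \<in> Z" for z
  proof -
    have adm': "\<psi> (g [^] k) = z powi k" if "g [^] k \<in> H" for k :: int using adm z that by (simp add: Z_def)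
    show ?thesis by (rule unit_character_extend_value[OF a g Zc[OF z] adm']) blast+
  qed
  then have "\<forall>z\<in>Z. \<exists>\<psi>'. unit_character ?H \<psi>' \<and> (\<forall>h k. h \<in> H \<longrightarrow> \<psi>' (h \<otimes> g [^] (k::int)) = \<psi> h * z powi k)" by blast
  from bchoice[OF this] obtain X where X: "\<And>z. z \<in> Z \<Longrightarrow> unit_character ?H (X z)"
    "\<And>z h k. z \<in> Z \<Longrightarrow> h \<in> H \<Longrightarrow> X z (h \<otimes> g [^] (k::int)) = \<psi> h * z powi k" by blast
  have HH: "H \<subseteq> ?H"
  proof
    fix h assume "h \<in> H"
    then show "h \<in> ?H" using hc by (intro CollectI exI[of _ h] exI[of _ "0::int"]) auto
  qed
  have XH: "X z h = \<psi> h" if "z \<in> Z" "h \<in> H" for z h using X(2)[OF that, of 0] hc[OF that(2)] by simp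
  have "(\<Sum>z\<in>Z. X z (x i)) = (if x i \<in> H then of_nat (card Z) * \<psi> (x i) else 0)"
    if i: "i \<in> {i\<in>I. x i \<in> ?H}" for i
  proof (cases "x i \<in> H")
    case True
    then show ?thesis using XH by simp
  next
    case False
    have e: "fst (ex i) \<in> H" "x i = fst (ex i) \<otimes> g [^] (snd (ex i))" using ex[of i] i by auto
    have "X z (x i) = \<psi> (fst (ex i)) * z powi (snd (ex i))" if "z \<in> Z" for z
      using X(2)[OF that e(1), of "snd (ex i)"] e(2) by simp
    then have "(\<Sum>z\<in>Z. X z (x i)) = \<psi> (fst (ex i)) * (\<Sum>z\<in>Z. z powi (snd (ex i)))"
      by (simp add: sum_distrib_left)
    also have "\<dots> = 0" unfolding Z_def using sum_roots_powi_eq_0[OF m nd] i False by simp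
    finally show ?thesis using False by simp
  qed
  then have "(\<Sum>z\<in>Z. \<Sum>i\<in>{i\<in>I. x i \<in> ?H}. c i * X z (x i))
      = (\<Sum>i\<in>{i\<in>I. x i \<in> ?H}. c i * (if x i \<in> H then of_nat (card Z) * \<psi> (x i) else 0))"
    by (subst sum.swap) (simp flip: sum_distrib_left)
  also have "\<dots> = (\<Sum>i\<in>{i\<in>I. x i \<in> H}. c i * (of_nat (card Z) * \<psi> (x i)))"
    using I HH by (intro sum.mono_neutral_cong_right) auto
  also have "\<dots> = of_nat (card Z) * (\<Sum>i\<in>{i\<in>I. x i \<in> H}. c i * \<psi> (x i))"
    by (simp add: sum_distrib_left mult_ac)
  finally obtain z where z: "z \<in> Z" "cmod (\<Sum>i\<in>{i\<in>I. x i \<in> H}. c i * \<psi> (x i)) \<le> cmod (\<Sum>i\<in>{i\<in>I. x i \<in> ?H}. c i * X z (x i))"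
    using exists_large_term[OF Z] by blast
  have "g \<in> ?H"
    using subgroup.one_closed[OF sub] g by (intro CollectI exI[of _ \<one>] exI[of _ "1::int"]) auto
  then show thesis using that[OF X(1)[OF z(1)] HH _ XH[OF z(1)] z(2)] by blast
qed

text \<open>
  A weak form of Fourier inversion: the coefficient of a finitely supported function at the trivial
  coset of \<open>N\<close> is an average of its values at characters that are trivial on \<open>N\<close>, so one of these values
  is at least as large. The character is built up from \<open>N\<close> by adjoining the \<open>x i\<close> one at a time.
\<close>

lemma dominating_character:
  fixes c :: "'i \<Rightarrow> complex"
  assumes N: "subgroup N G" and I: "finite I" and x: "\<And>i. i \<in> I \<Longrightarrow> x i \<in> carrier G"
  obtains H \<psi> where "unit_character H \<psi>" "N \<subseteq> H" "\<And>n. n \<in> N \<Longrightarrow> \<psi> n = 1" "\<And>i. i \<in> I \<Longrightarrow> x i \<in> H"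
    "cmod (\<Sum>i\<in>{i\<in>I. x i \<in> N}. c i) \<le> cmod (\<Sum>i\<in>I. c i * \<psi> (x i))"
proof -
  have "\<exists>H \<psi>. unit_character H \<psi> \<and> N \<subseteq> H \<and> (\<forall>n\<in>N. \<psi> n = 1) \<and> (\<forall>j\<in>J. x j \<in> H)
    \<and> cmod (\<Sum>i\<in>{i\<in>I. x i \<in> N}. c i) \<le> cmod (\<Sum>i\<in>{i\<in>I. x i \<in> H}. c i * \<psi> (x i))" if "J \<subseteq> I" for J
    using finite_subset[OF that I] that
  proof (induction J)
    case empty
    have "unit_character N (\<lambda>_. 1)" using N by (simp add: unit_character_def)
    then show ?case by (intro exI[of _ N] exI[of _ "\<lambda>_. 1"]) simp
  next
    case (insert j J)
    then obtain H \<psi> where H: "unit_character H \<psi>" "N \<subseteq> H" "\<forall>n\<in>N. \<psi> n = 1" "\<forall>j\<in>J. x j \<in> H"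
      "cmod (\<Sum>i\<in>{i\<in>I. x i \<in> N}. c i) \<le> cmod (\<Sum>i\<in>{i\<in>I. x i \<in> H}. c i * \<psi> (x i))" by auto
    have "x j \<in> carrier G" using insert x by auto
    from unit_character_extend[OF H(1) this I, where x = x and c = c]
    obtain H' \<psi>' where H': "unit_character H' \<psi>'" "H \<subseteq> H'" "x j \<in> H'" "\<And>h. h \<in> H \<Longrightarrow> \<psi>' h = \<psi> h"
      "cmod (\<Sum>i\<in>{i\<in>I. x i \<in> H}. c i * \<psi> (x i)) \<le> cmod (\<Sum>i\<in>{i\<in>I. x i \<in> H'}. c i * \<psi>' (x i))" by blast
    show ?case
      using H H' by (intro exI[of _ H'] exI[of _ \<psi>']) (auto intro: order_trans)
  qed
  from this[of I] obtain H \<psi> where H: "unit_character H \<psi>" "N \<subseteq> H" "\<forall>n\<in>N. \<psi> n = 1" "\<forall>j\<in>I. x j \<in> H"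
      "cmod (\<Sum>i\<in>{i\<in>I. x i \<in> N}. c i) \<le> cmod (\<Sum>i\<in>{i\<in>I. x i \<in> H}. c i * \<psi> (x i))" by auto
  have "{i\<in>I. x i \<in> H} = I" using H by auto
  then have "cmod (\<Sum>i\<in>{i\<in>I. x i \<in> N}. c i) \<le> cmod (\<Sum>i\<in>I. c i * \<psi> (x i))" using H(5) by simp
  then show thesis using that[OF H(1,2)] H(3,4) by blast
qed

section \<open>Products that vanish modulo subgroups\<close>

text \<open>
  The product of the \<open>1 - q\<close> in the group ring, expanded into a list of terms.
\<close>

primrec annihilator :: "'a list \<Rightarrow> (complex \<times> 'a) list" where
  "annihilator [] = [(1, \<one>)]"
| "annihilator (q # qs) = annihilator qs @ map (\<lambda>(c, g). (- c, q \<otimes> g)) (annihilator qs)"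

lemma annihilator_subgroup:
  assumes "subgroup H G" "set qs \<subseteq> H" "(c, g) \<in> set (annihilator qs)"
  shows "g \<in> H"
  using assms(2,3)
proof (induction qs arbitrary: c g)
  case Nil
  then show ?case using subgroup.one_closed[OF assms(1)] by simp
next
  case (Cons q qs)
  then show ?case using subgroup.m_closed[OF assms(1)] by auto
qed

lemma annihilator_character:
  assumes "unit_character H \<psi>" "set qs \<subseteq> H"
  shows "(\<Sum>(c, g)\<leftarrow>annihilator qs. c * \<psi> g) = (\<Prod>q\<leftarrow>qs. 1 - \<psi> q)"
  using assms(2)
proof (induction qs)
  case Nil
  then show ?case using unit_character_one[OF assms(1)] by simp
next
  case (Cons q qs)
  have sub: "subgroup H G" using assms(1) by (simp add: unit_character_def)
  have "(\<Sum>(c, g)\<leftarrow>map (\<lambda>(c, g). (- c, q \<otimes> g)) (annihilator qs). c * \<psi> g)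
      = (\<Sum>(c, g)\<leftarrow>annihilator qs. - \<psi> q * (c * \<psi> g))"
  proof -
    have "\<psi> (q \<otimes> g) = \<psi> q * \<psi> g" if "(c, g) \<in> set (annihilator qs)" for c g
      using annihilator_subgroup[OF sub _ that] Cons.prems assms(1) by (simp add: unit_character_def)
    then show ?thesis
      by (auto simp: o_def case_prod_beta intro!: arg_cong[where f = sum_list] map_cong)
  qed
  also have "\<dots> = - \<psi> q * (\<Sum>(c, g)\<leftarrow>annihilator qs. c * \<psi> g)"
  proof -
    have "(\<Sum>(c, g)\<leftarrow>L. - \<psi> q * (c * \<psi> g)) = - \<psi> q * (\<Sum>(c, g)\<leftarrow>L. c * \<psi> g)" for L :: "(complex \<times> 'a) list"
      by (induction L) (auto simp: algebra_simps)
    then show ?thesis .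
  qed
  finally show ?case using Cons by (simp add: algebra_simps)
qed

text \<open>
  If \<open>q \<in> X\<close>, then \<open>1 - q\<close>, and hence the product, is zero in the group ring of the quotient by \<open>X\<close>.
  The map \<open>e\<close> stands for the quotient map.
\<close>

lemma annihilator_vanishes:
  assumes X: "subgroup X G"
    and e: "\<And>g h. g \<in> carrier G \<Longrightarrow> h \<in> carrier G \<Longrightarrow> e g = e h \<longleftrightarrow> inv g \<otimes> h \<in> X"
    and qs: "set qs \<subseteq> carrier G" and q: "q \<in> set qs" "q \<in> X"
  shows "(\<Sum>(c, g)\<leftarrow>annihilator qs. if e g = \<eta> then c else 0) = 0"
  using qs q(1)
proof (induction qs arbitrary: \<eta>)
  case (Cons p qs)
  have p: "p \<in> carrier G" and qs: "set qs \<subseteq> carrier G" using Cons.prems by auto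
  have g: "g \<in> carrier G" if "(c, g) \<in> set (annihilator qs)" for c g
    using annihilator_subgroup[OF subgroup_self qs that] .
  have shift: "inv (p \<otimes> g) \<otimes> (p \<otimes> h) = inv g \<otimes> h" if "g \<in> carrier G" "h \<in> carrier G" for g h
  proof -
    have "inv (p \<otimes> g) \<otimes> (p \<otimes> h) = inv g \<otimes> ((inv p \<otimes> p) \<otimes> h)" using p that
      by (simp add: inv_mult m_ac del: l_inv r_inv)
    then show ?thesis using p that by simp
  qed
  have split: "(\<Sum>(c, g)\<leftarrow>annihilator (p # qs). if e g = \<eta> then c else 0)
    = (\<Sum>(c, g)\<leftarrow>annihilator qs. if e g = \<eta> then c else 0)
      - (\<Sum>(c, g)\<leftarrow>annihilator qs. if e (p \<otimes> g) = \<eta> then c else 0)" (is "_ = ?a - ?b")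
  proof -
    have "(\<Sum>(c, g)\<leftarrow>map (\<lambda>(c, g). (- c, p \<otimes> g)) L. if e g = \<eta> then c else 0)
      = - (\<Sum>(c, g)\<leftarrow>L. if e (p \<otimes> g) = \<eta> then c else 0)" for L :: "(complex \<times> 'a) list"
      by (induction L) auto
    then show ?thesis by simp
  qed
  show ?case
  proof (cases "p = q")
    case True
    have "e (p \<otimes> h) = e h" if h: "h \<in> carrier G" for h
    proof -
      have "inv h \<otimes> (p \<otimes> h) = p" using p h by (simp add: m_lcomm)
      then show ?thesis using e[of h "p \<otimes> h"] h p q(2) True by simp
    qed
    then have "?b = ?a" using g by (auto intro!: arg_cong[where f = sum_list] map_cong)
    then show ?thesis using split by simp
  next
    case False
    then have q': "q \<in> set qs" using Cons.prems by auto
    have "?b = 0"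
    proof (cases "\<exists>c0 g0. (c0, g0) \<in> set (annihilator qs) \<and> e (p \<otimes> g0) = \<eta>")
      case True
      then obtain c0 g0 where 0: "(c0, g0) \<in> set (annihilator qs)" "e (p \<otimes> g0) = \<eta>" by blast
      have "e (p \<otimes> h) = \<eta> \<longleftrightarrow> e h = e g0" if "h \<in> carrier G" for h
        using e[of "p \<otimes> h" "p \<otimes> g0"] e[of h g0] shift[OF that g[OF 0(1)]] p that g[OF 0(1)] 0(2) by auto
      then have "?b = (\<Sum>(c, g)\<leftarrow>annihilator qs. if e g = e g0 then c else 0)"
        using g by (auto intro!: arg_cong[where f = sum_list] map_cong)
      then show ?thesis using Cons.IH[OF qs q'] by simp
    next
      case False
      then have "?b = (\<Sum>(c, g)\<leftarrow>annihilator qs. 0)"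
        by (auto intro!: arg_cong[where f = sum_list] map_cong)
      moreover have "(\<Sum>(c, g)\<leftarrow>L. 0) = (0 :: complex)" for L :: "(complex \<times> 'a) list"
        by (induction L) auto
      ultimately show ?thesis by simp
    qed
    then show ?thesis using split Cons.IH[OF qs q'] by simp
  qed
qed simp

text \<open>
  A character that factors through \<open>e\<close> maps the product to \<open>\<Prod> (1 - \<psi> q)\<close>, so the product is not
  zero modulo \<open>e\<close>.
\<close>

lemma annihilator_nonzero:
  assumes \<psi>: "unit_character H \<psi>" and qs: "set qs \<subseteq> H" and ne: "\<And>q. q \<in> set qs \<Longrightarrow> \<psi> q \<noteq> 1"
    and e: "\<And>g h. g \<in> H \<Longrightarrow> h \<in> H \<Longrightarrow> e g = e h \<Longrightarrow> \<psi> g = \<psi> h"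
  obtains \<eta> where "(\<Sum>(c, g)\<leftarrow>annihilator qs. if e g = \<eta> then c else 0) \<noteq> 0"
proof (rule ccontr)
  assume nt: "\<not> thesis"
  then have zero: "(\<Sum>(c, g)\<leftarrow>annihilator qs. if e g = \<eta> then c else 0) = 0" for \<eta> using that by blast
  have sub: "subgroup H G" using \<psi> by (simp add: unit_character_def)
  let ?L = "annihilator qs" and ?I = "{..<length (annihilator qs)}"
  have H: "snd (?L ! i) \<in> H" if "i \<in> ?I" for i
    using annihilator_subgroup[OF sub qs, of "fst (?L ! i)"] that by (metis lessThan_iff nth_mem prod.collapse)
  obtain u where u: "(\<Sum>i\<in>?I. fst (?L ! i) * \<psi> (snd (?L ! i)))
      = (\<Sum>\<eta>\<in>(\<lambda>i. e (snd (?L ! i))) ` ?I. u \<eta> * (\<Sum>i\<in>?I. if e (snd (?L ! i)) = \<eta> then fst (?L ! i) else 0))"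
  proof (rule sum_by_classes[of ?I "\<lambda>i. e (snd (?L ! i))" "\<lambda>i. \<psi> (snd (?L ! i))" "\<lambda>i. fst (?L ! i)"])
    fix i j assume "i \<in> ?I" "j \<in> ?I" "e (snd (?L ! i)) = e (snd (?L ! j))"
    then show "\<psi> (snd (?L ! i)) = \<psi> (snd (?L ! j))" using e H by blast
  next
    fix i assume "i \<in> ?I"
    then show "cmod (\<psi> (snd (?L ! i))) = 1" using \<psi> H by (simp add: unit_character_def)
  qed auto
  have "(\<Sum>i\<in>?I. if e (snd (?L ! i)) = \<eta> then fst (?L ! i) else 0) = 0" for \<eta>
    using zero[of \<eta>] by (simp add: sum_list_sum_nth case_prod_beta atLeast0LessThan)
  then have "(\<Sum>i\<in>?I. fst (?L ! i) * \<psi> (snd (?L ! i))) = 0" using u by simp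
  then have "(\<Sum>(c, g)\<leftarrow>?L. c * \<psi> g) = 0" by (simp add: sum_list_sum_nth case_prod_beta atLeast0LessThan)
  then have "(\<Prod>q\<leftarrow>qs. 1 - \<psi> q) = 0" using annihilator_character[OF \<psi> qs] by simp
  then show False using ne by (auto simp: prod_list_zero_iff)
qed

section \<open>Powers in the group ring\<close>

primrec word_prod :: "('i \<Rightarrow> 'a) \<Rightarrow> 'i list \<Rightarrow> 'a" where
  "word_prod a [] = \<one>"
| "word_prod a (i # u) = a i \<otimes> word_prod a u"

lemma word_prod_subgroup:
  assumes "subgroup H G" "\<And>i. i \<in> F \<Longrightarrow> a i \<in> H" "set u \<subseteq> F" shows "word_prod a u \<in> H"
  using assms(3)
proof (induction u)
  case Nil
  then show ?case using subgroup.one_closed[OF assms(1)] by simp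
next
  case (Cons i u)
  then show ?case using subgroup.m_closed[OF assms(1)] assms(2) by simp
qed

lemma character_power:
  assumes \<psi>: "unit_character H \<psi>" and a: "\<And>i. i \<in> F \<Longrightarrow> a i \<in> H"
  shows "(\<Sum>u\<in>words_of F k. (\<Prod>i\<leftarrow>u. c i) * \<psi> (word_prod a u)) = (\<Sum>i\<in>F. c i * \<psi> (a i)) ^ k"
proof (induction k)
  case 0
  then show ?case using unit_character_one[OF \<psi>] by (simp add: words_of_0)
next
  case (Suc k)
  have sub: "subgroup H G" using \<psi> by (simp add: unit_character_def)
  have "\<psi> (a i \<otimes> word_prod a u) = \<psi> (a i) * \<psi> (word_prod a u)" if "i \<in> F" "u \<in> words_of F k" for i u
    using \<psi> a that word_prod_subgroup[OF sub a, where F = F and u = u] by (simp add: unit_character_def words_of_def)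
  then have "(\<Sum>u\<in>words_of F (Suc k). (\<Prod>i\<leftarrow>u. c i) * \<psi> (word_prod a u))
    = (\<Sum>i\<in>F. \<Sum>u\<in>words_of F k. (c i * \<psi> (a i)) * ((\<Prod>i\<leftarrow>u. c i) * \<psi> (word_prod a u)))"
    unfolding sum_words_of_Suc by (intro sum.cong) (auto simp: mult_ac)
  also have "\<dots> = (\<Sum>i\<in>F. c i * \<psi> (a i)) * (\<Sum>u\<in>words_of F k. (\<Prod>i\<leftarrow>u. c i) * \<psi> (word_prod a u))"
    by (simp add: sum_product)
  finally show ?case using Suc by simp
qed

text \<open>
  By commutativity a product depends only on how often each letter occurs in the word.
\<close>

lemma card_word_prods:
  assumes F: "finite F" and a: "\<And>i. i \<in> F \<Longrightarrow> a i \<in> carrier G"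
  shows "card (word_prod a ` words_of F k) \<le> (k + 1) ^ card F"
proof -
  let ?p = "\<lambda>m. finprod G (\<lambda>i. a i [^] (m i :: nat)) F"
  have eq: "word_prod a u = ?p (count_list u)" if "set u \<subseteq> F" for u
    using that
  proof (induction u)
    case Nil
    then show ?case by simp
  next
    case (Cons j u)
    have j: "j \<in> F" using Cons by simp
    have "?p (count_list (j # u)) = finprod G (\<lambda>i. (if j = i then a i else \<one>) \<otimes> a i [^] count_list u i) F"
    proof (rule finprod_cong')
      fix i assume i: "i \<in> F"
      show "a i [^] count_list (j # u) i = (if j = i then a i else \<one>) \<otimes> a i [^] count_list u i"
        using a[OF i] by (auto simp: m_comm)
    qed (use a in auto)
    also have "\<dots> = finprod G (\<lambda>i. if j = i then a i else \<one>) F \<otimes> ?p (count_list u)"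
      using a by (intro finprod_multf) auto
    also have "finprod G (\<lambda>i. if j = i then a i else \<one>) F = a j"
      using a F j by (intro finprod_singleton) auto
    finally show ?case using Cons by simp
  qed
  have "word_prod a ` words_of F k \<subseteq> ?p ` (F \<rightarrow>\<^sub>E {..k})"
  proof
    fix g assume "g \<in> word_prod a ` words_of F k"
    then obtain u where u: "set u \<subseteq> F" "length u = k" "g = word_prod a u" by (auto simp: words_of_def)
    have "count_list u i \<le> k" for i using count_le_length[of u i] u by simp
    then have "restrict (count_list u) F \<in> F \<rightarrow>\<^sub>E {..k}" by auto
    moreover have "g = ?p (restrict (count_list u) F)"
      unfolding u(3) eq[OF u(1)] using a by (intro finprod_cong') auto
    ultimately show "g \<in> ?p ` (F \<rightarrow>\<^sub>E {..k})" by blast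
  qed
  then have "card (word_prod a ` words_of F k) \<le> card (?p ` (F \<rightarrow>\<^sub>E {..k}))"
    by (rule card_mono[rotated]) (use F in \<open>auto intro!: finite_PiE\<close>)
  also have "\<dots> \<le> card (F \<rightarrow>\<^sub>E {..k})" by (rule card_image_le) (use F in \<open>auto intro!: finite_PiE\<close>)
  also have "\<dots> = (k + 1) ^ card F" using F by (simp add: card_PiE)
  finally show ?thesis .
qed

text \<open>
  Let \<open>\<phi>\<close> be the group ring element \<open>\<Sum> c i \<cdot> a i\<close>. Modulo \<open>e\<close> the element \<open>\<phi>\<^sup>k\<close> has at most
  \<open>(k + 1) ^ card F\<close> coefficients, and \<open>\<psi>(\<phi>)\<^sup>k\<close> is their sum with unimodular weights; the hypothesis
  bounds the sum of their squares, and the Cauchy--Schwarz inequality does the rest.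
\<close>

lemma character_growth_bound:
  assumes \<psi>: "unit_character H \<psi>" and F: "finite F" and a: "\<And>i. i \<in> F \<Longrightarrow> a i \<in> H"
    and e: "\<And>u u'. u \<in> words_of F k \<Longrightarrow> u' \<in> words_of F k \<Longrightarrow> e (word_prod a u) = e (word_prod a u')
      \<Longrightarrow> \<psi> (word_prod a u) = \<psi> (word_prod a u')"
    and B: "(\<Sum>\<eta>\<in>(\<lambda>u. e (word_prod a u)) ` words_of F k.
      (cmod (\<Sum>u\<in>words_of F k. if e (word_prod a u) = \<eta> then (\<Prod>i\<leftarrow>u. c i) else 0))\<^sup>2) \<le> B"
  shows "cmod (\<Sum>i\<in>F. c i * \<psi> (a i)) ^ (2 * k) \<le> real (k + 1) ^ card F * B"
proof -
  have sub: "subgroup H G" using \<psi> by (simp add: unit_character_def)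
  let ?W = "words_of F k" and ?S = "(\<lambda>u. e (word_prod a u)) ` words_of F k"
  let ?\<Xi> = "\<lambda>\<eta>. \<Sum>u\<in>words_of F k. if e (word_prod a u) = \<eta> then (\<Prod>i\<leftarrow>u. c i) else 0"
  have finW: "finite ?W" by (rule finite_words_of[OF F])
  obtain v where v: "\<And>\<eta>. \<eta> \<in> ?S \<Longrightarrow> cmod (v \<eta>) = 1"
    "(\<Sum>u\<in>?W. (\<Prod>i\<leftarrow>u. c i) * \<psi> (word_prod a u)) = (\<Sum>\<eta>\<in>?S. v \<eta> * ?\<Xi> \<eta>)"
  proof (rule sum_by_classes[OF finW, of "\<lambda>u. e (word_prod a u)" "\<lambda>u. \<psi> (word_prod a u)" "\<lambda>u. \<Prod>i\<leftarrow>u. c i"])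
    fix u u' assume "u \<in> ?W" "u' \<in> ?W" "e (word_prod a u) = e (word_prod a u')"
    then show "\<psi> (word_prod a u) = \<psi> (word_prod a u')" by (rule e)
  next
    fix u assume "u \<in> ?W"
    then have "word_prod a u \<in> H" using word_prod_subgroup[OF sub a, where F = F and u = u] by (simp add: words_of_def)
    then show "cmod (\<psi> (word_prod a u)) = 1" using \<psi> by (simp add: unit_character_def)
  qed auto
  have pw: "(\<Sum>u\<in>?W. (\<Prod>i\<leftarrow>u. c i) * \<psi> (word_prod a u)) = (\<Sum>i\<in>F. c i * \<psi> (a i)) ^ k"
    by (rule character_power[OF \<psi> a])
  have "cmod (\<Sum>i\<in>F. c i * \<psi> (a i)) ^ k = cmod (\<Sum>\<eta>\<in>?S. v \<eta> * ?\<Xi> \<eta>)"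
    using v(2) pw by (simp add: norm_power[symmetric])
  also have "\<dots> \<le> (\<Sum>\<eta>\<in>?S. cmod (v \<eta> * ?\<Xi> \<eta>))" by (rule norm_sum)
  also have "\<dots> = (\<Sum>\<eta>\<in>?S. 1 * cmod (?\<Xi> \<eta>))" using v(1) by (intro sum.cong) (auto simp: norm_mult)
  finally have 1: "cmod (\<Sum>i\<in>F. c i * \<psi> (a i)) ^ k \<le> (\<Sum>\<eta>\<in>?S. 1 * cmod (?\<Xi> \<eta>))" .
  have "cmod (\<Sum>i\<in>F. c i * \<psi> (a i)) ^ (2 * k) = (cmod (\<Sum>i\<in>F. c i * \<psi> (a i)) ^ k)\<^sup>2"
    by (simp add: power_mult mult.commute flip: power_mult)
  also have "\<dots> \<le> (\<Sum>\<eta>\<in>?S. 1 * cmod (?\<Xi> \<eta>))\<^sup>2" by (rule power_mono[OF 1]) simp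
  also have "\<dots> \<le> (\<Sum>\<eta>\<in>?S. 1\<^sup>2) * (\<Sum>\<eta>\<in>?S. (cmod (?\<Xi> \<eta>))\<^sup>2)" by (rule Cauchy_Schwarz_ineq_sum)
  also have "\<dots> \<le> real (card ?S) * B" using B by (simp add: mult_left_mono)
  also have "\<dots> \<le> real (k + 1) ^ card F * B"
  proof (rule mult_right_mono)
    have "card ?S \<le> card (word_prod a ` ?W)"
      using card_image_le[of "word_prod a ` ?W" e] finW by (simp add: image_image)
    also have "\<dots> \<le> (k + 1) ^ card F"
      using a subgroup.mem_carrier[OF sub] by (intro card_word_prods[OF F]) blast
    finally have "real (card ?S) \<le> real ((k + 1) ^ card F)" by (rule of_nat_mono)
    then show "real (card ?S) \<le> real (k + 1) ^ card F" by simp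
    have "0 \<le> (\<Sum>\<eta>\<in>?S. (cmod (?\<Xi> \<eta>))\<^sup>2)" by (intro sum_nonneg) simp
    then show "0 \<le> B" using B by linarith
  qed
  finally show ?thesis .
qed

end

lemma polynomial_less_exponential: "\<exists>k. real (k + 1) ^ m < 4 ^ k"
proof -
  have "((\<lambda>k. real (k + 1) ^ m / 4 ^ k) \<longlongrightarrow> 0) at_top" by real_asymp
  then have "eventually (\<lambda>k. real (k + 1) ^ m / 4 ^ k < 1) at_top" by (rule order_tendstoD) simp
  then obtain k where "real (k + 1) ^ m / 4 ^ k < 1" by (meson eventually_happens trivial_limit_sequentially)
  then show ?thesis by (auto simp: divide_less_eq)
qed

context self_similar_bundle
begin

section \<open>Paths and the action of the bundle\<close>

text \<open>
  \<open>walk v p u\<close>: the edge list \<open>p\<close> is a path with range \<open>v\<close> and source \<open>u\<close>.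
\<close>

primrec walk :: "'v \<Rightarrow> 'e list \<Rightarrow> 'v \<Rightarrow> bool" where
  "walk v [] u \<longleftrightarrow> u = v \<and> v \<in> verts E"
| "walk v (e # p) u \<longleftrightarrow> e \<in> arcs E \<and> head E e = v \<and> walk (tail E e) p u"

lemma awalk_rev_iff_walk: "awalk u (rev p) v \<longleftrightarrow> walk v p u"
proof (induction p arbitrary: v)
  case Nil
  then show ?case by (auto simp: awalk_Nil_iff)
next
  case (Cons e p)
  have "awalk u (rev p @ [e]) v \<longleftrightarrow> e \<in> arcs E \<and> head E e = v \<and> awalk u (rev p) (tail E e)"
    by (auto simp: awalk_def)
  then show ?case using Cons by simp
qed

lemma paths_to_eq: "paths_to E v = {p. \<exists>u. walk v p u}"
  unfolding paths_to_def by (rule Collect_cong) (metis awalk_rev_iff_walk)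

lemma walk_in_paths_to: "walk v p u \<Longrightarrow> p \<in> paths_to E v"
  unfolding paths_to_eq by blast

lemma in_paths_toE: "p \<in> paths_to E v \<Longrightarrow> (\<And>u. walk v p u \<Longrightarrow> thesis) \<Longrightarrow> thesis"
  unfolding paths_to_eq by blast

lemma paths_from_eq: "paths_from E u = {p. \<exists>v. walk v p u}"
  unfolding paths_from_def by (rule Collect_cong) (metis awalk_rev_iff_walk)

lemma walk_verts: "walk v p u \<Longrightarrow> v \<in> verts E \<and> u \<in> verts E"
  by (induction p arbitrary: v) auto

lemma walk_append: "walk v (p @ q) u \<longleftrightarrow> (\<exists>m. walk v p m \<and> walk m q u)"
  by (induction p arbitrary: v) (auto dest: walk_verts)

lemma walk_source_unique: "walk v p u \<Longrightarrow> walk v p u' \<Longrightarrow> u = u'"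
  by (induction p arbitrary: v) auto

lemma walk_range_unique: "walk v p u \<Longrightarrow> walk v' p u \<Longrightarrow> v = v'"
  by (cases p) auto

lemma G_group: "v \<in> verts E \<Longrightarrow> group (G v)"
  using fibre_group comm_group.axioms(2) by blast

lemma G_monoid: "v \<in> verts E \<Longrightarrow> monoid (G v)"
  using G_group group.is_monoid by blast

lemma G_mult [simp]:
  "v \<in> verts E \<Longrightarrow> g \<in> carrier (G v) \<Longrightarrow> h \<in> carrier (G v) \<Longrightarrow> g \<otimes>\<^bsub>G v\<^esub> h \<in> carrier (G v)"
  by (rule monoid.m_closed[OF G_monoid])

lemma G_one [simp]: "v \<in> verts E \<Longrightarrow> \<one>\<^bsub>G v\<^esub> \<in> carrier (G v)"
  by (rule monoid.one_closed[OF G_monoid])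

lemma G_inv [simp]: "v \<in> verts E \<Longrightarrow> g \<in> carrier (G v) \<Longrightarrow> inv\<^bsub>G v\<^esub> g \<in> carrier (G v)"
  by (rule group.inv_closed[OF G_group])

lemma G_l_one [simp]: "v \<in> verts E \<Longrightarrow> g \<in> carrier (G v) \<Longrightarrow> \<one>\<^bsub>G v\<^esub> \<otimes>\<^bsub>G v\<^esub> g = g"
  by (rule monoid.l_one[OF G_monoid])

lemma G_r_one [simp]: "v \<in> verts E \<Longrightarrow> g \<in> carrier (G v) \<Longrightarrow> g \<otimes>\<^bsub>G v\<^esub> \<one>\<^bsub>G v\<^esub> = g"
  by (rule monoid.r_one[OF G_monoid])

lemma G_l_inv [simp]: "v \<in> verts E \<Longrightarrow> g \<in> carrier (G v) \<Longrightarrow> inv\<^bsub>G v\<^esub> g \<otimes>\<^bsub>G v\<^esub> g = \<one>\<^bsub>G v\<^esub>"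
  by (rule group.l_inv[OF G_group])

lemma G_r_inv [simp]: "v \<in> verts E \<Longrightarrow> g \<in> carrier (G v) \<Longrightarrow> g \<otimes>\<^bsub>G v\<^esub> inv\<^bsub>G v\<^esub> g = \<one>\<^bsub>G v\<^esub>"
  by (rule group.r_inv[OF G_group])

lemma G_inv_inv [simp]: "v \<in> verts E \<Longrightarrow> g \<in> carrier (G v) \<Longrightarrow> inv\<^bsub>G v\<^esub> (inv\<^bsub>G v\<^esub> g) = g"
  by (rule group.inv_inv[OF G_group])

lemma G_assoc:
  "v \<in> verts E \<Longrightarrow> g \<in> carrier (G v) \<Longrightarrow> h \<in> carrier (G v) \<Longrightarrow> k \<in> carrier (G v)
    \<Longrightarrow> (g \<otimes>\<^bsub>G v\<^esub> h) \<otimes>\<^bsub>G v\<^esub> k = g \<otimes>\<^bsub>G v\<^esub> (h \<otimes>\<^bsub>G v\<^esub> k)"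
  by (rule monoid.m_assoc[OF G_monoid])

lemma G_cancel [simp]:
  "v \<in> verts E \<Longrightarrow> g \<in> carrier (G v) \<Longrightarrow> h \<in> carrier (G v) \<Longrightarrow> k \<in> carrier (G v)
    \<Longrightarrow> g \<otimes>\<^bsub>G v\<^esub> k = h \<otimes>\<^bsub>G v\<^esub> k \<longleftrightarrow> g = h"
  by (rule group.right_cancel[OF G_group])

text \<open>
  The section \<open>g|\<^sub>p\<close> along a path.
\<close>

primrec secs :: "'g \<Rightarrow> 'e list \<Rightarrow> 'g" where
  "secs g [] = g"
| "secs g (e # p) = secs (sec g e) p"

lemma secs_append: "secs g (p @ q) = secs (secs g p) q"
  by (induction p arbitrary: g) auto

lemma secs_closed [simp]: "walk v p u \<Longrightarrow> g \<in> carrier (G v) \<Longrightarrow> secs g p \<in> carrier (G u)"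
  by (induction p arbitrary: v g) (auto intro: sec_closed)

lemma act_in_paths_to: "v \<in> verts E \<Longrightarrow> g \<in> carrier (G v) \<Longrightarrow> p \<in> paths_to E v \<Longrightarrow> act v g p \<in> paths_to E v"
  using group_action.element_image[OF action] by blast

lemma act_mult: "g \<in> carrier (G v) \<Longrightarrow> h \<in> carrier (G v) \<Longrightarrow> walk v p u
    \<Longrightarrow> act v (g \<otimes>\<^bsub>G v\<^esub> h) p = act v g (act v h p)"
  using group_action.composition_rule[OF action] walk_verts unfolding paths_to_eq by blast

lemma act_one: "walk v p u \<Longrightarrow> act v \<one>\<^bsub>G v\<^esub> p = p"
proof -
  assume w: "walk v p u"
  then have v: "v \<in> verts E" and p: "p \<in> paths_to E v" using walk_verts by (auto simp: paths_to_eq)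
  show ?thesis
    using group_action.id_eq_one[OF action[OF v]] p by (metis restrict_apply')
qed

lemma act_Nil [simp]: "v \<in> verts E \<Longrightarrow> g \<in> carrier (G v) \<Longrightarrow> act v g [] = []"
  using length_act[of v g "[]"] walk_in_paths_to[of v "[]" v] by simp

lemma length_act_walk [simp]: "walk v p u \<Longrightarrow> g \<in> carrier (G v) \<Longrightarrow> length (act v g p) = length p"
  using length_act[of v g p] walk_verts walk_in_paths_to by simp

lemma edge_act:
  assumes e: "e \<in> arcs E" and g: "g \<in> carrier (G (head E e))"
  shows "act (head E e) g [e] = [edge_act g e]" "edge_act g e \<in> arcs E"
    "head E (edge_act g e) = head E e" "tail E (edge_act g e) = tail E e"
proof -
  have w: "walk (head E e) [e] (tail E e)" using e by simp
  have "length (act (head E e) g [e]) = 1" using length_act_walk[OF w g] by simp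
  then obtain f where f: "act (head E e) g [e] = [f]" by (cases "act (head E e) g [e]") auto
  then have ef: "edge_act g e = f" by (simp add: edge_act_def)
  have "[f] \<in> paths_to E (head E e)"
    using act_in_paths_to[OF _ g walk_in_paths_to[OF w]] f e by simp
  then show "act (head E e) g [e] = [edge_act g e]" "edge_act g e \<in> arcs E"
    "head E (edge_act g e) = head E e"
    using f ef by (auto elim!: in_paths_toE)
  show "tail E (edge_act g e) = tail E e"
    using source_act[OF e g] by (simp add: edge_act_def)
qed

lemma act_Cons_walk:
  assumes "walk (head E e) (e # p) u" "g \<in> carrier (G (head E e))"
  shows "act (head E e) g (e # p) = edge_act g e # act (tail E e) (sec g e) p"
  using act_Cons[of e g p] assms edge_act(1) walk_in_paths_to[of "tail E e" p u] by simp

lemma walk_act: "walk v p u \<Longrightarrow> g \<in> carrier (G v) \<Longrightarrow> walk v (act v g p) u"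
proof (induction p arbitrary: v g)
  case (Cons e p)
  then have e: "e \<in> arcs E" "head E e = v" and w: "walk (tail E e) p u" by auto
  have g: "g \<in> carrier (G (head E e))" using Cons e by simp
  show ?case
    using act_Cons_walk[of e p u g] Cons.prems edge_act[OF e(1) g] Cons.IH[OF w sec_closed[OF e(1) g]] e
    by simp
qed auto

lemma act_append:
  "walk v p m \<Longrightarrow> walk m q u \<Longrightarrow> g \<in> carrier (G v)
    \<Longrightarrow> act v g (p @ q) = act v g p @ act m (secs g p) q"
proof (induction p arbitrary: v g)
  case (Cons e p)
  then have e: "e \<in> arcs E" "head E e = v" and w: "walk (tail E e) p m" by auto
  have g: "g \<in> carrier (G (head E e))" using Cons e by simp
  have w2: "walk (head E e) (e # p @ q) u" "walk (head E e) (e # p) m"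
    using e w Cons.prems by (auto simp: walk_append)
  show ?case
    using act_Cons_walk[OF w2(1) g] act_Cons_walk[OF w2(2) g] Cons.IH[OF w Cons.prems(2) sec_closed[OF e(1) g]] e
    by simp
qed auto

lemma secs_mult:
  "walk v p u \<Longrightarrow> g \<in> carrier (G v) \<Longrightarrow> h \<in> carrier (G v)
    \<Longrightarrow> secs (g \<otimes>\<^bsub>G v\<^esub> h) p = secs g (act v h p) \<otimes>\<^bsub>G u\<^esub> secs h p"
proof (induction p arbitrary: v g h)
  case (Cons e p)
  then have e: "e \<in> arcs E" and v: "v = head E e" and w: "walk (tail E e) p u" by auto
  have g: "g \<in> carrier (G (head E e))" and h: "h \<in> carrier (G (head E e))" using Cons v by auto
  have g': "sec g (edge_act h e) \<in> carrier (G (tail E e))"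
    using sec_closed[of "edge_act h e" g] edge_act[OF e h] g by simp
  have "secs (g \<otimes>\<^bsub>G v\<^esub> h) (e # p) = secs (sec g (edge_act h e) \<otimes>\<^bsub>G (tail E e)\<^esub> sec h e) p"
    using sec_mult[OF e g h] v by (simp add: edge_act_def)
  also have "\<dots> = secs (sec g (edge_act h e)) (act (tail E e) (sec h e) p) \<otimes>\<^bsub>G u\<^esub> secs (sec h e) p"
    by (rule Cons.IH[OF w g' sec_closed[OF e h]])
  also have "\<dots> = secs g (act v h (e # p)) \<otimes>\<^bsub>G u\<^esub> secs h (e # p)"
    using act_Cons_walk[of e p u h] Cons.prems v h by simp
  finally show ?case .
qed auto

lemma secs_one: "walk v p u \<Longrightarrow> secs \<one>\<^bsub>G v\<^esub> p = \<one>\<^bsub>G u\<^esub>"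
  by (induction p arbitrary: v) (auto simp: sec_one)

lemma act_inv_act:
  assumes "walk v p u" "g \<in> carrier (G v)"
  shows "act v (inv\<^bsub>G v\<^esub> g) (act v g p) = p" "act v g (act v (inv\<^bsub>G v\<^esub> g) p) = p"
    "secs (inv\<^bsub>G v\<^esub> g) (act v g p) = inv\<^bsub>G u\<^esub> (secs g p)"
proof -
  have v: "v \<in> verts E" "u \<in> verts E" using assms walk_verts by auto
  show "act v (inv\<^bsub>G v\<^esub> g) (act v g p) = p"
    using act_mult[of "inv\<^bsub>G v\<^esub> g" v g p u] assms v by (simp add: act_one)
  show "act v g (act v (inv\<^bsub>G v\<^esub> g) p) = p"
    using act_mult[of g v "inv\<^bsub>G v\<^esub> g" p u] assms v by (simp add: act_one)
  have "secs (inv\<^bsub>G v\<^esub> g) (act v g p) \<otimes>\<^bsub>G u\<^esub> secs g p = \<one>\<^bsub>G u\<^esub>"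
    using secs_mult[of v p u "inv\<^bsub>G v\<^esub> g" g] assms v by (simp add: secs_one)
  moreover have "secs (inv\<^bsub>G v\<^esub> g) (act v g p) \<in> carrier (G u)"
    using secs_closed[OF walk_act[OF assms]] assms v by simp
  ultimately show "secs (inv\<^bsub>G v\<^esub> g) (act v g p) = inv\<^bsub>G u\<^esub> (secs g p)"
    using group.inv_equality[OF G_group[OF v(2)]] assms by (metis secs_closed)
qed

section \<open>Words as partial injections\<close>

text \<open>
  The triple \<open>(p, u, g)\<close> stands for the element \<open>p g\<close> of the semigroup, \<open>u\<close> being the source of \<open>p\<close>, and
  words act on these elements by left multiplication. The group coordinate is what makes the
  representation faithful even if the action on paths is not.
\<close>

primrec gen_rel :: "('v, 'e, 'g) gen \<Rightarrow> (('e list \<times> 'v \<times> 'g) \<times> ('e list \<times> 'v \<times> 'g)) set" where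
  "gen_rel Zero = {}"
| "gen_rel (Edge e) = {((p, u, g), (e # p, u, g)) | p u g. e \<in> arcs E \<and> walk (tail E e) p u \<and> g \<in> carrier (G u)}"
| "gen_rel (Edge_star e) = {((e # p, u, g), (p, u, g)) | p u g. e \<in> arcs E \<and> walk (tail E e) p u \<and> g \<in> carrier (G u)}"
| "gen_rel (Elt v h) = {((p, u, g), (act v h p, u, secs h p \<otimes>\<^bsub>G u\<^esub> g)) | p u g. walk v p u \<and> g \<in> carrier (G u)}"

text \<open>
  The last letter of a word acts first.
\<close>

primrec word_rel :: "('v, 'e, 'g) word \<Rightarrow> (('e list \<times> 'v \<times> 'g) \<times> ('e list \<times> 'v \<times> 'g)) set" where
  "word_rel [] = Id"
| "word_rel (a # x) = word_rel x O gen_rel a"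

lemma word_rel_append: "word_rel (x @ y) = word_rel y O word_rel x"
  by (induction x) auto

lemma gens_cases:
  assumes "a \<in> gens"
  obtains "a = Zero" | e where "a = Edge e" "e \<in> arcs E" | e where "a = Edge_star e" "e \<in> arcs E"
  | v g where "a = Elt v g" "v \<in> verts E" "g \<in> carrier (G v)"
  using assms unfolding gens_def by blast

lemma in_gens [simp]:
  "Zero \<in> gens" "Edge e \<in> gens \<longleftrightarrow> e \<in> arcs E" "Edge_star e \<in> gens \<longleftrightarrow> e \<in> arcs E"
  "Elt v g \<in> gens \<longleftrightarrow> v \<in> verts E \<and> g \<in> carrier (G v)"
  unfolding gens_def by auto

lemma gen_star_in_gens: "a \<in> gens \<Longrightarrow> gen_star a \<in> gens"
  by (erule gens_cases) auto

lemma word_star_gens: "set x \<subseteq> gens \<Longrightarrow> set (word_star x) \<subseteq> gens"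
  unfolding word_star_def using gen_star_in_gens by auto

lemma word_star_in_words: "x \<in> words \<Longrightarrow> word_star x \<in> words"
  using word_star_gens unfolding words_def by (auto simp: word_star_def)

lemma word_star_star:
  assumes "x \<in> words" shows "word_star (word_star x) = x"
proof -
  have "gen_star (gen_star a) = a" if "a \<in> gens" for a using that by (cases rule: gens_cases) auto
  then show ?thesis using assms by (auto simp: word_star_def rev_map words_def intro!: map_idI)
qed

lemma gen_rel_star:
  assumes "a \<in> gens" shows "gen_rel (gen_star a) = (gen_rel a)\<inverse>"
  using assms
proof (cases rule: gens_cases)
  case (4 v h)
  have 1: "(b, a) \<in> gen_rel (Elt v (inv\<^bsub>G v\<^esub> h))" if ab: "(a, b) \<in> gen_rel (Elt v h)"
    and h: "h \<in> carrier (G v)" for a b h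
  proof -
    obtain p u g where *: "a = (p, u, g)" "b = (act v h p, u, secs h p \<otimes>\<^bsub>G u\<^esub> g)" "walk v p u"
      "g \<in> carrier (G u)" using ab by auto
    have u: "u \<in> verts E" using * walk_verts by auto
    have s: "secs h p \<in> carrier (G u)" using * h by simp
    have "secs (inv\<^bsub>G v\<^esub> h) (act v h p) \<otimes>\<^bsub>G u\<^esub> (secs h p \<otimes>\<^bsub>G u\<^esub> g) = g"
      using act_inv_act(3)[OF *(3) h] * u s by (simp flip: G_assoc)
    then show ?thesis using * act_inv_act(1)[OF *(3) h] walk_act[OF *(3) h] u s
      by (auto intro!: exI[of _ "act v h p"])
  qed
  show ?thesis
    using 1[of _ _ h] 1[of _ _ "inv\<^bsub>G v\<^esub> h"] 4 by auto
qed auto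

lemma word_rel_star: "set x \<subseteq> gens \<Longrightarrow> word_rel (word_star x) = (word_rel x)\<inverse>"
proof (induction x)
  case (Cons a x)
  have "word_star (a # x) = word_star x @ [gen_star a]" by (simp add: word_star_def)
  then show ?case using Cons gen_rel_star[of a] by (simp add: word_rel_append converse_relcomp)
qed (simp add: word_star_def)

lemma gen_rel_single_valued: "single_valued (gen_rel a)"
  by (cases a) (auto simp: single_valued_def)

lemma word_rel_single_valued: "single_valued (word_rel x)"
  by (induction x) (auto intro: single_valued_relcomp gen_rel_single_valued)

lemma word_rel_functional: "(a, b) \<in> word_rel x \<Longrightarrow> (a, c) \<in> word_rel x \<Longrightarrow> b = c"
  using word_rel_single_valued unfolding single_valued_def by blast

lemma word_cong_words: "x \<bumpeq> y \<Longrightarrow> x \<in> words \<and> y \<in> words"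
proof (induction rule: word_cong.induct)
  case (star x y)
  then show ?case using word_star_in_words by blast
next
  case (regular x)
  then show ?case using word_star_in_words[of x] by (auto simp: words_def)
next
  case (idem_commute x y)
  then show ?case using word_star_in_words[of x] word_star_in_words[of y] by (auto simp: words_def)
next
  case (elt_edge e g)
  then show ?case using edge_act[of e g] sec_closed[of e g] by (auto simp: words_def)
qed (auto simp: words_def)

lemma partial_injection_regular:
  assumes "single_valued R" shows "(R O R\<inverse>) O R = R"
proof (intro equalityI subrelI)
  fix a b assume "(a, b) \<in> (R O R\<inverse>) O R"
  then show "(a, b) \<in> R" using assms unfolding single_valued_def by blast
next
  fix a b assume "(a, b) \<in> R"
  then show "(a, b) \<in> (R O R\<inverse>) O R" by blast
qed

lemma partial_injection_idem_commute:
  assumes "single_valued R" "single_valued S"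
  shows "((S\<inverse> O S) O R\<inverse>) O R = ((R\<inverse> O R) O S\<inverse>) O S"
  using assms unfolding single_valued_def by blast

text \<open>
  Partial injections form an inverse semigroup in which the involution is the converse. So the laws of
  inverse semigroups hold automatically, and the remaining relations are those of the action.
\<close>

lemma word_rel_sound: "x \<bumpeq> y \<Longrightarrow> word_rel x = word_rel y"
proof (induction rule: word_cong.induct)
  case (mult x y x' y')
  then show ?case by (simp add: word_rel_append)
next
  case (star x y)
  then show ?case using word_cong_words[OF star.hyps] by (simp add: word_rel_star words_def)
next
  case (regular x)
  then show ?case
    using partial_injection_regular[OF word_rel_single_valued[of x]]
    by (simp add: word_rel_append word_rel_star words_def O_assoc)
next
  case (idem_commute x y)
  then show ?case
    using partial_injection_idem_commute[OF word_rel_single_valued[of x] word_rel_single_valued[of y]]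
    by (simp add: word_rel_append word_rel_star words_def O_assoc)
next
  case (elt_mult v g h)
  show ?case
  proof (intro equalityI subrelI)
    fix a b assume "(a, b) \<in> word_rel [Elt v g, Elt v h]"
    then obtain p u k where *: "a = (p, u, k)" "walk v p u" "k \<in> carrier (G u)"
      "b = (act v g (act v h p), u, secs g (act v h p) \<otimes>\<^bsub>G u\<^esub> (secs h p \<otimes>\<^bsub>G u\<^esub> k))" 
      by (auto dest: walk_source_unique)
    then show "(a, b) \<in> word_rel [Elt v (g \<otimes>\<^bsub>G v\<^esub> h)]"
      using elt_mult walk_verts[OF *(2)] walk_act[OF *(2) elt_mult(3)]
      by (auto simp: act_mult secs_mult G_assoc)
  next
    fix a b assume "(a, b) \<in> word_rel [Elt v (g \<otimes>\<^bsub>G v\<^esub> h)]"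
    then obtain p u k where *: "a = (p, u, k)" "walk v p u" "k \<in> carrier (G u)"
      "b = (act v (g \<otimes>\<^bsub>G v\<^esub> h) p, u, secs (g \<otimes>\<^bsub>G v\<^esub> h) p \<otimes>\<^bsub>G u\<^esub> k)" 
      by auto
    have w: "walk v (act v h p) u" using walk_act[OF *(2) elt_mult(3)] .
    have "(a, (act v h p, u, secs h p \<otimes>\<^bsub>G u\<^esub> k)) \<in> gen_rel (Elt v h)" using * by auto
    moreover have "((act v h p, u, secs h p \<otimes>\<^bsub>G u\<^esub> k), b) \<in> gen_rel (Elt v g)"
      using * w elt_mult walk_verts[OF *(2)] by (auto simp: act_mult secs_mult G_assoc)
    ultimately show "(a, b) \<in> word_rel [Elt v g, Elt v h]" by auto
  qed
next
  case (elt_undefined u v g h)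
  then show ?case by (auto dest: walk_range_unique walk_act)
next
  case (elt_edge e g)
  note e = edge_act[OF elt_edge] 
  show ?case
  proof (intro equalityI subrelI)
    fix a b assume "(a, b) \<in> word_rel [Elt (head E e) g, Edge e]"
    then obtain p u k where *: "a = (p, u, k)" "walk (tail E e) p u" "k \<in> carrier (G u)"
      "b = (act (head E e) g (e # p), u, secs g (e # p) \<otimes>\<^bsub>G u\<^esub> k)" 
      by (auto dest: walk_source_unique)
    have w: "walk (head E e) (e # p) u" using * elt_edge by auto
    have s: "sec g e \<in> carrier (G (tail E e))" using sec_closed elt_edge by blast
    have "(a, (act (tail E e) (sec g e) p, u, secs (sec g e) p \<otimes>\<^bsub>G u\<^esub> k)) \<in> gen_rel (Elt (tail E e) (sec g e))"
      using * by auto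
    moreover have "((act (tail E e) (sec g e) p, u, secs (sec g e) p \<otimes>\<^bsub>G u\<^esub> k), b) \<in> gen_rel (Edge (edge_act g e))"
      using * w e walk_act[OF *(2) s] s act_Cons_walk[OF w elt_edge(2)] walk_verts[OF *(2)] by auto
    ultimately show "(a, b) \<in> word_rel [Edge (edge_act g e), Elt (tail E e) (sec g e)]" by auto
  next
    fix a b assume "(a, b) \<in> word_rel [Edge (edge_act g e), Elt (tail E e) (sec g e)]"
    then obtain p u k where *: "a = (p, u, k)" "walk (tail E e) p u" "k \<in> carrier (G u)"
      "b = (edge_act g e # act (tail E e) (sec g e) p, u, secs (sec g e) p \<otimes>\<^bsub>G u\<^esub> k)" 
      by auto
    have w: "walk (head E e) (e # p) u" using * elt_edge by auto
    have "(a, (e # p, u, k)) \<in> gen_rel (Edge e)" using * elt_edge by auto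
    moreover have "((e # p, u, k), b) \<in> gen_rel (Elt (head E e) g)"
      using * w act_Cons_walk[OF w elt_edge(2)] by auto
    ultimately show "(a, b) \<in> word_rel [Elt (head E e) g, Edge e]" by auto
  qed
next
  case (edge_source e)
  show ?case
  proof (intro equalityI subrelI)
    fix a b assume "(a, b) \<in> word_rel [Edge e, Vert (tail E e)]"
    then show "(a, b) \<in> word_rel [Edge e]"
      by (auto simp: act_one secs_one dest: walk_verts)
  next
    fix a b assume "(a, b) \<in> word_rel [Edge e]"
    then obtain p u k where *: "a = (p, u, k)" "walk (tail E e) p u" "k \<in> carrier (G u)" "b = (e # p, u, k)"
      by auto
    then have "(a, a) \<in> gen_rel (Vert (tail E e))" by (auto simp: act_one secs_one dest: walk_verts)
    then show "(a, b) \<in> word_rel [Edge e, Vert (tail E e)]" using * edge_source by auto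
  qed
next
  case (edge_range e)
  show ?case
  proof (intro equalityI subrelI)
    fix a b assume "(a, b) \<in> word_rel [Vert (head E e), Edge e]"
    then obtain p u k where *: "a = (p, u, k)" "walk (tail E e) p u" "k \<in> carrier (G u)"
      "b = (act (head E e) \<one>\<^bsub>G (head E e)\<^esub> (e # p), u, secs \<one>\<^bsub>G (head E e)\<^esub> (e # p) \<otimes>\<^bsub>G u\<^esub> k)" 
      by (auto dest: walk_source_unique)
    have w: "walk (head E e) (e # p) u" using * edge_range by auto
    show "(a, b) \<in> word_rel [Edge e]"
      using * edge_range act_one[OF w] secs_one[OF w] walk_verts[OF w] by auto
  next
    fix a b assume "(a, b) \<in> word_rel [Edge e]"
    then obtain p u k where *: "a = (p, u, k)" "walk (tail E e) p u" "k \<in> carrier (G u)" "b = (e # p, u, k)"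
      by auto
    have w: "walk (head E e) (e # p) u" using * edge_range by auto
    have "(b, b) \<in> gen_rel (Vert (head E e))" using * edge_range act_one[OF w] secs_one[OF w] walk_verts[OF w] by auto
    then show "(a, b) \<in> word_rel [Vert (head E e), Edge e]" using * edge_range by auto
  qed
next
  case (star_source e)
  show ?case
  proof (intro equalityI subrelI)
    fix a b assume "(a, b) \<in> word_rel [Vert (tail E e), Edge_star e]"
    then show "(a, b) \<in> word_rel [Edge_star e]"
      by (auto simp: act_one secs_one dest: walk_verts walk_source_unique)
  next
    fix a b assume "(a, b) \<in> word_rel [Edge_star e]"
    then obtain p u k where *: "b = (p, u, k)" "walk (tail E e) p u" "k \<in> carrier (G u)" "a = (e # p, u, k)"
      by auto
    then have "(b, b) \<in> gen_rel (Vert (tail E e))" by (auto simp: act_one secs_one dest: walk_verts)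
    then show "(a, b) \<in> word_rel [Vert (tail E e), Edge_star e]" using * star_source by auto
  qed
next
  case (star_range e)
  show ?case
  proof (intro equalityI subrelI)
    fix a b assume "(a, b) \<in> word_rel [Edge_star e, Vert (head E e)]"
    then obtain p u k where *: "a = (p, u, k)" "walk (head E e) p u" "k \<in> carrier (G u)" "(a, b) \<in> gen_rel (Edge_star e)"
      by (auto simp: act_one secs_one dest: walk_verts)
    then show "(a, b) \<in> word_rel [Edge_star e]" by auto
  next
    fix a b assume "(a, b) \<in> word_rel [Edge_star e]"
    then obtain p u k where *: "b = (p, u, k)" "walk (tail E e) p u" "k \<in> carrier (G u)" "a = (e # p, u, k)"
      by auto
    have w: "walk (head E e) (e # p) u" using * star_range by auto
    have "(a, a) \<in> gen_rel (Vert (head E e))" using * act_one[OF w] secs_one[OF w] walk_verts[OF w] w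
      by (auto intro!: exI[of _ "e # p"])
    then show "(a, b) \<in> word_rel [Edge_star e, Vert (head E e)]" using * star_range by auto
  qed
next
  case (star_edge e)
  show ?case
  proof (intro equalityI subrelI)
    fix a b assume "(a, b) \<in> word_rel [Edge_star e, Edge e]"
    then show "(a, b) \<in> word_rel [Vert (tail E e)]"
      by (auto simp: act_one secs_one dest: walk_verts)
  next
    fix a b assume "(a, b) \<in> word_rel [Vert (tail E e)]"
    then obtain p u k where *: "a = (p, u, k)" "walk (tail E e) p u" "k \<in> carrier (G u)"
      "b = (act (tail E e) \<one>\<^bsub>G (tail E e)\<^esub> p, u, secs \<one>\<^bsub>G (tail E e)\<^esub> p \<otimes>\<^bsub>G u\<^esub> k)"
      by auto
    then have "b = (p, u, k)"
      using act_one[OF *(2)] secs_one[OF *(2)] walk_verts[OF *(2)] by simp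
    then have "(a, (e # p, u, k)) \<in> gen_rel (Edge e)" "((e # p, u, k), b) \<in> gen_rel (Edge_star e)"
      using star_edge * by auto
    then show "(a, b) \<in> word_rel [Edge_star e, Edge e]" by auto
  qed
qed auto

section \<open>Normal forms\<close>

definition nf_word :: "'v \<Rightarrow> 'e list \<Rightarrow> 'g \<Rightarrow> 'e list \<Rightarrow> ('v, 'e, 'g) word" where
  "nf_word v p g q = map Edge p @ [Elt v g] @ map Edge_star (rev q)"

definition nf_params :: "'v \<Rightarrow> 'e list \<Rightarrow> 'g \<Rightarrow> 'e list \<Rightarrow> bool" where
  "nf_params v p g q \<longleftrightarrow> (\<exists>w. walk w p v) \<and> g \<in> carrier (G v) \<and> (\<exists>w. walk w q v)"

lemma pgq_eq: "pgq v p g q = cls (nf_word v p g q)"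
  by (simp add: pgq_def nf_word_def)

lemma walk_edges: "walk w p v \<Longrightarrow> set p \<subseteq> arcs E"
  by (induction p arbitrary: w) auto

lemma nf_word_in_words: "nf_params v p g q \<Longrightarrow> nf_word v p g q \<in> words"
  unfolding nf_params_def nf_word_def words_def using walk_edges walk_verts by fastforce

lemma cong_in_context:
  assumes "x \<bumpeq> y" "set z \<subseteq> gens" "set w \<subseteq> gens"
  shows "z @ x @ w \<bumpeq> z @ y @ w"
proof -
  have 1: "x @ w \<bumpeq> y @ w"
  proof (cases "w = []")
    case False
    then show ?thesis using assms by (intro word_cong.mult word_cong.refl) (auto simp: words_def)
  qed (use assms in simp)
  show ?thesis
  proof (cases "z = []")
    case False
    then have "z \<in> words" using assms by (simp add: words_def)
    then show ?thesis using word_cong.mult[OF word_cong.refl 1] by blast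
  qed (use 1 in simp)
qed

lemma zero_absorbs_right: "set w \<subseteq> gens \<Longrightarrow> [Zero] @ w \<bumpeq> [Zero]"
proof (induction w)
  case Nil
  then show ?case by (auto intro!: word_cong.refl simp: words_def)
next
  case (Cons a w)
  have "[Zero, a] @ w \<bumpeq> [Zero] @ w"
    using cong_in_context[OF word_cong.zero_left[of a], of "[]" w] Cons.prems by simp
  then show ?case using Cons word_cong.trans by fastforce
qed

lemma zero_absorbs_left: "set z \<subseteq> gens \<Longrightarrow> z @ [Zero] \<bumpeq> [Zero]"
proof (induction z)
  case Nil
  then show ?case by (auto intro!: word_cong.refl simp: words_def)
next
  case (Cons a z)
  have "[a] @ (z @ [Zero]) \<bumpeq> [a] @ [Zero]"
    using cong_in_context[of "z @ [Zero]" "[Zero]" "[a]" "[]"] Cons by simp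
  then show ?case using word_cong.zero_right[of a] Cons.prems word_cong.trans by fastforce
qed

lemma zero_in_context:
  assumes "x \<bumpeq> [Zero]" "set z \<subseteq> gens" "set w \<subseteq> gens"
  shows "z @ x @ w \<bumpeq> [Zero]"
proof -
  have 1: "z @ x @ w \<bumpeq> z @ [Zero] @ w" using cong_in_context assms by blast
  have 2: "z @ [Zero] @ w \<bumpeq> z @ [Zero]"
    using cong_in_context[OF zero_absorbs_right[OF assms(3)], of z "[]"] assms by simp
  show ?thesis using 1 2 zero_absorbs_left[OF assms(2)] word_cong.trans by blast
qed

lemma vert_edge_distinct:
  assumes "e \<in> arcs E" "v \<in> verts E" "g \<in> carrier (G v)" "v \<noteq> head E e"
  shows "[Elt v g, Edge e] \<bumpeq> [Zero]"
proof -
  have "[Elt v g, Edge e] \<bumpeq> [Elt v g, Vert (head E e), Edge e]"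
    using cong_in_context[OF word_cong.edge_range[OF assms(1)], of "[Elt v g]" "[]"] assms
    by (simp add: word_cong.sym)
  moreover have "[] @ [Elt v g, Vert (head E e)] @ [Edge e] \<bumpeq> [Zero]"
    using assms by (intro zero_in_context word_cong.elt_undefined) auto
  ultimately show ?thesis using word_cong.trans by fastforce
qed

lemma edge_elt_distinct:
  assumes "e \<in> arcs E" "v \<in> verts E" "g \<in> carrier (G v)" "v \<noteq> tail E e"
  shows "[Edge e, Elt v g] \<bumpeq> [Zero]"
proof -
  have "[Edge e, Elt v g] \<bumpeq> [Edge e, Vert (tail E e), Elt v g]"
    using cong_in_context[OF word_cong.edge_source[OF assms(1)], of "[]" "[Elt v g]"] assms
    by (simp add: word_cong.sym)
  moreover have "[Edge e] @ [Vert (tail E e), Elt v g] @ [] \<bumpeq> [Zero]"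
    using assms by (intro zero_in_context word_cong.elt_undefined) auto
  ultimately show ?thesis using word_cong.trans by fastforce
qed

lemma edge_edge_distinct:
  assumes "e \<in> arcs E" "f \<in> arcs E" "head E f \<noteq> tail E e"
  shows "[Edge e, Edge f] \<bumpeq> [Zero]"
proof -
  have "[Edge e, Edge f] \<bumpeq> [Edge e, Vert (tail E e), Edge f]"
    using cong_in_context[OF word_cong.edge_source[OF assms(1)], of "[]" "[Edge f]"] assms
    by (simp add: word_cong.sym)
  moreover have "[Edge e] @ [Vert (tail E e), Edge f] @ [] \<bumpeq> [Zero]"
    using assms by (intro zero_in_context vert_edge_distinct) auto
  ultimately show ?thesis using word_cong.trans by fastforce
qed

lemma star_elt_distinct:
  assumes "e \<in> arcs E" "v \<in> verts E" "g \<in> carrier (G v)" "v \<noteq> head E e"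
  shows "[Edge_star e, Elt v g] \<bumpeq> [Zero]"
proof -
  have "[Edge_star e, Elt v g] \<bumpeq> [Edge_star e, Vert (head E e), Elt v g]"
    using cong_in_context[OF word_cong.star_range[OF assms(1)], of "[]" "[Elt v g]"] assms
    by (simp add: word_cong.sym)
  moreover have "[Edge_star e] @ [Vert (head E e), Elt v g] @ [] \<bumpeq> [Zero]"
    using assms by (intro zero_in_context word_cong.elt_undefined) auto
  ultimately show ?thesis using word_cong.trans by fastforce
qed

lemma elt_nf_word:
  "walk u p v \<Longrightarrow> h \<in> carrier (G u) \<Longrightarrow> g \<in> carrier (G v) \<Longrightarrow> walk w q v \<Longrightarrow>
    [Elt u h] @ nf_word v p g q \<bumpeq> nf_word v (act u h p) (secs h p \<otimes>\<^bsub>G v\<^esub> g) q"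
proof (induction p arbitrary: u h)
  case Nil
  then have "[] @ [Elt u h, Elt v g] @ map Edge_star (rev q)
      \<bumpeq> [] @ [Elt v (h \<otimes>\<^bsub>G v\<^esub> g)] @ map Edge_star (rev q)"
    using walk_edges[OF Nil(4)] by (intro cong_in_context) (auto intro: word_cong.elt_mult)
  then show ?case using Nil by (simp add: nf_word_def)
next
  case (Cons e p)
  then have e: "e \<in> arcs E" and u: "u = head E e" and p: "walk (tail E e) p v" by auto
  have h: "h \<in> carrier (G (head E e))" using Cons u by simp
  have nf: "nf_params v p g q" using p Cons by (auto simp: nf_params_def)
  then have gens: "set (nf_word v p g q) \<subseteq> gens" using nf_word_in_words by (simp add: words_def)
  have "[] @ [Elt u h, Edge e] @ nf_word v p g q
      \<bumpeq> [] @ [Edge (edge_act h e), Elt (tail E e) (sec h e)] @ nf_word v p g q"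
    using word_cong.elt_edge[OF e h] gens u by (intro cong_in_context) auto
  moreover have "[Edge (edge_act h e)] @ ([Elt (tail E e) (sec h e)] @ nf_word v p g q) @ []
      \<bumpeq> [Edge (edge_act h e)] @ nf_word v (act (tail E e) (sec h e) p) (secs (sec h e) p \<otimes>\<^bsub>G v\<^esub> g) q @ []"
    using Cons.IH[OF p sec_closed[OF e h] Cons.prems(3,4)] edge_act[OF e h] by (intro cong_in_context) auto
  ultimately have "[Elt u h] @ nf_word v (e # p) g q \<bumpeq> Edge (edge_act h e) # nf_word v (act (tail E e) (sec h e) p) (secs (sec h e) p \<otimes>\<^bsub>G v\<^esub> g) q"
    using word_cong.trans by (fastforce simp: nf_word_def)
  moreover have "act u h (e # p) = edge_act h e # act (tail E e) (sec h e) p"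
    using act_Cons_walk[OF _ h] Cons.prems u by blast
  ultimately show ?case by (simp add: nf_word_def)
qed

lemma nf_paramsI: "walk w p v \<Longrightarrow> g \<in> carrier (G v) \<Longrightarrow> walk w' q v \<Longrightarrow> nf_params v p g q"
  by (auto simp: nf_params_def)

text \<open>
  A generator on the left of \<open>p g q\<^sup>*\<close> is absorbed. The only case in which \<open>q\<close> changes is \<open>e\<^sup>*\<close> with \<open>p\<close>
  empty: the star of the relation for \<open>g\<^sup>-\<^sup>1 e\<close> moves the edge past \<open>g\<close> to the right.
\<close>

lemma gen_times_nf_word:
  assumes a: "a \<in> gens" and nf: "nf_params v p g q"
  shows "[a] @ nf_word v p g q \<bumpeq> [Zero] \<or>
    (\<exists>v' p' g' q'. nf_params v' p' g' q' \<and> [a] @ nf_word v p g q \<bumpeq> nf_word v' p' g' q')"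
proof -
  have gens: "set (nf_word v p g q) \<subseteq> gens"
    using nf_word_in_words[OF nf] by (simp add: words_def)
  obtain w w' where p: "walk w p v" and g: "g \<in> carrier (G v)" and q: "walk w' q v"
    using nf by (auto simp: nf_params_def)
  have v: "v \<in> verts E" using p walk_verts by auto
  have gq: "set (map Edge_star (rev q)) \<subseteq> gens" using walk_edges[OF q] by auto
  have refl: "[a] @ nf_word v p g q \<bumpeq> [a] @ nf_word v p g q"
    using a gens by (auto intro!: word_cong.refl simp: words_def)
  from a show ?thesis
  proof (cases rule: gens_cases)
    case 1
    then show ?thesis using zero_absorbs_right[OF gens] by simp
  next
    case (2 e)
    show ?thesis
    proof (cases "w = tail E e")
      case True
      then have "nf_params v (e # p) g q" using p g q 2 by (intro nf_paramsI[of "head E e"]) auto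
      then show ?thesis using refl 2 by (intro disjI2 exI[of _ v] exI[of _ "e # p"] exI[of _ g] exI[of _ q]) (auto simp: nf_word_def)
    next
      case False
      show ?thesis
      proof (cases p)
        case Nil
        have "[] @ [Edge e, Elt v g] @ map Edge_star (rev q) \<bumpeq> [Zero]"
          using Nil p False 2 v g gq by (intro zero_in_context edge_elt_distinct) auto
        then show ?thesis using Nil 2 by (simp add: nf_word_def)
      next
        case (Cons f p')
        have "[] @ [Edge e, Edge f] @ nf_word v p' g q \<bumpeq> [Zero]"
          using Cons p False 2 gens by (intro zero_in_context edge_edge_distinct) (auto simp: nf_word_def)
        then show ?thesis using Cons 2 by (simp add: nf_word_def)
      qed
    qed
  next
    case (3 e)
    show ?thesis
    proof (cases p)
      case Nil
      show ?thesis
      proof (cases "head E e = v")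
        case True
        let ?h = "inv\<^bsub>G v\<^esub> g"
        let ?f = "edge_act ?h e" and ?k = "inv\<^bsub>G (tail E e)\<^esub> (sec ?h e)"
        have h: "?h \<in> carrier (G (head E e))" using True v g by simp
        have "word_star [Elt (head E e) ?h, Edge e] \<bumpeq> word_star [Edge ?f, Elt (tail E e) (sec ?h e)]"
          using word_cong.star[OF word_cong.elt_edge[OF 3(2) h]] .
        then have "[Edge_star e, Elt v g] \<bumpeq> [Elt (tail E e) ?k, Edge_star ?f]"
          using v g True by (simp add: word_star_def)
        then have "[] @ [Edge_star e, Elt v g] @ map Edge_star (rev q)
            \<bumpeq> [] @ [Elt (tail E e) ?k, Edge_star ?f] @ map Edge_star (rev q)"
          using gq by (intro cong_in_context) auto
        moreover have "nf_params (tail E e) [] ?k (q @ [?f])"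
          using edge_act[OF 3(2) h] q True sec_closed[OF 3(2) h] 3
          by (auto simp: nf_params_def walk_append)
        ultimately show ?thesis using 3 Nil
          by (intro disjI2 exI[of _ "tail E e"] exI[of _ "[]"] exI[of _ ?k] exI[of _ "q @ [?f]"]) (auto simp: nf_word_def)
      next
        case False
        have "[] @ [Edge_star e, Elt v g] @ map Edge_star (rev q) \<bumpeq> [Zero]"
          using False 3 v g gq by (intro zero_in_context star_elt_distinct) auto
        then show ?thesis using Nil 3 by (simp add: nf_word_def)
      qed
    next
      case (Cons f p')
      have gens': "set (nf_word v p' g q) \<subseteq> gens" using gens Cons by (auto simp: nf_word_def)
      show ?thesis
      proof (cases "e = f")
        case True
        have w: "walk (tail E e) p' v" using p Cons True by simp
        have "[] @ [Edge_star e, Edge f] @ nf_word v p' g q \<bumpeq> [] @ [Vert (tail E e)] @ nf_word v p' g q"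
          using True 3 gens' by (intro cong_in_context) (auto intro: word_cong.star_edge)
        moreover have "[Vert (tail E e)] @ nf_word v p' g q
            \<bumpeq> nf_word v (act (tail E e) \<one>\<^bsub>G (tail E e)\<^esub> p') (secs \<one>\<^bsub>G (tail E e)\<^esub> p' \<otimes>\<^bsub>G v\<^esub> g) q"
          using w g q 3 by (intro elt_nf_word) auto
        ultimately have "[Edge_star e, Edge f] @ nf_word v p' g q \<bumpeq> nf_word v p' g q"
          using act_one[OF w] secs_one[OF w] v g word_cong.trans by fastforce
        then show ?thesis using w g q Cons 3
          by (intro disjI2 exI[of _ v] exI[of _ p'] exI[of _ g] exI[of _ q]) (auto simp: nf_word_def intro: nf_paramsI)
      next
        case False
        have "[] @ [Edge_star e, Edge f] @ nf_word v p' g q \<bumpeq> [Zero]"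
          using Cons p False 3 gens' by (intro zero_in_context word_cong.star_edge_distinct) auto
        then show ?thesis using Cons 3 by (simp add: nf_word_def)
      qed
    qed
  next
    case (4 u h)
    show ?thesis
    proof (cases "u = w")
      case True
      then show ?thesis
        using elt_nf_word[OF p _ g q, of h] 4 walk_act[OF p, of h] q g v secs_closed[OF p, of h]
          nf_paramsI[of w "act w h p" v "secs h p \<otimes>\<^bsub>G v\<^esub> g" w' q]
        by auto
    next
      case False
      show ?thesis
      proof (cases p)
        case Nil
        have "[] @ [Elt u h, Elt v g] @ map Edge_star (rev q) \<bumpeq> [Zero]"
          using Nil p False 4 v g gq by (intro zero_in_context word_cong.elt_undefined) auto
        then show ?thesis using Nil 4 by (simp add: nf_word_def)
      next
        case (Cons f p')
        have "[] @ [Elt u h, Edge f] @ nf_word v p' g q \<bumpeq> [Zero]"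
          using Cons p False 4 gens by (intro zero_in_context vert_edge_distinct) (auto simp: nf_word_def)
        then show ?thesis using Cons 4 by (simp add: nf_word_def)
      qed
    qed
  qed
qed

lemma normal_form:
  assumes "x \<in> words"
  obtains (zero) "x \<bumpeq> [Zero]" | (nf) v p g q where "nf_params v p g q" "x \<bumpeq> nf_word v p g q"
proof -
  have "x \<noteq> []" "set x \<subseteq> gens" using assms by (auto simp: words_def)
  then have "x \<bumpeq> [Zero] \<or> (\<exists>v p g q. nf_params v p g q \<and> x \<bumpeq> nf_word v p g q)"
  proof (induction x rule: list_nonempty_induct)
    case (single a)
    then have a: "a \<in> gens" by simp
    from a show ?case
    proof (cases rule: gens_cases)
      case 1
      then show ?thesis by (auto intro!: word_cong.refl simp: words_def)
    next
      case (2 e)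
      have "nf_params (tail E e) [e] \<one>\<^bsub>G (tail E e)\<^esub> []" using 2 by (auto simp: nf_params_def)
      moreover have "[Edge e] \<bumpeq> nf_word (tail E e) [e] \<one>\<^bsub>G (tail E e)\<^esub> []"
        using word_cong.sym[OF word_cong.edge_source[OF 2(2)]] by (simp add: nf_word_def)
      ultimately show ?thesis using 2 by blast
    next
      case (3 e)
      have "nf_params (tail E e) [] \<one>\<^bsub>G (tail E e)\<^esub> [e]" using 3 by (auto simp: nf_params_def)
      moreover have "[Edge_star e] \<bumpeq> nf_word (tail E e) [] \<one>\<^bsub>G (tail E e)\<^esub> [e]"
        using word_cong.sym[OF word_cong.star_source[OF 3(2)]] by (simp add: nf_word_def)
      ultimately show ?thesis using 3 by blast
    next
      case (4 v g)
      have "nf_params v [] g []" using 4 by (auto simp: nf_params_def)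
      moreover have "[Elt v g] \<bumpeq> nf_word v [] g []"
        using 4 by (auto simp: nf_word_def words_def intro!: word_cong.refl)
      ultimately show ?thesis using 4 by blast
    qed
  next
    case (cons a x)
    then have a: "a \<in> gens" by simp
    consider "x \<bumpeq> [Zero]" | v p g q where "nf_params v p g q" "x \<bumpeq> nf_word v p g q"
      using cons by auto
    then show ?case
    proof cases
      case 1
      then show ?thesis using zero_in_context[OF 1, of "[a]" "[]"] a by simp
    next
      case 2
      have "[a] @ x \<bumpeq> [a] @ nf_word v p g q" using cong_in_context[OF 2(2), of "[a]" "[]"] a by simp
      then show ?thesis using gen_times_nf_word[OF a 2(1)] word_cong.trans by fastforce
    qed
  qed
  then show thesis using that by blast
qed

lemma word_rel_edges:
  "walk w p v \<Longrightarrow> walk v r u \<Longrightarrow> k \<in> carrier (G u) \<Longrightarrow> ((r, u, k), b) \<in> word_rel (map Edge p) \<longleftrightarrow> b = (p @ r, u, k)"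
proof (induction p arbitrary: w b)
  case (Cons e p)
  then have "walk (tail E e) (p @ r) u" by (auto simp: walk_append)
  moreover have "((r, u, k), c) \<in> word_rel (map Edge p) \<longleftrightarrow> c = (p @ r, u, k)" for c
    using Cons.IH[of "tail E e" c] Cons.prems by simp
  ultimately show ?case using Cons.prems by (auto simp: relcomp_unfold)
qed auto

lemma word_rel_edge_stars:
  assumes "walk w q v" "walk v r u" "k \<in> carrier (G u)"
  shows "(a, (r, u, k)) \<in> word_rel (map Edge_star (rev q)) \<longleftrightarrow> a = (q @ r, u, k)"
proof -
  have "map Edge_star (rev q) = word_star (map Edge q)" by (simp add: word_star_def rev_map)
  moreover have "set (map Edge q) \<subseteq> gens" using walk_edges[OF assms(1)] by auto
  ultimately show ?thesis using word_rel_star[of "map Edge q"] word_rel_edges[OF assms, of a] by simp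
qed

lemma word_rel_nf_word:
  assumes "nf_params v p g q"
  shows "word_rel (nf_word v p g q)
    = {((q @ r, u, k), (p @ act v g r, u, secs g r \<otimes>\<^bsub>G u\<^esub> k)) | r u k. walk v r u \<and> k \<in> carrier (G u)}"
proof -
  obtain w w' where p: "walk w p v" and g: "g \<in> carrier (G v)" and q: "walk w' q v"
    using assms by (auto simp: nf_params_def)
  show ?thesis
  proof (intro equalityI subrelI)
    fix a b assume "(a, b) \<in> word_rel (nf_word v p g q)"
    then obtain c d where 1: "(a, c) \<in> word_rel (map Edge_star (rev q))" "(c, d) \<in> gen_rel (Elt v g)"
      "(d, b) \<in> word_rel (map Edge p)"
      by (auto simp: nf_word_def word_rel_append)
    then obtain r u k where c: "c = (r, u, k)" "walk v r u" "k \<in> carrier (G u)"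
      "d = (act v g r, u, secs g r \<otimes>\<^bsub>G u\<^esub> k)" by auto
    have "a = (q @ r, u, k)" using word_rel_edge_stars[OF q c(2,3)] 1 c by simp
    moreover have "b = (p @ act v g r, u, secs g r \<otimes>\<^bsub>G u\<^esub> k)"
      using word_rel_edges[OF p walk_act[OF c(2) g], of "secs g r \<otimes>\<^bsub>G u\<^esub> k" b] 1 c g walk_verts[OF c(2)] by simp
    ultimately show "(a, b) \<in> {((q @ r, u, k), (p @ act v g r, u, secs g r \<otimes>\<^bsub>G u\<^esub> k)) | r u k. walk v r u \<and> k \<in> carrier (G u)}"
      using c by blast
  next
    fix a b assume "(a, b) \<in> {((q @ r, u, k), (p @ act v g r, u, secs g r \<otimes>\<^bsub>G u\<^esub> k)) | r u k. walk v r u \<and> k \<in> carrier (G u)}"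
    then obtain r u k where c: "a = (q @ r, u, k)" "b = (p @ act v g r, u, secs g r \<otimes>\<^bsub>G u\<^esub> k)" 
      "walk v r u" "k \<in> carrier (G u)" by blast
    have "(a, (r, u, k)) \<in> word_rel (map Edge_star (rev q))"
      using word_rel_edge_stars[OF q c(3,4)] c by simp
    moreover have "((r, u, k), (act v g r, u, secs g r \<otimes>\<^bsub>G u\<^esub> k)) \<in> word_rel [Elt v g]"
      using c by auto
    moreover have "((act v g r, u, secs g r \<otimes>\<^bsub>G u\<^esub> k), b) \<in> word_rel (map Edge p)"
      using word_rel_edges[OF p walk_act[OF c(3) g], of "secs g r \<otimes>\<^bsub>G u\<^esub> k" b] c g walk_verts[OF c(3)] by simp
    ultimately show "(a, b) \<in> word_rel (nf_word v p g q)"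
      unfolding nf_word_def word_rel_append by blast
  qed
qed

lemma word_rel_nf_word_apex:
  assumes "nf_params v p g q"
  shows "((q, v, \<one>\<^bsub>G v\<^esub>), (p, v, g)) \<in> word_rel (nf_word v p g q)"
proof -
  have "v \<in> verts E" "g \<in> carrier (G v)" using assms walk_verts by (auto simp: nf_params_def)
  then show ?thesis
    unfolding word_rel_nf_word[OF assms]
    by (auto intro!: exI[of _ "[]"])
qed

text \<open>
  The parameters can be read off: \<open>q\<close> is the shortest path on which \<open>p g q\<^sup>*\<close> is defined, and
  \<open>(q, v, 1)\<close> is mapped to \<open>(p, v, g)\<close>.
\<close>

lemma nf_word_rel_inj:
  assumes nf: "nf_params v p g q" and nf': "nf_params v' p' g' q'"
    and eq: "word_rel (nf_word v p g q) = word_rel (nf_word v' p' g' q')"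
  shows "v = v' \<and> p = p' \<and> g = g' \<and> q = q'"
proof -
  have 1: "((q, v, \<one>\<^bsub>G v\<^esub>), (p, v, g)) \<in> word_rel (nf_word v' p' g' q')"
    using word_rel_nf_word_apex[OF nf] eq by simp
  have 2: "((q', v', \<one>\<^bsub>G v'\<^esub>), (p', v', g')) \<in> word_rel (nf_word v p g q)"
    using word_rel_nf_word_apex[OF nf'] eq by simp
  obtain r where r: "q = q' @ r" "walk v' r v" using 1 word_rel_nf_word[OF nf'] by auto
  obtain r' where r': "q' = q @ r'" using 2 word_rel_nf_word[OF nf] by auto
  have "r = []" using r r' by simp
  then have "q = q'" "v = v'" using r by auto
  then have "((q, v, \<one>\<^bsub>G v\<^esub>), (p', v, g')) \<in> word_rel (nf_word v' p' g' q')"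
    using word_rel_nf_word_apex[OF nf'] by simp
  then show ?thesis using word_rel_functional[OF 1] \<open>q = q'\<close> \<open>v = v'\<close> by blast
qed

text \<open>
  Both words have normal forms, which the partial injections determine. Identities in the semigroup
  thereby become computations with partial injections.
\<close>

lemma word_cong_iff_word_rel:
  assumes "x \<in> words" "y \<in> words"
  shows "x \<bumpeq> y \<longleftrightarrow> word_rel x = word_rel y"
proof
  assume eq: "word_rel x = word_rel y"
  from assms(1) show "x \<bumpeq> y"
  proof (cases rule: normal_form)
    case zero
    then have x: "word_rel x = {}" using word_rel_sound by fastforce
    from assms(2) show ?thesis
    proof (cases rule: normal_form)
      case zero
      then show ?thesis using \<open>x \<bumpeq> [Zero]\<close> word_cong.sym word_cong.trans by blast
    next
      case (nf v p g q)
      then show ?thesis using word_rel_sound[OF nf(2)] word_rel_nf_word_apex[OF nf(1)] x eq by auto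
    qed
  next
    case (nf v p g q)
    note nf1 = nf
    from assms(2) show ?thesis
    proof (cases rule: normal_form)
      case zero
      then have "word_rel y = {}" using word_rel_sound by fastforce
      then show ?thesis using word_rel_sound[OF nf(2)] word_rel_nf_word_apex[OF nf(1)] eq by auto
    next
      case (nf v' p' g' q')
      then show ?thesis
        using nf_word_rel_inj[OF nf1(1) nf(1)] word_rel_sound[OF nf1(2)] word_rel_sound[OF nf(2)] eq
          word_cong.sym[OF nf(2)] nf1(2) word_cong.trans by metis
    qed
  qed
qed (rule word_rel_sound)

lemma cls_eq_iff_word_rel: "x \<in> words \<Longrightarrow> y \<in> words \<Longrightarrow> cls x = cls y \<longleftrightarrow> word_rel x = word_rel y"
  unfolding word_cong_iff_word_rel[symmetric] cls_def
  using word_cong.refl word_cong.sym word_cong.trans by blast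

end

section \<open>Infinite paths\<close>

lemma stream_eq_by_prefixes:
  assumes "\<And>n. n \<ge> m \<Longrightarrow> stake n a = stake n b" shows "a = b"
proof -
  have "a !! i = b !! i" for i
  proof -
    have "stake (max m (Suc i)) a ! i = stake (max m (Suc i)) b ! i" using assms by simp
    then show ?thesis by (simp add: stake_nth)
  qed
  then have "snth a = snth b" by blast
  then show ?thesis using stream_smap_nats[of a] stream_smap_nats[of b] by simp
qed

lemma stake_split: "n \<le> m \<Longrightarrow> stake m w = stake n w @ stake (m - n) (sdrop n w)"
  using stake_add[of n w "m - n"] by simp

context self_similar_bundle
begin

lemma inf_paths_sdrop: "w \<in> inf_paths \<Longrightarrow> sdrop n w \<in> inf_paths"
  by (auto simp: inf_paths_def sdrop_snth simp flip: add_Suc_right)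

lemma inf_range_verts: "w \<in> inf_paths \<Longrightarrow> inf_range w \<in> verts E"
  unfolding inf_paths_def inf_range_def by (metis (mono_tags, lifting) head_in_verts mem_Collect_eq snth.simps(1))

lemma walk_stake: "w \<in> inf_paths \<Longrightarrow> walk (inf_range w) (stake n w) (inf_range (sdrop n w))"
proof (induction n arbitrary: w)
  case 0
  then show ?case using inf_range_verts by simp
next
  case (Suc n)
  have "shd w \<in> arcs E" "tail E (shd w) = inf_range (stl w)"
    using Suc.prems unfolding inf_paths_def inf_range_def
    by (metis (mono_tags, lifting) mem_Collect_eq snth.simps(1) snth.simps(2))+
  moreover have "stl w \<in> inf_paths" using inf_paths_sdrop[OF Suc.prems, of 1] by simp
  ultimately show ?case using Suc.IH[of "stl w"] by (simp add: inf_range_def)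
qed

lemma inf_paths_by_prefixes:
  assumes "\<And>n. \<exists>v u. walk v (stake n w) u" shows "w \<in> inf_paths"
  unfolding inf_paths_def
proof (intro CollectI allI)
  fix n
  obtain v u where "walk v (stake (n + 2) w) u" using assms by blast
  moreover have "stake (n + 2) w = stake n w @ stake 2 (sdrop n w)" by (rule stake_add[symmetric])
  moreover have "stake 2 (sdrop n w) = [w !! n, w !! Suc n]" by (simp add: numeral_2_eq_2)
  ultimately have "walk v (stake n w @ [w !! n, w !! Suc n]) u" by (simp only:)
  then show "w !! n \<in> arcs E \<and> tail E (w !! n) = head E (w !! Suc n)"
    by (auto simp: walk_append)
qed

lemma shift_inf_paths:
  assumes "walk v p u" "w \<in> inf_paths" "inf_range w = u"
  shows "p @- w \<in> inf_paths" "inf_range (p @- w) = v"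
proof -
  have "p @- w \<in> inf_paths \<and> inf_range (p @- w) = v"
    using assms
  proof (induction p arbitrary: v)
    case (Cons e p)
    then have IH: "p @- w \<in> inf_paths" "inf_range (p @- w) = tail E e" by auto
    have "(e ## (p @- w)) !! n \<in> arcs E \<and> tail E ((e ## (p @- w)) !! n) = head E ((e ## (p @- w)) !! Suc n)" for n
      using IH Cons.prems by (cases n) (auto simp: inf_paths_def inf_range_def)
    then show ?case using Cons by (auto simp: inf_paths_def inf_range_def)
  qed (auto simp: inf_range_def)
  then show "p @- w \<in> inf_paths" "inf_range (p @- w) = v" by auto
qed

lemma stake_inf_act:
  assumes w: "w \<in> inf_paths" and g: "g \<in> carrier (G (inf_range w))"
  shows "stake n (inf_act (inf_range w) g w) = act (inf_range w) g (stake n w)"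
proof (rule nth_equalityI)
  show len: "length (stake n (inf_act (inf_range w) g w)) = length (act (inf_range w) g (stake n w))"
    using length_act_walk[OF walk_stake[OF w] g] by simp
  fix i assume "i < length (stake n (inf_act (inf_range w) g w))"
  then have i: "Suc i \<le> n" by simp
  have "siterate Suc 0 !! i = i" by (simp add: Suc_funpow)
  then have "stake n (inf_act (inf_range w) g w) ! i = act (inf_range w) g (stake (Suc i) w) ! i"
    using i by (simp add: inf_act_def stake_nth)
  also have "\<dots> = act (inf_range w) g (stake n w) ! i"
    unfolding stake_split[OF i, of w]
    using act_append[OF walk_stake[OF w, of "Suc i"] walk_stake[OF inf_paths_sdrop[OF w, of "Suc i"], of "n - Suc i"] g]
      length_act_walk[OF walk_stake[OF w] g, of "Suc i"] by (simp add: nth_append)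
  finally show "stake n (inf_act (inf_range w) g w) ! i = act (inf_range w) g (stake n w) ! i" .
qed

lemma inf_act_inf_paths:
  assumes w: "w \<in> inf_paths" and g: "g \<in> carrier (G (inf_range w))"
  shows "inf_act (inf_range w) g w \<in> inf_paths" "inf_range (inf_act (inf_range w) g w) = inf_range w"
proof -
  have walk: "walk (inf_range w) (stake n (inf_act (inf_range w) g w)) (inf_range (sdrop n w))" for n
    unfolding stake_inf_act[OF assms] by (rule walk_act[OF walk_stake[OF w] g])
  then show "inf_act (inf_range w) g w \<in> inf_paths" using inf_paths_by_prefixes by blast
  show "inf_range (inf_act (inf_range w) g w) = inf_range w"
    using walk[of 1] by (simp add: inf_range_def)
qed

lemma inf_act_shift:
  assumes r: "walk v r u" and w: "w \<in> inf_paths" "inf_range w = u" and g: "g \<in> carrier (G v)"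
  shows "inf_act v g (r @- w) = act v g r @- inf_act u (secs g r) w"
proof (rule stream_eq_by_prefixes[of "length r"])
  fix n assume n: "length r \<le> n"
  note rw = shift_inf_paths[OF r w]
  have s: "stake n (r @- w) = r @ stake (n - length r) w" using n by (simp add: stake_shift)
  have "stake n (inf_act v g (r @- w)) = act v g (r @ stake (n - length r) w)"
    using stake_inf_act[OF rw(1), of g n] rw(2) g s by simp
  also have "\<dots> = act v g r @ act u (secs g r) (stake (n - length r) w)"
    using act_append[OF r walk_stake[OF w(1), unfolded w(2)] g] .
  also have "\<dots> = stake n (act v g r @- inf_act u (secs g r) w)"
    using stake_inf_act[OF w(1), of "secs g r" "n - length r"] w(2) secs_closed[OF r g] n r g
    by (simp add: stake_shift)
  finally show "stake n (inf_act v g (r @- w)) = stake n (act v g r @- inf_act u (secs g r) w)" .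
qed

lemma inf_act_mult:
  assumes w: "w \<in> inf_paths" and g: "g \<in> carrier (G (inf_range w))" and h: "h \<in> carrier (G (inf_range w))"
  shows "inf_act (inf_range w) (g \<otimes>\<^bsub>G (inf_range w)\<^esub> h) w = inf_act (inf_range w) g (inf_act (inf_range w) h w)"
proof (rule stream_eq_by_prefixes[of 0])
  fix n
  show "stake n (inf_act (inf_range w) (g \<otimes>\<^bsub>G (inf_range w)\<^esub> h) w) = stake n (inf_act (inf_range w) g (inf_act (inf_range w) h w))"
    using stake_inf_act[OF w, of "g \<otimes>\<^bsub>G (inf_range w)\<^esub> h" n] stake_inf_act[OF w h, of n]
      stake_inf_act[OF inf_act_inf_paths(1)[OF w h], of g n] inf_act_inf_paths(2)[OF w h]
      act_mult[OF g h walk_stake[OF w]] g h inf_range_verts[OF w] by simp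
qed

lemma inf_act_one:
  assumes w: "w \<in> inf_paths"
  shows "inf_act (inf_range w) \<one>\<^bsub>G (inf_range w)\<^esub> w = w"
  by (rule stream_eq_by_prefixes[of 0])
    (use stake_inf_act[OF w, of "\<one>\<^bsub>G (inf_range w)\<^esub>"] act_one[OF walk_stake[OF w]] inf_range_verts[OF w] in simp)

lemma inf_act_inv:
  assumes w: "w \<in> inf_paths" and g: "g \<in> carrier (G (inf_range w))"
  shows "inf_act (inf_range w) (inv\<^bsub>G (inf_range w)\<^esub> g) (inf_act (inf_range w) g w) = w"
  using inf_act_mult[OF w _ g, of "inv\<^bsub>G (inf_range w)\<^esub> g"] inf_act_one[OF w] g inf_range_verts[OF w] by simp

section \<open>Local behaviour of words\<close>

primrec gen_deg :: "('v, 'e, 'g) gen \<Rightarrow> int" where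
  "gen_deg Zero = 0" | "gen_deg (Edge e) = 1" | "gen_deg (Edge_star e) = -1" | "gen_deg (Elt v g) = 0"

definition word_deg :: "('v, 'e, 'g) word \<Rightarrow> int" where
  "word_deg x = sum_list (map gen_deg x)"

text \<open>
  A word that is defined on the path \<open>p\<close> acts on all extensions of \<open>p\<close> through one group element \<open>k\<close>: an
  extension \<open>r\<close> is moved by \<open>k\<close>, and the group coordinate is multiplied by the section of \<open>k\<close> along \<open>r\<close>.
  The integer \<open>d\<close> is the change of length, which depends on the word alone.
\<close>

definition local_form ::
  "(('e list \<times> 'v \<times> 'g) \<times> ('e list \<times> 'v \<times> 'g)) set \<Rightarrow> int \<Rightarrow> 'e list \<Rightarrow> 'v \<Rightarrow> 'e list \<Rightarrow> 'g \<Rightarrow> bool" where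
  "local_form R d p u p' k \<longleftrightarrow> (\<exists>w. walk w p' u) \<and> k \<in> carrier (G u) \<and> int (length p') = int (length p) + d
    \<and> (\<forall>r u' g. walk u r u' \<longrightarrow> g \<in> carrier (G u')
         \<longrightarrow> ((p @ r, u', g), (p' @ act u k r, u', secs k r \<otimes>\<^bsub>G u'\<^esub> g)) \<in> R)"

lemma local_formD:
  "local_form R d p u p' k \<Longrightarrow> walk u r u' \<Longrightarrow> g \<in> carrier (G u')
    \<Longrightarrow> ((p @ r, u', g), (p' @ act u k r, u', secs k r \<otimes>\<^bsub>G u'\<^esub> g)) \<in> R"
  by (auto simp: local_form_def)

lemma gen_rel_local:
  assumes a: "a \<in> gens" and rel: "((p, u, g), (p', u', h)) \<in> gen_rel a" and p: "walk w p u" and g: "g \<in> carrier (G u)"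
  shows "u' = u \<and> (\<exists>k. h = k \<otimes>\<^bsub>G u\<^esub> g \<and> local_form (gen_rel a) (gen_deg a) p u p' k)"
  using a
proof (cases rule: gens_cases)
  case (2 e)
  then have p': "p' = e # p" "h = g" "u' = u" "walk (tail E e) p u" using rel by auto
  have "((p @ r, u'', l), (p' @ act u \<one>\<^bsub>G u\<^esub> r, u'', secs \<one>\<^bsub>G u\<^esub> r \<otimes>\<^bsub>G u''\<^esub> l)) \<in> gen_rel a"
    if "walk u r u''" "l \<in> carrier (G u'')" for r u'' l
    using 2 p' that walk_verts[OF that(1)] by (auto simp: act_one secs_one walk_append)
  moreover have "walk (head E e) p' u" using p' 2 by simp
  ultimately have "local_form (gen_rel a) (gen_deg a) p u p' \<one>\<^bsub>G u\<^esub>"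
    using 2 p' walk_verts[OF p] unfolding local_form_def by auto
  then show ?thesis using p' g walk_verts[OF p] by (intro conjI exI[of _ "\<one>\<^bsub>G u\<^esub>"]) auto
next
  case (3 e)
  then have p': "p = e # p'" "h = g" "u' = u" "walk (tail E e) p' u" using rel by auto
  have "((p @ r, u'', l), (p' @ act u \<one>\<^bsub>G u\<^esub> r, u'', secs \<one>\<^bsub>G u\<^esub> r \<otimes>\<^bsub>G u''\<^esub> l)) \<in> gen_rel a"
    if "walk u r u''" "l \<in> carrier (G u'')" for r u'' l
    using 3 p' that walk_verts[OF that(1)] by (auto simp: act_one secs_one walk_append)
  then have "local_form (gen_rel a) (gen_deg a) p u p' \<one>\<^bsub>G u\<^esub>"
    using 3 p' walk_verts[OF p] unfolding local_form_def by auto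
  then show ?thesis using p' g walk_verts[OF p] by (intro conjI exI[of _ "\<one>\<^bsub>G u\<^esub>"]) auto
next
  case (4 v k)
  then have p: "walk v p u" and p': "p' = act v k p" "u' = u" "h = secs k p \<otimes>\<^bsub>G u\<^esub> g" using rel by auto
  have "((p @ r, u'', l), (p' @ act u (secs k p) r, u'', secs (secs k p) r \<otimes>\<^bsub>G u''\<^esub> l)) \<in> gen_rel a"
    if "walk u r u''" "l \<in> carrier (G u'')" for r u'' l
    using 4 p' act_append[OF p that(1) 4(3)] that p by (auto simp: walk_append secs_append)
  then have "local_form (gen_rel a) (gen_deg a) p u p' (secs k p)"
    using 4 p p' walk_act[OF p 4(3)] unfolding local_form_def by auto
  then show ?thesis using p' by auto
qed (use rel in auto)

lemma local_form_comp:
  assumes f: "local_form R d p u p' k" and f': "local_form R' d' p' u p'' k'"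
  shows "local_form (R O R') (d' + d) p u p'' (k' \<otimes>\<^bsub>G u\<^esub> k)"
proof -
  have k: "k \<in> carrier (G u)" "k' \<in> carrier (G u)" using assms by (auto simp: local_form_def)
  have u: "u \<in> verts E" using f walk_verts by (auto simp: local_form_def)
  have "((p @ r, u', g), (p'' @ act u (k' \<otimes>\<^bsub>G u\<^esub> k) r, u', secs (k' \<otimes>\<^bsub>G u\<^esub> k) r \<otimes>\<^bsub>G u'\<^esub> g)) \<in> R O R'"
    if r: "walk u r u'" and g: "g \<in> carrier (G u')" for r u' g
  proof -
    have u': "u' \<in> verts E" using r walk_verts by auto
    have r': "walk u (act u k r) u'" using walk_act[OF r k(1)] .
    have "((p @ r, u', g), (p' @ act u k r, u', secs k r \<otimes>\<^bsub>G u'\<^esub> g)) \<in> R"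
      using f r g by (auto simp: local_form_def)
    moreover have "((p' @ act u k r, u', secs k r \<otimes>\<^bsub>G u'\<^esub> g),
        (p'' @ act u k' (act u k r), u', secs k' (act u k r) \<otimes>\<^bsub>G u'\<^esub> (secs k r \<otimes>\<^bsub>G u'\<^esub> g))) \<in> R'"
      using f' r' g u' secs_closed[OF r k(1)] by (auto simp: local_form_def)
    ultimately show ?thesis
      using act_mult[OF k(2,1) r] secs_mult[OF r k(2,1)] secs_closed[OF r k(1)] secs_closed[OF r' k(2)] g u'
      by (auto simp: G_assoc)
  qed
  then show ?thesis using assms k u unfolding local_form_def by auto
qed

lemma word_rel_local:
  assumes "set x \<subseteq> gens" "((p, u, g), (p', u', h)) \<in> word_rel x" "walk w p u" "g \<in> carrier (G u)"
  shows "u' = u \<and> (\<exists>k. h = k \<otimes>\<^bsub>G u\<^esub> g \<and> local_form (word_rel x) (word_deg x) p u p' k)"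
  using assms
proof (induction x arbitrary: p' u' h)
  case Nil
  have "local_form (word_rel []) (word_deg []) p u p \<one>\<^bsub>G u\<^esub>"
    unfolding local_form_def using Nil walk_verts[OF Nil(3)]
    by (auto simp: word_deg_def act_one secs_one dest: walk_verts)
  then show ?case using Nil walk_verts[OF Nil(3)] by (auto intro!: exI[of _ "\<one>\<^bsub>G u\<^esub>"])
next
  case (Cons a x)
  then obtain c where c: "((p, u, g), c) \<in> word_rel x" "(c, (p', u', h)) \<in> gen_rel a" by auto
  obtain p1 u1 h1 where c_eq: "c = (p1, u1, h1)" by (cases c)
  then obtain k1 where 1: "u1 = u" "h1 = k1 \<otimes>\<^bsub>G u\<^esub> g" "local_form (word_rel x) (word_deg x) p u p1 k1"
    using Cons.IH[of p1 u1 h1] Cons.prems c by auto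
  have u: "u \<in> verts E" using Cons.prems walk_verts by auto
  have k1: "k1 \<in> carrier (G u)" using 1 by (auto simp: local_form_def)
  obtain w1 where w1: "walk w1 p1 u" using 1 by (auto simp: local_form_def)
  have a: "a \<in> gens" using Cons.prems by simp
  have rel: "((p1, u, k1 \<otimes>\<^bsub>G u\<^esub> g), (p', u', h)) \<in> gen_rel a" using c c_eq 1 by simp
  obtain k2 where 2: "u' = u" "h = k2 \<otimes>\<^bsub>G u\<^esub> (k1 \<otimes>\<^bsub>G u\<^esub> g)" "local_form (gen_rel a) (gen_deg a) p1 u p' k2"
    using gen_rel_local[OF a rel w1] k1 Cons.prems u by auto
  have k2: "k2 \<in> carrier (G u)" using 2 by (auto simp: local_form_def)
  have "local_form (word_rel (a # x)) (word_deg (a # x)) p u p' (k2 \<otimes>\<^bsub>G u\<^esub> k1)"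
    using local_form_comp[OF 1(3) 2(3)] by (simp add: word_deg_def)
  then show ?case using 2 k1 k2 Cons.prems(4) u by (intro conjI exI[of _ "k2 \<otimes>\<^bsub>G u\<^esub> k1"]) (auto simp: G_assoc)
qed

text \<open>
  The range is part of the condition because it is not determined by the prefix of length \<open>0\<close>.
\<close>

definition nbhd :: "nat \<Rightarrow> 'e stream \<Rightarrow> 'e stream set" where
  "nbhd n w = cylinder (inf_range w) (stake n w)"

lemma in_nbhd: "z \<in> nbhd n w \<longleftrightarrow> z \<in> inf_paths \<and> inf_range z = inf_range w \<and> stake n z = stake n w"
  by (auto simp: nbhd_def cylinder_def)

lemma nbhd_self [simp]: "w \<in> inf_paths \<Longrightarrow> w \<in> nbhd n w" by (simp add: in_nbhd)

lemma nbhd_antimono: "n \<le> m \<Longrightarrow> nbhd m w \<subseteq> nbhd n w"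
  unfolding in_nbhd subset_iff by (metis length_stake stake_split append_eq_append_conv)

lemma nbhd_sym: "z \<in> nbhd n w \<Longrightarrow> nbhd n z = nbhd n w"
  by (auto simp: in_nbhd)

lemma walk_stake_range_eq:
  assumes "z \<in> nbhd n w" "w \<in> inf_paths" shows "inf_range (sdrop n z) = inf_range (sdrop n w)"
  using walk_stake[of z n] walk_stake[of w n] assms walk_source_unique by (metis in_nbhd)

text \<open>
  The product of \<open>x\<close> with the prefix of length \<open>n\<close> of \<open>w\<close> is the element \<open>p k\<close> of the semigroup.
\<close>

definition reads :: "('v, 'e, 'g) word \<Rightarrow> 'e stream \<Rightarrow> nat \<Rightarrow> 'e list \<Rightarrow> 'g \<Rightarrow> bool" where
  "reads x w n p k \<longleftrightarrow> ((stake n w, inf_range (sdrop n w), \<one>\<^bsub>G (inf_range (sdrop n w))\<^esub>),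
     (p, inf_range (sdrop n w), k)) \<in> word_rel x"

lemma reads_functional: "reads x w n p k \<Longrightarrow> reads x w n p' k' \<Longrightarrow> p = p' \<and> k = k'"
  unfolding reads_def using word_rel_functional by blast

lemma reads_local:
  assumes "w \<in> inf_paths" "x \<in> words" "reads x w n p k"
  shows "local_form (word_rel x) (word_deg x) (stake n w) (inf_range (sdrop n w)) p k"
proof -
  have u: "inf_range (sdrop n w) \<in> verts E" using inf_range_verts inf_paths_sdrop assms by blast
  then have one: "\<one>\<^bsub>G (inf_range (sdrop n w))\<^esub> \<in> carrier (G (inf_range (sdrop n w)))" by simp
  have "set x \<subseteq> gens" using assms by (auto simp: words_def)
  note l = word_rel_local[OF this assms(3)[unfolded reads_def] walk_stake[OF assms(1)] one]
  then obtain k' where "k = k' \<otimes>\<^bsub>G (inf_range (sdrop n w))\<^esub> \<one>\<^bsub>G (inf_range (sdrop n w))\<^esub>" 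
    and k': "local_form (word_rel x) (word_deg x) (stake n w) (inf_range (sdrop n w)) p k'" by blast
  then have "k = k'" using u by (auto simp: local_form_def)
  then show ?thesis using k' by simp
qed

lemma reads_facts:
  assumes "w \<in> inf_paths" "x \<in> words" "reads x w n p k"
  shows "k \<in> carrier (G (inf_range (sdrop n w)))" "\<exists>v. walk v p (inf_range (sdrop n w))"
    "int (length p) = int n + word_deg x"
  using reads_local[OF assms] by (auto simp: local_form_def)

lemma reads_mono:
  assumes "w \<in> inf_paths" "x \<in> words" "reads x w n p k" "n \<le> m"
  shows "reads x w m (p @ act (inf_range (sdrop n w)) k (stake (m - n) (sdrop n w))) (secs k (stake (m - n) (sdrop n w)))"
proof -
  let ?u = "inf_range (sdrop n w)" and ?r = "stake (m - n) (sdrop n w)"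
  have d: "sdrop (m - n) (sdrop n w) = sdrop m w" using assms(4) by (simp add: sdrop_add)
  have r: "walk ?u ?r (inf_range (sdrop m w))"
    using walk_stake[OF inf_paths_sdrop[OF assms(1), of n], of "m - n"] d by simp
  have v: "inf_range (sdrop m w) \<in> verts E" using r walk_verts by blast
  have "k \<in> carrier (G ?u)" using reads_facts assms by blast
  then show ?thesis
    using local_formD[OF reads_local[OF assms(1-3)] r, of "\<one>\<^bsub>G (inf_range (sdrop m w))\<^esub>"] v secs_closed[OF r]
    unfolding reads_def stake_split[OF assms(4)] by simp
qed

lemma reads_nbhd:
  assumes "w \<in> inf_paths" "z \<in> nbhd n w" shows "reads x z n p k \<longleftrightarrow> reads x w n p k"
  using assms walk_stake_range_eq[OF assms(2,1)] by (simp add: reads_def in_nbhd)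

text \<open>
  The infinite path to which a word with the reading \<open>(n, p, k)\<close> maps \<open>w\<close>.
\<close>

definition value_at :: "'e stream \<Rightarrow> nat \<Rightarrow> 'e list \<Rightarrow> 'g \<Rightarrow> 'e stream" where
  "value_at w n p k = p @- inf_act (inf_range (sdrop n w)) k (sdrop n w)"

lemma value_at_mono:
  assumes "w \<in> inf_paths" "k \<in> carrier (G (inf_range (sdrop n w)))" "n \<le> m"
  shows "value_at w m (p @ act (inf_range (sdrop n w)) k (stake (m - n) (sdrop n w))) (secs k (stake (m - n) (sdrop n w)))
    = value_at w n p k"
proof -
  let ?u = "inf_range (sdrop n w)" and ?r = "stake (m - n) (sdrop n w)"
  have d: "sdrop (m - n) (sdrop n w) = sdrop m w" using assms(3) by (simp add: sdrop_add)
  have r: "walk ?u ?r (inf_range (sdrop m w))"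
    using walk_stake[OF inf_paths_sdrop[OF assms(1), of n], of "m - n"] d by simp
  have "sdrop n w = ?r @- sdrop m w" using stake_sdrop[of "m - n" "sdrop n w"] d by simp
  then have "inf_act ?u k (sdrop n w) = act ?u k ?r @- inf_act (inf_range (sdrop m w)) (secs k ?r) (sdrop m w)"
    using inf_act_shift[OF r inf_paths_sdrop[OF assms(1)] HOL.refl assms(2)] by metis
  then show ?thesis by (simp add: value_at_def)
qed

definition defined_at :: "('v, 'e, 'g) word \<Rightarrow> 'e stream \<Rightarrow> bool" where
  "defined_at x w \<longleftrightarrow> x \<in> words \<and> w \<in> inf_paths \<and> (\<exists>n p k. reads x w n p k)"

definition app :: "('v, 'e, 'g) word \<Rightarrow> 'e stream \<Rightarrow> 'e stream" where
  "app x w = (THE z. \<exists>n p k. reads x w n p k \<and> z = value_at w n p k)"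

text \<open>
  Equality of the germs of \<open>x\<close> and \<open>y\<close> at \<open>w\<close>; see \<open>germ_eq_iff\<close>.
\<close>

definition agree :: "('v, 'e, 'g) word \<Rightarrow> ('v, 'e, 'g) word \<Rightarrow> 'e stream \<Rightarrow> bool" where
  "agree x y w \<longleftrightarrow> (\<exists>n p k. reads x w n p k \<and> reads y w n p k)"

lemma reads_value_unique:
  assumes "w \<in> inf_paths" "x \<in> words" "reads x w n p k" "reads x w n' p' k'"
  shows "value_at w n p k = value_at w n' p' k'"
proof -
  let ?m = "max n n'"
  have "reads x w ?m (p @ act (inf_range (sdrop n w)) k (stake (?m - n) (sdrop n w))) (secs k (stake (?m - n) (sdrop n w)))"
    "reads x w ?m (p' @ act (inf_range (sdrop n' w)) k' (stake (?m - n') (sdrop n' w))) (secs k' (stake (?m - n') (sdrop n' w)))"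
    using reads_mono assms by auto
  note eq = reads_functional[OF this]
  have "value_at w n p k = value_at w ?m (p @ act (inf_range (sdrop n w)) k (stake (?m - n) (sdrop n w))) (secs k (stake (?m - n) (sdrop n w)))"
    using value_at_mono[OF assms(1), of k n ?m p] reads_facts[OF assms(1-3)] by simp
  also have "\<dots> = value_at w n' p' k'"
    unfolding eq[THEN conjunct1] eq[THEN conjunct2]
    using value_at_mono[OF assms(1), of k' n' ?m p'] reads_facts[OF assms(1,2,4)] by simp
  finally show ?thesis .
qed

lemma app_eq:
  assumes "w \<in> inf_paths" "x \<in> words" "reads x w n p k"
  shows "app x w = value_at w n p k"
  unfolding app_def using reads_value_unique[OF assms] assms(3) by (intro the_equality) metis+

lemma reads_ge:
  assumes "defined_at x w"
  obtains n p k where "n \<ge> m" "length p \<ge> m" "reads x w n p k"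
proof -
  obtain n0 p0 k0 where r: "reads x w n0 p0 k0" and w: "w \<in> inf_paths" and x: "x \<in> words"
    using assms by (auto simp: defined_at_def)
  define n where "n = max n0 (m + nat \<bar>word_deg x\<bar>)"
  have "n0 \<le> n" by (simp add: n_def)
  note r' = reads_mono[OF w x r this]
  have "n \<ge> m" "m \<le> int n + word_deg x" by (auto simp: n_def)
  then show thesis using that[OF _ _ r'] reads_facts(3)[OF w x r'] by auto
qed

lemma value_at_props:
  assumes w: "w \<in> inf_paths" and k: "k \<in> carrier (G (inf_range (sdrop n w)))" and p: "walk v p (inf_range (sdrop n w))"
  shows "value_at w n p k \<in> inf_paths" "inf_range (value_at w n p k) = v"
    "stake (length p) (value_at w n p k) = p"
    "sdrop (length p) (value_at w n p k) = inf_act (inf_range (sdrop n w)) k (sdrop n w)"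
    "inf_range (sdrop (length p) (value_at w n p k)) = inf_range (sdrop n w)"
  using shift_inf_paths[OF p] inf_act_inf_paths[OF inf_paths_sdrop[OF w, of n] k]
  by (auto simp: value_at_def stake_shift sdrop_shift)

lemma app_inf_paths: "defined_at x w \<Longrightarrow> app x w \<in> inf_paths"
  using app_eq value_at_props(1) reads_facts unfolding defined_at_def by metis

lemma reads_append:
  assumes y: "y \<in> words" and x: "x \<in> words" and w: "w \<in> inf_paths" and r: "reads y w n p k"
  shows "reads (x @ y) w n q h \<longleftrightarrow>
    (\<exists>k'. h = k' \<otimes>\<^bsub>G (inf_range (sdrop n w))\<^esub> k \<and> reads x (app y w) (length p) q k')"
proof -
  let ?u = "inf_range (sdrop n w)"
  obtain v where p: "walk v p ?u" using reads_facts[OF w y r] by blast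
  have k: "k \<in> carrier (G ?u)" using reads_facts[OF w y r] by blast
  have u: "?u \<in> verts E" using p walk_verts by blast
  note vp = value_at_props[OF w k p]
  have app: "app y w = value_at w n p k" using app_eq[OF w y r] .
  have gx: "set x \<subseteq> gens" using x by (auto simp: words_def)
  have "reads (x @ y) w n q h \<longleftrightarrow> ((p, ?u, k), (q, ?u, h)) \<in> word_rel x"
    using r word_rel_functional unfolding reads_def word_rel_append by blast
  also have "\<dots> \<longleftrightarrow> (\<exists>k'. h = k' \<otimes>\<^bsub>G ?u\<^esub> k \<and> reads x (app y w) (length p) q k')"
  proof
    assume a: "((p, ?u, k), (q, ?u, h)) \<in> word_rel x"
    obtain k' where k': "h = k' \<otimes>\<^bsub>G ?u\<^esub> k" "local_form (word_rel x) (word_deg x) p ?u q k'"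
      using word_rel_local[OF gx a p k] by blast
    then have "((p @ [], ?u, \<one>\<^bsub>G ?u\<^esub>), (q @ act ?u k' [], ?u, secs k' [] \<otimes>\<^bsub>G ?u\<^esub> \<one>\<^bsub>G ?u\<^esub>)) \<in> word_rel x"
      using local_formD[OF k'(2), of "[]" ?u "\<one>\<^bsub>G ?u\<^esub>"] u by simp
    then have "reads x (app y w) (length p) q k'"
      using k' u by (auto simp: reads_def app vp(3,5) local_form_def)
    then show "\<exists>k'. h = k' \<otimes>\<^bsub>G ?u\<^esub> k \<and> reads x (app y w) (length p) q k'" using k' by blast
  next
    assume "\<exists>k'. h = k' \<otimes>\<^bsub>G ?u\<^esub> k \<and> reads x (app y w) (length p) q k'"
    then obtain k' where k': "h = k' \<otimes>\<^bsub>G ?u\<^esub> k" "reads x (app y w) (length p) q k'" by blast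
    have l: "local_form (word_rel x) (word_deg x) p ?u q k'"
      using reads_local[OF _ x k'(2)] vp(1,3,5) app by simp
    then have "((p @ [], ?u, k), (q @ act ?u k' [], ?u, secs k' [] \<otimes>\<^bsub>G ?u\<^esub> k)) \<in> word_rel x"
      using local_formD[OF l, of "[]" ?u k] u k by simp
    then show "((p, ?u, k), (q, ?u, h)) \<in> word_rel x" using k' u l by (auto simp: local_form_def)
  qed
  finally show ?thesis .
qed

lemma defined_atI: "x \<in> words \<Longrightarrow> w \<in> inf_paths \<Longrightarrow> reads x w n p k \<Longrightarrow> defined_at x w"
  unfolding defined_at_def by blast

lemma defined_atD: "defined_at x w \<Longrightarrow> x \<in> words" "defined_at x w \<Longrightarrow> w \<in> inf_paths"
  unfolding defined_at_def by blast+

lemma app_props: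
  assumes "w \<in> inf_paths" "x \<in> words" "reads x w n p k"
  shows "app x w \<in> inf_paths" "stake (length p) (app x w) = p"
    "inf_range (sdrop (length p) (app x w)) = inf_range (sdrop n w)"
    "sdrop (length p) (app x w) = inf_act (inf_range (sdrop n w)) k (sdrop n w)"
proof -
  obtain v where "walk v p (inf_range (sdrop n w))" using reads_facts(2)[OF assms] by blast
  from value_at_props[OF assms(1) reads_facts(1)[OF assms] this]
  show "app x w \<in> inf_paths" "stake (length p) (app x w) = p"
    "inf_range (sdrop (length p) (app x w)) = inf_range (sdrop n w)"
    "sdrop (length p) (app x w) = inf_act (inf_range (sdrop n w)) k (sdrop n w)"
    unfolding app_eq[OF assms] by auto
qed

lemma words_append: "x \<in> words \<Longrightarrow> y \<in> words \<Longrightarrow> x @ y \<in> words"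
  by (auto simp: words_def)

lemma agree_sym: "agree x y w \<Longrightarrow> agree y x w"
  unfolding agree_def by blast

lemma agree_refl: "defined_at x w \<Longrightarrow> agree x x w"
  unfolding agree_def defined_at_def by blast

lemma agree_ge:
  assumes "agree x y w" "w \<in> inf_paths" "x \<in> words" "y \<in> words"
  obtains n p k where "n \<ge> m" "reads x w n p k" "reads y w n p k"
proof -
  obtain n p k where r: "reads x w n p k" "reads y w n p k" using assms by (auto simp: agree_def)
  show thesis
    using that[of "max m n"] reads_mono[OF assms(2,3) r(1), of "max m n"] reads_mono[OF assms(2,4) r(2), of "max m n"] by simp
qed

lemma agree_trans:
  assumes "agree x y w" "agree y z w" "w \<in> inf_paths" "x \<in> words" "y \<in> words" "z \<in> words"
  shows "agree x z w"
proof -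
  obtain n p k where 1: "reads x w n p k" "reads y w n p k" using assms by (auto simp: agree_def)
  obtain n' p' k' where 2: "n' \<ge> n" "reads y w n' p' k'" "reads z w n' p' k'"
    using agree_ge[OF assms(2,3,5,6)] by blast
  show ?thesis
    using reads_mono[OF assms(3,4) 1(1) 2(1)] reads_functional[OF reads_mono[OF assms(3,5) 1(2) 2(1)] 2(2)] 2(3)
    unfolding agree_def by auto
qed

lemma agree_app: "agree x y w \<Longrightarrow> w \<in> inf_paths \<Longrightarrow> x \<in> words \<Longrightarrow> y \<in> words \<Longrightarrow> app x w = app y w"
  unfolding agree_def using app_eq by metis

lemma agree_nbhd:
  assumes "reads x w n p k" "reads y w n p k" "w \<in> inf_paths" "z \<in> nbhd n w"
  shows "agree x y z"
  using assms reads_nbhd unfolding agree_def by blast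

lemma defined_append:
  assumes y: "defined_at y w" and x: "defined_at x (app y w)"
  shows "defined_at (x @ y) w" "app (x @ y) w = app x (app y w)"
proof -
  note d = defined_atD[OF y] defined_atD[OF x]
  obtain m p0 k0 where r0: "reads x (app y w) m p0 k0" using x by (auto simp: defined_at_def)
  obtain n p k where r: "length p \<ge> m" "reads y w n p k" using reads_ge[OF y, of m] by blast
  note r1 = reads_mono[OF d(4,3) r0 r(1)]
  obtain q k' where q: "reads x (app y w) (length p) q k'" using r1 by blast
  have xy: "reads (x @ y) w n q (k' \<otimes>\<^bsub>G (inf_range (sdrop n w))\<^esub> k)"
    using reads_append[OF d(1,3,2) r(2)] q by blast
  show "defined_at (x @ y) w" using defined_atI[OF words_append d(2) xy] d by blast
  note ap = app_props[OF d(2,1) r(2)]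
  have k: "k \<in> carrier (G (inf_range (sdrop n w)))" using reads_facts[OF d(2,1) r(2)] by blast
  have k': "k' \<in> carrier (G (inf_range (sdrop n w)))" using reads_facts[OF d(4,3) q] ap(3) by simp
  have "app (x @ y) w = value_at w n q (k' \<otimes>\<^bsub>G (inf_range (sdrop n w))\<^esub> k)"
    using app_eq[OF d(2) words_append xy] d by blast
  also have "\<dots> = value_at (app y w) (length p) q k'"
    unfolding value_at_def ap(3) ap(4)[symmetric]
    using inf_act_mult[OF inf_paths_sdrop[OF d(2)] k' k] ap(4) by simp
  also have "\<dots> = app x (app y w)" using app_eq[OF d(4,3) q] by simp
  finally show "app (x @ y) w = app x (app y w)" .
qed

lemma agree_append_right:
  assumes r: "defined_at r w" and x: "x \<in> words" and y: "y \<in> words"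
  shows "agree (x @ r) (y @ r) w \<longleftrightarrow> agree x y (app r w)"
proof
  note d = defined_atD[OF r]
  assume "agree (x @ r) (y @ r) w"
  moreover obtain n0 p0 k0 where r0: "reads r w n0 p0 k0" using r by (auto simp: defined_at_def)
  ultimately obtain n q h where n: "n \<ge> n0" and q: "reads (x @ r) w n q h" "reads (y @ r) w n q h"
    using agree_ge[of "x @ r" "y @ r" w n0] words_append d x y by metis
  obtain p k where p: "reads r w n p k" using reads_mono[OF d(2,1) r0 n] by blast
  let ?G = "G (inf_range (sdrop n w))"
  have u: "inf_range (sdrop n w) \<in> verts E" using inf_range_verts inf_paths_sdrop d by blast
  note ap = app_props[OF d(2,1) p]
  have k: "k \<in> carrier ?G" using reads_facts[OF d(2,1) p] by blast
  obtain k1 k2 where k1: "h = k1 \<otimes>\<^bsub>?G\<^esub> k" "reads x (app r w) (length p) q k1"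
    and k2: "h = k2 \<otimes>\<^bsub>?G\<^esub> k" "reads y (app r w) (length p) q k2"
    using reads_append[OF d(1) x d(2) p] reads_append[OF d(1) y d(2) p] q by blast
  have "k1 \<in> carrier ?G" "k2 \<in> carrier ?G"
    using reads_facts[OF ap(1) x k1(2)] reads_facts[OF ap(1) y k2(2)] ap(3) by auto
  then have "k1 = k2" using k1 k2 k u by auto
  then show "agree x y (app r w)" using k1 k2 by (auto simp: agree_def)
next
  note d = defined_atD[OF r]
  assume a: "agree x y (app r w)"
  obtain m p0 k0 where m: "reads x (app r w) m p0 k0" "reads y (app r w) m p0 k0" using a by (auto simp: agree_def)
  obtain n p k where p: "length p \<ge> m" "reads r w n p k" using reads_ge[OF r, of m] by blast
  note ap = app_props[OF d(2,1) p(2)]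
  show "agree (x @ r) (y @ r) w"
    using reads_mono[OF ap(1) x m(1) p(1)] reads_mono[OF ap(1) y m(2) p(1)]
      reads_append[OF d(1) x d(2) p(2)] reads_append[OF d(1) y d(2) p(2)]
    unfolding agree_def by blast
qed

lemma agree_append_left:
  assumes a: "agree x y w" and x: "defined_at x w" and y: "y \<in> words" and t: "defined_at t (app x w)"
  shows "agree (t @ x) (t @ y) w"
proof -
  note d = defined_atD[OF x] defined_atD[OF t]
  obtain m p0 k0 where r0: "reads t (app x w) m p0 k0" using t by (auto simp: defined_at_def)
  obtain n p k where p: "n \<ge> m + nat \<bar>word_deg x\<bar>" "reads x w n p k" "reads y w n p k"
    using agree_ge[OF a d(2,1) y] by blast
  have "int (length p) = int n + word_deg x" using reads_facts[OF d(2,1) p(2)] by blast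
  then have "m \<le> length p" using p(1) by linarith
  then have "\<exists>q h. reads t (app x w) (length p) q h" using reads_mono[OF d(4,3) r0] by blast
  then show ?thesis
    using reads_append[OF d(1,3,2) p(2)] reads_append[OF y d(3,2) p(3)]
    unfolding agree_def agree_app[OF a d(2,1) y] by blast
qed

lemma reads_word_star:
  assumes w: "w \<in> inf_paths" and x: "x \<in> words" and r: "reads x w n p k"
  shows "reads (word_star x) (app x w) (length p) (stake n w) (inv\<^bsub>G (inf_range (sdrop n w))\<^esub> k)"
proof -
  let ?u = "inf_range (sdrop n w)"
  have gx: "set x \<subseteq> gens" "set (word_star x) \<subseteq> gens" using x word_star_gens[of x] by (auto simp: words_def)
  have u: "?u \<in> verts E" using inf_range_verts inf_paths_sdrop w by blast
  obtain v where p: "walk v p ?u" using reads_facts[OF w x r] by blast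
  have k: "k \<in> carrier (G ?u)" using reads_facts[OF w x r] by blast
  have rel: "((p, ?u, k), (stake n w, ?u, \<one>\<^bsub>G ?u\<^esub>)) \<in> word_rel (word_star x)"
    using r word_rel_star[OF gx(1)] by (simp add: reads_def)
  obtain l where l: "\<one>\<^bsub>G ?u\<^esub> = l \<otimes>\<^bsub>G ?u\<^esub> k" "local_form (word_rel (word_star x)) (word_deg (word_star x)) p ?u (stake n w) l"
    using word_rel_local[OF gx(2) rel p k] by blast
  have "l \<in> carrier (G ?u)" using l by (simp add: local_form_def)
  then have "l = inv\<^bsub>G ?u\<^esub> k" using l(1) k u group.inv_equality[OF G_group] by metis
  then show ?thesis
    using local_formD[OF l(2), of "[]" ?u "\<one>\<^bsub>G ?u\<^esub>"] app_props(2,3)[OF w x r] u k by (simp add: reads_def)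
qed

lemma defined_word_star:
  assumes "defined_at x w"
  shows "defined_at (word_star x) (app x w)" "app (word_star x) (app x w) = w"
proof -
  note d = defined_atD[OF assms]
  obtain n p k where r: "reads x w n p k" using assms by (auto simp: defined_at_def)
  note s = reads_word_star[OF d(2,1) r]
  note ap = app_props[OF d(2,1) r]
  have sx: "word_star x \<in> words" using word_star_in_words d by blast
  show "defined_at (word_star x) (app x w)" using defined_atI[OF sx ap(1) s] .
  have k: "k \<in> carrier (G (inf_range (sdrop n w)))" using reads_facts[OF d(2,1) r] by blast
  show "app (word_star x) (app x w) = w"
    using app_eq[OF ap(1) sx s, unfolded value_at_def ap(3), unfolded ap(4)] inf_act_inv[OF inf_paths_sdrop[OF d(2)] k]
    by (simp add: stake_sdrop)
qed

lemma reads_word_star_self: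
  assumes w: "w \<in> inf_paths" and x: "x \<in> words" and r: "reads x w n p k"
  shows "reads (word_star x @ x) w n (stake n w) \<one>\<^bsub>G (inf_range (sdrop n w))\<^esub>"
proof -
  have "k \<in> carrier (G (inf_range (sdrop n w)))" using reads_facts[OF w x r] by blast
  moreover have "inf_range (sdrop n w) \<in> verts E" using inf_range_verts inf_paths_sdrop w by blast
  ultimately show ?thesis
    using reads_append[OF x word_star_in_words[OF x] w r] reads_word_star[OF w x r] by (metis G_l_inv)
qed

lemma agree_cancel_right:
  assumes x: "defined_at x w" and y: "defined_at y w"
  shows "agree (x @ word_star y @ y) x w"
proof -
  note d = defined_atD[OF x] defined_atD[OF y]
  obtain m p k where ry: "reads y w m p k" using y by (auto simp: defined_at_def)
  obtain n q h where n: "n \<ge> m" and rx: "reads x w n q h" using reads_ge[OF x, of m] by blast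
  let ?e = "word_star y @ y"
  have e: "?e \<in> words" using d word_star_in_words words_append by blast
  obtain p' k' where "reads y w n p' k'" using reads_mono[OF d(4,3) ry n] by blast
  then have re: "reads ?e w n (stake n w) \<one>\<^bsub>G (inf_range (sdrop n w))\<^esub>" using reads_word_star_self d by blast
  have app: "app ?e w = w"
    using defined_append(2)[OF y defined_word_star(1)[OF y]] defined_word_star(2)[OF y] by simp
  have "h \<in> carrier (G (inf_range (sdrop n w)))" using reads_facts[OF d(2,1) rx] by blast
  moreover have "inf_range (sdrop n w) \<in> verts E" using inf_range_verts inf_paths_sdrop d by blast
  ultimately have "reads (x @ ?e) w n q h"
    using reads_append[OF e d(1,2) re, of q h] app rx by (auto intro!: exI[of _ h])
  then show ?thesis using rx unfolding agree_def by blast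
qed

lemma agree_cancel_left:
  assumes r: "defined_at r w" and x: "defined_at x (app r w)"
  shows "agree (word_star x @ x @ r) r w"
proof -
  note d = defined_atD[OF r] defined_atD[OF x]
  obtain m p0 k0 where rx: "reads x (app r w) m p0 k0" using x by (auto simp: defined_at_def)
  obtain n p k where p: "length p \<ge> m" "reads r w n p k" using reads_ge[OF r, of m] by blast
  let ?e = "word_star x @ x"
  have e: "?e \<in> words" using d word_star_in_words words_append by blast
  obtain p' k' where "reads x (app r w) (length p) p' k'" using reads_mono[OF d(4,3) rx p(1)] by blast
  note re = reads_word_star_self[OF d(4,3) this]
  note ap = app_props[OF d(2,1) p(2)]
  have "k \<in> carrier (G (inf_range (sdrop n w)))" using reads_facts[OF d(2,1) p(2)] by blast
  moreover have "inf_range (sdrop n w) \<in> verts E" using inf_range_verts inf_paths_sdrop d by blast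
  ultimately have "reads (?e @ r) w n p k"
    using reads_append[OF d(1) e d(2) p(2), of p k] re ap by (metis G_l_one)
  then show ?thesis using p(2) unfolding agree_def by auto
qed

lemma agree_word_star:
  assumes "agree x y w" "w \<in> inf_paths" "x \<in> words" "y \<in> words"
  shows "agree (word_star x) (word_star y) (app x w)"
proof -
  obtain n p k where r: "reads x w n p k" "reads y w n p k" using assms by (auto simp: agree_def)
  show ?thesis
    using reads_word_star[OF assms(2,3) r(1)] reads_word_star[OF assms(2,4) r(2)] agree_app[OF assms]
    unfolding agree_def by auto
qed

section \<open>The groupoid of germs\<close>

lemma S_mult_cls: "x \<in> words \<Longrightarrow> y \<in> words \<Longrightarrow> S_mult (cls x) (cls y) = cls (x @ y)"
  unfolding S_mult_def cls_def
proof (intro equalityI subsetI CollectI)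
  fix z assume "x \<in> words" "y \<in> words" "z \<in> {z. \<exists>a\<in>{a. x \<bumpeq> a}. \<exists>b\<in>{b. y \<bumpeq> b}. a @ b \<bumpeq> z}"
  then show "x @ y \<bumpeq> z" using word_cong.mult word_cong.trans by blast
next
  fix z assume "x \<in> words" "y \<in> words" "z \<in> {z. x @ y \<bumpeq> z}"
  then show "\<exists>a\<in>{a. x \<bumpeq> a}. \<exists>b\<in>{b. y \<bumpeq> b}. a @ b \<bumpeq> z" using word_cong.refl by blast
qed

lemma S_star_cls: "x \<in> words \<Longrightarrow> S_star (cls x) = cls (word_star x)"
  unfolding S_star_def cls_def using word_cong.refl word_cong.star word_cong.trans by blast

lemma S_rel_cls:
  assumes x: "x \<in> words"
  shows "S_rel (cls x) w z \<longleftrightarrow> defined_at x w \<and> z = app x w"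
proof
  assume "S_rel (cls x) w z"
  then obtain v p g q w' where *: "p \<in> paths_from E v" "q \<in> paths_from E v" "g \<in> carrier (G v)"
    "w' \<in> inf_paths" "inf_range w' = v" "cls x = pgq v p g q" "w = q @- w'" "z = p @- inf_act v g w'"
    unfolding S_rel_def by blast
  have nf: "nf_params v p g q" using * by (auto simp: nf_params_def paths_from_eq)
  obtain c where q: "walk c q v" using nf by (auto simp: nf_params_def)
  have eq: "word_rel x = word_rel (nf_word v p g q)"
    using * cls_eq_iff_word_rel[OF x nf_word_in_words[OF nf]] by (simp add: pgq_eq)
  have w: "w \<in> inf_paths" using shift_inf_paths[OF q] * by simp
  have d: "stake (length q) w = q" "sdrop (length q) w = w'" using * by (simp_all add: stake_shift sdrop_shift)
  have r: "reads x w (length q) p g"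
    unfolding reads_def d eq using word_rel_nf_word_apex[OF nf] * by simp
  show "defined_at x w \<and> z = app x w"
    using defined_atI[OF x w r] app_eq[OF w x r] * d by (simp add: value_at_def)
next
  assume a: "defined_at x w \<and> z = app x w"
  then have w: "w \<in> inf_paths" using defined_atD by blast
  obtain n P k where r: "reads x w n P k" using a by (auto simp: defined_at_def)
  from x show "S_rel (cls x) w z"
  proof (cases rule: normal_form)
    case zero
    then show ?thesis using word_rel_sound[OF zero] r by (simp add: reads_def)
  next
    case (nf v p g q)
    let ?u = "inf_range (sdrop n w)"
    note eq = word_rel_sound[OF nf(2)]
    obtain s where s: "stake n w = q @ s" "walk v s ?u" "P = p @ act v g s" "k = secs g s \<otimes>\<^bsub>G ?u\<^esub> \<one>\<^bsub>G ?u\<^esub>"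
      using r unfolding reads_def eq word_rel_nf_word[OF nf(1)] by blast
    have g: "g \<in> carrier (G v)" using nf by (simp add: nf_params_def)
    have k: "k = secs g s" using s secs_closed[OF s(2) g] walk_verts[OF s(2)] by simp
    let ?w = "s @- sdrop n w"
    have w': "?w \<in> inf_paths" "inf_range ?w = v" using shift_inf_paths[OF s(2) inf_paths_sdrop[OF w]] by auto
    have "w = q @- ?w" using stake_sdrop[of n w] s by simp
    moreover have "z = p @- inf_act v g ?w"
      using a app_eq[OF w x r] inf_act_shift[OF s(2) inf_paths_sdrop[OF w] HOL.refl g] s(3) k
      by (simp add: value_at_def)
    moreover have "cls x = pgq v p g q"
      using cls_eq_iff_word_rel[OF x nf_word_in_words[OF nf(1)]] eq by (simp add: pgq_eq)
    moreover have "p \<in> paths_from E v" "q \<in> paths_from E v" "v \<in> verts E"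
      using nf walk_verts by (auto simp: nf_params_def paths_from_eq)
    ultimately show ?thesis using w' g unfolding S_rel_def by blast
  qed
qed

lemma S_dom_cls: "x \<in> words \<Longrightarrow> w \<in> S_dom (cls x) \<longleftrightarrow> defined_at x w"
  by (simp add: S_dom_def S_rel_cls)

lemma S_app_cls: "defined_at x w \<Longrightarrow> S_app (cls x) w = app x w"
  using S_rel_cls[OF defined_atD(1)] by (simp add: S_app_def)

lemma zero_in_words: "[Zero] \<in> words" by (simp add: words_def)

lemma defined_at_nonzero: "defined_at x w \<Longrightarrow> cls x \<noteq> S_zero"
  using cls_eq_iff_word_rel[OF _ zero_in_words] by (auto simp: S_zero_def defined_at_def reads_def)

lemma in_germ_pairs: "(s, w) \<in> germ_pairs \<longleftrightarrow> (\<exists>x. s = cls x \<and> defined_at x w)"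
proof
  assume "(s, w) \<in> germ_pairs"
  then obtain x where "x \<in> words" "s = cls x" "w \<in> S_dom (cls x)" by (auto simp: germ_pairs_def Sgp_def)
  then show "\<exists>x. s = cls x \<and> defined_at x w" using S_dom_cls by blast
next
  assume "\<exists>x. s = cls x \<and> defined_at x w"
  then obtain x where x: "s = cls x" "defined_at x w" by blast
  then show "(s, w) \<in> germ_pairs"
    using S_dom_cls[OF defined_atD(1)[OF x(2)]] defined_at_nonzero[OF x(2)] defined_atD(1)[OF x(2)]
    by (auto simp: germ_pairs_def Sgp_def)
qed

lemma germ_pairs_cases:
  assumes "a \<in> germ_pairs" obtains x w where "a = (cls x, w)" "defined_at x w"
proof -
  obtain s w where "a = (s, w)" by (cases a)
  then show thesis using that assms in_germ_pairs by blast
qed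

lemma cls_in_germ_pairs: "x \<in> words \<Longrightarrow> (cls x, w) \<in> germ_pairs \<longleftrightarrow> defined_at x w"
  using S_dom_cls[of x w] defined_at_nonzero[of x w] by (auto simp: germ_pairs_def Sgp_def)

lemma word_rel_edges_dom:
  "p \<noteq> [] \<Longrightarrow> walk w p v \<Longrightarrow> (a, b) \<in> word_rel (map Edge p) \<Longrightarrow> \<exists>r u k. a = (r, u, k) \<and> walk v r u \<and> k \<in> carrier (G u)"
proof (induction p arbitrary: w b)
  case (Cons e p)
  then obtain c where c: "(a, c) \<in> word_rel (map Edge p)" "(c, b) \<in> gen_rel (Edge e)" by auto
  show ?case
  proof (cases "p = []")
    case True
    then show ?thesis using Cons.prems c by auto
  next
    case False
    then show ?thesis using Cons.IH[OF False _ c(1)] Cons.prems by auto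
  qed
qed auto

lemma word_rel_prefix:
  assumes p: "walk w p v"
  shows "word_rel (Vert w # map Edge p) = {((r, u, k), (p @ r, u, k)) | r u k. walk v r u \<and> k \<in> carrier (G u)}"
proof (intro equalityI subrelI)
  fix a b assume "(a, b) \<in> word_rel (Vert w # map Edge p)"
  then obtain c where c: "(a, c) \<in> word_rel (map Edge p)" "(c, b) \<in> gen_rel (Vert w)" by auto
  have "\<exists>r u k. a = (r, u, k) \<and> walk v r u \<and> k \<in> carrier (G u)"
    using word_rel_edges_dom[OF _ p c(1)] p c by (cases "p = []") auto
  then obtain r u k where a: "a = (r, u, k)" "walk v r u" "k \<in> carrier (G u)" by blast
  have pr: "walk w (p @ r) u" using p a by (auto simp: walk_append)
  have ceq: "c = (p @ r, u, k)" using word_rel_edges[OF p a(2,3)] c a by simp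
  then have "b = c" using c(2) act_one[OF pr] secs_one[OF pr] a walk_verts[OF pr] by auto
  then show "(a, b) \<in> {((r, u, k), (p @ r, u, k)) | r u k. walk v r u \<and> k \<in> carrier (G u)}"
    using a ceq by blast
next
  fix a b assume "(a, b) \<in> {((r, u, k), (p @ r, u, k)) | r u k. walk v r u \<and> k \<in> carrier (G u)}"
  then obtain r u k where a: "a = (r, u, k)" "b = (p @ r, u, k)" "walk v r u" "k \<in> carrier (G u)" by blast
  have pr: "walk w (p @ r) u" using p a by (auto simp: walk_append)
  have "(a, b) \<in> word_rel (map Edge p)" using word_rel_edges[OF p a(3,4)] a by simp
  moreover have "(b, b) \<in> gen_rel (Vert w)" using act_one[OF pr] secs_one[OF pr] a walk_verts[OF pr] pr
    by (auto intro!: exI[of _ "p @ r"])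
  ultimately show "(a, b) \<in> word_rel (Vert w # map Edge p)" by auto
qed

text \<open>
  If the products with some prefix are equal, then so are those with longer prefixes, and on a
  sufficiently long prefix both words have a reading.
\<close>

lemma S_mult_prefix_eq_iff:
  assumes x: "defined_at x w" and y: "y \<in> words"
  shows "(\<exists>n. S_mult (cls x) (prefix_elt n w) = S_mult (cls y) (prefix_elt n w)) \<longleftrightarrow> agree x y w"
proof -
  note d = defined_atD[OF x]
  define pre where "pre n = Vert (inf_range w) # map Edge (stake n w)" for n
  have pre: "pre n \<in> words" for n
    using walk_edges[OF walk_stake[OF d(2), of n]] inf_range_verts[OF d(2)] by (auto simp: pre_def words_def)
  have eq: "S_mult (cls x) (prefix_elt n w) = S_mult (cls y) (prefix_elt n w)
    \<longleftrightarrow> word_rel (pre n) O word_rel x = word_rel (pre n) O word_rel y" for n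
    using S_mult_cls[OF d(1) pre] S_mult_cls[OF y pre] cls_eq_iff_word_rel[OF words_append[OF d(1) pre] words_append[OF y pre]]
    by (simp add: prefix_elt_def word_rel_append flip: pre_def)
  note rel = word_rel_prefix[OF walk_stake[OF d(2)], folded pre_def]
  show ?thesis
    unfolding eq
  proof
    assume "\<exists>n. word_rel (pre n) O word_rel x = word_rel (pre n) O word_rel y"
    then obtain n where n: "word_rel (pre n) O word_rel x = word_rel (pre n) O word_rel y" by blast
    obtain m p k where m: "m \<ge> n" "reads x w m p k" using reads_ge[OF x, of n] by blast
    let ?r = "stake (m - n) (sdrop n w)" and ?u = "inf_range (sdrop m w)"
    have u: "?u \<in> verts E" using inf_range_verts inf_paths_sdrop d by blast
    have "walk (inf_range (sdrop n w)) ?r ?u"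
      using walk_stake[OF inf_paths_sdrop[OF d(2), of n], of "m - n"] m(1) by simp
    then have 1: "((?r, ?u, \<one>\<^bsub>G ?u\<^esub>), (stake m w, ?u, \<one>\<^bsub>G ?u\<^esub>)) \<in> word_rel (pre n)"
      unfolding rel using u stake_split[OF m(1), of w] by auto
    then have "((?r, ?u, \<one>\<^bsub>G ?u\<^esub>), (p, ?u, k)) \<in> word_rel (pre n) O word_rel y"
      using m(2) n unfolding reads_def by blast
    then obtain c where "((?r, ?u, \<one>\<^bsub>G ?u\<^esub>), c) \<in> word_rel (pre n)" "(c, (p, ?u, k)) \<in> word_rel y" by blast
    then have "reads y w m p k" using word_rel_functional[OF 1] unfolding reads_def by blast
    then show "agree x y w" using m(2) by (auto simp: agree_def)
  next
    assume "agree x y w"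
    then obtain n p k where r: "reads x w n p k" "reads y w n p k" by (auto simp: agree_def)
    have "(a, b) \<in> word_rel (pre n) O word_rel x' \<longleftrightarrow>
      (\<exists>s u g. a = (s, u, g) \<and> walk (inf_range (sdrop n w)) s u \<and> g \<in> carrier (G u)
        \<and> b = (p @ act (inf_range (sdrop n w)) k s, u, secs k s \<otimes>\<^bsub>G u\<^esub> g))" (is "_ \<longleftrightarrow> ?R")
      if x': "x' \<in> words" "reads x' w n p k" for a b x'
    proof
      assume "(a, b) \<in> word_rel (pre n) O word_rel x'"
      then obtain s u g where s: "a = (s, u, g)" "walk (inf_range (sdrop n w)) s u" "g \<in> carrier (G u)"
        and b: "((stake n w @ s, u, g), b) \<in> word_rel x'" unfolding rel by blast
      then show ?R
        using word_rel_functional[OF b] local_formD[OF reads_local[OF d(2) x'] s(2,3)] by blast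
    next
      assume ?R
      then obtain s u g where s: "a = (s, u, g)" "walk (inf_range (sdrop n w)) s u" "g \<in> carrier (G u)"
        "b = (p @ act (inf_range (sdrop n w)) k s, u, secs k s \<otimes>\<^bsub>G u\<^esub> g)" by blast
      have "(a, (stake n w @ s, u, g)) \<in> word_rel (pre n)" unfolding rel using s by blast
      moreover have "((stake n w @ s, u, g), b) \<in> word_rel x'"
        using local_formD[OF reads_local[OF d(2) x'] s(2,3)] s(4) by simp
      ultimately show "(a, b) \<in> word_rel (pre n) O word_rel x'" by blast
    qed
    note form = this
    have "(a, b) \<in> word_rel (pre n) O word_rel x \<longleftrightarrow> (a, b) \<in> word_rel (pre n) O word_rel y" for a b
      unfolding form[OF d(1) r(1)] form[OF y r(2)] by (rule HOL.refl)
    then have "word_rel (pre n) O word_rel x = word_rel (pre n) O word_rel y"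
      by (intro equalityI subrelI) simp_all
    then show "\<exists>n. word_rel (pre n) O word_rel x = word_rel (pre n) O word_rel y" by blast
  qed
qed

lemma in_germ_rel:
  assumes "x \<in> words" "y \<in> words"
  shows "((cls x, w), (cls y, z)) \<in> germ_rel \<longleftrightarrow> w = z \<and> defined_at x w \<and> defined_at y w \<and> agree x y w"
  using S_mult_prefix_eq_iff[OF _ assms(2)] cls_in_germ_pairs assms unfolding germ_rel_def by auto

definition germ :: "('v, 'e, 'g) word \<Rightarrow> 'e stream \<Rightarrow> ('v, 'e, 'g) germ" where
  "germ x w = germ_of (cls x) w"

lemma equiv_germ_rel: "equiv germ_pairs germ_rel"
proof (rule equivI)
  show "germ_rel \<subseteq> germ_pairs \<times> germ_pairs" unfolding germ_rel_def by blast
  show "refl_on germ_pairs germ_rel"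
    by (rule refl_onI) (auto simp: germ_rel_def)
  show "sym_on UNIV germ_rel" by (rule symI) (auto simp: germ_rel_def)
  show "trans_on UNIV germ_rel"
  proof (rule transI)
    fix a b c assume ab: "(a, b) \<in> germ_rel" and bc: "(b, c) \<in> germ_rel"
    have "a \<in> germ_pairs" "b \<in> germ_pairs" "c \<in> germ_pairs" using ab bc by (auto simp: germ_rel_def)
    then obtain x w where x: "a = (cls x, w)" "defined_at x w" using germ_pairs_cases by blast
    obtain y w' where y: "b = (cls y, w')" "defined_at y w'" using \<open>b \<in> germ_pairs\<close> germ_pairs_cases by blast
    obtain z w'' where z: "c = (cls z, w'')" "defined_at z w''" using \<open>c \<in> germ_pairs\<close> germ_pairs_cases by blast
    note eq = x(1) y(1) z(1) and d = x(2) y(2) z(2)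
    note x = d[THEN defined_atD(1)]
    have "w = w'" "agree x y w" using ab in_germ_rel[OF x(1,2)] eq by auto
    moreover have "w' = w''" "agree y z w'" using bc in_germ_rel[OF x(2,3)] eq by auto
    ultimately show "(a, c) \<in> germ_rel"
      using in_germ_rel[OF x(1,3), of w w''] agree_trans[of x y w z] x d defined_atD(2)[OF d(1)] eq by simp
  qed
qed

lemma germ_eq_iff:
  assumes "defined_at x w" "defined_at y z"
  shows "germ x w = germ y z \<longleftrightarrow> w = z \<and> agree x y w"
  unfolding germ_def germ_of_def
  using eq_equiv_class_iff[OF equiv_germ_rel, of "(cls x, w)" "(cls y, z)"] assms
    in_germ_rel[of x y w z] cls_in_germ_pairs defined_atD by auto

lemma germ_in_germs: "defined_at x w \<Longrightarrow> germ x w \<in> germs"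
  unfolding germ_def germ_of_def germs_def using cls_in_germ_pairs defined_atD(1) by (intro quotientI) auto

lemma germs_cases:
  assumes "\<gamma> \<in> germs" obtains x w where "defined_at x w" "\<gamma> = germ x w"
proof -
  obtain a where a: "a \<in> germ_pairs" "\<gamma> = germ_rel `` {a}" using assms unfolding germs_def by (rule quotientE)
  obtain s w where sw: "a = (s, w)" by (cases a)
  then obtain x where "s = cls x" "defined_at x w" using a in_germ_pairs by blast
  then show thesis using that a sw by (simp add: germ_def germ_of_def)
qed

lemma in_germ:
  assumes "defined_at x w"
  shows "(s, z) \<in> germ x w \<longleftrightarrow> (\<exists>y. s = cls y \<and> z = w \<and> defined_at y w \<and> agree x y w)"
proof
  assume "(s, z) \<in> germ x w"
  then have r: "((cls x, w), (s, z)) \<in> germ_rel" by (simp add: germ_def germ_of_def)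
  then have "(s, z) \<in> germ_pairs" by (auto simp: germ_rel_def)
  then obtain y where "s = cls y" "defined_at y z" using in_germ_pairs by blast
  then show "\<exists>y. s = cls y \<and> z = w \<and> defined_at y w \<and> agree x y w"
    using r in_germ_rel[of x y w z] defined_atD(1) assms by blast
next
  assume "\<exists>y. s = cls y \<and> z = w \<and> defined_at y w \<and> agree x y w"
  then show "(s, z) \<in> germ x w"
    using in_germ_rel[of x _ w w] defined_atD(1) assms by (auto simp: germ_def germ_of_def)
qed

lemma germ_source_germ: "defined_at x w \<Longrightarrow> germ_source (germ x w) = w"
  unfolding germ_source_def using in_germ agree_refl by (intro the_equality) blast+

lemma germ_range_germ:
  assumes "defined_at x w" shows "germ_range (germ x w) = app x w"
  unfolding germ_range_def
proof (rule the_equality)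
  show "\<exists>s z. (s, z) \<in> germ x w \<and> app x w = S_app s z"
  proof (intro exI conjI)
    show "(cls x, w) \<in> germ x w" using in_germ[OF assms] agree_refl[OF assms] assms by blast
    show "app x w = S_app (cls x) w" using S_app_cls[OF assms] by simp
  qed
  fix r assume "\<exists>s z. (s, z) \<in> germ x w \<and> r = S_app s z"
  then obtain s z where *: "(s, z) \<in> germ x w" "r = S_app s z" by blast
  then obtain y where y: "s = cls y" "z = w" "defined_at y w" "agree x y w" using in_germ[OF assms] by blast
  show "r = app x w"
    using * y S_app_cls[OF y(3)] agree_app[OF y(4)] defined_atD[OF assms] defined_atD[OF y(3)] by simp
qed

lemma germ_mult_germ:
  assumes y: "defined_at y w" and x: "defined_at x (app y w)"
  shows "germ_mult (germ x (app y w)) (germ y w) = germ (x @ y) w"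
  unfolding germ_mult_def
proof (rule the_equality)
  show "\<exists>s t z. (t, z) \<in> germ y w \<and> (s, S_app t z) \<in> germ x (app y w) \<and> germ (x @ y) w = germ_of (S_mult s t) z"
  proof (intro exI conjI)
    show "(cls y, w) \<in> germ y w" using in_germ[OF y] agree_refl[OF y] y by blast
    show "(cls x, S_app (cls y) w) \<in> germ x (app y w)"
      unfolding S_app_cls[OF y] using in_germ[OF x] agree_refl[OF x] x by blast
    show "germ (x @ y) w = germ_of (S_mult (cls x) (cls y)) w"
      using S_mult_cls[OF defined_atD(1)[OF x] defined_atD(1)[OF y]] by (simp add: germ_def)
  qed
  fix \<eta> assume "\<exists>s t z. (t, z) \<in> germ y w \<and> (s, S_app t z) \<in> germ x (app y w) \<and> \<eta> = germ_of (S_mult s t) z"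
  then obtain s t z where *: "(t, z) \<in> germ y w" "(s, S_app t z) \<in> germ x (app y w)" "\<eta> = germ_of (S_mult s t) z" by blast
  obtain y' where y': "t = cls y'" "z = w" "defined_at y' w" "agree y y' w" using *(1) in_germ[OF y] by blast
  note dy = defined_atD[OF y] defined_atD(1)[OF y'(3)] defined_atD(1)[OF x]
  have app: "app y' w = app y w" using agree_app[OF y'(4)] dy by simp
  obtain x' where x': "s = cls x'" "defined_at x' (app y w)" "agree x x' (app y w)"
    using *(2) in_germ[OF x] by blast
  note dx' = defined_atD(1)[OF x'(2)]
  have \<eta>: "\<eta> = germ (x' @ y') w" using * x' y' S_mult_cls[OF dx' dy(3)] by (simp add: germ_def)
  have "agree (x @ y) (x' @ y) w" using agree_append_right[OF y dy(4) dx'] x' by blast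
  moreover have "agree (x' @ y) (x' @ y') w" using agree_append_left[OF y'(4) y dy(3) x'(2)] .
  ultimately have "agree (x @ y) (x' @ y') w" using agree_trans words_append dy dx' by metis
  moreover have "defined_at (x' @ y') w" using defined_append[OF y'(3)] x' app by simp
  ultimately have "germ (x @ y) w = germ (x' @ y') w"
    using germ_eq_iff[OF defined_append(1)[OF y x], of "x' @ y'" w] by simp
  then show "\<eta> = germ (x @ y) w" using \<eta> by simp
qed

lemma germ_inv_germ:
  assumes x: "defined_at x w"
  shows "germ_inv (germ x w) = germ (word_star x) (app x w)"
  unfolding germ_inv_def
proof (rule the_equality)
  show "\<exists>s z. (s, z) \<in> germ x w \<and> germ (word_star x) (app x w) = germ_of (S_star s) (S_app s z)"
  proof (intro exI conjI)
    show "(cls x, w) \<in> germ x w" using in_germ[OF x] agree_refl[OF x] x by blast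
    show "germ (word_star x) (app x w) = germ_of (S_star (cls x)) (S_app (cls x) w)"
      using S_app_cls[OF x] S_star_cls[OF defined_atD(1)[OF x]] by (simp add: germ_def)
  qed
  fix \<eta> assume "\<exists>s z. (s, z) \<in> germ x w \<and> \<eta> = germ_of (S_star s) (S_app s z)"
  then obtain s z where *: "(s, z) \<in> germ x w" "\<eta> = germ_of (S_star s) (S_app s z)" by blast
  obtain y where y: "s = cls y" "z = w" "defined_at y w" "agree x y w" using *(1) in_germ[OF x] by blast
  note d = defined_atD[OF x] defined_atD[OF y(3)]
  have app: "app x w = app y w" using agree_app[OF y(4)] d by simp
  have "\<eta> = germ (word_star y) (app y w)" using * y S_app_cls[OF y(3)] S_star_cls[OF d(3)] by (simp add: germ_def)
  then show "\<eta> = germ (word_star x) (app x w)"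
    using germ_eq_iff[OF defined_word_star(1)[OF y(3)] defined_word_star(1)[OF x]] app
      agree_sym[OF agree_word_star[OF y(4) d(2,1,3)]] by simp
qed

lemma reads_vert:
  assumes w: "w \<in> inf_paths"
  shows "reads [Vert (inf_range w)] w n (stake n w) \<one>\<^bsub>G (inf_range (sdrop n w))\<^esub>"
proof -
  have p: "walk (inf_range w) (stake n w) (inf_range (sdrop n w))" using walk_stake[OF w] .
  show ?thesis
    using act_one[OF p] secs_one[OF p] walk_verts[OF p] p by (auto simp: reads_def intro!: exI[of _ "stake n w"])
qed

lemma vert_defined:
  assumes w: "w \<in> inf_paths"
  shows "defined_at [Vert (inf_range w)] w" "app [Vert (inf_range w)] w = w"
proof -
  have x: "[Vert (inf_range w)] \<in> words" using inf_range_verts[OF w] by (simp add: words_def)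
  show "defined_at [Vert (inf_range w)] w" using defined_atI[OF x w reads_vert[OF w]] .
  show "app [Vert (inf_range w)] w = w"
    using app_eq[OF w x reads_vert[OF w, of 0]] inf_act_one[OF w] by (simp add: value_at_def)
qed

lemma germ_unit_eq: "germ_unit w = germ [Vert (inf_range w)] w"
  by (simp add: germ_unit_def germ_def)

text \<open>
  The quotient \<open>\<gamma>\<beta>\<^sup>-\<^sup>1\<close> of two germs with the same source.
\<close>

definition germ_div :: "('v, 'e, 'g) germ \<Rightarrow> ('v, 'e, 'g) germ \<Rightarrow> ('v, 'e, 'g) germ" where
  "germ_div \<gamma> \<beta> = germ_mult \<gamma> (germ_inv \<beta>)"

lemma defined_div:
  assumes "defined_at x w" "defined_at y w"
  shows "defined_at (x @ word_star y) (app y w)" "app (x @ word_star y) (app y w) = app x w"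
  using defined_append[OF defined_word_star(1)[OF assms(2)], of x] defined_word_star(2)[OF assms(2)] assms by auto

lemma germ_div_germ:
  assumes "defined_at x w" "defined_at y w"
  shows "germ_div (germ x w) (germ y w) = germ (x @ word_star y) (app y w)"
  using germ_mult_germ[OF defined_word_star(1)[OF assms(2)], of x] defined_word_star(2)[OF assms(2)] assms
  by (simp add: germ_div_def germ_inv_germ)

text \<open>
  Right multiplication with the germ of \<open>y\<close> can be undone.
\<close>

lemma germ_div_eq_iff:
  assumes x: "defined_at x w" and y: "defined_at y w" and t: "defined_at t (app y w)"
  shows "germ_div (germ x w) (germ y w) = germ t (app y w) \<longleftrightarrow> germ x w = germ (t @ y) w"
proof -
  note d = defined_atD[OF x] defined_atD[OF y] defined_atD(1)[OF t]
  have xy: "x @ word_star y \<in> words" "x @ word_star y @ y \<in> words" "t @ y \<in> words"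
    using d word_star_in_words words_append by metis+
  have "germ_div (germ x w) (germ y w) = germ t (app y w) \<longleftrightarrow> agree (x @ word_star y) t (app y w)"
    using germ_div_germ[OF x y] germ_eq_iff[OF defined_div(1)[OF x y] t] by simp
  also have "\<dots> \<longleftrightarrow> agree (x @ word_star y @ y) (t @ y) w"
    using agree_append_right[OF y xy(1) d(5)] by simp
  also have "\<dots> \<longleftrightarrow> agree x (t @ y) w"
    using agree_trans[OF agree_sym[OF agree_cancel_right[OF x y]] _ d(2,1) xy(2,3)]
      agree_trans[OF agree_cancel_right[OF x y] _ d(2) xy(2) d(1) xy(3)] by blast
  also have "\<dots> \<longleftrightarrow> germ x w = germ (t @ y) w"
    using germ_eq_iff[OF x defined_append(1)[OF y t]] by simp
  finally show ?thesis .
qed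

lemma fibre_cases:
  assumes "\<gamma> \<in> fibre w" obtains x where "defined_at x w" "\<gamma> = germ x w"
  using assms germs_cases germ_source_germ unfolding fibre_def by (metis (mono_tags, lifting) mem_Collect_eq)

lemma germ_in_fibre: "defined_at x w \<Longrightarrow> germ x w \<in> fibre w"
  using germ_in_germs germ_source_germ by (simp add: fibre_def)

lemma germ_div_props:
  assumes "\<gamma> \<in> fibre w" "\<beta> \<in> fibre w"
  shows "germ_div \<gamma> \<beta> \<in> fibre (germ_range \<beta>)" "germ_range (germ_div \<gamma> \<beta>) = germ_range \<gamma>"
proof -
  obtain x y where *: "defined_at x w" "\<gamma> = germ x w" "defined_at y w" "\<beta> = germ y w"
    using assms fibre_cases by metis
  show "germ_div \<gamma> \<beta> \<in> fibre (germ_range \<beta>)" "germ_range (germ_div \<gamma> \<beta>) = germ_range \<gamma>"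
    using germ_div_germ[OF *(1,3)] defined_div[OF *(1,3)] germ_in_fibre germ_range_germ * by auto
qed

lemma germ_div_cancel_right:
  assumes "\<gamma> \<in> fibre w" "\<gamma>' \<in> fibre w" "\<beta> \<in> fibre w" "germ_div \<gamma> \<beta> = germ_div \<gamma>' \<beta>"
  shows "\<gamma> = \<gamma>'"
proof -
  obtain x x' y where *: "defined_at x w" "\<gamma> = germ x w" "defined_at x' w" "\<gamma>' = germ x' w" "defined_at y w" "\<beta> = germ y w"
    using assms fibre_cases by metis
  have "germ x w = germ (x' @ word_star y @ y) w"
    using germ_div_eq_iff[OF *(1,5) defined_div(1)[OF *(3,5)]] assms(4) * germ_div_germ[OF *(3,5)] by simp
  moreover have "germ x' w = germ (x' @ word_star y @ y) w"
    using germ_div_eq_iff[OF *(3,5) defined_div(1)[OF *(3,5)]] * germ_div_germ[OF *(3,5)] by simp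
  ultimately show ?thesis using * by simp
qed

lemma germ_div_cancel_left:
  assumes "\<gamma> \<in> fibre w" "\<beta> \<in> fibre w" "\<beta>' \<in> fibre w" "germ_div \<gamma> \<beta> = germ_div \<gamma> \<beta>'"
  shows "\<beta> = \<beta>'"
proof -
  obtain x y y' where *: "defined_at x w" "\<gamma> = germ x w" "defined_at y w" "\<beta> = germ y w" "defined_at y' w" "\<beta>' = germ y' w"
    using assms fibre_cases by metis
  note d = defined_atD[OF *(1)] defined_atD(1)[OF *(3)] defined_atD(1)[OF *(5)]
  let ?z = "app y w" and ?s = "word_star x @ x"
  have eq: "app y w = app y' w" "agree (x @ word_star y) (x @ word_star y') ?z"
    using assms(4) germ_div_germ[OF *(1,3)] germ_div_germ[OF *(1,5)] germ_eq_iff[OF defined_div(1)[OF *(1,3)] defined_div(1)[OF *(1,5)]] * by auto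
  note dy = defined_word_star[OF *(3)] and dy' = defined_word_star[OF *(5)]
  have sx: "defined_at (word_star x) (app (x @ word_star y) ?z)"
    using defined_div(2)[OF *(1,3)] defined_word_star(1)[OF *(1)] by simp
  have w: "word_star x \<in> words" "word_star y \<in> words" "word_star y' \<in> words" "x @ word_star y \<in> words" "x @ word_star y' \<in> words"
    using d word_star_in_words words_append by auto
  have 1: "agree (word_star x @ x @ word_star y) (word_star x @ x @ word_star y') ?z"
    using agree_append_left[OF eq(2) defined_div(1)[OF *(1,3)] w(5) sx] .
  have 2: "agree (word_star x @ x @ word_star y) (word_star y) ?z" 
    using agree_cancel_left[OF dy(1)] dy(2) *(1) by simp
  have 3: "agree (word_star x @ x @ word_star y') (word_star y') ?z" 
    using agree_cancel_left[OF dy'(1)] dy'(2) *(1) eq(1) by simp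
  have z: "?z \<in> inf_paths" using defined_atD(2)[OF dy(1)] .
  have 4: "agree (word_star y) (word_star y') ?z"
    using agree_trans[OF agree_trans[OF agree_sym[OF 2] 1 z w(2)] 3 z w(2) _ w(3)] w(1,4,5) words_append by simp
  have "agree (word_star (word_star y)) (word_star (word_star y')) w"
    using agree_word_star[OF 4 z w(2,3)] dy(2) by simp
  then show ?thesis using germ_eq_iff[OF *(3,5)] d * by (simp add: word_star_star)
qed

lemma germ_div_unit:
  assumes "\<gamma> \<in> fibre w" shows "germ_div \<gamma> (germ_unit w) = \<gamma>"
proof -
  obtain x where x: "defined_at x w" "\<gamma> = germ x w" using assms fibre_cases by blast
  note d = defined_atD[OF x(1)]
  note v = vert_defined[OF d(2)]
  have "germ_div \<gamma> (germ_unit w) = germ x (app [Vert (inf_range w)] w) \<longleftrightarrow> germ x w = germ (x @ [Vert (inf_range w)]) w"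
    using germ_div_eq_iff[OF x(1) v(1), of x] v x germ_unit_eq by simp
  moreover have "agree x (x @ [Vert (inf_range w)]) w"
  proof -
    obtain n p k where r: "reads x w n p k" using x by (auto simp: defined_at_def)
    have "reads (x @ [Vert (inf_range w)]) w n p k"
      using reads_append[OF defined_atD(1)[OF v(1)] d reads_vert[OF d(2)], of n p k] v(2) r
        reads_facts(1)[OF d(2,1) r] inf_range_verts[OF inf_paths_sdrop[OF d(2), of n]] by auto
    then show ?thesis using r by (auto simp: agree_def)
  qed
  ultimately show ?thesis
    using germ_eq_iff[OF x(1) defined_append(1)[OF v(1)], of x] v x by simp
qed

section \<open>The topology of the groupoid\<close>

lemma app_continuous:
  assumes x: "defined_at x w"
  obtains n where "n \<ge> m" "\<And>z. z \<in> nbhd n w \<Longrightarrow> defined_at x z \<and> app x z \<in> nbhd m (app x w)"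
proof -
  note d = defined_atD[OF x]
  obtain n p k where r: "n \<ge> m" "length p \<ge> m" "reads x w n p k" using reads_ge[OF x, of m] by blast
  have "defined_at x z \<and> app x z \<in> nbhd m (app x w)" if z: "z \<in> nbhd n w" for z
  proof
    have zp: "z \<in> inf_paths" using z by (simp add: in_nbhd)
    have rz: "reads x z n p k" using reads_nbhd[OF d(2) z] r(3) by blast
    show "defined_at x z" using defined_atI[OF d(1) zp rz] .
    obtain v where p: "walk v p (inf_range (sdrop n w))" using reads_facts[OF d(2,1) r(3)] by blast
    then have pz: "walk v p (inf_range (sdrop n z))" using walk_stake_range_eq[OF z d(2)] by simp
    have "inf_range (app x z) = v" "inf_range (app x w) = v"
      using value_at_props(2)[OF zp reads_facts(1)[OF zp d(1) rz] pz] value_at_props(2)[OF d(2) reads_facts(1)[OF d(2,1) r(3)] p]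
        app_eq[OF zp d(1) rz] app_eq[OF d(2,1) r(3)] by auto
    moreover have "stake (length p) (app x z) = stake (length p) (app x w)"
      using app_props(2)[OF zp d(1) rz] app_props(2)[OF d(2,1) r(3)] by simp
    ultimately have "app x z \<in> nbhd (length p) (app x w)"
      using app_props(1)[OF zp d(1) rz] by (simp add: in_nbhd)
    then show "app x z \<in> nbhd m (app x w)" using nbhd_antimono[OF r(2)] by blast
  qed
  then show thesis using that r(1) by blast
qed

lemma nbhd_subset: "nbhd n w \<subseteq> inf_paths" by (auto simp: in_nbhd)

lemma openin_inf_path_top:
  "openin inf_path_top U \<longleftrightarrow> U \<subseteq> inf_paths \<and> (\<forall>w\<in>U. \<exists>n. nbhd n w \<subseteq> U)"
proof
  let ?S = "{cylinder v p | v p. v \<in> verts E \<and> p \<in> paths_to E v}"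
  assume "openin inf_path_top U"
  then have "generate_topology_on ?S U"
    unfolding inf_path_top_def by (simp add: openin_topology_generated_by_iff)
  then show "U \<subseteq> inf_paths \<and> (\<forall>w\<in>U. \<exists>n. nbhd n w \<subseteq> U)"
  proof (induction rule: generate_topology_on.induct)
    case (Int a b)
    have "\<exists>n. nbhd n w \<subseteq> a \<inter> b" if w: "w \<in> a \<inter> b" for w
    proof -
      obtain n m where "nbhd n w \<subseteq> a" "nbhd m w \<subseteq> b" using Int w by blast
      then have "nbhd (max n m) w \<subseteq> a \<inter> b"
        using nbhd_antimono[of n "max n m" w] nbhd_antimono[of m "max n m" w] by auto
      then show ?thesis by blast
    qed
    then show ?case using Int by blast
  next
    case (UN K)
    have "\<exists>n. nbhd n w \<subseteq> \<Union>K" if w: "w \<in> \<Union>K" for w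
    proof -
      obtain k where "k \<in> K" "w \<in> k" using w by blast
      then show ?thesis using UN(2)[of k] by blast
    qed
    then show ?case using UN by blast
  next
    case (Basis s)
    then obtain v p where s: "s = cylinder v p" by blast
    have "nbhd (length p) w \<subseteq> s" if "w \<in> s" for w
      using that by (auto simp: s cylinder_def in_nbhd)
    then show ?case using s by (auto simp: cylinder_def)
  qed auto
next
  assume U: "U \<subseteq> inf_paths \<and> (\<forall>w\<in>U. \<exists>n. nbhd n w \<subseteq> U)"
  have "openin inf_path_top (nbhd n w)" if "w \<in> inf_paths" for n w
    unfolding inf_path_top_def
    using that walk_in_paths_to[OF walk_stake[OF that, of n]] inf_range_verts[OF that]
    by (intro topology_generated_by_Basis) (auto simp: nbhd_def)
  then have "openin inf_path_top (\<Union>{nbhd n w | n w. w \<in> U \<and> nbhd n w \<subseteq> U})"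
    using U by (intro openin_Union) auto
  moreover have "\<Union>{nbhd n w | n w. w \<in> U \<and> nbhd n w \<subseteq> U} = U"
  proof (intro equalityI subsetI)
    fix w assume w: "w \<in> U"
    then obtain n where "nbhd n w \<subseteq> U" using U by blast
    moreover have "w \<in> nbhd n w" using w U by auto
    ultimately show "w \<in> \<Union>{nbhd n w | n w. w \<in> U \<and> nbhd n w \<subseteq> U}" using w by blast
  qed blast
  ultimately show "openin inf_path_top U" by simp
qed

lemma openin_germ_top_iff:
  "openin germ_top U \<longleftrightarrow> U \<subseteq> germs \<and>
    (\<forall>x w. defined_at x w \<longrightarrow> germ x w \<in> U \<longrightarrow> (\<exists>n. \<forall>z\<in>nbhd n w. defined_at x z \<and> germ x z \<in> U))"
proof -
  let ?P = "{(s, w). (s, w) \<in> germ_pairs \<and> germ_of s w \<in> U}"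
  let ?T = "prod_topology (discrete_topology Sgp) inf_path_top"
  have "openin germ_pair_top ?P \<longleftrightarrow>
    (\<forall>x w. defined_at x w \<longrightarrow> germ x w \<in> U \<longrightarrow> (\<exists>n. \<forall>z\<in>nbhd n w. defined_at x z \<and> germ x z \<in> U))" (is "_ \<longleftrightarrow> ?R")
  proof
    assume "openin germ_pair_top ?P"
    then obtain T where T: "openin ?T T" "?P = T \<inter> germ_pairs"
      unfolding germ_pair_top_def openin_subtopology by blast
    show ?R
    proof (intro allI impI)
      fix x w assume x: "defined_at x w" "germ x w \<in> U"
      have "(cls x, w) \<in> ?P" using x cls_in_germ_pairs[OF defined_atD(1)[OF x(1)]] by (simp add: germ_def)
      then have xT: "(cls x, w) \<in> T" using T(2) by simp
      obtain A B where AB: "openin inf_path_top B" "cls x \<in> A" "w \<in> B" "A \<times> B \<subseteq> T"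
        using T(1)[unfolded openin_prod_topology_alt, rule_format, OF xT] by (elim exE conjE)
      obtain n where n: "nbhd n w \<subseteq> B" using AB openin_inf_path_top by blast
      obtain m where m: "m \<ge> n" "\<And>z. z \<in> nbhd m w \<Longrightarrow> defined_at x z" using app_continuous[OF x(1)] by metis
      have "defined_at x z \<and> germ x z \<in> U" if z: "z \<in> nbhd m w" for z
      proof -
        have d: "defined_at x z" using m z by blast
        have "(cls x, z) \<in> T" using AB(2,4) n nbhd_antimono[OF m(1)] z by blast
        then have "(cls x, z) \<in> ?P" using T(2) cls_in_germ_pairs[OF defined_atD(1)[OF d]] d by blast
        then show ?thesis using d by (simp add: germ_def)
      qed
      then show "\<exists>n. \<forall>z\<in>nbhd n w. defined_at x z \<and> germ x z \<in> U" by blast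
    qed
  next
    assume R: ?R
    have "openin ?T ?P"
      unfolding openin_prod_topology_alt
    proof (intro allI impI)
      fix s w assume sw: "(s, w) \<in> ?P"
      then obtain x where x: "s = cls x" "defined_at x w" using in_germ_pairs by blast
      have "germ x w \<in> U" using sw x by (simp add: germ_def)
      then obtain n where n: "\<forall>z\<in>nbhd n w. defined_at x z \<and> germ x z \<in> U" using R x(2) by blast
      have w: "w \<in> inf_paths" using x defined_atD by blast
      have 1: "openin (discrete_topology Sgp) {s}" using x defined_atD(1) by (auto simp: Sgp_def)
      have "\<exists>m. nbhd m z \<subseteq> nbhd n w" if "z \<in> nbhd n w" for z
        using nbhd_sym[OF that] by blast
      then have 2: "openin inf_path_top (nbhd n w)" using nbhd_subset by (simp add: openin_inf_path_top)
      have "{s} \<times> nbhd n w \<subseteq> ?P"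
        using n x cls_in_germ_pairs[OF defined_atD(1)[OF x(2)]] by (auto simp: germ_def)
      then show "\<exists>A B. openin (discrete_topology Sgp) A \<and> openin inf_path_top B \<and> s \<in> A \<and> w \<in> B \<and> A \<times> B \<subseteq> ?P"
        using 1 2 w by (intro exI[of _ "{s}"] exI[of _ "nbhd n w"]) auto
    qed
    then show "openin germ_pair_top ?P"
      unfolding germ_pair_top_def openin_subtopology by blast
  qed
  then show ?thesis by (simp add: openin_germ_top)
qed

lemma topspace_germ_top: "topspace germ_top = germs"
proof -
  have "openin germ_top germs"
    unfolding openin_germ_top_iff
  proof (intro conjI allI impI)
    fix x w assume "defined_at x w"
    then obtain n where "\<And>z. z \<in> nbhd n w \<Longrightarrow> defined_at x z" using app_continuous by metis
    then show "\<exists>n. \<forall>z\<in>nbhd n w. defined_at x z \<and> germ x z \<in> germs" using germ_in_germs by blast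
  qed simp
  moreover have "openin germ_top U \<Longrightarrow> U \<subseteq> germs" for U by (simp add: openin_germ_top_iff)
  ultimately show ?thesis unfolding topspace_def by blast
qed

text \<open>
  For words that are defined on the whole cylinder these sets are open bisections, compact if there are
  finitely many edges, and they form a base of the topology.
\<close>

definition basic :: "('v, 'e, 'g) word \<Rightarrow> nat \<Rightarrow> 'e stream \<Rightarrow> ('v, 'e, 'g) germ set" where
  "basic x n w = germ x ` nbhd n w"

definition basic_ok :: "('v, 'e, 'g) word \<Rightarrow> nat \<Rightarrow> 'e stream \<Rightarrow> bool" where
  "basic_ok x n w \<longleftrightarrow> w \<in> inf_paths \<and> (\<forall>z\<in>nbhd n w. defined_at x z)"

lemma germ_in_basic:
  assumes ok: "basic_ok x n w" and y: "defined_at y z"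
  shows "germ y z \<in> basic x n w \<longleftrightarrow> z \<in> nbhd n w \<and> agree y x z"
  using germ_eq_iff[OF y] ok unfolding basic_def basic_ok_def image_iff by blast

lemma openin_basic:
  assumes ok: "basic_ok x n w" shows "openin germ_top (basic x n w)"
  unfolding openin_germ_top_iff
proof (intro conjI allI impI)
  show "basic x n w \<subseteq> germs" using ok germ_in_germs by (auto simp: basic_def basic_ok_def)
  fix y z assume y: "defined_at y z" and "germ y z \<in> basic x n w"
  then have z: "z \<in> nbhd n w" and a: "agree y x z" using germ_in_basic[OF ok] by auto
  note d = defined_atD[OF y]
  obtain m p k where m: "reads y z m p k" "reads x z m p k" using a by (auto simp: agree_def)
  have "defined_at y z' \<and> germ y z' \<in> basic x n w" if z': "z' \<in> nbhd (max m n) z" for z'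
  proof -
    have z'm: "z' \<in> nbhd m z" "z' \<in> nbhd n z" using z' nbhd_antimono[of m "max m n" z] nbhd_antimono[of n "max m n" z] by auto
    have "reads y z' m p k" using m reads_nbhd[OF d(2) z'm(1)] by blast
    then have y': "defined_at y z'" using defined_atI[OF d(1)] z'm by (simp add: in_nbhd)
    moreover have "z' \<in> nbhd n w" using nbhd_sym[OF z] z'm by simp
    ultimately show ?thesis using germ_in_basic[OF ok y'] agree_nbhd[OF m d(2) z'm(1)] by blast
  qed
  then show "\<exists>n'. \<forall>z'\<in>nbhd n' z. defined_at y z' \<and> germ y z' \<in> basic x n w" by blast
qed

lemma open_contains_basic:
  assumes U: "openin germ_top U" and x: "defined_at x w" "germ x w \<in> U"
  obtains n where "basic_ok x n w" "basic x n w \<subseteq> U"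
proof -
  obtain n where "\<forall>z\<in>nbhd n w. defined_at x z \<and> germ x z \<in> U" using U x unfolding openin_germ_top_iff by blast
  then show thesis using that[of n] defined_atD[OF x(1)] by (auto simp: basic_ok_def basic_def)
qed

section \<open>Generic paths and compactness of cylinders\<close>

lemma limit_path:
  assumes m: "strict_mono m" and z: "\<And>i. z i \<in> inf_paths" and step: "\<And>i. z (Suc i) \<in> nbhd (m i) (z i)"
  obtains y where "\<And>i. y \<in> nbhd (m i) (z i)"
proof -
  have close: "z b \<in> nbhd (m a) (z a)" if "a \<le> b" for a b
    using that
  proof (induction b rule: dec_induct)
    case base
    then show ?case using z by simp
  next
    case (step b)
    have "m a \<le> m b" using strict_mono_less_eq[OF m] step by simp
    then have "z (Suc b) \<in> nbhd (m a) (z b)" using assms(3)[of b] nbhd_antimono by blast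
    then show ?case using nbhd_sym[OF step.IH] by simp
  qed
  have nth: "z b !! j = z a !! j" if "a \<le> b" "j < m a" for a b j
    using close[OF that(1)] that(2) by (metis in_nbhd stake_nth)
  have mi: "i \<le> m i" for i using strict_mono_imp_increasing[OF m] .
  \<comment> \<open>The \<open>j\<close>-th edge no longer changes after stage \<open>j + 1\<close>, because \<open>j < m (j + 1)\<close>.\<close>
  define y where "y = smap (\<lambda>j. z (Suc j) !! j) nats"
  have y: "y !! j = z (Suc j) !! j" for j by (simp add: y_def)
  have ynth: "y !! j = z i !! j" if "j < m i" for i j
  proof (cases "Suc j \<le> i")
    case True
    then show ?thesis using nth[OF True, of j] mi[of "Suc j"] y by simp
  next
    case False
    then show ?thesis using nth[of i "Suc j" j] that y by simp
  qed
  have st: "stake (m i) y = stake (m i) (z i)" for i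
    by (rule nth_equalityI) (auto simp: stake_nth ynth)
  have r: "inf_range (z i) = inf_range (z 0)" for i using close[of 0 i] by (simp add: in_nbhd)
  have "stake i y = stake i (z i)" for i
    by (rule nth_equalityI) (use ynth mi in \<open>auto simp: stake_nth intro: less_le_trans\<close>)
  then have "y \<in> inf_paths" using walk_stake[OF z] by (intro inf_paths_by_prefixes) metis
  moreover have "inf_range y = inf_range (z 0)"
    using y[of 0] r[of 1] by (simp add: inf_range_def)
  ultimately have "y \<in> nbhd (m i) (z i)" for i using st[of i] r[of i] by (simp add: in_nbhd)
  then show thesis by (rule that)
qed

text \<open>
  At a generic path distinct germs are separated: the set on which the germs of two words agree is open,
  and a generic path does not lie on its boundary.
\<close>

definition generic :: "'e stream \<Rightarrow> bool" where
  "generic y \<longleftrightarrow> y \<in> inf_paths \<and> (\<forall>x\<in>words. \<forall>x'\<in>words. \<exists>n.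
     (\<forall>z\<in>nbhd n y. agree x x' z) \<or> (\<forall>z\<in>nbhd n y. \<not> agree x x' z))"

text \<open>
  Right multiplication with \<open>r\<close> turns agreement of two words near \<open>app r y\<close> into agreement near \<open>y\<close>.
\<close>

lemma generic_app:
  assumes y: "generic y" and r: "defined_at r y"
  shows "generic (app r y)"
  unfolding generic_def
proof (intro conjI ballI)
  note d = defined_atD[OF r]
  show "app r y \<in> inf_paths" using app_inf_paths[OF r] .
  fix x x' assume x: "x \<in> words" "x' \<in> words"
  obtain n where n: "(\<forall>z\<in>nbhd n y. agree (x @ r) (x' @ r) z) \<or> (\<forall>z\<in>nbhd n y. \<not> agree (x @ r) (x' @ r) z)"
    using y words_append[OF x(1) d(1)] words_append[OF x(2) d(1)] unfolding generic_def by blast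
  note s = defined_word_star[OF r]
  obtain m where m: "\<And>z. z \<in> nbhd m (app r y) \<Longrightarrow> defined_at (word_star r) z \<and> app (word_star r) z \<in> nbhd n y"
    using app_continuous[OF s(1), of n] s(2) by metis
  have "agree x x' z \<longleftrightarrow> agree (x @ r) (x' @ r) (app (word_star r) z)" if z: "z \<in> nbhd m (app r y)" for z
  proof -
    have "defined_at r (app (word_star r) z)" "app r (app (word_star r) z) = z"
      using defined_word_star[of "word_star r" z] m[OF z] word_star_star[OF d(1)] by auto
    then show ?thesis using agree_append_right[OF _ x] by metis
  qed
  then show "\<exists>n. (\<forall>z\<in>nbhd n (app r y). agree x x' z) \<or> (\<forall>z\<in>nbhd n (app r y). \<not> agree x x' z)"
    using n m by blast
qed

lemma decide_agree_nearby:
  assumes z: "z \<in> inf_paths" and x: "x \<in> words" "x' \<in> words"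
  obtains z' m' where "z' \<in> nbhd m z" "m < m'" "(\<forall>u\<in>nbhd m' z'. agree x x' u) \<or> (\<forall>u\<in>nbhd m' z'. \<not> agree x x' u)"
proof (cases "\<exists>z'\<in>nbhd m z. agree x x' z'")
  case True
  then obtain z' n p k where z': "z' \<in> nbhd m z" and r: "reads x z' n p k" "reads x' z' n p k" by (auto simp: agree_def)
  have z'p: "z' \<in> inf_paths" using z' by (simp add: in_nbhd)
  have "\<forall>u\<in>nbhd (max (Suc m) n) z'. agree x x' u"
    using agree_nbhd[OF r z'p] nbhd_antimono[of n "max (Suc m) n" z'] by auto
  then show ?thesis using that[OF z', of "max (Suc m) n"] by auto
next
  case False
  then have "\<forall>u\<in>nbhd (Suc m) z. \<not> agree x x' u" using nbhd_antimono[of m "Suc m" z] by auto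
  then show ?thesis using that[of z "Suc m"] z by auto
qed

text \<open>
  A direct form of the Baire category argument: the countably many pairs of words are decided one after
  the other on shrinking cylinders, and the limit of these cylinders is a generic path.
\<close>

lemma generic_dense:
  assumes count: "countable words" and w: "w \<in> inf_paths"
  obtains y where "y \<in> nbhd n w" "generic y"
proof -
  define P where "P = from_nat_into (words \<times> words)"
  have ne: "words \<times> words \<noteq> {}" using zero_in_words by blast
  have P: "fst (P i) \<in> words" "snd (P i) \<in> words" for i
    using from_nat_into[OF ne, of i] by (auto simp: P_def mem_Times_iff)
  define decided where "decided i z m \<longleftrightarrow> (\<forall>u\<in>nbhd m z. agree (fst (P i)) (snd (P i)) u) \<or> (\<forall>u\<in>nbhd m z. \<not> agree (fst (P i)) (snd (P i)) u)" for i z m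
  have "\<exists>f. \<forall>i. (fst (f i) \<in> inf_paths \<and> (i = 0 \<longrightarrow> f i = (w, n)))
      \<and> (fst (f (Suc i)) \<in> nbhd (snd (f i)) (fst (f i)) \<and> snd (f i) < snd (f (Suc i)) \<and> decided i (fst (f (Suc i))) (snd (f (Suc i))))"
  proof (rule dependent_nat_choice)
    show "\<exists>x. fst x \<in> inf_paths \<and> ((0::nat) = 0 \<longrightarrow> x = (w, n))" using w by auto
    fix x :: "'e stream \<times> nat" and i :: nat assume x: "fst x \<in> inf_paths \<and> (i = 0 \<longrightarrow> x = (w, n))"
    obtain z' m' where *: "z' \<in> nbhd (snd x) (fst x)" "snd x < m'" "decided i z' m'"
      using decide_agree_nearby[of "fst x" "fst (P i)" "snd (P i)" "snd x"] x P unfolding decided_def by metis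
    then show "\<exists>y. (fst y \<in> inf_paths \<and> (Suc i = 0 \<longrightarrow> y = (w, n))) \<and>
      fst y \<in> nbhd (snd x) (fst x) \<and> snd x < snd y \<and> decided i (fst y) (snd y)"
      by (intro exI[of _ "(z', m')"]) (auto simp: in_nbhd)
  qed
  then obtain f where all: "\<forall>i. (fst (f i) \<in> inf_paths \<and> (i = 0 \<longrightarrow> f i = (w, n)))
      \<and> (fst (f (Suc i)) \<in> nbhd (snd (f i)) (fst (f i)) \<and> snd (f i) < snd (f (Suc i)) \<and> decided i (fst (f (Suc i))) (snd (f (Suc i))))"
    by (elim exE)
  then have f: "\<And>i. fst (f i) \<in> inf_paths" "f 0 = (w, n)"
    "\<And>i. fst (f (Suc i)) \<in> nbhd (snd (f i)) (fst (f i))" "\<And>i. snd (f i) < snd (f (Suc i))"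
    "\<And>i. decided i (fst (f (Suc i))) (snd (f (Suc i)))" by simp_all
  obtain y where y: "\<And>i. y \<in> nbhd (snd (f i)) (fst (f i))"
    using limit_path[of "\<lambda>i. snd (f i)" "\<lambda>i. fst (f i)"] f by (auto simp: strict_mono_Suc_iff)
  have "generic y"
    unfolding generic_def
  proof (intro conjI ballI)
    show "y \<in> inf_paths" using y[of 0] by (simp add: in_nbhd)
    fix x x' assume "x \<in> words" "x' \<in> words"
    then obtain i where i: "P i = (x, x')"
      using from_nat_into_surj[of "words \<times> words" "(x, x')"] count by (auto simp: P_def)
    show "\<exists>n. (\<forall>z\<in>nbhd n y. agree x x' z) \<or> (\<forall>z\<in>nbhd n y. \<not> agree x x' z)"
      using f(5)[of i] nbhd_sym[OF y[of "Suc i"]] unfolding decided_def i by auto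
  qed
  then show thesis using that y[of 0] f(2) by auto
qed

text \<open>
  Koenig's lemma: if a cylinder has no finite subcover, then neither has one of the finitely many
  cylinders into which the next edge divides it, and the path obtained in the limit would have no
  neighbourhood inside a set of the cover.
\<close>

lemma finite_subcover_nbhd:
  assumes fin: "finite (arcs E)" and w: "w \<in> inf_paths"
    and cov: "\<And>z. z \<in> nbhd n w \<Longrightarrow> \<exists>U\<in>\<U>. \<exists>m. nbhd m z \<subseteq> U"
  obtains \<F> where "finite \<F>" "\<F> \<subseteq> \<U>" "nbhd n w \<subseteq> \<Union>\<F>"
proof (rule ccontr)
  assume nt: "\<not> thesis"
  define bad where "bad m z \<longleftrightarrow> z \<in> inf_paths \<and> (\<nexists>\<F>. finite \<F> \<and> \<F> \<subseteq> \<U> \<and> nbhd m z \<subseteq> \<Union>\<F>)" for m z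
  have "bad n w" using nt that w by (auto simp: bad_def)
  have step: "\<exists>z'. z' \<in> nbhd m z \<and> bad (Suc m) z'" if bad: "bad m z" for m z
  proof (rule ccontr)
    assume neg: "\<nexists>z'. z' \<in> nbhd m z \<and> bad (Suc m) z'"
    let ?A = "{e \<in> arcs E. \<exists>z'\<in>nbhd m z. z' !! m = e}"
    have ex: "\<exists>\<F>. finite \<F> \<and> \<F> \<subseteq> \<U> \<and> {z'\<in>nbhd m z. z' !! m = e} \<subseteq> \<Union>\<F>" if e: "e \<in> ?A" for e
    proof -
      obtain z' where z': "z' \<in> nbhd m z" "z' !! m = e" using e by blast
      then have "\<not> bad (Suc m) z'" "z' \<in> inf_paths" using neg nbhd_subset by blast+
      then obtain \<F> where \<F>: "finite \<F>" "\<F> \<subseteq> \<U>" "nbhd (Suc m) z' \<subseteq> \<Union>\<F>"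
        unfolding bad_def by blast
      have "{u\<in>nbhd m z. u !! m = e} \<subseteq> nbhd (Suc m) z'"
        using z' by (auto simp: in_nbhd stake_Suc simp del: stake.simps)
      then have "{u\<in>nbhd m z. u !! m = e} \<subseteq> \<Union>\<F>" using \<F>(3) by (rule subset_trans)
      then show "\<exists>\<F>. finite \<F> \<and> \<F> \<subseteq> \<U> \<and> {z'\<in>nbhd m z. z' !! m = e} \<subseteq> \<Union>\<F>"
        by (intro exI[of _ \<F>] conjI \<F>(1) \<F>(2))
    qed
    define F where "F e = (SOME \<F>. finite \<F> \<and> \<F> \<subseteq> \<U> \<and> {z'\<in>nbhd m z. z' !! m = e} \<subseteq> \<Union>\<F>)" for e
    have F: "finite (F e) \<and> F e \<subseteq> \<U> \<and> {z'\<in>nbhd m z. z' !! m = e} \<subseteq> \<Union>(F e)" if e: "e \<in> ?A" for e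
      unfolding F_def by (rule someI_ex[OF ex[OF e]])
    have "finite (\<Union>e\<in>?A. F e)" using fin F by auto
    moreover have "(\<Union>e\<in>?A. F e) \<subseteq> \<U>" using F by blast
    moreover have "nbhd m z \<subseteq> \<Union>(\<Union>e\<in>?A. F e)"
    proof
      fix u assume u: "u \<in> nbhd m z"
      then have "u !! m \<in> ?A" by (auto simp: in_nbhd inf_paths_def)
      then show "u \<in> \<Union>(\<Union>e\<in>?A. F e)" using F[of "u !! m"] u by blast
    qed
    ultimately show False using bad unfolding bad_def by blast
  qed
  have "\<exists>f. \<forall>i. (bad (n + i) (f i) \<and> (i = 0 \<longrightarrow> f i = w)) \<and> f (Suc i) \<in> nbhd (n + i) (f i)"
  proof (rule dependent_nat_choice)
    show "\<exists>x. bad (n + 0) x \<and> ((0::nat) = 0 \<longrightarrow> x = w)" using \<open>bad n w\<close> by auto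
    fix x i assume "bad (n + i) x \<and> (i = 0 \<longrightarrow> x = w)"
    then show "\<exists>y. (bad (n + Suc i) y \<and> (Suc i = 0 \<longrightarrow> y = w)) \<and> y \<in> nbhd (n + i) x"
      using step[of "n + i" x] by auto
  qed
  then obtain f where "\<forall>i. (bad (n + i) (f i) \<and> (i = 0 \<longrightarrow> f i = w)) \<and> f (Suc i) \<in> nbhd (n + i) (f i)"
    by (elim exE)
  then have f: "\<And>i. bad (n + i) (f i)" "f 0 = w" "\<And>i. f (Suc i) \<in> nbhd (n + i) (f i)" by simp_all
  have "strict_mono (\<lambda>i. n + i)" by (simp add: strict_mono_def)
  then obtain y where y: "\<And>i. y \<in> nbhd (n + i) (f i)"
    using limit_path[of "\<lambda>i. n + i" f] f by (auto simp: bad_def)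
  have "y \<in> nbhd n w" using y[of 0] f(2) by simp
  then obtain U m where U: "U \<in> \<U>" "nbhd m y \<subseteq> U" using cov by blast
  have "nbhd (n + m) (f m) = nbhd (n + m) y" using nbhd_sym[OF y[of m]] by simp
  also have "\<dots> \<subseteq> nbhd m y" by (rule nbhd_antimono) simp
  finally have "nbhd (n + m) (f m) \<subseteq> \<Union>{U}" using U by auto
  then show False using f(1)[of m] U(1) unfolding bad_def by blast
qed

lemma compact_open_bisection_basic:
  assumes fin: "finite (arcs E)" and ok: "basic_ok x n w"
  shows "compact_open_bisection (basic x n w)"
  unfolding compact_open_bisection_def
proof (intro conjI)
  have w: "w \<in> inf_paths" and def: "\<And>z. z \<in> nbhd n w \<Longrightarrow> defined_at x z" using ok by (auto simp: basic_ok_def)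
  show "openin germ_top (basic x n w)" by (rule openin_basic[OF ok])
  show "inj_on germ_source (basic x n w)"
    using def germ_source_germ by (auto simp: inj_on_def basic_def)
  have "z = z'" if "z \<in> nbhd n w" "z' \<in> nbhd n w" "app x z = app x z'" for z z'
    using arg_cong[OF that(3), of "app (word_star x)"]
    unfolding defined_word_star(2)[OF def[OF that(1)]] defined_word_star(2)[OF def[OF that(2)]] .
  then show "inj_on germ_range (basic x n w)"
    using def germ_range_germ by (auto simp: inj_on_def basic_def)
  show "compactin germ_top (basic x n w)"
    unfolding compactin_def
  proof (intro conjI allI impI)
    show "basic x n w \<subseteq> topspace germ_top"
      unfolding topspace_germ_top using def germ_in_germs by (auto simp: basic_def)
    fix \<U> assume U: "Ball \<U> (openin germ_top) \<and> basic x n w \<subseteq> \<Union>\<U>"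
    define pre where "pre U = {z \<in> nbhd n w. germ x z \<in> U}" for U
    have "\<exists>V\<in>pre ` \<U>. \<exists>m. nbhd m z \<subseteq> V" if z: "z \<in> nbhd n w" for z
    proof -
      obtain A where A: "A \<in> \<U>" "germ x z \<in> A" using U z by (auto simp: basic_def)
      have "openin germ_top A" using U A by blast
      then obtain m where m: "\<forall>u\<in>nbhd m z. defined_at x u \<and> germ x u \<in> A"
        unfolding openin_germ_top_iff using def[OF z] A(2) by blast
      have "nbhd (max m n) z \<subseteq> pre A"
        using m nbhd_antimono[of m "max m n" z] nbhd_antimono[of n "max m n" z] nbhd_sym[OF z] by (auto simp: pre_def)
      then show ?thesis using A by blast
    qed
    from finite_subcover_nbhd[OF fin w this]
    obtain \<F> where F: "finite \<F>" "\<F> \<subseteq> pre ` \<U>" "nbhd n w \<subseteq> \<Union>\<F>" by blast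
    obtain \<V> where V: "finite \<V>" "\<V> \<subseteq> \<U>" "\<F> = pre ` \<V>" using finite_subset_image[OF F(1,2)] by blast
    have "basic x n w \<subseteq> \<Union>\<V>" using F(3) V(3) by (auto simp: basic_def pre_def)
    then show "\<exists>\<F>. finite \<F> \<and> \<F> \<subseteq> \<U> \<and> basic x n w \<subseteq> \<Union>\<F>" using V by blast
  qed
qed

lemma compact_open_bisection_finite_union:
  assumes B: "compact_open_bisection B"
  obtains R where "finite R" "\<And>x n w. (x, n, w) \<in> R \<Longrightarrow> basic_ok x n w" "B = (\<Union>(x, n, w)\<in>R. basic x n w)"
proof -
  let ?Q = "{(x, n, w). basic_ok x n w \<and> basic x n w \<subseteq> B}"
  have op: "openin germ_top B" and sub: "B \<subseteq> germs"
    using B by (auto simp: compact_open_bisection_def openin_germ_top_iff)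
  have "B \<subseteq> \<Union>((\<lambda>(x, n, w). basic x n w) ` ?Q)"
  proof
    fix \<gamma> assume g: "\<gamma> \<in> B"
    then obtain x w where x: "defined_at x w" "\<gamma> = germ x w" using sub germs_cases by blast
    obtain n where n: "basic_ok x n w" "basic x n w \<subseteq> B" using open_contains_basic[OF op x(1)] x g by blast
    have "\<gamma> \<in> basic x n w" using germ_in_basic[OF n(1) x(1)] agree_refl[OF x(1)] x defined_atD(2)[OF x(1)] by simp
    then show "\<gamma> \<in> \<Union>((\<lambda>(x, n, w). basic x n w) ` ?Q)" using n by blast
  qed
  then have cov: "Ball ((\<lambda>(x, n, w). basic x n w) ` ?Q) (openin germ_top) \<and> B \<subseteq> \<Union>((\<lambda>(x, n, w). basic x n w) ` ?Q)"
    using openin_basic by auto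
  have "compactin germ_top B" using B by (simp add: compact_open_bisection_def)
  then have "\<forall>\<U>. Ball \<U> (openin germ_top) \<and> B \<subseteq> \<Union>\<U> \<longrightarrow> (\<exists>\<F>. finite \<F> \<and> \<F> \<subseteq> \<U> \<and> B \<subseteq> \<Union>\<F>)"
    unfolding compactin_def by (rule conjunct2)
  from mp[OF spec[OF this] cov]
  obtain \<F> where F: "finite \<F>" "\<F> \<subseteq> (\<lambda>(x, n, w). basic x n w) ` ?Q" "B \<subseteq> \<Union>\<F>" by (elim exE conjE)
  obtain R where R: "finite R" "R \<subseteq> ?Q" "\<F> = (\<lambda>(x, n, w). basic x n w) ` R" using finite_subset_image[OF F(1,2)] by blast
  have "B = (\<Union>(x, n, w)\<in>R. basic x n w)" using R F(3) by auto
  then show thesis using that[of R] R by auto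
qed

section \<open>The Hilbert spaces of the source fibres\<close>

lemma l2_iff:
  "\<xi> \<in> l2 x \<longleftrightarrow> (\<forall>\<beta>. \<beta> \<notin> fibre x \<longrightarrow> \<xi> \<beta> = 0) \<and>
    (\<exists>C. \<forall>A. finite A \<and> A \<subseteq> fibre x \<longrightarrow> (\<Sum>\<beta>\<in>A. (cmod (\<xi> \<beta>))\<^sup>2) \<le> C)"
proof -
  have "(\<lambda>\<beta>. (cmod (\<xi> \<beta>))\<^sup>2) summable_on fibre x \<longleftrightarrow>
    (\<exists>C. \<forall>A. finite A \<and> A \<subseteq> fibre x \<longrightarrow> (\<Sum>\<beta>\<in>A. (cmod (\<xi> \<beta>))\<^sup>2) \<le> C)"
  proof
    assume s: "(\<lambda>\<beta>. (cmod (\<xi> \<beta>))\<^sup>2) summable_on fibre x"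
    show "\<exists>C. \<forall>A. finite A \<and> A \<subseteq> fibre x \<longrightarrow> (\<Sum>\<beta>\<in>A. (cmod (\<xi> \<beta>))\<^sup>2) \<le> C"
      using finite_sum_le_infsum[OF s] by (intro exI[of _ "\<Sum>\<^sub>\<infinity>\<beta>\<in>fibre x. (cmod (\<xi> \<beta>))\<^sup>2"]) auto
  next
    assume "\<exists>C. \<forall>A. finite A \<and> A \<subseteq> fibre x \<longrightarrow> (\<Sum>\<beta>\<in>A. (cmod (\<xi> \<beta>))\<^sup>2) \<le> C"
    then obtain C where C: "\<And>A. finite A \<Longrightarrow> A \<subseteq> fibre x \<Longrightarrow> (\<Sum>\<beta>\<in>A. (cmod (\<xi> \<beta>))\<^sup>2) \<le> C" by blast
    show "(\<lambda>\<beta>. (cmod (\<xi> \<beta>))\<^sup>2) summable_on fibre x"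
      by (rule nonneg_bdd_above_summable_on) (auto intro!: bdd_aboveI[of _ C] C)
  qed
  then show ?thesis unfolding l2_def by simp
qed

lemma l2_norm_nonneg [simp]: "0 \<le> l2_norm x \<xi>"
  unfolding l2_norm_def by (simp add: infsum_nonneg)

lemma l2_norm_sq: "(l2_norm x \<xi>)\<^sup>2 = (\<Sum>\<^sub>\<infinity>\<beta>\<in>fibre x. (cmod (\<xi> \<beta>))\<^sup>2)"
  unfolding l2_norm_def by (simp add: infsum_nonneg)

lemma l2_finite_sum_le:
  "\<xi> \<in> l2 x \<Longrightarrow> finite A \<Longrightarrow> A \<subseteq> fibre x \<Longrightarrow> (\<Sum>\<beta>\<in>A. (cmod (\<xi> \<beta>))\<^sup>2) \<le> (l2_norm x \<xi>)\<^sup>2"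
  unfolding l2_norm_sq by (rule finite_sum_le_infsum) (auto simp: l2_def)

lemma l2_norm_leI:
  assumes "\<xi> \<in> l2 x" "0 \<le> C" "\<And>A. finite A \<Longrightarrow> A \<subseteq> fibre x \<Longrightarrow> (\<Sum>\<beta>\<in>A. (cmod (\<xi> \<beta>))\<^sup>2) \<le> C\<^sup>2"
  shows "l2_norm x \<xi> \<le> C"
proof -
  have "(l2_norm x \<xi>)\<^sup>2 \<le> C\<^sup>2"
    unfolding l2_norm_sq using assms by (intro infsum_le_finite_sums) (auto simp: l2_def)
  then show ?thesis using assms(2) by (rule power2_le_imp_le)
qed

lemma l2_entry_le: "\<xi> \<in> l2 x \<Longrightarrow> \<gamma> \<in> fibre x \<Longrightarrow> cmod (\<xi> \<gamma>) \<le> l2_norm x \<xi>"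
  using l2_finite_sum_le[of \<xi> x "{\<gamma>}"] by (auto intro: power2_le_imp_le)

lemma cmod_add_sq_le: "(cmod (a + b))\<^sup>2 \<le> 2 * (cmod a)\<^sup>2 + 2 * (cmod b)\<^sup>2"
proof -
  have "(cmod (a + b))\<^sup>2 \<le> (cmod a + cmod b)\<^sup>2" by (intro power_mono norm_triangle_ineq) simp
  also have "\<dots> \<le> 2 * (cmod a)\<^sup>2 + 2 * (cmod b)\<^sup>2"
    using sum_squares_bound[of "cmod a" "cmod b"] by (simp add: power2_sum)
  finally show ?thesis .
qed

lemma l2_add:
  assumes "\<xi> \<in> l2 x" "\<eta> \<in> l2 x" shows "(\<lambda>\<beta>. \<xi> \<beta> + \<eta> \<beta>) \<in> l2 x"
  unfolding l2_iff
proof (intro conjI exI allI impI)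
  fix \<beta> assume "\<beta> \<notin> fibre x"
  then show "\<xi> \<beta> + \<eta> \<beta> = 0" using assms by (simp add: l2_iff)
next
  fix A assume A: "finite A \<and> A \<subseteq> fibre x"
  have "(\<Sum>\<beta>\<in>A. (cmod (\<xi> \<beta> + \<eta> \<beta>))\<^sup>2) \<le> (\<Sum>\<beta>\<in>A. 2 * (cmod (\<xi> \<beta>))\<^sup>2 + 2 * (cmod (\<eta> \<beta>))\<^sup>2)"
    by (intro sum_mono cmod_add_sq_le)
  also have "\<dots> \<le> 2 * (l2_norm x \<xi>)\<^sup>2 + 2 * (l2_norm x \<eta>)\<^sup>2"
    using l2_finite_sum_le[OF assms(1), of A] l2_finite_sum_le[OF assms(2), of A] A
    by (simp add: sum.distrib flip: sum_distrib_left)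
  finally show "(\<Sum>\<beta>\<in>A. (cmod (\<xi> \<beta> + \<eta> \<beta>))\<^sup>2) \<le> 2 * (l2_norm x \<xi>)\<^sup>2 + 2 * (l2_norm x \<eta>)\<^sup>2" .
qed

lemma l2_scale:
  assumes "\<xi> \<in> l2 x" shows "(\<lambda>\<beta>. c * \<xi> \<beta>) \<in> l2 x"
  unfolding l2_iff
proof (intro conjI exI allI impI)
  fix \<beta> assume "\<beta> \<notin> fibre x"
  then show "c * \<xi> \<beta> = 0" using assms by (simp add: l2_iff)
next
  fix A assume A: "finite A \<and> A \<subseteq> fibre x"
  have "(\<Sum>\<beta>\<in>A. (cmod (c * \<xi> \<beta>))\<^sup>2) = (cmod c)\<^sup>2 * (\<Sum>\<beta>\<in>A. (cmod (\<xi> \<beta>))\<^sup>2)"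
    by (simp add: norm_mult power_mult_distrib sum_distrib_left)
  also have "\<dots> \<le> (cmod c)\<^sup>2 * (l2_norm x \<xi>)\<^sup>2"
    using l2_finite_sum_le[OF assms, of A] A by (intro mult_left_mono) auto
  finally show "(\<Sum>\<beta>\<in>A. (cmod (c * \<xi> \<beta>))\<^sup>2) \<le> (cmod c)\<^sup>2 * (l2_norm x \<xi>)\<^sup>2" .
qed

lemma l2_diff: "\<xi> \<in> l2 x \<Longrightarrow> \<eta> \<in> l2 x \<Longrightarrow> (\<lambda>\<beta>. \<xi> \<beta> - \<eta> \<beta>) \<in> l2 x"
  using l2_add[of \<xi> x "\<lambda>\<beta>. -1 * \<eta> \<beta>"] l2_scale[of \<eta> x "-1"] by simp

lemma l2_finite_support:
  assumes "finite A" "A \<subseteq> fibre x" "\<And>\<beta>. \<beta> \<notin> A \<Longrightarrow> \<xi> \<beta> = 0"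
  shows "\<xi> \<in> l2 x" "(l2_norm x \<xi>)\<^sup>2 = (\<Sum>\<beta>\<in>A. (cmod (\<xi> \<beta>))\<^sup>2)"
proof -
  have le: "(\<Sum>\<beta>\<in>A'. (cmod (\<xi> \<beta>))\<^sup>2) \<le> (\<Sum>\<beta>\<in>A. (cmod (\<xi> \<beta>))\<^sup>2)" if "finite A'" for A'
  proof -
    have "(\<Sum>\<beta>\<in>A'. (cmod (\<xi> \<beta>))\<^sup>2) = (\<Sum>\<beta>\<in>A' \<inter> A. (cmod (\<xi> \<beta>))\<^sup>2)"
      using assms(3) that by (intro sum.mono_neutral_right) auto
    also have "\<dots> \<le> (\<Sum>\<beta>\<in>A. (cmod (\<xi> \<beta>))\<^sup>2)" using assms(1) by (intro sum_mono2) auto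
    finally show ?thesis .
  qed
  show "\<xi> \<in> l2 x" unfolding l2_iff using assms le by blast
  have "(l2_norm x \<xi>)\<^sup>2 = (\<Sum>\<^sub>\<infinity>\<beta>\<in>A. (cmod (\<xi> \<beta>))\<^sup>2)"
    unfolding l2_norm_sq using assms by (intro infsum_cong_neutral) auto
  then show "(l2_norm x \<xi>)\<^sup>2 = (\<Sum>\<beta>\<in>A. (cmod (\<xi> \<beta>))\<^sup>2)" using assms(1) by simp
qed

lemma delta_l2: "\<beta> \<in> fibre x \<Longrightarrow> delta \<beta> \<in> l2 x" "\<beta> \<in> fibre x \<Longrightarrow> l2_norm x (delta \<beta>) = 1"
proof -
  assume b: "\<beta> \<in> fibre x"
  note f = l2_finite_support[of "{\<beta>}" x "delta \<beta>"]
  show "delta \<beta> \<in> l2 x" using f(1) b by (simp add: delta_def)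
  have "(l2_norm x (delta \<beta>))\<^sup>2 = 1" using f(2) b by (simp add: delta_def)
  then show "l2_norm x (delta \<beta>) = 1" using l2_norm_nonneg[of x "delta \<beta>"] by (simp add: power2_eq_1_iff)
qed

section \<open>The regular representation\<close>

lemma fibre_inf_paths: "\<beta> \<in> fibre x \<Longrightarrow> x \<in> inf_paths"
  by (erule fibre_cases) (rule defined_atD(2))

lemma unit_in_fibre: "x \<in> inf_paths \<Longrightarrow> germ_unit x \<in> fibre x"
  unfolding germ_unit_eq using germ_in_fibre vert_defined by blast

text \<open>
  In the matrix of the indicator function of a bisection each row has at most one nonzero entry, and by
  \<open>bisection_column\<close> so has each column. Hence bisections act contractively.
\<close>

lemma bisection_row:
  assumes B: "compact_open_bisection B" and "\<gamma> \<in> fibre x" "\<beta> \<in> fibre x" "\<beta>' \<in> fibre x"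
    and "germ_div \<gamma> \<beta> \<in> B" "germ_div \<gamma> \<beta>' \<in> B"
  shows "\<beta> = \<beta>'"
proof -
  have "germ_range (germ_div \<gamma> \<beta>) = germ_range (germ_div \<gamma> \<beta>')"
    using germ_div_props(2) assms by simp
  then have "germ_div \<gamma> \<beta> = germ_div \<gamma> \<beta>'"
    using B assms by (auto simp: compact_open_bisection_def dest: inj_onD)
  then show ?thesis using germ_div_cancel_left assms by blast
qed

lemma bisection_column:
  assumes B: "compact_open_bisection B" and "\<gamma> \<in> fibre x" "\<gamma>' \<in> fibre x" "\<beta> \<in> fibre x"
    and "germ_div \<gamma> \<beta> \<in> B" "germ_div \<gamma>' \<beta> \<in> B"
  shows "\<gamma> = \<gamma>'"
proof -
  have "germ_source (germ_div \<gamma> \<beta>) = germ_source (germ_div \<gamma>' \<beta>)"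
    using germ_div_props(1)[of \<gamma> x \<beta>] germ_div_props(1)[of \<gamma>' x \<beta>] assms by (simp add: fibre_def)
  then have "germ_div \<gamma> \<beta> = germ_div \<gamma>' \<beta>"
    using B assms by (auto simp: compact_open_bisection_def dest: inj_onD)
  then show ?thesis using germ_div_cancel_right assms by blast
qed

lemma bisection_row_subsingleton:
  assumes B: "compact_open_bisection B" and g: "\<gamma> \<in> fibre x"
  obtains \<alpha> where "{\<beta> \<in> fibre x. germ_div \<gamma> \<beta> \<in> B} \<subseteq> {\<alpha>}"
proof (cases "\<exists>\<alpha> \<in> fibre x. germ_div \<gamma> \<alpha> \<in> B")
  case True
  then obtain \<alpha> where a: "\<alpha> \<in> fibre x" "germ_div \<gamma> \<alpha> \<in> B" by blast
  have "{\<beta> \<in> fibre x. germ_div \<gamma> \<beta> \<in> B} \<subseteq> {\<alpha>}"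
  proof
    fix \<beta> assume "\<beta> \<in> {\<beta> \<in> fibre x. germ_div \<gamma> \<beta> \<in> B}"
    then show "\<beta> \<in> {\<alpha>}" using bisection_row[OF B g a(1), of \<beta>] a(2) by simp
  qed
  then show thesis by (rule that)
next
  case False
  then have "{\<beta> \<in> fibre x. germ_div \<gamma> \<beta> \<in> B} \<subseteq> {undefined}" by blast
  then show thesis by (rule that)
qed

lemma bisection_row_finite:
  "compact_open_bisection B \<Longrightarrow> \<gamma> \<in> fibre x \<Longrightarrow> finite {\<beta> \<in> fibre x. germ_div \<gamma> \<beta> \<in> B}"
  by (erule (1) bisection_row_subsingleton) (erule finite_subset, simp)

lemma steinberg_row_finite:
  assumes f: "f \<in> steinberg" and g: "\<gamma> \<in> fibre x"
  shows "finite {\<beta> \<in> fibre x. f (germ_div \<gamma> \<beta>) \<noteq> 0}"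
proof -
  obtain F c where F: "f = (\<lambda>\<gamma>. \<Sum>B\<in>F. c B * indicator B \<gamma>)" "finite F" "\<And>B. B \<in> F \<Longrightarrow> compact_open_bisection B"
    using f unfolding steinberg_def by blast
  have "{\<beta> \<in> fibre x. f (germ_div \<gamma> \<beta>) \<noteq> 0} \<subseteq> (\<Union>B\<in>F. {\<beta> \<in> fibre x. germ_div \<gamma> \<beta> \<in> B})"
  proof
    fix \<beta> assume b: "\<beta> \<in> {\<beta> \<in> fibre x. f (germ_div \<gamma> \<beta>) \<noteq> 0}"
    then have "(\<Sum>B\<in>F. c B * indicator B (germ_div \<gamma> \<beta>)) \<noteq> 0" using F(1) by simp
    then obtain B where "B \<in> F" "c B * indicator B (germ_div \<gamma> \<beta>) \<noteq> 0" by (rule sum.not_neutral_contains_not_neutral)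
    then have "B \<in> F" "germ_div \<gamma> \<beta> \<in> B" by (auto simp: indicator_def split: if_splits)
    then show "\<beta> \<in> (\<Union>B\<in>F. {\<beta> \<in> fibre x. germ_div \<gamma> \<beta> \<in> B})" using b by blast
  qed
  moreover have "finite (\<Union>B\<in>F. {\<beta> \<in> fibre x. germ_div \<gamma> \<beta> \<in> B})"
    using F bisection_row_finite[OF _ g] by blast
  ultimately show ?thesis by (rule finite_subset)
qed

lemma reg_finite:
  assumes f: "f \<in> steinberg" and g: "\<gamma> \<in> fibre x" and S: "finite S" "S \<subseteq> fibre x"
    and sup: "\<And>\<beta>. \<beta> \<in> fibre x \<Longrightarrow> \<beta> \<notin> S \<Longrightarrow> f (germ_div \<gamma> \<beta>) * \<xi> \<beta> = 0"
  shows "reg f x \<xi> \<gamma> = (\<Sum>\<beta>\<in>S. f (germ_div \<gamma> \<beta>) * \<xi> \<beta>)"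
proof -
  have "reg f x \<xi> \<gamma> = (\<Sum>\<^sub>\<infinity>\<beta>\<in>fibre x. f (germ_div \<gamma> \<beta>) * \<xi> \<beta>)"
    using g by (simp add: reg_def germ_div_def)
  also have "\<dots> = (\<Sum>\<^sub>\<infinity>\<beta>\<in>S. f (germ_div \<gamma> \<beta>) * \<xi> \<beta>)"
    using S sup by (intro infsum_cong_neutral) auto
  finally show ?thesis using S by simp
qed

lemma reg_row:
  assumes "f \<in> steinberg" "\<gamma> \<in> fibre x"
  shows "reg f x \<xi> \<gamma> = (\<Sum>\<beta>\<in>{\<beta> \<in> fibre x. f (germ_div \<gamma> \<beta>) \<noteq> 0}. f (germ_div \<gamma> \<beta>) * \<xi> \<beta>)"
  using assms steinberg_row_finite[OF assms] by (intro reg_finite) auto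

lemma reg_outside: "\<gamma> \<notin> fibre x \<Longrightarrow> reg f x \<xi> \<gamma> = 0"
  by (simp add: reg_def)

lemma reg_add: "f \<in> steinberg \<Longrightarrow> reg f x (\<lambda>\<beta>. \<xi> \<beta> + \<eta> \<beta>) = (\<lambda>\<beta>. reg f x \<xi> \<beta> + reg f x \<eta> \<beta>)"
proof
  fix \<gamma> assume f: "f \<in> steinberg"
  show "reg f x (\<lambda>\<beta>. \<xi> \<beta> + \<eta> \<beta>) \<gamma> = reg f x \<xi> \<gamma> + reg f x \<eta> \<gamma>"
    by (cases "\<gamma> \<in> fibre x") (auto simp: reg_row[OF f] reg_outside ring_distribs sum.distrib)
qed

lemma reg_scale: "f \<in> steinberg \<Longrightarrow> reg f x (\<lambda>\<beta>. c * \<xi> \<beta>) = (\<lambda>\<beta>. c * reg f x \<xi> \<beta>)"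
proof
  fix \<gamma> assume f: "f \<in> steinberg"
  show "reg f x (\<lambda>\<beta>. c * \<xi> \<beta>) \<gamma> = c * reg f x \<xi> \<gamma>"
    by (cases "\<gamma> \<in> fibre x") (auto simp: reg_row[OF f] reg_outside sum_distrib_left mult_ac)
qed

lemma reg_delta:
  assumes f: "f \<in> steinberg" and "\<gamma> \<in> fibre x" "\<beta> \<in> fibre x"
  shows "reg f x (delta \<beta>) \<gamma> = f (germ_div \<gamma> \<beta>)"
  using reg_finite[OF f assms(2), of "{\<beta>}" "delta \<beta>"] assms by (simp add: delta_def)

lemma bisection_sum_le:
  assumes B: "compact_open_bisection B" and xi: "\<xi> \<in> l2 x" and A: "finite A" "A \<subseteq> fibre x"
  shows "(\<Sum>\<gamma>\<in>A. (cmod (\<Sum>\<beta>\<in>{\<beta> \<in> fibre x. germ_div \<gamma> \<beta> \<in> B}. \<xi> \<beta>))\<^sup>2) \<le> (l2_norm x \<xi>)\<^sup>2"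
proof -
  let ?R = "\<lambda>\<gamma>. {\<beta> \<in> fibre x. germ_div \<gamma> \<beta> \<in> B}"
  have fin: "finite (?R \<gamma>)" if "\<gamma> \<in> A" for \<gamma> using bisection_row_finite[OF B] A that by blast
  have "(\<Sum>\<gamma>\<in>A. (cmod (\<Sum>\<beta>\<in>?R \<gamma>. \<xi> \<beta>))\<^sup>2) = (\<Sum>\<gamma>\<in>A. \<Sum>\<beta>\<in>?R \<gamma>. (cmod (\<xi> \<beta>))\<^sup>2)"
  proof (rule sum.cong[OF HOL.refl])
    fix \<gamma> assume g: "\<gamma> \<in> A"
    have "\<gamma> \<in> fibre x" using g A by blast
    then obtain b where "?R \<gamma> \<subseteq> {b}" by (rule bisection_row_subsingleton[OF B])
    then consider "?R \<gamma> = {}" | "?R \<gamma> = {b}" by (auto dest: subset_singletonD)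
    then show "(cmod (\<Sum>\<beta>\<in>?R \<gamma>. \<xi> \<beta>))\<^sup>2 = (\<Sum>\<beta>\<in>?R \<gamma>. (cmod (\<xi> \<beta>))\<^sup>2)"
    proof cases
      case 1
      show ?thesis unfolding 1 by simp
    next
      case 2
      show ?thesis unfolding 2 by simp
    qed
  qed
  also have "\<dots> = (\<Sum>\<beta>\<in>(\<Union>\<gamma>\<in>A. ?R \<gamma>). (cmod (\<xi> \<beta>))\<^sup>2)"
  proof (rule sum.UNION_disjoint[symmetric])
    show "\<forall>\<gamma>\<in>A. \<forall>\<gamma>'\<in>A. \<gamma> \<noteq> \<gamma>' \<longrightarrow> ?R \<gamma> \<inter> ?R \<gamma>' = {}"
      using bisection_column[OF B] A by blast
  qed (use A fin in auto)
  also have "\<dots> \<le> (l2_norm x \<xi>)\<^sup>2"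
    using A fin by (intro l2_finite_sum_le[OF xi]) auto
  finally show ?thesis .
qed

text \<open>
  By the Cauchy--Schwarz inequality, finitely many contractive bisections act boundedly; the constant is
  not optimal.
\<close>

lemma reg_bounded:
  assumes f: "f \<in> steinberg"
  obtains C where "0 \<le> C" "\<And>x \<xi>. \<xi> \<in> l2 x \<Longrightarrow> reg f x \<xi> \<in> l2 x \<and> l2_norm x (reg f x \<xi>) \<le> C * l2_norm x \<xi>"
proof -
  obtain F c where F: "f = (\<lambda>\<gamma>. \<Sum>B\<in>F. c B * indicator B \<gamma>)" "finite F" "\<And>B. B \<in> F \<Longrightarrow> compact_open_bisection B"
    using f unfolding steinberg_def by blast
  define K where "K = (\<Sum>B\<in>F. (cmod (c B))\<^sup>2) * real (card F)"
  have K: "0 \<le> K" by (simp add: K_def sum_nonneg)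
  have bound: "(\<Sum>\<gamma>\<in>A. (cmod (reg f x \<xi> \<gamma>))\<^sup>2) \<le> K * (l2_norm x \<xi>)\<^sup>2"
    if xi: "\<xi> \<in> l2 x" and A: "finite A" "A \<subseteq> fibre x" for x \<xi> A
  proof -
    let ?R = "\<lambda>B \<gamma>. {\<beta> \<in> fibre x. germ_div \<gamma> \<beta> \<in> B}"
    have row: "reg f x \<xi> \<gamma> = (\<Sum>B\<in>F. c B * (\<Sum>\<beta>\<in>?R B \<gamma>. \<xi> \<beta>))" if g: "\<gamma> \<in> A" for \<gamma>
    proof -
      have gf: "\<gamma> \<in> fibre x" using g A by blast
      let ?S = "\<Union>B\<in>F. ?R B \<gamma>"
      have S: "finite ?S" "?S \<subseteq> fibre x" using F bisection_row_finite[OF _ gf] by auto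
      have "reg f x \<xi> \<gamma> = (\<Sum>\<beta>\<in>?S. f (germ_div \<gamma> \<beta>) * \<xi> \<beta>)"
      proof (rule reg_finite[OF f gf S])
        fix \<beta> assume "\<beta> \<in> fibre x" "\<beta> \<notin> ?S"
        then have "f (germ_div \<gamma> \<beta>) = 0" unfolding F(1) by (auto intro!: sum.neutral)
        then show "f (germ_div \<gamma> \<beta>) * \<xi> \<beta> = 0" by simp
      qed
      also have "\<dots> = (\<Sum>B\<in>F. \<Sum>\<beta>\<in>?S. c B * indicator B (germ_div \<gamma> \<beta>) * \<xi> \<beta>)"
        unfolding F(1) sum_distrib_right by (rule sum.swap)
      also have "\<dots> = (\<Sum>B\<in>F. c B * (\<Sum>\<beta>\<in>?R B \<gamma>. \<xi> \<beta>))"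
      proof (rule sum.cong[OF HOL.refl])
        fix B assume B: "B \<in> F"
        have "(\<Sum>\<beta>\<in>?S. c B * indicator B (germ_div \<gamma> \<beta>) * \<xi> \<beta>) = (\<Sum>\<beta>\<in>?R B \<gamma>. c B * \<xi> \<beta>)"
          using S B by (intro sum.mono_neutral_cong_right) (auto simp: indicator_def)
        then show "(\<Sum>\<beta>\<in>?S. c B * indicator B (germ_div \<gamma> \<beta>) * \<xi> \<beta>) = c B * (\<Sum>\<beta>\<in>?R B \<gamma>. \<xi> \<beta>)"
          by (simp add: sum_distrib_left)
      qed
      finally show ?thesis .
    qed
    have "(\<Sum>\<gamma>\<in>A. (cmod (reg f x \<xi> \<gamma>))\<^sup>2) \<le> (\<Sum>\<gamma>\<in>A. (\<Sum>B\<in>F. (cmod (c B))\<^sup>2) * (\<Sum>B\<in>F. (cmod (\<Sum>\<beta>\<in>?R B \<gamma>. \<xi> \<beta>))\<^sup>2))"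
    proof (rule sum_mono)
      fix \<gamma> assume g: "\<gamma> \<in> A"
      have "cmod (reg f x \<xi> \<gamma>) \<le> (\<Sum>B\<in>F. cmod (c B) * cmod (\<Sum>\<beta>\<in>?R B \<gamma>. \<xi> \<beta>))"
        unfolding row[OF g] by (rule order_trans[OF norm_sum]) (simp add: norm_mult)
      then have "(cmod (reg f x \<xi> \<gamma>))\<^sup>2 \<le> (\<Sum>B\<in>F. cmod (c B) * cmod (\<Sum>\<beta>\<in>?R B \<gamma>. \<xi> \<beta>))\<^sup>2"
        by (rule power_mono) simp
      also have "\<dots> \<le> (\<Sum>B\<in>F. (cmod (c B))\<^sup>2) * (\<Sum>B\<in>F. (cmod (\<Sum>\<beta>\<in>?R B \<gamma>. \<xi> \<beta>))\<^sup>2)"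
        by (rule Cauchy_Schwarz_ineq_sum)
      finally show "(cmod (reg f x \<xi> \<gamma>))\<^sup>2 \<le> (\<Sum>B\<in>F. (cmod (c B))\<^sup>2) * (\<Sum>B\<in>F. (cmod (\<Sum>\<beta>\<in>?R B \<gamma>. \<xi> \<beta>))\<^sup>2)" .
    qed
    also have "\<dots> = (\<Sum>B\<in>F. (cmod (c B))\<^sup>2) * (\<Sum>B\<in>F. \<Sum>\<gamma>\<in>A. (cmod (\<Sum>\<beta>\<in>?R B \<gamma>. \<xi> \<beta>))\<^sup>2)"
      unfolding sum_distrib_left[symmetric] by (subst sum.swap) (rule HOL.refl)
    also have "\<dots> \<le> (\<Sum>B\<in>F. (cmod (c B))\<^sup>2) * (\<Sum>B\<in>F. (l2_norm x \<xi>)\<^sup>2)"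
      using bisection_sum_le[OF F(3) xi A] by (intro mult_left_mono sum_mono) (auto simp: sum_nonneg)
    also have "\<dots> = K * (l2_norm x \<xi>)\<^sup>2" by (simp add: K_def)
    finally show ?thesis .
  qed
  have "reg f x \<xi> \<in> l2 x \<and> l2_norm x (reg f x \<xi>) \<le> sqrt K * l2_norm x \<xi>" if xi: "\<xi> \<in> l2 x" for x \<xi>
  proof
    show l2: "reg f x \<xi> \<in> l2 x" unfolding l2_iff using bound[OF xi] reg_outside by blast
    show "l2_norm x (reg f x \<xi>) \<le> sqrt K * l2_norm x \<xi>"
      using bound[OF xi] K by (intro l2_norm_leI[OF l2]) (auto simp: power_mult_distrib)
  qed
  then show thesis using that[of "sqrt K"] K by simp
qed

lemma reg_l2: "f \<in> steinberg \<Longrightarrow> \<xi> \<in> l2 x \<Longrightarrow> reg f x \<xi> \<in> l2 x"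
  by (erule reg_bounded) blast

lemma reg_family_apply: "x \<in> inf_paths \<Longrightarrow> \<xi> \<in> l2 x \<Longrightarrow> reg_family f x \<xi> = reg f x \<xi>"
  by (simp add: reg_family_def)

lemma zero_family_apply: "x \<in> inf_paths \<Longrightarrow> \<xi> \<in> l2 x \<Longrightarrow> zero_family x \<xi> = (\<lambda>_. 0)"
  by (simp add: zero_family_def)

lemma reg_family_bounded:
  assumes f: "f \<in> steinberg" shows "reg_family f \<in> bounded_families"
proof -
  obtain C where C: "0 \<le> C" "\<And>x \<xi>. \<xi> \<in> l2 x \<Longrightarrow> reg f x \<xi> \<in> l2 x \<and> l2_norm x (reg f x \<xi>) \<le> C * l2_norm x \<xi>"
    using reg_bounded[OF f] by blast
  have "reg_family f \<in> (\<Pi>\<^sub>E x\<in>inf_paths. l2 x \<rightarrow>\<^sub>E l2 x)"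
    using C(2) unfolding reg_family_def by auto
  moreover have "dist_le (reg_family f) zero_family C"
    unfolding dist_le_def using C(2) by (auto simp: reg_family_apply zero_family_apply)
  ultimately show ?thesis
    unfolding bounded_families_def
    by (auto simp: reg_family_apply l2_add l2_scale reg_add[OF f] reg_scale[OF f])
qed

lemma reg_family_Cstar: "f \<in> steinberg \<Longrightarrow> reg_family f \<in> Cstar_red"
proof -
  assume f: "f \<in> steinberg"
  have "l2_norm x (\<lambda>\<beta>. 0) = 0" for x by (simp add: l2_norm_def)
  then have "dist_le (reg_family f) (reg_family f) \<epsilon>" if "\<epsilon> > 0" for \<epsilon>
    unfolding dist_le_def using that by (simp add: reg_family_apply)
  then show ?thesis unfolding Cstar_red_def using reg_family_bounded[OF f] f by blast
qed

lemma bounded_families_facts: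
  assumes T: "T \<in> bounded_families" and x: "x \<in> inf_paths" and xi: "\<xi> \<in> l2 x"
  shows "T x \<xi> \<in> l2 x" "\<And>\<eta>. \<eta> \<in> l2 x \<Longrightarrow> T x (\<lambda>\<beta>. \<xi> \<beta> + \<eta> \<beta>) = (\<lambda>\<beta>. T x \<xi> \<beta> + T x \<eta> \<beta>)"
    "\<And>c. T x (\<lambda>\<beta>. c * \<xi> \<beta>) = (\<lambda>\<beta>. c * T x \<xi> \<beta>)"
proof -
  have "T \<in> (\<Pi>\<^sub>E x\<in>inf_paths. l2 x \<rightarrow>\<^sub>E l2 x)" using T by (simp add: bounded_families_def)
  then have "T x \<in> l2 x \<rightarrow>\<^sub>E l2 x" using x by (rule PiE_mem)
  then show "T x \<xi> \<in> l2 x" using xi by (rule PiE_mem)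
  show "\<And>\<eta>. \<eta> \<in> l2 x \<Longrightarrow> T x (\<lambda>\<beta>. \<xi> \<beta> + \<eta> \<beta>) = (\<lambda>\<beta>. T x \<xi> \<beta> + T x \<eta> \<beta>)"
    "\<And>c. T x (\<lambda>\<beta>. c * \<xi> \<beta>) = (\<lambda>\<beta>. c * T x \<xi> \<beta>)"
    using T x xi unfolding bounded_families_def by auto
qed

lemma bounded_families_finite_sum:
  assumes T: "T \<in> bounded_families" and x: "x \<in> inf_paths" and A: "finite A" "A \<subseteq> fibre x"
  shows "T x (\<lambda>\<gamma>. \<Sum>\<beta>\<in>A. \<xi> \<beta> * delta \<beta> \<gamma>) = (\<lambda>\<gamma>. \<Sum>\<beta>\<in>A. \<xi> \<beta> * T x (delta \<beta>) \<gamma>)"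
  using A
proof (induction A)
  case empty
  have "(\<lambda>_. 0) \<in> l2 x" by (rule l2_finite_support[of "{}"]) auto
  from bounded_families_facts(3)[OF T x this, of 0] show ?case by simp
next
  case (insert \<alpha> A)
  have fin: "(\<lambda>\<gamma>. \<Sum>\<beta>\<in>A. \<xi> \<beta> * delta \<beta> \<gamma>) \<in> l2 x"
    using insert by (intro l2_finite_support[of A]) (auto simp: delta_def intro!: sum.neutral)
  have a: "delta \<alpha> \<in> l2 x" using delta_l2 insert by simp
  have "T x (\<lambda>\<gamma>. \<Sum>\<beta>\<in>insert \<alpha> A. \<xi> \<beta> * delta \<beta> \<gamma>) = T x (\<lambda>\<gamma>. \<xi> \<alpha> * delta \<alpha> \<gamma> + (\<Sum>\<beta>\<in>A. \<xi> \<beta> * delta \<beta> \<gamma>))"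
    using insert by simp
  also have "\<dots> = (\<lambda>\<gamma>. T x (\<lambda>\<gamma>. \<xi> \<alpha> * delta \<alpha> \<gamma>) \<gamma> + T x (\<lambda>\<gamma>. \<Sum>\<beta>\<in>A. \<xi> \<beta> * delta \<beta> \<gamma>) \<gamma>)"
    by (rule bounded_families_facts(2)[OF T x l2_scale[OF a] fin])
  also have "\<dots> = (\<lambda>\<gamma>. \<Sum>\<beta>\<in>insert \<alpha> A. \<xi> \<beta> * T x (delta \<beta>) \<gamma>)"
    using insert bounded_families_facts(3)[OF T x a] by simp
  finally show ?case .
qed

lemma finite_support_expand:
  assumes "finite A" "\<And>\<beta>. \<beta> \<notin> A \<Longrightarrow> \<xi> \<beta> = 0"
  shows "\<xi> = (\<lambda>\<gamma>. \<Sum>\<beta>\<in>A. \<xi> \<beta> * delta \<beta> \<gamma>)"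
  using assms by (auto simp: delta_def if_distrib cong: if_cong)

lemma bounded_families_finite_support:
  assumes T: "T \<in> bounded_families" and x: "x \<in> inf_paths" and A: "finite A" "A \<subseteq> fibre x"
    and off: "\<And>\<beta>. \<beta> \<notin> A \<Longrightarrow> \<xi> \<beta> = 0"
  shows "T x \<xi> \<gamma> = (\<Sum>\<beta>\<in>A. \<xi> \<beta> * T x (delta \<beta>) \<gamma>)"
proof -
  have "T x \<xi> = T x (\<lambda>\<gamma>. \<Sum>\<beta>\<in>A. \<xi> \<beta> * delta \<beta> \<gamma>)"
    by (rule arg_cong[OF finite_support_expand[OF A(1) off]])
  also have "\<dots> = (\<lambda>\<gamma>. \<Sum>\<beta>\<in>A. \<xi> \<beta> * T x (delta \<beta>) \<gamma>)"
    by (rule bounded_families_finite_sum[OF T x A])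
  finally show ?thesis by (rule fun_cong)
qed

lemma j_map_eq:
  assumes T: "T \<in> bounded_families" and g: "\<gamma> \<in> fibre x"
  shows "j_map T \<gamma> = T x (delta (germ_unit x)) \<gamma>"
proof -
  have src: "germ_source \<gamma> = x" using g by (simp add: fibre_def)
  have "(\<Sum>\<^sub>\<infinity>\<beta>\<in>fibre x. T x (delta (germ_unit x)) \<beta> * cnj (delta \<gamma> \<beta>))
    = (\<Sum>\<^sub>\<infinity>\<beta>\<in>{\<gamma>}. T x (delta (germ_unit x)) \<beta> * cnj (delta \<gamma> \<beta>))"
    using g by (intro infsum_cong_neutral) (auto simp: delta_def)
  then show ?thesis by (simp add: j_map_def src l2_inner_def Let_def delta_def)
qed

lemma j_map_reg_family:
  assumes f: "f \<in> steinberg" and g: "\<gamma> \<in> germs" shows "j_map (reg_family f) \<gamma> = f \<gamma>"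
proof -
  let ?x = "germ_source \<gamma>"
  have gf: "\<gamma> \<in> fibre ?x" using g by (simp add: fibre_def)
  have x: "?x \<in> inf_paths" using fibre_inf_paths[OF gf] .
  show ?thesis
    using j_map_eq[OF reg_family_bounded[OF f] gf] reg_family_apply[OF x delta_l2(1)[OF unit_in_fibre[OF x]]]
      reg_delta[OF f gf unit_in_fibre[OF x]] germ_div_unit[OF gf] by simp
qed

lemma dist_entry:
  assumes T: "T \<in> bounded_families" and f: "f \<in> steinberg" and dist: "dist_le T (reg_family f) \<epsilon>"
    and g: "\<gamma> \<in> fibre x" and b: "\<beta> \<in> fibre x"
  shows "cmod (T x (delta \<beta>) \<gamma> - f (germ_div \<gamma> \<beta>)) \<le> \<epsilon>"
proof -
  have x: "x \<in> inf_paths" using fibre_inf_paths[OF g] .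
  note d = delta_l2[OF b]
  have C: "reg f x (delta \<beta>) \<in> l2 x" by (rule reg_l2[OF f d(1)])
  have l2: "(\<lambda>\<eta>. T x (delta \<beta>) \<eta> - reg f x (delta \<beta>) \<eta>) \<in> l2 x"
    by (rule l2_diff[OF bounded_families_facts(1)[OF T x d(1)] C])
  have "cmod (T x (delta \<beta>) \<gamma> - reg f x (delta \<beta>) \<gamma>) \<le> l2_norm x (\<lambda>\<eta>. T x (delta \<beta>) \<eta> - reg f x (delta \<beta>) \<eta>)"
    using l2_entry_le[OF l2 g] .
  also have "\<dots> \<le> \<epsilon> * l2_norm x (delta \<beta>)"
  proof -
    have "l2_norm x (\<lambda>\<eta>. T x (delta \<beta>) \<eta> - reg_family f x (delta \<beta>) \<eta>) \<le> \<epsilon> * l2_norm x (delta \<beta>)"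
      using dist x d(1) unfolding dist_le_def by blast
    then show ?thesis by (simp add: reg_family_apply[OF x d(1)])
  qed
  also have "\<dots> = \<epsilon>" by (simp add: d(2))
  finally show ?thesis using reg_delta[OF f g b] by simp
qed

lemma Cstar_bounded: "T \<in> Cstar_red \<Longrightarrow> T \<in> bounded_families"
  by (simp add: Cstar_red_def)

lemma j_map_dist:
  assumes T: "T \<in> bounded_families" and f: "f \<in> steinberg" and dist: "dist_le T (reg_family f) \<epsilon>"
    and g: "\<gamma> \<in> germs"
  shows "cmod (j_map T \<gamma> - f \<gamma>) \<le> \<epsilon>"
proof -
  let ?x = "germ_source \<gamma>"
  have gf: "\<gamma> \<in> fibre ?x" using g by (simp add: fibre_def)
  have x: "?x \<in> inf_paths" using fibre_inf_paths[OF gf] .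
  show ?thesis
    using dist_entry[OF T f dist gf unit_in_fibre[OF x]] j_map_eq[OF T gf] germ_div_unit[OF gf] by simp
qed

text \<open>
  For elements of the Steinberg algebra the matrix is invariant under right translation, and this
  property passes to norm limits.
\<close>

lemma Cstar_entry:
  assumes T: "T \<in> Cstar_red" and g: "\<gamma> \<in> fibre x" and b: "\<beta> \<in> fibre x"
  shows "T x (delta \<beta>) \<gamma> = j_map T (germ_div \<gamma> \<beta>)"
proof -
  have Tb: "T \<in> bounded_families" using Cstar_bounded[OF T] .
  have dg: "germ_div \<gamma> \<beta> \<in> germs" using germ_div_props(1)[OF g b] by (simp add: fibre_def)
  have "cmod (T x (delta \<beta>) \<gamma> - j_map T (germ_div \<gamma> \<beta>)) \<le> \<epsilon>" if e: "\<epsilon> > 0" for \<epsilon>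
  proof -
    have "\<epsilon> / 2 > 0" using e by simp
    then obtain f where f: "f \<in> steinberg" "dist_le T (reg_family f) (\<epsilon> / 2)"
      using T unfolding Cstar_red_def by blast
    have "cmod (T x (delta \<beta>) \<gamma> - j_map T (germ_div \<gamma> \<beta>))
      \<le> cmod (T x (delta \<beta>) \<gamma> - f (germ_div \<gamma> \<beta>)) + cmod (j_map T (germ_div \<gamma> \<beta>) - f (germ_div \<gamma> \<beta>))"
      using norm_triangle_ineq4[of "T x (delta \<beta>) \<gamma> - f (germ_div \<gamma> \<beta>)" "j_map T (germ_div \<gamma> \<beta>) - f (germ_div \<gamma> \<beta>)"] by simp
    then show ?thesis using dist_entry[OF Tb f g b] j_map_dist[OF Tb f dg] by simp
  qed
  then have "cmod (T x (delta \<beta>) \<gamma> - j_map T (germ_div \<gamma> \<beta>)) \<le> 0" by (rule field_le_epsilon) simp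
  then show ?thesis by simp
qed

text \<open>
  Injectivity of the \<open>j\<close>-map: it determines the matrix of \<open>T\<close>, and vectors of finite support are dense.
\<close>

lemma Cstar_eq_zero:
  assumes T: "T \<in> Cstar_red" and zero: "\<And>\<gamma>. \<gamma> \<in> germs \<Longrightarrow> j_map T \<gamma> = 0"
  shows "T = zero_family"
proof -
  have Tb: "T \<in> bounded_families" using Cstar_bounded[OF T] .
  obtain C where C: "dist_le T zero_family C" using Tb by (auto simp: bounded_families_def)
  have val: "T x \<xi> \<gamma> = 0" if x: "x \<in> inf_paths" and xi: "\<xi> \<in> l2 x" and g: "\<gamma> \<in> fibre x" for x \<xi> \<gamma>
  proof -
    have small: "cmod (T x \<xi> \<gamma>) \<le> \<bar>C\<bar> * \<delta>" if d: "\<delta> > 0" for \<delta>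
    proof -
      have s: "(\<lambda>\<beta>. (cmod (\<xi> \<beta>))\<^sup>2) summable_on fibre x" using xi by (simp add: l2_def)
      obtain A where A: "finite A" "A \<subseteq> fibre x" "dist (\<Sum>\<beta>\<in>A. (cmod (\<xi> \<beta>))\<^sup>2) ((l2_norm x \<xi>)\<^sup>2) \<le> \<delta>\<^sup>2"
        using infsum_finite_approximation[OF s, of "\<delta>\<^sup>2"] d unfolding l2_norm_sq by auto
      \<comment> \<open>The finite part \<open>\<xi>1\<close> is annihilated by \<open>T\<close>, and the tail \<open>\<xi>2\<close> has norm at most \<open>\<delta>\<close>.\<close>
      define \<xi>1 where "\<xi>1 = (\<lambda>\<beta>. if \<beta> \<in> A then \<xi> \<beta> else 0)"
      define \<xi>2 where "\<xi>2 = (\<lambda>\<beta>. if \<beta> \<in> A then 0 else \<xi> \<beta>)"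
      have sum2: "(\<Sum>\<beta>\<in>A'. (cmod (\<xi>2 \<beta>))\<^sup>2) \<le> \<delta>\<^sup>2" if A': "finite A'" "A' \<subseteq> fibre x" for A'
      proof -
        have "(\<Sum>\<beta>\<in>A'. (cmod (\<xi>2 \<beta>))\<^sup>2) = (\<Sum>\<beta>\<in>A' - A. (cmod (\<xi> \<beta>))\<^sup>2)"
          using A' by (intro sum.mono_neutral_cong_right) (auto simp: \<xi>2_def)
        moreover have "(\<Sum>\<beta>\<in>A' - A. (cmod (\<xi> \<beta>))\<^sup>2) + (\<Sum>\<beta>\<in>A. (cmod (\<xi> \<beta>))\<^sup>2) = (\<Sum>\<beta>\<in>(A' - A) \<union> A. (cmod (\<xi> \<beta>))\<^sup>2)"
          using A A' by (intro sum.union_disjoint[symmetric]) auto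
        moreover have "\<dots> \<le> (l2_norm x \<xi>)\<^sup>2" using A A' by (intro l2_finite_sum_le[OF xi]) auto
        ultimately show ?thesis using A(3) by (simp add: dist_real_def)
      qed
      have l2: "\<xi>1 \<in> l2 x" "\<xi>2 \<in> l2 x"
        using A sum2 xi unfolding l2_iff[of \<xi>2] by (auto simp: \<xi>1_def \<xi>2_def l2_iff[of \<xi>] intro!: l2_finite_support[of A])
      have n2: "l2_norm x \<xi>2 \<le> \<delta>" using sum2 d by (intro l2_norm_leI[OF l2(2)]) auto
      have "\<xi> = (\<lambda>\<beta>. \<xi>1 \<beta> + \<xi>2 \<beta>)" by (auto simp: \<xi>1_def \<xi>2_def)
      then have "T x \<xi> = T x (\<lambda>\<beta>. \<xi>1 \<beta> + \<xi>2 \<beta>)" by (rule arg_cong)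
      also have "\<dots> = (\<lambda>\<beta>. T x \<xi>1 \<beta> + T x \<xi>2 \<beta>)" by (rule bounded_families_facts(2)[OF Tb x l2])
      finally have "T x \<xi> \<gamma> = T x \<xi>1 \<gamma> + T x \<xi>2 \<gamma>" by (rule fun_cong)
      moreover have "T x \<xi>1 \<gamma> = 0"
      proof -
        have "T x \<xi>1 \<gamma> = (\<Sum>\<beta>\<in>A. \<xi>1 \<beta> * T x (delta \<beta>) \<gamma>)"
          by (rule bounded_families_finite_support[OF Tb x A(1,2)]) (simp add: \<xi>1_def)
        also have "\<dots> = 0"
        proof (rule sum.neutral, rule ballI)
          fix \<beta> assume "\<beta> \<in> A"
          then have b: "\<beta> \<in> fibre x" using A by blast
          then show "\<xi>1 \<beta> * T x (delta \<beta>) \<gamma> = 0"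
            using Cstar_entry[OF T g b] zero[of "germ_div \<gamma> \<beta>"] germ_div_props(1)[OF g b] by (simp add: fibre_def)
        qed
        finally show ?thesis .
      qed
      moreover have "cmod (T x \<xi>2 \<gamma>) \<le> \<bar>C\<bar> * \<delta>"
      proof -
        have "cmod (T x \<xi>2 \<gamma>) \<le> l2_norm x (T x \<xi>2)" by (rule l2_entry_le[OF bounded_families_facts(1)[OF Tb x l2(2)] g])
        also have "\<dots> \<le> C * l2_norm x \<xi>2" using C x l2(2) unfolding dist_le_def by (auto simp: zero_family_apply)
        also have "\<dots> \<le> \<bar>C\<bar> * l2_norm x \<xi>2" by (intro mult_right_mono) auto
        also have "\<dots> \<le> \<bar>C\<bar> * \<delta>" using n2 by (intro mult_left_mono) auto
        finally show ?thesis .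
      qed
      ultimately show ?thesis by simp
    qed
    have "cmod (T x \<xi> \<gamma>) \<le> 0"
    proof (rule field_le_epsilon)
      fix e :: real assume e: "e > 0"
      have "cmod (T x \<xi> \<gamma>) \<le> \<bar>C\<bar> * (e / (\<bar>C\<bar> + 1))" using small[of "e / (\<bar>C\<bar> + 1)"] e by simp
      also have "\<dots> \<le> e" using e by (simp add: field_simps)
      finally show "cmod (T x \<xi> \<gamma>) \<le> 0 + e" by simp
    qed
    then show ?thesis by simp
  qed
  have ext: "T \<in> (\<Pi>\<^sub>E x\<in>inf_paths. l2 x \<rightarrow>\<^sub>E l2 x)" using Tb by (simp add: bounded_families_def)
  show ?thesis
  proof (rule HOL.ext, rule HOL.ext, rule HOL.ext)
    fix x \<xi> \<gamma>
    show "T x \<xi> \<gamma> = zero_family x \<xi> \<gamma>"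
    proof (cases "x \<in> inf_paths")
      case False
      then have "T x = undefined" "zero_family x = undefined" using ext by (auto simp: zero_family_def PiE_def extensional_def)
      then show ?thesis by simp
    next
      case x: True
      have Tx: "T x \<in> l2 x \<rightarrow>\<^sub>E l2 x" using ext x by (rule PiE_mem)
      show ?thesis
      proof (cases "\<xi> \<in> l2 x")
        case False
        then have "T x \<xi> = undefined" "zero_family x \<xi> = undefined"
          using Tx x by (auto simp: zero_family_def PiE_def extensional_def)
        then show ?thesis by simp
      next
        case xi: True
        have "T x \<xi> \<gamma> = 0"
          using val[OF x xi, of \<gamma>] bounded_families_facts(1)[OF Tb x xi] by (cases "\<gamma> \<in> fibre x") (auto simp: l2_def)
        then show ?thesis using zero_family_apply[OF x xi] by simp
      qed
    qed
  qed
qed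

text \<open>
  On a block where the matrix of \<open>T\<close> vanishes, a bound for \<open>T - b\<close> is a bound for \<open>b\<close>.
\<close>

lemma compression_bound:
  assumes T: "T \<in> Cstar_red" and b: "b \<in> steinberg" and dist: "dist_le T (reg_family b) \<epsilon>"
    and x: "x \<in> inf_paths" and A: "finite A" "A \<subseteq> fibre x" and S: "finite S" "S \<subseteq> fibre x"
    and zero: "\<And>\<gamma> \<beta>. \<gamma> \<in> S \<Longrightarrow> \<beta> \<in> A \<Longrightarrow> j_map T (germ_div \<gamma> \<beta>) = 0"
  shows "(\<Sum>\<gamma>\<in>S. (cmod (\<Sum>\<beta>\<in>A. b (germ_div \<gamma> \<beta>) * \<xi> \<beta>))\<^sup>2) \<le> \<epsilon>\<^sup>2 * (\<Sum>\<beta>\<in>A. (cmod (\<xi> \<beta>))\<^sup>2)"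
proof -
  have Tb: "T \<in> bounded_families" using Cstar_bounded[OF T] .
  define \<xi>' where "\<xi>' = (\<lambda>\<beta>. if \<beta> \<in> A then \<xi> \<beta> else 0)"
  have xi': "\<xi>' \<in> l2 x" "(l2_norm x \<xi>')\<^sup>2 = (\<Sum>\<beta>\<in>A. (cmod (\<xi> \<beta>))\<^sup>2)"
    using l2_finite_support[OF A, of \<xi>'] by (auto simp: \<xi>'_def)
  let ?d = "\<lambda>\<gamma>. T x \<xi>' \<gamma> - reg b x \<xi>' \<gamma>"
  have reg_l2: "reg b x \<xi>' \<in> l2 x" by (rule reg_l2[OF b xi'(1)])
  have l2: "?d \<in> l2 x"
    by (rule l2_diff[OF bounded_families_facts(1)[OF Tb x xi'(1)] reg_l2])
  have dl: "l2_norm x ?d \<le> \<epsilon> * l2_norm x \<xi>'" using dist x xi'(1) unfolding dist_le_def by (auto simp: reg_family_apply)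
  have ent: "?d \<gamma> = - (\<Sum>\<beta>\<in>A. b (germ_div \<gamma> \<beta>) * \<xi> \<beta>)" if g: "\<gamma> \<in> S" for \<gamma>
  proof -
    have gf: "\<gamma> \<in> fibre x" using g S by blast
    have "T x \<xi>' \<gamma> = (\<Sum>\<beta>\<in>A. \<xi>' \<beta> * T x (delta \<beta>) \<gamma>)"
      by (rule bounded_families_finite_support[OF Tb x A]) (simp add: \<xi>'_def)
    also have "\<dots> = 0"
      using Cstar_entry[OF T gf] zero[OF g] A by (intro sum.neutral ballI) (auto simp: subset_iff)
    finally have "T x \<xi>' \<gamma> = 0" .
    moreover have "reg b x \<xi>' \<gamma> = (\<Sum>\<beta>\<in>A. b (germ_div \<gamma> \<beta>) * \<xi>' \<beta>)"
      by (rule reg_finite[OF b gf A]) (simp add: \<xi>'_def)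
    moreover have "(\<Sum>\<beta>\<in>A. b (germ_div \<gamma> \<beta>) * \<xi>' \<beta>) = (\<Sum>\<beta>\<in>A. b (germ_div \<gamma> \<beta>) * \<xi> \<beta>)"
      by (rule sum.cong) (auto simp: \<xi>'_def)
    ultimately show ?thesis by simp
  qed
  have "(\<Sum>\<gamma>\<in>S. (cmod (\<Sum>\<beta>\<in>A. b (germ_div \<gamma> \<beta>) * \<xi> \<beta>))\<^sup>2) = (\<Sum>\<gamma>\<in>S. (cmod (?d \<gamma>))\<^sup>2)"
    using ent by (intro sum.cong) auto
  also have "\<dots> \<le> (l2_norm x ?d)\<^sup>2" by (rule l2_finite_sum_le[OF l2 S])
  also have "\<dots> \<le> (\<epsilon> * l2_norm x \<xi>')\<^sup>2" by (rule power_mono[OF dl]) simp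
  also have "\<dots> = \<epsilon>\<^sup>2 * (\<Sum>\<beta>\<in>A. (cmod (\<xi> \<beta>))\<^sup>2)" by (simp add: power_mult_distrib xi'(2))
  finally show ?thesis .
qed

section \<open>Singular elements vanish over generic paths\<close>

lemma finite_common_nbhd:
  assumes "finite I" "\<And>i. i \<in> I \<Longrightarrow> \<exists>n. \<forall>z\<in>nbhd n w. P i z"
  shows "\<exists>n. \<forall>z\<in>nbhd n w. \<forall>i\<in>I. P i z"
  using assms
proof (induction I)
  case (insert i I)
  obtain n where n: "\<forall>z\<in>nbhd n w. \<forall>i\<in>I. P i z" using insert by auto
  obtain m where m: "\<forall>z\<in>nbhd m w. P i z" using insert.prems[of i] by blast
  have "\<forall>z\<in>nbhd (max n m) w. \<forall>j\<in>insert i I. P j z"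
    using n m nbhd_antimono[of n "max n m" w] nbhd_antimono[of m "max n m" w] by auto
  then show ?case by blast
qed auto

lemma bisection_locally_constant:
  assumes B: "compact_open_bisection B" and gen: "generic w" and x: "defined_at x w"
  shows "\<exists>n. \<forall>z\<in>nbhd n w. germ x z \<in> B \<longleftrightarrow> germ x w \<in> B"
proof -
  note d = defined_atD[OF x]
  obtain R where R: "finite R" "\<And>y n v. (y, n, v) \<in> R \<Longrightarrow> basic_ok y n v" "B = (\<Union>(y, n, v)\<in>R. basic y n v)"
    using compact_open_bisection_finite_union[OF B] by metis
  obtain n0 where n0: "\<And>z. z \<in> nbhd n0 w \<Longrightarrow> defined_at x z" using app_continuous[OF x] by metis
  have "\<exists>n. \<forall>z\<in>nbhd n w. germ x z \<in> (case r of (y, n, v) \<Rightarrow> basic y n v) \<longleftrightarrow> germ x w \<in> (case r of (y, n, v) \<Rightarrow> basic y n v)"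
    if r: "r \<in> R" for r
  proof -
    obtain y n v where r_eq: "r = (y, n, v)" by (cases r) auto
    have ok: "basic_ok y n v" using R(2) r r_eq by blast
    have "v \<in> nbhd n v" using ok by (simp add: basic_ok_def)
    then have "y \<in> words" using ok defined_atD(1) unfolding basic_ok_def by blast
    then obtain m where m: "(\<forall>z\<in>nbhd m w. agree x y z) \<or> (\<forall>z\<in>nbhd m w. \<not> agree x y z)"
      using gen d(1) unfolding generic_def by blast
    have "germ x z \<in> basic y n v \<longleftrightarrow> germ x w \<in> basic y n v" if z: "z \<in> nbhd (max n0 (max m n)) w" for z
    proof -
      have "n0 \<le> max n0 (max m n)" "m \<le> max n0 (max m n)" "n \<le> max n0 (max m n)" by linarith+
      then have zz: "z \<in> nbhd n0 w" "z \<in> nbhd m w" "z \<in> nbhd n w"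
        using z nbhd_antimono[of n0 "max n0 (max m n)" w] nbhd_antimono[of m "max n0 (max m n)" w] nbhd_antimono[of n "max n0 (max m n)" w] by auto
      have "z \<in> nbhd n v \<longleftrightarrow> w \<in> nbhd n v" using zz(3) d(2) by (auto simp: in_nbhd)
      moreover have "agree x y z \<longleftrightarrow> agree x y w" using m zz(2) d(2) by auto
      ultimately show ?thesis using germ_in_basic[OF ok n0[OF zz(1)]] germ_in_basic[OF ok x] by simp
    qed
    then show ?thesis unfolding r_eq by auto
  qed
  note local = this
  have "\<exists>n. \<forall>z\<in>nbhd n w. \<forall>r\<in>R. germ x z \<in> (case r of (y, n, v) \<Rightarrow> basic y n v) \<longleftrightarrow> germ x w \<in> (case r of (y, n, v) \<Rightarrow> basic y n v)"
    by (rule finite_common_nbhd[OF R(1)]) (erule local)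
  then obtain n where n: "\<And>z r. z \<in> nbhd n w \<Longrightarrow> r \<in> R \<Longrightarrow>
    germ x z \<in> (case r of (y, n, v) \<Rightarrow> basic y n v) \<longleftrightarrow> germ x w \<in> (case r of (y, n, v) \<Rightarrow> basic y n v)" by blast
  have "\<forall>z\<in>nbhd n w. germ x z \<in> B \<longleftrightarrow> germ x w \<in> B"
    unfolding R(3) UN_iff using n by blast
  then show ?thesis by blast
qed

lemma steinberg_locally_constant:
  assumes f: "f \<in> steinberg" and gen: "generic w" and x: "defined_at x w"
  shows "\<exists>n. \<forall>z\<in>nbhd n w. f (germ x z) = f (germ x w)"
proof -
  obtain F c where F: "f = (\<lambda>\<gamma>. \<Sum>B\<in>F. c B * indicator B \<gamma>)" "finite F" "\<And>B. B \<in> F \<Longrightarrow> compact_open_bisection B"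
    using f unfolding steinberg_def by blast
  obtain n where n: "\<forall>z\<in>nbhd n w. \<forall>B\<in>F. germ x z \<in> B \<longleftrightarrow> germ x w \<in> B"
    using finite_common_nbhd[OF F(2), of w "\<lambda>B z. germ x z \<in> B \<longleftrightarrow> germ x w \<in> B"] bisection_locally_constant[OF F(3) gen x] by blast
  have "f (germ x z) = f (germ x w)" if "z \<in> nbhd n w" for z
    unfolding F(1) using n that by (intro sum.cong) (auto simp: indicator_def)
  then show ?thesis by blast
qed

text \<open>
  Over a generic path every function of the Steinberg algebra is locally constant along the germ of a
  word. If \<open>j(T)\<close> did not vanish at such a germ, then a close approximation would be constant and large
  near it, and \<open>j(T)\<close> would be nonzero on an open set.
\<close>

lemma singular_vanishes_over_generic:
  assumes T: "T \<in> singular_ideal" and g: "\<gamma> \<in> germs" and gen: "generic (germ_source \<gamma>)"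
  shows "j_map T \<gamma> = 0"
proof (rule ccontr)
  assume ne: "j_map T \<gamma> \<noteq> 0"
  have TC: "T \<in> Cstar_red" and int: "germ_top interior_of supp (j_map T) = {}" using T by (auto simp: singular_ideal_def)
  note Tb = Cstar_bounded[OF TC]
  obtain x w where x: "defined_at x w" "\<gamma> = germ x w" using g germs_cases by blast
  have w: "generic w" using gen x germ_source_germ[OF x(1)] by simp
  define \<epsilon> where "\<epsilon> = cmod (j_map T \<gamma>) / 3"
  have e: "\<epsilon> > 0" using ne by (simp add: \<epsilon>_def)
  obtain f where f: "f \<in> steinberg" "dist_le T (reg_family f) \<epsilon>" using TC e unfolding Cstar_red_def by blast
  obtain n where n: "\<forall>z\<in>nbhd n w. f (germ x z) = f (germ x w)" using steinberg_locally_constant[OF f(1) w x(1)] by blast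
  obtain m where m: "m \<ge> n" "\<And>z. z \<in> nbhd m w \<Longrightarrow> defined_at x z" using app_continuous[OF x(1)] by metis
  have ok: "basic_ok x m w" using m defined_atD(2)[OF x(1)] by (simp add: basic_ok_def)
  have "basic x m w \<subseteq> supp (j_map T)"
  proof
    fix \<zeta> assume "\<zeta> \<in> basic x m w"
    then obtain z where z: "z \<in> nbhd m w" "\<zeta> = germ x z" by (auto simp: basic_def)
    have zg: "\<zeta> \<in> germs" using germ_in_germs[OF m(2)[OF z(1)]] z by simp
    have "f \<zeta> = f \<gamma>" using n z x nbhd_antimono[OF m(1)] by auto
    then have "cmod (j_map T \<gamma>) \<le> cmod (j_map T \<zeta>) + cmod (j_map T \<gamma> - f \<gamma>) + cmod (j_map T \<zeta> - f \<zeta>)"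
      using norm_triangle_ineq[of "j_map T \<zeta>" "(j_map T \<gamma> - f \<gamma>) - (j_map T \<zeta> - f \<zeta>)"]
        norm_triangle_ineq4[of "j_map T \<gamma> - f \<gamma>" "j_map T \<zeta> - f \<zeta>"] by simp
    moreover have "cmod (j_map T \<gamma>) = 3 * \<epsilon>" by (simp add: \<epsilon>_def)
    ultimately have "cmod (j_map T \<zeta>) > 0"
      using j_map_dist[OF Tb f g] j_map_dist[OF Tb f zg] e by linarith
    then show "\<zeta> \<in> supp (j_map T)" using zg by (simp add: supp_def)
  qed
  then have "basic x m w \<subseteq> germ_top interior_of supp (j_map T)"
    using openin_basic[OF ok] by (rule interior_of_maximal)
  moreover have "germ x w \<in> basic x m w" using defined_atD(2)[OF x(1)] by (auto simp: basic_def)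
  ultimately show False using int by blast
qed

text \<open>
  Every nonempty open set contains a germ over a generic path.
\<close>

lemma alg_singularI:
  assumes count: "countable words" and f: "f \<in> steinberg"
    and zero: "\<And>\<gamma>. \<gamma> \<in> germs \<Longrightarrow> generic (germ_source \<gamma>) \<Longrightarrow> f \<gamma> = 0"
  shows "f \<in> alg_singular_ideal"
proof -
  have "germ_top interior_of supp f = {}"
  proof (rule ccontr)
    assume "germ_top interior_of supp f \<noteq> {}"
    then obtain \<gamma> where g: "\<gamma> \<in> germ_top interior_of supp f" by blast
    have op: "openin germ_top (germ_top interior_of supp f)" by (rule openin_interior_of)
    have sub: "germ_top interior_of supp f \<subseteq> supp f" by (rule interior_of_subset)
    have "\<gamma> \<in> germs" using g sub by (auto simp: supp_def)
    then obtain x w where x: "defined_at x w" "\<gamma> = germ x w" using germs_cases by blast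
    obtain n where n: "basic_ok x n w" "basic x n w \<subseteq> germ_top interior_of supp f"
      using open_contains_basic[OF op x(1)] g x by blast
    obtain y where y: "y \<in> nbhd n w" "generic y" using generic_dense[OF count defined_atD(2)[OF x(1)]] by blast
    have d: "defined_at x y" using n(1) y(1) by (simp add: basic_ok_def)
    have "germ x y \<in> supp f" using n(2) y(1) sub by (auto simp: basic_def)
    then show False using zero[of "germ x y"] germ_in_germs[OF d] germ_source_germ[OF d] y(2) by (simp add: supp_def)
  qed
  then show ?thesis using f by (simp add: alg_singular_ideal_def)
qed

section \<open>Linear combinations of bisections\<close>

lemma steinberg_zero: "(\<lambda>_. 0) \<in> steinberg"
  unfolding steinberg_def by (auto intro!: exI[of _ "{}"])

lemma steinberg_indicator: "compact_open_bisection B \<Longrightarrow> (\<lambda>\<gamma>. c * indicator B \<gamma>) \<in> steinberg"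
  unfolding steinberg_def
  by (intro CollectI exI[of _ "{B}"] exI[of _ "\<lambda>_. c"])
    (simp only: sum.insert finite.emptyI empty_iff not_False_eq_True sum.empty add_0_right finite.insertI ball_simps simp_thms)

lemma steinberg_add:
  assumes "f \<in> steinberg" "g \<in> steinberg" shows "(\<lambda>\<gamma>. f \<gamma> + g \<gamma>) \<in> steinberg"
proof -
  obtain F c where F: "f = (\<lambda>\<gamma>. \<Sum>B\<in>F. c B * indicator B \<gamma>)" "finite F" "\<forall>B\<in>F. compact_open_bisection B"
    using assms(1) unfolding steinberg_def by blast
  obtain F' c' where F': "g = (\<lambda>\<gamma>. \<Sum>B\<in>F'. c' B * indicator B \<gamma>)" "finite F'" "\<forall>B\<in>F'. compact_open_bisection B"
    using assms(2) unfolding steinberg_def by blast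
  let ?d = "\<lambda>B. (if B \<in> F then c B else 0) + (if B \<in> F' then c' B else 0)"
  have "f \<gamma> + g \<gamma> = (\<Sum>B\<in>F \<union> F'. ?d B * indicator B \<gamma>)" for \<gamma>
  proof -
    have "f \<gamma> = (\<Sum>B\<in>F \<union> F'. (if B \<in> F then c B else 0) * indicator B \<gamma>)"
      unfolding F(1) using F(2) F'(2) by (intro sum.mono_neutral_cong_left) auto
    moreover have "g \<gamma> = (\<Sum>B\<in>F \<union> F'. (if B \<in> F' then c' B else 0) * indicator B \<gamma>)"
      unfolding F'(1) using F(2) F'(2) by (intro sum.mono_neutral_cong_left) auto
    ultimately show ?thesis by (simp add: sum.distrib distrib_right)
  qed
  then show ?thesis unfolding steinberg_def
    using F F' by (intro CollectI exI[of _ "F \<union> F'"] exI[of _ ?d]) auto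
qed

lemma steinberg_sum_list:
  assumes "\<And>c g. (c, g) \<in> set L \<Longrightarrow> compact_open_bisection (Z g)"
  shows "(\<lambda>\<gamma>. \<Sum>(c, g)\<leftarrow>L. c * indicator (Z g) \<gamma>) \<in> steinberg"
  using assms
proof (induction L)
  case Nil
  then show ?case using steinberg_zero by simp
next
  case (Cons a L)
  obtain c g where a: "a = (c, g)" by (cases a)
  have "(\<lambda>\<gamma>. \<Sum>(c, g)\<leftarrow>L. c * indicator (Z g) \<gamma>) \<in> steinberg"
    by (rule Cons.IH) (use Cons.prems in auto)
  moreover have "compact_open_bisection (Z g)" using Cons.prems[of c g] a by simp
  ultimately show ?case using steinberg_add[OF steinberg_indicator[of "Z g" c]] a by simp
qed

section \<open>Loops at prefixes of a path\<close>

definition vertex_at :: "'e stream \<Rightarrow> nat \<Rightarrow> 'v" where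
  "vertex_at x n = inf_range (sdrop n x)"

text \<open>
  The element \<open>p g p\<^sup>*\<close> for the prefix \<open>p\<close> of length \<open>n\<close> of \<open>x\<close>.
\<close>

definition loop :: "'e stream \<Rightarrow> nat \<Rightarrow> 'g \<Rightarrow> ('v, 'e, 'g) word" where
  "loop x n g = nf_word (vertex_at x n) (stake n x) g (stake n x)"

definition stab :: "'e stream \<Rightarrow> nat \<Rightarrow> 'g set" where
  "stab x n = {g \<in> carrier (G (vertex_at x n)). app (loop x n g) x = x}"

lemma vertex_at_verts: "x \<in> inf_paths \<Longrightarrow> vertex_at x n \<in> verts E"
  unfolding vertex_at_def using inf_range_verts inf_paths_sdrop by blast

lemma loop_params:
  "x \<in> inf_paths \<Longrightarrow> g \<in> carrier (G (vertex_at x n)) \<Longrightarrow> nf_params (vertex_at x n) (stake n x) g (stake n x)"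
  unfolding nf_params_def vertex_at_def using walk_stake by blast

lemma loop_words: "x \<in> inf_paths \<Longrightarrow> g \<in> carrier (G (vertex_at x n)) \<Longrightarrow> loop x n g \<in> words"
  unfolding loop_def by (rule nf_word_in_words[OF loop_params])

lemma nbhd_vertex: "x \<in> inf_paths \<Longrightarrow> z \<in> nbhd n x \<Longrightarrow> inf_range (sdrop n z) = vertex_at x n"
  unfolding vertex_at_def by (rule walk_stake_range_eq)

lemma loop_reads:
  assumes x: "x \<in> inf_paths" and g: "g \<in> carrier (G (vertex_at x n))" and z: "z \<in> nbhd n x"
  shows "reads (loop x n g) z n (stake n x) g"
  using word_rel_nf_word_apex[OF loop_params[OF x g]] z nbhd_vertex[OF x z]
  by (simp add: reads_def loop_def in_nbhd)

lemma loop_defined: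
  assumes x: "x \<in> inf_paths" and g: "g \<in> carrier (G (vertex_at x n))" and z: "z \<in> nbhd n x"
  shows "defined_at (loop x n g) z" "app (loop x n g) z \<in> nbhd n x"
    "app (loop x n g) z = stake n x @- inf_act (vertex_at x n) g (sdrop n z)"
proof -
  have zp: "z \<in> inf_paths" using z by (simp add: in_nbhd)
  note r = loop_reads[OF assms]
  show "defined_at (loop x n g) z" by (rule defined_atI[OF loop_words[OF x g] zp r])
  have eq: "app (loop x n g) z = value_at z n (stake n x) g" by (rule app_eq[OF zp loop_words[OF x g] r])
  then show "app (loop x n g) z = stake n x @- inf_act (vertex_at x n) g (sdrop n z)"
    by (simp add: value_at_def nbhd_vertex[OF x z])
  have "walk (inf_range x) (stake n x) (inf_range (sdrop n z))"
    using walk_stake[OF x, of n] nbhd_vertex[OF x z] by (simp add: vertex_at_def)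
  from value_at_props[OF zp _ this] g show "app (loop x n g) z \<in> nbhd n x"
    unfolding eq in_nbhd nbhd_vertex[OF x z] by simp
qed

lemma loop_mult:
  assumes x: "x \<in> inf_paths" and g: "g \<in> carrier (G (vertex_at x n))" and h: "h \<in> carrier (G (vertex_at x n))"
    and z: "z \<in> nbhd n x"
  shows "agree (loop x n g @ loop x n h) (loop x n (g \<otimes>\<^bsub>G (vertex_at x n)\<^esub> h)) z"
    "app (loop x n (g \<otimes>\<^bsub>G (vertex_at x n)\<^esub> h)) z = app (loop x n g) (app (loop x n h) z)"
proof -
  have zp: "z \<in> inf_paths" using z by (simp add: in_nbhd)
  have gh: "g \<otimes>\<^bsub>G (vertex_at x n)\<^esub> h \<in> carrier (G (vertex_at x n))" using g h vertex_at_verts[OF x] by simp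
  have r: "reads (loop x n g) (app (loop x n h) z) (length (stake n x)) (stake n x) g"
    using loop_reads[OF x g loop_defined(2)[OF x h z]] by simp
  have "reads (loop x n g @ loop x n h) z n (stake n x) (g \<otimes>\<^bsub>G (vertex_at x n)\<^esub> h)"
    using reads_append[OF loop_words[OF x h] loop_words[OF x g] zp loop_reads[OF x h z]] r nbhd_vertex[OF x z] by auto
  then show a: "agree (loop x n g @ loop x n h) (loop x n (g \<otimes>\<^bsub>G (vertex_at x n)\<^esub> h)) z"
    using loop_reads[OF x gh z] unfolding agree_def by blast
  have "app (loop x n g @ loop x n h) z = app (loop x n (g \<otimes>\<^bsub>G (vertex_at x n)\<^esub> h)) z"
    using agree_app[OF a zp words_append[OF loop_words[OF x g] loop_words[OF x h]] loop_words[OF x gh]] .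
  then show "app (loop x n (g \<otimes>\<^bsub>G (vertex_at x n)\<^esub> h)) z = app (loop x n g) (app (loop x n h) z)"
    using defined_append(2)[OF loop_defined(1)[OF x h z] loop_defined(1)[OF x g loop_defined(2)[OF x h z]]] by simp
qed

lemma loop_one:
  assumes x: "x \<in> inf_paths" and z: "z \<in> nbhd n x"
  shows "app (loop x n \<one>\<^bsub>G (vertex_at x n)\<^esub>) z = z"
    "defined_at t z \<Longrightarrow> agree (t @ loop x n \<one>\<^bsub>G (vertex_at x n)\<^esub>) t z"
proof -
  let ?o = "\<one>\<^bsub>G (vertex_at x n)\<^esub>"
  have zp: "z \<in> inf_paths" using z by (simp add: in_nbhd)
  have o: "?o \<in> carrier (G (vertex_at x n))" using vertex_at_verts[OF x] by simp
  have st: "stake n x = stake n z" using z by (simp add: in_nbhd)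
  show app: "app (loop x n ?o) z = z"
    using loop_defined(3)[OF x o z] inf_act_one[OF inf_paths_sdrop[OF zp, of n]] nbhd_vertex[OF x z] st
    by (simp add: stake_sdrop)
  assume t: "defined_at t z"
  obtain m p k where m: "m \<ge> n" "reads t z m p k" using reads_ge[OF t, of n] by blast
  let ?u = "inf_range (sdrop m z)"
  have u: "?u \<in> verts E" using inf_range_verts inf_paths_sdrop zp by blast
  let ?r = "stake (m - n) (sdrop n z)"
  have r: "walk (vertex_at x n) ?r ?u"
    using walk_stake[OF inf_paths_sdrop[OF zp, of n], of "m - n"] nbhd_vertex[OF x z] m(1) by simp
  have "reads (loop x n ?o) z m (stake m z) \<one>\<^bsub>G ?u\<^esub>"
    using reads_mono[OF zp loop_words[OF x o] loop_reads[OF x o z] m(1)] nbhd_vertex[OF x z] act_one[OF r] secs_one[OF r]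
      stake_split[OF m(1), of z] st by simp
  from reads_append[OF loop_words[OF x o] defined_atD(1)[OF t] zp this, of p k]
  have "reads (t @ loop x n ?o) z m p k"
    using m(2) app reads_facts(1)[OF zp defined_atD(1)[OF t] m(2)] u by auto
  then show "agree (t @ loop x n ?o) t z" using m(2) unfolding agree_def by blast
qed

lemma loop_agree_iff:
  assumes x: "x \<in> inf_paths" and g: "g \<in> carrier (G (vertex_at x n))" and h: "h \<in> carrier (G (vertex_at x n))"
    and z: "z \<in> nbhd n x"
  shows "agree (loop x n g) (loop x n h) z \<longleftrightarrow>
    agree (loop x n (inv\<^bsub>G (vertex_at x n)\<^esub> g \<otimes>\<^bsub>G (vertex_at x n)\<^esub> h)) (loop x n \<one>\<^bsub>G (vertex_at x n)\<^esub>) z"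
proof -
  let ?G = "G (vertex_at x n)"
  have v: "vertex_at x n \<in> verts E" using vertex_at_verts[OF x] .
  have zp: "z \<in> inf_paths" using z by (simp add: in_nbhd)
  note lw = loop_words[OF x]
  have mul: "agree (loop x n (k \<otimes>\<^bsub>?G\<^esub> a)) (loop x n (k \<otimes>\<^bsub>?G\<^esub> b)) z"
    if ab: "agree (loop x n a) (loop x n b) z" and c: "a \<in> carrier ?G" "b \<in> carrier ?G" "k \<in> carrier ?G" for a b k
  proof -
    have kc: "k \<otimes>\<^bsub>?G\<^esub> a \<in> carrier ?G" "k \<otimes>\<^bsub>?G\<^esub> b \<in> carrier ?G" using c v by auto
    have 1: "agree (loop x n k @ loop x n a) (loop x n k @ loop x n b) z"
      by (rule agree_append_left[OF ab loop_defined(1)[OF x c(1) z] lw[OF c(2)] loop_defined(1)[OF x c(3) loop_defined(2)[OF x c(1) z]]])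
    note w = words_append[OF lw[OF c(3)] lw[OF c(1)]] words_append[OF lw[OF c(3)] lw[OF c(2)]]
    show ?thesis
      by (rule agree_trans[OF agree_trans[OF agree_sym[OF loop_mult(1)[OF x c(3,1) z]] 1 zp lw[OF kc(1)] w] loop_mult(1)[OF x c(3,2) z] zp lw[OF kc(1)] w(2) lw[OF kc(2)]])
  qed
  have i: "inv\<^bsub>?G\<^esub> g \<in> carrier ?G" "inv\<^bsub>?G\<^esub> g \<otimes>\<^bsub>?G\<^esub> h \<in> carrier ?G" "\<one>\<^bsub>?G\<^esub> \<in> carrier ?G" using g h v by auto
  have e: "g \<otimes>\<^bsub>?G\<^esub> (inv\<^bsub>?G\<^esub> g \<otimes>\<^bsub>?G\<^esub> h) = h" using g h v by (simp flip: G_assoc)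
  show ?thesis
  proof
    assume "agree (loop x n g) (loop x n h) z"
    from mul[OF this g h i(1)]
    show "agree (loop x n (inv\<^bsub>?G\<^esub> g \<otimes>\<^bsub>?G\<^esub> h)) (loop x n \<one>\<^bsub>?G\<^esub>) z" using g v agree_sym by simp
  next
    assume "agree (loop x n (inv\<^bsub>?G\<^esub> g \<otimes>\<^bsub>?G\<^esub> h)) (loop x n \<one>\<^bsub>?G\<^esub>) z"
    from mul[OF this i(2,3) g] show "agree (loop x n g) (loop x n h) z" using e g v agree_sym by simp
  qed
qed

text \<open>
  The subgroup of those \<open>g\<close> whose loop has a trivial germ at \<open>z\<close>; the germs of loops at \<open>z\<close> are its
  cosets by \<open>germ_loop_eq_iff\<close>.
\<close>

definition trivial_at :: "'e stream \<Rightarrow> nat \<Rightarrow> 'e stream \<Rightarrow> 'g set" where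
  "trivial_at x n z = {g \<in> carrier (G (vertex_at x n)). agree (loop x n g) (loop x n \<one>\<^bsub>G (vertex_at x n)\<^esub>) z}"

lemma germ_loop_eq_iff:
  assumes x: "x \<in> inf_paths" and g: "g \<in> carrier (G (vertex_at x n))" and h: "h \<in> carrier (G (vertex_at x n))"
    and z: "z \<in> nbhd n x"
  shows "germ (loop x n g) z = germ (loop x n h) z \<longleftrightarrow>
    inv\<^bsub>G (vertex_at x n)\<^esub> g \<otimes>\<^bsub>G (vertex_at x n)\<^esub> h \<in> trivial_at x n z"
  using germ_eq_iff[OF loop_defined(1)[OF x g z] loop_defined(1)[OF x h z]] loop_agree_iff[OF assms] g h vertex_at_verts[OF x]
  by (simp add: trivial_at_def)

lemma trivial_at_subgroup:
  assumes x: "x \<in> inf_paths" and z: "z \<in> nbhd n x"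
  shows "subgroup (trivial_at x n z) (G (vertex_at x n))"
proof -
  let ?G = "G (vertex_at x n)"
  have v: "vertex_at x n \<in> verts E" using vertex_at_verts[OF x] .
  interpret A: comm_group ?G by (rule fibre_group[OF v])
  note e = germ_loop_eq_iff[OF x _ _ z]
  have carr: "trivial_at x n z \<subseteq> carrier ?G" by (auto simp: trivial_at_def)
  have one: "\<one>\<^bsub>?G\<^esub> \<in> trivial_at x n z" using e[OF A.one_closed A.one_closed] by simp
  have triv: "g \<in> trivial_at x n z \<longleftrightarrow> germ (loop x n g) z = germ (loop x n \<one>\<^bsub>?G\<^esub>) z" if "g \<in> carrier ?G" for g
    using e[OF A.one_closed that] that by auto
  have inv: "inv\<^bsub>?G\<^esub> g \<in> trivial_at x n z" if g: "g \<in> trivial_at x n z" for g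
  proof -
    have gc: "g \<in> carrier ?G" using g carr by blast
    show ?thesis using e[OF gc A.one_closed] triv[OF gc] g gc by simp
  qed
  show ?thesis
  proof (rule A.subgroupI)
    show "trivial_at x n z \<subseteq> carrier ?G" by (rule carr)
    show "trivial_at x n z \<noteq> {}" using one by blast
    show "inv\<^bsub>?G\<^esub> g \<in> trivial_at x n z" if "g \<in> trivial_at x n z" for g by (rule inv[OF that])
    fix g h assume gh: "g \<in> trivial_at x n z" "h \<in> trivial_at x n z"
    have c: "g \<in> carrier ?G" "h \<in> carrier ?G" "inv\<^bsub>?G\<^esub> g \<in> carrier ?G" using gh carr by auto
    have "germ (loop x n (inv\<^bsub>?G\<^esub> g)) z = germ (loop x n h) z"
      using triv[OF c(3)] triv[OF c(2)] inv[OF gh(1)] gh(2) by simp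
    then show "g \<otimes>\<^bsub>?G\<^esub> h \<in> trivial_at x n z" using e[OF c(3,2)] c by simp
  qed
qed

lemma stab_subgroup:
  assumes x: "x \<in> inf_paths" shows "subgroup (stab x n) (G (vertex_at x n))"
proof -
  let ?G = "G (vertex_at x n)"
  have v: "vertex_at x n \<in> verts E" using vertex_at_verts[OF x] .
  interpret A: comm_group ?G by (rule fibre_group[OF v])
  note m = loop_mult(2)[OF x _ _ nbhd_self[OF x]]
  show ?thesis
  proof (rule A.subgroupI)
    show "stab x n \<subseteq> carrier ?G" by (auto simp: stab_def)
    show "stab x n \<noteq> {}" using loop_one(1)[OF x nbhd_self[OF x]] A.one_closed by (auto simp: stab_def)
  next
    fix g assume g: "g \<in> stab x n"
    then have c: "g \<in> carrier ?G" "inv\<^bsub>?G\<^esub> g \<in> carrier ?G" "app (loop x n g) x = x" by (auto simp: stab_def)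
    have "app (loop x n (inv\<^bsub>?G\<^esub> g)) x = x"
      using m[OF c(2,1)] c loop_one(1)[OF x nbhd_self[OF x]] by simp
    then show "inv\<^bsub>?G\<^esub> g \<in> stab x n" using c by (simp add: stab_def)
  next
    fix g h assume "g \<in> stab x n" "h \<in> stab x n"
    then have c: "g \<in> carrier ?G" "h \<in> carrier ?G" "app (loop x n g) x = x" "app (loop x n h) x = x" by (auto simp: stab_def)
    then show "g \<otimes>\<^bsub>?G\<^esub> h \<in> stab x n" using m[OF c(1,2)] by (simp add: stab_def)
  qed
qed

text \<open>
  Passing to a longer prefix replaces \<open>g\<close> by its section, which fixes the shorter tail.
\<close>

lemma loop_level:
  assumes x: "x \<in> inf_paths" and g: "g \<in> stab x n" and n: "n \<le> m"
  obtains g' where "g' \<in> stab x m" "agree (loop x n g) (loop x m g') x"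
proof -
  let ?r = "stake (m - n) (sdrop n x)" and ?v = "vertex_at x n" and ?u = "vertex_at x m"
  have gc: "g \<in> carrier (G ?v)" and fix_x: "app (loop x n g) x = x" using g by (auto simp: stab_def)
  note xn = nbhd_self[OF x]
  have r: "walk ?v ?r ?u"
    using walk_stake[OF inf_paths_sdrop[OF x, of n], of "m - n"] n by (simp add: vertex_at_def)
  have x_eq: "x = stake n x @- inf_act ?v g (sdrop n x)" using loop_defined(3)[OF x gc xn] fix_x by simp
  have "sdrop n x = inf_act ?v g (sdrop n x)"
    using arg_cong[OF x_eq, of "sdrop n"] by (simp add: sdrop_shift)
  then have "?r = act ?v g ?r"
    using stake_inf_act[OF inf_paths_sdrop[OF x, of n], of g "m - n"] gc by (simp add: vertex_at_def)
  then have fixr: "act ?v g ?r = ?r" by simp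
  let ?g = "secs g ?r"
  have g': "?g \<in> carrier (G ?u)" using secs_closed[OF r gc] .
  have rd: "reads (loop x n g) x m (stake m x) ?g"
    using reads_mono[OF x loop_words[OF x gc] loop_reads[OF x gc xn] n] fixr stake_split[OF n, of x]
    by (simp add: vertex_at_def)
  have a: "agree (loop x n g) (loop x m ?g) x"
    using rd loop_reads[OF x g' nbhd_self[OF x]] unfolding agree_def by blast
  have "app (loop x m ?g) x = x"
    using agree_app[OF a x loop_words[OF x gc] loop_words[OF x g']] fix_x by simp
  then have "?g \<in> stab x m" using g' by (simp add: stab_def)
  then show thesis using that a by blast
qed

section \<open>Elements of the Steinberg algebra near a path\<close>

text \<open>
  Left multiplication with \<open>t\<close> carries germs of loops near \<open>x\<close> to germs that start on the same path; by the
  last equation the result depends only on the germ of the loop.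
\<close>

lemma twisted_loop:
  assumes x: "x \<in> inf_paths" and t: "basic_ok t n x" and z: "z \<in> nbhd n x"
    and g: "g \<in> carrier (G (vertex_at x n))"
  shows "defined_at (t @ loop x n g) z" "app (t @ loop x n g) z = app t (app (loop x n g) z)"
    "germ (t @ loop x n g) z = germ_mult (germ t (germ_range (germ (loop x n g) z))) (germ (loop x n g) z)"
proof -
  have d: "defined_at t (app (loop x n g) z)" using t loop_defined(2)[OF x g z] by (simp add: basic_ok_def)
  note l = loop_defined(1)[OF x g z]
  show "defined_at (t @ loop x n g) z" "app (t @ loop x n g) z = app t (app (loop x n g) z)"
    using defined_append[OF l d] by auto
  show "germ (t @ loop x n g) z = germ_mult (germ t (germ_range (germ (loop x n g) z))) (germ (loop x n g) z)"
    using germ_mult_germ[OF l d] germ_range_germ[OF l] by simp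
qed

lemma basic_ok_word: "basic_ok t n x \<Longrightarrow> t \<in> words"
  unfolding basic_ok_def using nbhd_self defined_atD(1) by blast

lemma twisted_loop_eq_iff:
  assumes x: "x \<in> inf_paths" and t: "basic_ok t n x" and z: "z \<in> nbhd n x"
    and g: "g \<in> carrier (G (vertex_at x n))" and h: "h \<in> carrier (G (vertex_at x n))"
  shows "germ (t @ loop x n g) z = germ (t @ loop x n h) z \<longleftrightarrow> germ (loop x n g) z = germ (loop x n h) z"
proof
  assume "germ (loop x n g) z = germ (loop x n h) z"
  then show "germ (t @ loop x n g) z = germ (t @ loop x n h) z"
    using twisted_loop(3)[OF x t z g] twisted_loop(3)[OF x t z h] by simp
next
  assume eq: "germ (t @ loop x n g) z = germ (t @ loop x n h) z"
  have zp: "z \<in> inf_paths" using z by (simp add: in_nbhd)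
  note dg = twisted_loop(1)[OF x t z g] and dh = twisted_loop(1)[OF x t z h]
  note lg = loop_defined(1)[OF x g z] and lh = loop_defined(1)[OF x h z]
  note wg = loop_words[OF x g] and wh = loop_words[OF x h] and wt = basic_ok_word[OF t]
  note ws = word_star_in_words[OF wt]
  have tg: "defined_at t (app (loop x n g) z)" using t loop_defined(2)[OF x g z] by (simp add: basic_ok_def)
  have th: "defined_at t (app (loop x n h) z)" using t loop_defined(2)[OF x h z] by (simp add: basic_ok_def)
  have a: "agree (t @ loop x n g) (t @ loop x n h) z" using eq germ_eq_iff[OF dg dh] by simp
  have ds: "defined_at (word_star t) (app (t @ loop x n g) z)"
    using twisted_loop(2)[OF x t z g] defined_word_star(1)[OF tg] by simp
  have 1: "agree (word_star t @ t @ loop x n g) (word_star t @ t @ loop x n h) z"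
    by (rule agree_append_left[OF a dg words_append[OF wt wh] ds])
  note w3 = words_append[OF ws words_append[OF wt wg]] words_append[OF ws words_append[OF wt wh]]
  have "agree (loop x n g) (loop x n h) z"
    by (rule agree_trans[OF agree_trans[OF agree_sym[OF agree_cancel_left[OF lg tg]] 1 zp wg w3] agree_cancel_left[OF lh th] zp wg w3(2) wh])
  then show "germ (loop x n g) z = germ (loop x n h) z" using germ_eq_iff[OF lg lh] by simp
qed

lemma twisted_div:
  assumes x: "x \<in> inf_paths" and t: "basic_ok t n x" and z: "z \<in> nbhd n x"
    and g: "g \<in> carrier (G (vertex_at x n))" and h: "h \<in> carrier (G (vertex_at x n))"
  shows "germ_div (germ (t @ loop x n h) z) (germ (loop x n g) z)
    = germ (t @ loop x n (h \<otimes>\<^bsub>G (vertex_at x n)\<^esub> inv\<^bsub>G (vertex_at x n)\<^esub> g)) (app (loop x n g) z)"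
proof -
  let ?G = "G (vertex_at x n)" and ?y = "app (loop x n g) z"
  let ?k = "h \<otimes>\<^bsub>?G\<^esub> inv\<^bsub>?G\<^esub> g"
  have v: "vertex_at x n \<in> verts E" using vertex_at_verts[OF x] .
  have zp: "z \<in> inf_paths" using z by (simp add: in_nbhd)
  have k: "?k \<in> carrier ?G" "?k \<otimes>\<^bsub>?G\<^esub> g = h" using g h v by (auto simp: G_assoc)
  have y: "?y \<in> nbhd n x" using loop_defined(2)[OF x g z] .
  note lw = loop_words[OF x] and wt = basic_ok_word[OF t]
  have ld: "defined_at (loop x n ?k @ loop x n g) z"
    using defined_append(1)[OF loop_defined(1)[OF x g z] loop_defined(1)[OF x k(1) y]] .
  have ap: "app (loop x n ?k @ loop x n g) z = app (loop x n h) z"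
    using defined_append(2)[OF loop_defined(1)[OF x g z] loop_defined(1)[OF x k(1) y]] loop_mult(2)[OF x k(1) g z] k(2) by simp
  have "defined_at t (app (loop x n ?k @ loop x n g) z)"
    unfolding ap using t loop_defined(2)[OF x h z] by (simp add: basic_ok_def)
  moreover have "agree (loop x n ?k @ loop x n g) (loop x n h) z" using loop_mult(1)[OF x k(1) g z] k(2) by simp
  ultimately have "agree (t @ loop x n ?k @ loop x n g) (t @ loop x n h) z"
    using agree_append_left[OF _ ld lw[OF h]] by blast
  then have "germ (t @ loop x n h) z = germ ((t @ loop x n ?k) @ loop x n g) z"
    using germ_eq_iff[OF twisted_loop(1)[OF x t z h] defined_append(1)[OF loop_defined(1)[OF x g z] twisted_loop(1)[OF x t y k(1)]]]
      agree_sym by simp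
  then show ?thesis
    using germ_div_eq_iff[OF twisted_loop(1)[OF x t z h] loop_defined(1)[OF x g z] twisted_loop(1)[OF x t y k(1)]] by blast
qed

lemma bisection_near_isotropy:
  assumes B: "compact_open_bisection B" and x: "x \<in> inf_paths" and t: "basic_ok t n x"
    and a: "a \<in> carrier (G (vertex_at x n))" "germ (t @ loop x n a) x \<in> B"
    and h: "h \<in> carrier (G (vertex_at x n))"
  shows "\<exists>N. \<forall>z\<in>nbhd N x. z \<in> nbhd n x \<longrightarrow> (germ (t @ loop x n h) z \<in> B \<longleftrightarrow> germ (loop x n h) z = germ (loop x n a) z)"
proof -
  have op: "openin germ_top B" and inj: "inj_on germ_source B" using B by (auto simp: compact_open_bisection_def)
  obtain N where N: "\<forall>z\<in>nbhd N x. germ (t @ loop x n a) z \<in> B"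
    using op[unfolded openin_germ_top_iff] twisted_loop(1)[OF x t nbhd_self[OF x] a(1)] a(2) by blast
  have "germ (t @ loop x n h) z \<in> B \<longleftrightarrow> germ (loop x n h) z = germ (loop x n a) z"
    if z: "z \<in> nbhd N x" "z \<in> nbhd n x" for z
  proof -
    have aB: "germ (t @ loop x n a) z \<in> B" using N z by blast
    have src: "germ_source (germ (t @ loop x n h) z) = germ_source (germ (t @ loop x n a) z)"
      using germ_source_germ[OF twisted_loop(1)[OF x t z(2) h]] germ_source_germ[OF twisted_loop(1)[OF x t z(2) a(1)]] by simp
    have "germ (t @ loop x n h) z \<in> B \<longleftrightarrow> germ (t @ loop x n h) z = germ (t @ loop x n a) z"
      using inj_onD[OF inj src _ aB] aB by auto
    then show ?thesis using twisted_loop_eq_iff[OF x t z(2) h a(1)] by simp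
  qed
  then show ?thesis by blast
qed

text \<open>
  Suppose that translated loops meet the basic set over paths arbitrarily close to \<open>x\<close>. Then the two
  words change lengths by the same amount and have, by continuity, the same value at \<open>x\<close>. So their readings at \<open>x\<close> differ
  by a group element that fixes the tail of \<open>x\<close>, and this element exhibits a translated loop at \<open>x\<close> in
  the basic set.
\<close>

lemma basic_away_from_isotropy:
  assumes ok: "basic_ok y k v" and x: "x \<in> inf_paths" and t: "basic_ok t n x" and h: "h \<in> stab x n"
    and none: "\<And>m g. g \<in> stab x m \<Longrightarrow> n \<le> m \<Longrightarrow> germ (t @ loop x m g) x \<notin> basic y k v"
  shows "\<exists>N. \<forall>z\<in>nbhd N x. z \<in> nbhd n x \<longrightarrow> germ (t @ loop x n h) z \<notin> basic y k v"
proof (cases "x \<in> nbhd k v")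
  case False
  have "germ (t @ loop x n h) z \<notin> basic y k v" if z: "z \<in> nbhd k x" "z \<in> nbhd n x" for z
  proof -
    have "z \<notin> nbhd k v" using False z(1) x by (auto simp: in_nbhd)
    moreover have "h \<in> carrier (G (vertex_at x n))" using h by (simp add: stab_def)
    ultimately show ?thesis using germ_in_basic[OF ok twisted_loop(1)[OF x t z(2)]] by blast
  qed
  then show ?thesis by blast
next
  case True
  have hc: "h \<in> carrier (G (vertex_at x n))" and hx: "app (loop x n h) x = x" using h by (auto simp: stab_def)
  have y: "defined_at y x" using ok True by (simp add: basic_ok_def)
  note dy = defined_atD[OF y]
  let ?s = "t @ loop x n h"
  have s: "defined_at ?s x" by (rule twisted_loop(1)[OF x t nbhd_self[OF x] hc])
  note ds = defined_atD[OF s]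
  show ?thesis
  proof (rule ccontr)
    assume neg: "\<not> ?thesis"
    have near: "\<exists>z\<in>nbhd N x. agree ?s y z" for N
    proof -
      obtain z where z: "z \<in> nbhd N x" "z \<in> nbhd n x" "germ ?s z \<in> basic y k v" using neg by blast
      then show ?thesis using germ_in_basic[OF ok twisted_loop(1)[OF x t z(2) hc]] by blast
    qed
    have deg: "word_deg ?s = word_deg y"
    proof -
      obtain z m p g where z: "z \<in> nbhd 0 x" "reads ?s z m p g" "reads y z m p g" using near[of 0] by (auto simp: agree_def)
      have zp: "z \<in> inf_paths" using z(1) by (simp add: in_nbhd)
      show ?thesis using reads_facts(3)[OF zp ds(1) z(2)] reads_facts(3)[OF zp dy(1) z(3)] by simp
    qed
    have app_eq: "app ?s x = app y x"
    proof (rule stream_eq_by_prefixes[of 0])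
      fix M
      obtain N1 where N1: "\<And>z. z \<in> nbhd N1 x \<Longrightarrow> app ?s z \<in> nbhd M (app ?s x)" using app_continuous[OF s] by metis
      obtain N2 where N2: "\<And>z. z \<in> nbhd N2 x \<Longrightarrow> app y z \<in> nbhd M (app y x)" using app_continuous[OF y] by metis
      obtain z where z: "z \<in> nbhd (max N1 N2) x" "agree ?s y z" using near by blast
      have "z \<in> nbhd N1 x" "z \<in> nbhd N2 x" "z \<in> inf_paths"
        using z(1) nbhd_antimono[of N1 "max N1 N2" x] nbhd_antimono[of N2 "max N1 N2" x] by (auto simp: in_nbhd)
      then have "stake M (app ?s z) = stake M (app ?s x)" "stake M (app y z) = stake M (app y x)" "app ?s z = app y z"
        using N1[of z] N2[of z] agree_app[OF z(2) _ ds(1) dy(1)] by (auto simp: in_nbhd)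
      then show "stake M (app ?s x) = stake M (app y x)" by simp
    qed
    obtain m0 p0 k0 where r0: "reads ?s x m0 p0 k0" using s by (auto simp: defined_at_def)
    obtain m p2 k2 where m: "m \<ge> max m0 n" "reads y x m p2 k2" using reads_ge[OF y, of "max m0 n"] by blast
    have "m0 \<le> m" using m(1) by simp
    then obtain p1 k1 where r1: "reads ?s x m p1 k1" using reads_mono[OF ds(2,1) r0] by blast
    have len: "length p1 = length p2"
      using reads_facts(3)[OF x ds(1) r1] reads_facts(3)[OF x dy(1) m(2)] deg by simp
    note a1 = app_props[OF x ds(1) r1] and a2 = app_props[OF x dy(1) m(2)]
    have p: "p1 = p2" using a1(2) a2(2) unfolding app_eq len by (rule box_equals[OF HOL.refl])
    let ?G = "G (vertex_at x m)" and ?w = "sdrop m x"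
    have vm: "vertex_at x m \<in> verts E" using vertex_at_verts[OF x] .
    have w: "?w \<in> inf_paths" using inf_paths_sdrop[OF x] .
    have k: "k1 \<in> carrier ?G" "k2 \<in> carrier ?G"
      using reads_facts(1)[OF x ds(1) r1] reads_facts(1)[OF x dy(1) m(2)] by (auto simp: vertex_at_def)
    have same: "inf_act (vertex_at x m) k1 ?w = inf_act (vertex_at x m) k2 ?w"
      using a1(4) a2(4) app_eq p by (simp add: vertex_at_def)
    \<comment> \<open>The element by which the two readings at \<open>x\<close> differ.\<close>
    let ?g = "inv\<^bsub>?G\<^esub> k1 \<otimes>\<^bsub>?G\<^esub> k2"
    have g: "?g \<in> carrier ?G" and ki: "inv\<^bsub>?G\<^esub> k1 \<in> carrier ?G" using k vm by auto
    have "inf_act (vertex_at x m) ?g ?w = ?w"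
      using inf_act_mult[OF w, of "inv\<^bsub>?G\<^esub> k1" k2] inf_act_inv[OF w, of k1] same k ki by (simp add: vertex_at_def)
    then have gx: "app (loop x m ?g) x = x" using loop_defined(3)[OF x g nbhd_self[OF x]] by (simp add: stake_sdrop)
    have gs: "?g \<in> stab x m" using g gx by (simp add: stab_def)
    have "k1 \<otimes>\<^bsub>?G\<^esub> ?g = k2" using k vm by (simp flip: G_assoc)
    then have "reads (?s @ loop x m ?g) x m p2 k2"
      using reads_append[OF loop_words[OF x g] ds(1) x loop_reads[OF x g nbhd_self[OF x]], of p2 k2] gx r1 p
      by (auto simp: vertex_at_def)
    then have 1: "agree (?s @ loop x m ?g) y x" using m(2) unfolding agree_def by blast
    have nm: "n \<le> m" using m(1) by simp
    obtain h' where h': "h' \<in> stab x m" "agree (loop x n h) (loop x m h') x" using loop_level[OF x h nm] by blast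
    have h'c: "h' \<in> carrier ?G" using h' by (simp add: stab_def)
    let ?k = "h' \<otimes>\<^bsub>?G\<^esub> ?g"
    have ks: "?k \<in> stab x m" using subgroup.m_closed[OF stab_subgroup[OF x] h'(1) gs] .
    then have kc: "?k \<in> carrier ?G" by (simp add: stab_def)
    note xm = nbhd_self[OF x, of m]
    note wl = loop_words[OF x]
    have wt: "t \<in> words" by (rule basic_ok_word[OF t])
    have dg: "defined_at (loop x m ?g) x" by (rule loop_defined(1)[OF x g xm])
    have 2: "agree (loop x n h @ loop x m ?g) (loop x m h' @ loop x m ?g) x"
      using agree_append_right[OF dg wl[OF hc] wl[OF h'c]] h'(2) gx by simp
    have 3: "agree (loop x n h @ loop x m ?g) (loop x m ?k) x"
      by (rule agree_trans[OF 2 loop_mult(1)[OF x h'c g xm] x words_append[OF wl[OF hc] wl[OF g]] words_append[OF wl[OF h'c] wl[OF g]] wl[OF kc]])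
    have dhg: "defined_at (loop x n h @ loop x m ?g) x" "app (loop x n h @ loop x m ?g) x = x"
      using defined_append[OF dg, of "loop x n h"] gx loop_defined(1)[OF x hc nbhd_self[OF x]] hx by auto
    have tx: "defined_at t x" using t nbhd_self[OF x] by (simp add: basic_ok_def)
    have 4: "agree (t @ loop x n h @ loop x m ?g) (t @ loop x m ?k) x"
      using agree_append_left[OF 3 dhg(1) wl[OF kc]] dhg(2) tx by simp
    have 5: "agree (t @ loop x m ?k) y x"
      using agree_trans[OF agree_sym[OF 4] _ x words_append[OF wt wl[OF kc]] words_append[OF wt words_append[OF wl[OF hc] wl[OF g]]] dy(1)] 1
      by simp
    have kx: "app (loop x m ?k) x = x" using ks by (simp add: stab_def)
    have dtk: "defined_at (t @ loop x m ?k) x"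
      using defined_append(1)[OF loop_defined(1)[OF x kc xm], of t] kx tx by simp
    have "germ (t @ loop x m ?k) x \<in> basic y k v"
      using germ_in_basic[OF ok dtk] True 5 by blast
    then show False using none[OF ks nm] by blast
  qed
qed

lemma twisted_loop_level:
  assumes x: "x \<in> inf_paths" and t: "defined_at t x" and g: "g \<in> stab x m" and mn: "m \<le> n"
  obtains g' where "g' \<in> stab x n" "germ (t @ loop x n g') x = germ (t @ loop x m g) x"
proof -
  obtain g' where g': "g' \<in> stab x n" "agree (loop x m g) (loop x n g') x" using loop_level[OF x g mn] by blast
  have gc: "g \<in> carrier (G (vertex_at x m))" "app (loop x m g) x = x" using g by (auto simp: stab_def)
  have g'c: "g' \<in> carrier (G (vertex_at x n))" "app (loop x n g') x = x" using g' by (auto simp: stab_def)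
  note l = loop_defined(1)[OF x gc(1) nbhd_self[OF x]] and l' = loop_defined(1)[OF x g'c(1) nbhd_self[OF x]]
  have d: "defined_at (t @ loop x m g) x" "defined_at (t @ loop x n g') x"
    using defined_append(1)[OF l, of t] defined_append(1)[OF l', of t] gc(2) g'c(2) t by auto
  have "agree (t @ loop x m g) (t @ loop x n g') x"
    using agree_append_left[OF g'(2) l loop_words[OF x g'c(1)]] t gc(2) by simp
  then have "germ (t @ loop x n g') x = germ (t @ loop x m g) x"
    using germ_eq_iff[OF d] by simp
  then show thesis using that g'(1) by blast
qed

lemma bisection_away_from_isotropy:
  assumes B: "compact_open_bisection B" and x: "x \<in> inf_paths" and t: "basic_ok t n x" and h: "h \<in> stab x n"
    and none: "\<And>m g. g \<in> stab x m \<Longrightarrow> n \<le> m \<Longrightarrow> germ (t @ loop x m g) x \<notin> B"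
  shows "\<exists>N. \<forall>z\<in>nbhd N x. z \<in> nbhd n x \<longrightarrow> germ (t @ loop x n h) z \<notin> B"
proof -
  obtain R where R: "finite R" "\<And>y k v. (y, k, v) \<in> R \<Longrightarrow> basic_ok y k v" "B = (\<Union>(y, k, v)\<in>R. basic y k v)"
    using compact_open_bisection_finite_union[OF B] by metis
  have "\<exists>N. \<forall>z\<in>nbhd N x. \<forall>r\<in>R. z \<in> nbhd n x \<longrightarrow> germ (t @ loop x n h) z \<notin> (case r of (y, k, v) \<Rightarrow> basic y k v)"
  proof (rule finite_common_nbhd[OF R(1)])
    fix r assume r: "r \<in> R"
    obtain y k v where r_eq: "r = (y, k, v)" by (cases r) auto
    have sub: "basic y k v \<subseteq> B" unfolding R(3) using r r_eq by blast
    have "\<exists>N. \<forall>z\<in>nbhd N x. z \<in> nbhd n x \<longrightarrow> germ (t @ loop x n h) z \<notin> basic y k v"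
    proof (rule basic_away_from_isotropy[OF _ x t h])
      show "basic_ok y k v" using R(2) r r_eq by blast
      show "germ (t @ loop x m g) x \<notin> basic y k v" if "g \<in> stab x m" "n \<le> m" for m g
        using none[OF that] sub by blast
    qed
    then show "\<exists>N. \<forall>z\<in>nbhd N x. z \<in> nbhd n x \<longrightarrow> germ (t @ loop x n h) z \<notin> (case r of (y, k, v) \<Rightarrow> basic y k v)"
      unfolding r_eq by simp
  qed
  then obtain N where N: "\<And>z r. z \<in> nbhd N x \<Longrightarrow> r \<in> R \<Longrightarrow> z \<in> nbhd n x \<Longrightarrow>
    germ (t @ loop x n h) z \<notin> (case r of (y, k, v) \<Rightarrow> basic y k v)" by blast
  have "\<forall>z\<in>nbhd N x. z \<in> nbhd n x \<longrightarrow> germ (t @ loop x n h) z \<notin> B"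
    unfolding R(3) UN_iff using N by blast
  then show ?thesis by blast
qed

text \<open>
  The bisections that contain a translated loop at \<open>x\<close> are the index set \<open>F\<close>, and by \<open>loop_level\<close> one
  level \<open>n\<close> serves all of them. The other bisections miss the translated loops near \<open>x\<close>.
\<close>

lemma steinberg_near_point:
  assumes b: "b \<in> steinberg" and t: "defined_at t x"
  obtains n and F :: "('v, 'e, 'g) germ set set" and c :: "('v, 'e, 'g) germ set \<Rightarrow> complex" and a
  where "basic_ok t n x" "finite F" "\<And>i. i \<in> F \<Longrightarrow> a i \<in> stab x n"
    "\<And>h. h \<in> stab x n \<Longrightarrow> \<exists>N. \<forall>z\<in>nbhd N x. z \<in> nbhd n x \<longrightarrow> b (germ (t @ loop x n h) z)
      = (\<Sum>i\<in>F. if germ (loop x n h) z = germ (loop x n (a i)) z then c i else 0)"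
proof -
  have x: "x \<in> inf_paths" using t defined_atD by blast
  obtain F0 c where F0: "b = (\<lambda>\<gamma>. \<Sum>B\<in>F0. c B * indicator B \<gamma>)" "finite F0" "\<And>B. B \<in> F0 \<Longrightarrow> compact_open_bisection B"
    using b unfolding steinberg_def by blast
  obtain n0 where n0: "\<And>z. z \<in> nbhd n0 x \<Longrightarrow> defined_at t z" using app_continuous[OF t] by metis
  define meets where "meets B m \<longleftrightarrow> n0 \<le> m \<and> (\<exists>g\<in>stab x m. germ (t @ loop x m g) x \<in> B)" for B m
  define F where "F = {B\<in>F0. \<exists>m. meets B m}"
  have F: "finite F" "F \<subseteq> F0" using F0(2) by (auto simp: F_def)
  define lev where "lev B = (SOME m. meets B m)" for B
  have lev: "meets B (lev B)" if "B \<in> F" for B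
    using that someI_ex[of "meets B"] by (auto simp: F_def lev_def)
  \<comment> \<open>Any level above \<open>n0\<close> and above all \<open>lev B\<close> would do.\<close>
  define n where "n = n0 + (\<Sum>B\<in>F. lev B)"
  have n_ge: "lev B \<le> n" if "B \<in> F" for B
    using member_le_sum[of B F lev] that F(1) by (simp add: n_def)
  have ok: "basic_ok t n x"
    unfolding basic_ok_def using x n0 nbhd_antimono[of n0 n x] by (auto simp: n_def)
  have ex: "\<exists>g. g \<in> stab x n \<and> germ (t @ loop x n g) x \<in> B" if B: "B \<in> F" for B
  proof -
    obtain g where g: "g \<in> stab x (lev B)" "germ (t @ loop x (lev B) g) x \<in> B" using lev[OF B] by (auto simp: meets_def)
    obtain g' where "g' \<in> stab x n" "germ (t @ loop x n g') x = germ (t @ loop x (lev B) g) x"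
      using twisted_loop_level[OF x t g(1) n_ge[OF B]] by blast
    then show ?thesis using g(2) by auto
  qed
  define a where "a B = (SOME g. g \<in> stab x n \<and> germ (t @ loop x n g) x \<in> B)" for B
  have a: "a B \<in> stab x n" "germ (t @ loop x n (a B)) x \<in> B" if "B \<in> F" for B
    using someI_ex[OF ex[OF that]] by (auto simp: a_def)
  have exp: "\<exists>N. \<forall>z\<in>nbhd N x. z \<in> nbhd n x \<longrightarrow> b (germ (t @ loop x n h) z)
      = (\<Sum>i\<in>F. if germ (loop x n h) z = germ (loop x n (a i)) z then c i else 0)" if h: "h \<in> stab x n" for h
  proof -
    let ?P = "\<lambda>B z. z \<in> nbhd n x \<longrightarrow> (germ (t @ loop x n h) z \<in> B \<longleftrightarrow> B \<in> F \<and> germ (loop x n h) z = germ (loop x n (a B)) z)"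
    have hc: "h \<in> carrier (G (vertex_at x n))" using h by (simp add: stab_def)
    have "\<exists>N. \<forall>z\<in>nbhd N x. \<forall>B\<in>F0. ?P B z"
    proof (rule finite_common_nbhd[OF F0(2)])
      fix B assume B: "B \<in> F0"
      show "\<exists>N. \<forall>z\<in>nbhd N x. ?P B z"
      proof (cases "B \<in> F")
        case True
        have ac: "a B \<in> carrier (G (vertex_at x n))" using a(1)[OF True] by (simp add: stab_def)
        show ?thesis using bisection_near_isotropy[OF F0(3)[OF B] x ok ac a(2)[OF True] hc] True by simp
      next
        case False
        have "germ (t @ loop x m g) x \<notin> B" if "g \<in> stab x m" "n \<le> m" for m g
          using False B that by (auto simp: F_def meets_def n_def)
        from bisection_away_from_isotropy[OF F0(3)[OF B] x ok h this] show ?thesis using False by simp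
      qed
    qed
    then obtain N where N: "\<And>z B. z \<in> nbhd N x \<Longrightarrow> B \<in> F0 \<Longrightarrow> ?P B z" by blast
    have "b (germ (t @ loop x n h) z) = (\<Sum>i\<in>F. if germ (loop x n h) z = germ (loop x n (a i)) z then c i else 0)"
      if z: "z \<in> nbhd N x" "z \<in> nbhd n x" for z
    proof -
      have "b (germ (t @ loop x n h) z)
        = (\<Sum>B\<in>F0. if B \<in> F \<and> germ (loop x n h) z = germ (loop x n (a B)) z then c B else 0)"
        unfolding F0(1) using N[OF z(1)] z(2) by (intro sum.cong) (auto simp: indicator_def)
      also have "\<dots> = (\<Sum>i\<in>F. if germ (loop x n h) z = germ (loop x n (a i)) z then c i else 0)"
        using F F0(2) by (intro sum.mono_neutral_cong_right) auto
      finally show ?thesis .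
    qed
    then show ?thesis by blast
  qed
  show thesis by (rule that[OF ok F(1) a(1) exp])
qed

lemma loop_shift:
  assumes x: "x \<in> inf_paths" and y: "y \<in> nbhd n x" and c: "p \<in> carrier (G (vertex_at x n))"
    "q \<in> carrier (G (vertex_at x n))" "g \<in> carrier (G (vertex_at x n))"
  shows "germ (loop x n p) (app (loop x n g) y) = germ (loop x n q) (app (loop x n g) y) \<longleftrightarrow>
    germ (loop x n (p \<otimes>\<^bsub>G (vertex_at x n)\<^esub> g)) y = germ (loop x n (q \<otimes>\<^bsub>G (vertex_at x n)\<^esub> g)) y"
proof -
  let ?G = "G (vertex_at x n)"
  note l = loop_defined(1)[OF x c(3) y] and z = loop_defined(2)[OF x c(3) y]
  have mult: "germ (loop x n (r \<otimes>\<^bsub>?G\<^esub> g)) y = germ_mult (germ (loop x n r) (app (loop x n g) y)) (germ (loop x n g) y)"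
    "defined_at (loop x n r @ loop x n g) y"
    "germ (loop x n (r \<otimes>\<^bsub>?G\<^esub> g)) y = germ (loop x n r @ loop x n g) y"
    if r: "r \<in> carrier ?G" for r
  proof -
    have rg: "r \<otimes>\<^bsub>?G\<^esub> g \<in> carrier ?G" using r c(3) vertex_at_verts[OF x] by simp
    note lr = loop_defined(1)[OF x r z]
    show d: "defined_at (loop x n r @ loop x n g) y" using defined_append(1)[OF l lr] .
    show e: "germ (loop x n (r \<otimes>\<^bsub>?G\<^esub> g)) y = germ (loop x n r @ loop x n g) y"
      using germ_eq_iff[OF d loop_defined(1)[OF x rg y]] loop_mult(1)[OF x r c(3) y] by simp
    show "germ (loop x n (r \<otimes>\<^bsub>?G\<^esub> g)) y = germ_mult (germ (loop x n r) (app (loop x n g) y)) (germ (loop x n g) y)"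
      using e germ_mult_germ[OF l lr] by simp
  qed
  have "germ (loop x n p) (app (loop x n g) y) = germ (loop x n q) (app (loop x n g) y) \<longleftrightarrow>
    agree (loop x n p) (loop x n q) (app (loop x n g) y)"
    using germ_eq_iff[OF loop_defined(1)[OF x c(1) z] loop_defined(1)[OF x c(2) z]] by simp
  also have "\<dots> \<longleftrightarrow> agree (loop x n p @ loop x n g) (loop x n q @ loop x n g) y"
    using agree_append_right[OF l loop_words[OF x c(1)] loop_words[OF x c(2)]] by simp
  also have "\<dots> \<longleftrightarrow> germ (loop x n (p \<otimes>\<^bsub>?G\<^esub> g)) y = germ (loop x n (q \<otimes>\<^bsub>?G\<^esub> g)) y"
    unfolding mult(3)[OF c(1)] mult(3)[OF c(2)] using germ_eq_iff[OF mult(2)[OF c(1)] mult(2)[OF c(2)]] by simp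
  finally show ?thesis .
qed

text \<open>
  Between loops and translated loops, the matrix of \<open>b\<close> is that of multiplication with \<open>\<Sum> c i \<cdot> a i\<close>.
\<close>

lemma matrix_near_point:
  fixes F :: "'i set" and c :: "'i \<Rightarrow> complex"
  assumes x: "x \<in> inf_paths" and t: "basic_ok t n x" and a: "\<And>i. i \<in> F \<Longrightarrow> a i \<in> stab x n"
    and near: "\<And>h. h \<in> stab x n \<Longrightarrow> \<exists>N. \<forall>z\<in>nbhd N x. z \<in> nbhd n x \<longrightarrow> b (germ (t @ loop x n h) z)
      = (\<Sum>i\<in>F. if germ (loop x n h) z = germ (loop x n (a i)) z then c i else 0)"
    and g: "g \<in> stab x n" and h: "h \<in> stab x n"
  shows "\<exists>M. \<forall>y\<in>nbhd M x. y \<in> nbhd n x \<longrightarrow> b (germ_div (germ (t @ loop x n h) y) (germ (loop x n g) y))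
    = (\<Sum>i\<in>F. if germ (loop x n h) y = germ (loop x n (a i \<otimes>\<^bsub>G (vertex_at x n)\<^esub> g)) y then c i else 0)"
proof -
  let ?G = "G (vertex_at x n)"
  let ?k = "h \<otimes>\<^bsub>?G\<^esub> inv\<^bsub>?G\<^esub> g"
  have v: "vertex_at x n \<in> verts E" using vertex_at_verts[OF x] .
  have gc: "g \<in> carrier ?G" "app (loop x n g) x = x" and hc: "h \<in> carrier ?G" using g h by (auto simp: stab_def)
  have ac: "a i \<in> carrier ?G" if "i \<in> F" for i using a[OF that] by (simp add: stab_def)
  have k: "?k \<in> stab x n"
    using subgroup.m_closed[OF stab_subgroup[OF x] h subgroup.m_inv_closed[OF stab_subgroup[OF x] g]] .
  have kc: "?k \<in> carrier ?G" "?k \<otimes>\<^bsub>?G\<^esub> g = h" using gc hc v by (auto simp: G_assoc)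
  obtain N where N: "\<forall>z\<in>nbhd N x. z \<in> nbhd n x \<longrightarrow> b (germ (t @ loop x n ?k) z)
      = (\<Sum>i\<in>F. if germ (loop x n ?k) z = germ (loop x n (a i)) z then c i else 0)" using near[OF k] by blast
  obtain M where M: "\<And>y. y \<in> nbhd M x \<Longrightarrow> app (loop x n g) y \<in> nbhd N (app (loop x n g) x)"
    using app_continuous[OF loop_defined(1)[OF x gc(1) nbhd_self[OF x]]] by metis
  have "b (germ_div (germ (t @ loop x n h) y) (germ (loop x n g) y))
    = (\<Sum>i\<in>F. if germ (loop x n h) y = germ (loop x n (a i \<otimes>\<^bsub>?G\<^esub> g)) y then c i else 0)"
    if y: "y \<in> nbhd M x" "y \<in> nbhd n x" for y
  proof -
    let ?z = "app (loop x n g) y"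
    have z: "?z \<in> nbhd N x" "?z \<in> nbhd n x" using M[OF y(1)] gc(2) loop_defined(2)[OF x gc(1) y(2)] by auto
    have "b (germ_div (germ (t @ loop x n h) y) (germ (loop x n g) y)) = b (germ (t @ loop x n ?k) ?z)"
      using twisted_div[OF x t y(2) gc(1) hc] by simp
    also have "\<dots> = (\<Sum>i\<in>F. if germ (loop x n ?k) ?z = germ (loop x n (a i)) ?z then c i else 0)" using N z by blast
    also have "\<dots> = (\<Sum>i\<in>F. if germ (loop x n h) y = germ (loop x n (a i \<otimes>\<^bsub>?G\<^esub> g)) y then c i else 0)"
      using loop_shift[OF x y(2) kc(1) ac gc(1)] kc(2) by (intro sum.cong) auto
    finally show ?thesis .
  qed
  then show ?thesis by blast
qed

abbreviation wprod :: "'e stream \<Rightarrow> nat \<Rightarrow> ('i \<Rightarrow> 'g) \<Rightarrow> 'i list \<Rightarrow> 'g" where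
  "wprod x n \<equiv> comm_group.word_prod (G (vertex_at x n))"

section \<open>From singular operators to singular functions\<close>

text \<open>
  Let \<open>\<Xi> j\<close> be the coefficients of the \<open>j\<close>-th power of \<open>\<phi> = \<Sum> c i \<cdot> a i\<close> modulo equality of germs at \<open>y\<close>.
  Applying \<open>b\<close> and translating back takes \<open>\<Xi> j\<close> to \<open>\<Xi> (j + 1)\<close>. Since \<open>T\<close> vanishes over the orbit of the
  generic path \<open>y\<close>, each such step multiplies the norm by at most \<open>\<epsilon>\<close>.
\<close>

lemma generic_character_bound:
  fixes F :: "'i set" and c :: "'i \<Rightarrow> complex"
  assumes T: "T \<in> singular_ideal" and b: "b \<in> steinberg" and dist: "dist_le T (reg_family b) \<epsilon>"
    and x: "x \<in> inf_paths" and t: "basic_ok t n x" and F: "finite F" and a: "\<And>i. i \<in> F \<Longrightarrow> a i \<in> carrier (G (vertex_at x n))"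
    and y: "generic y" "y \<in> nbhd n x"
    and mat: "\<And>j u u'. j < k \<Longrightarrow> u \<in> words_of F j \<Longrightarrow> u' \<in> words_of F (Suc j) \<Longrightarrow>
      b (germ_div (germ (t @ loop x n (wprod x n a u')) y) (germ (loop x n (wprod x n a u)) y))
      = (\<Sum>i\<in>F. if germ (loop x n (wprod x n a u')) y = germ (loop x n (wprod x n a (i # u))) y then c i else 0)"
    and \<psi>: "comm_group.unit_character (G (vertex_at x n)) H \<psi>" and aH: "\<And>i. i \<in> F \<Longrightarrow> a i \<in> H"
    and cl: "\<And>u u'. u \<in> words_of F k \<Longrightarrow> u' \<in> words_of F k \<Longrightarrow>
      germ (loop x n (wprod x n a u)) y = germ (loop x n (wprod x n a u')) y \<Longrightarrow> \<psi> (wprod x n a u) = \<psi> (wprod x n a u')"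
  shows "cmod (\<Sum>i\<in>F. c i * \<psi> (a i)) ^ (2 * k) \<le> real (k + 1) ^ card F * (\<epsilon>\<^sup>2) ^ k"
proof -
  let ?G = "G (vertex_at x n)"
  have v: "vertex_at x n \<in> verts E" using vertex_at_verts[OF x] .
  interpret A: comm_group ?G by (rule fibre_group[OF v])
  have yp: "y \<in> inf_paths" using y(2) by (simp add: in_nbhd)
  have TC: "T \<in> Cstar_red" using T by (simp add: singular_ideal_def)
  define e where "e g = germ (loop x n g) y" for g
  define s where "s g = germ (t @ loop x n g) y" for g
  \<comment> \<open>Translation by \<open>t\<close>, as a map on germs; it identifies the rows of the matrix with its columns.\<close>
  define \<tau> where "\<tau> \<beta> = germ_mult (germ t (germ_range \<beta>)) \<beta>" for \<beta>
  have \<tau>: "\<tau> (e g) = s g" if "g \<in> carrier ?G" for g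
    using twisted_loop(3)[OF x t y(2) that] by (simp add: \<tau>_def e_def s_def)
  have s_inj: "s g = s h \<longleftrightarrow> e g = e h" if "g \<in> carrier ?G" "h \<in> carrier ?G" for g h
    using twisted_loop_eq_iff[OF x t y(2) that] by (simp add: e_def s_def)
  have e_fib: "e g \<in> fibre y" if "g \<in> carrier ?G" for g
    using germ_in_fibre[OF loop_defined(1)[OF x that y(2)]] by (simp add: e_def)
  have s_fib: "s g \<in> fibre y" if "g \<in> carrier ?G" for g
    using germ_in_fibre[OF twisted_loop(1)[OF x t y(2) that]] by (simp add: s_def)
  have wc: "A.word_prod a u \<in> carrier ?G" if "u \<in> words_of F j" for u j
    using A.word_prod_subgroup[OF A.subgroup_self, of F a u] a that by (auto simp: words_of_def)
  define co where "co u = (\<Prod>i\<leftarrow>u. c i)" for u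
  define S where "S j = (\<lambda>u. e (A.word_prod a u)) ` words_of F j" for j
  define \<Xi> where "\<Xi> j \<eta> = (\<Sum>u\<in>words_of F j. if e (A.word_prod a u) = \<eta> then co u else 0)" for j \<eta>
  have S: "finite (S j)" "S j \<subseteq> fibre y" for j
    using finite_words_of[OF F] wc e_fib by (auto simp: S_def)
  have step: "\<Xi> (Suc j) \<eta> = (\<Sum>\<beta>\<in>S j. b (germ_div (\<tau> \<eta>) \<beta>) * \<Xi> j \<beta>)" if j: "j < k" and eta: "\<eta> \<in> S (Suc j)" for j \<eta>
  proof -
    obtain u' where u': "u' \<in> words_of F (Suc j)" "\<eta> = e (A.word_prod a u')" using eta by (auto simp: S_def)
    have "\<Xi> (Suc j) \<eta> = (\<Sum>i\<in>F. \<Sum>u\<in>words_of F j. if e (A.word_prod a (i # u)) = \<eta> then co (i # u) else 0)"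
      unfolding \<Xi>_def by (rule sum_words_of_Suc)
    also have "\<dots> = (\<Sum>u\<in>words_of F j. \<Sum>i\<in>F. if e (A.word_prod a (i # u)) = \<eta> then co (i # u) else 0)"
      by (rule sum.swap)
    also have "\<dots> = (\<Sum>u\<in>words_of F j. co u * b (germ_div (\<tau> \<eta>) (e (A.word_prod a u))))"
    proof (rule sum.cong[OF HOL.refl])
      fix u assume u: "u \<in> words_of F j"
      have "b (germ_div (\<tau> \<eta>) (e (A.word_prod a u))) = (\<Sum>i\<in>F. if e (A.word_prod a (i # u)) = \<eta> then c i else 0)"
        using mat[OF j u u'(1)] \<tau>[OF wc[OF u'(1)]] u'(2) by (simp add: e_def s_def eq_commute cong: if_cong)
      then show "(\<Sum>i\<in>F. if e (A.word_prod a (i # u)) = \<eta> then co (i # u) else 0)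
        = co u * b (germ_div (\<tau> \<eta>) (e (A.word_prod a u)))"
        by (simp add: sum_distrib_left co_def mult.commute if_distrib cong: if_cong)
    qed
    also have "\<dots> = (\<Sum>\<beta>\<in>S j. b (germ_div (\<tau> \<eta>) \<beta>) * \<Xi> j \<beta>)"
      unfolding S_def \<Xi>_def
      by (rule sum_over_classes[OF finite_words_of[OF F], where \<phi> = "\<lambda>\<beta>. b (germ_div (\<tau> \<eta>) \<beta>)"])
    finally show ?thesis .
  qed
  have \<tau>_inj: "inj_on \<tau> (S j)" for j
  proof (rule inj_onI)
    fix \<eta> \<eta>' assume "\<eta> \<in> S j" "\<eta>' \<in> S j" and eq: "\<tau> \<eta> = \<tau> \<eta>'"
    then obtain u u' where u: "u \<in> words_of F j" "\<eta> = e (A.word_prod a u)" "u' \<in> words_of F j" "\<eta>' = e (A.word_prod a u')"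
      by (auto simp: S_def)
    then show "\<eta> = \<eta>'" using eq \<tau>[OF wc[OF u(1)]] \<tau>[OF wc[OF u(3)]] s_inj[OF wc[OF u(1)] wc[OF u(3)]] by simp
  qed
  have bound: "j \<le> k \<Longrightarrow> (\<Sum>\<eta>\<in>S j. (cmod (\<Xi> j \<eta>))\<^sup>2) \<le> (\<epsilon>\<^sup>2) ^ j" for j
  proof (induction j)
    case 0
    show ?case by (simp add: S_def \<Xi>_def words_of_0 co_def)
  next
    case (Suc j)
    then have j: "j < k" by simp
    have "(\<Sum>\<eta>\<in>S (Suc j). (cmod (\<Xi> (Suc j) \<eta>))\<^sup>2)
      = (\<Sum>\<eta>\<in>S (Suc j). (cmod (\<Sum>\<beta>\<in>S j. b (germ_div (\<tau> \<eta>) \<beta>) * \<Xi> j \<beta>))\<^sup>2)"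
      using step[OF j] by (intro sum.cong) auto
    also have "\<dots> = (\<Sum>\<gamma>\<in>\<tau> ` S (Suc j). (cmod (\<Sum>\<beta>\<in>S j. b (germ_div \<gamma> \<beta>) * \<Xi> j \<beta>))\<^sup>2)"
      by (simp add: sum.reindex[OF \<tau>_inj] o_def)
    also have "\<dots> \<le> \<epsilon>\<^sup>2 * (\<Sum>\<beta>\<in>S j. (cmod (\<Xi> j \<beta>))\<^sup>2)"
    proof (rule compression_bound[OF TC b dist yp S])
      show "finite (\<tau> ` S (Suc j))" using S(1) by simp
      show "\<tau> ` S (Suc j) \<subseteq> fibre y" using \<tau> s_fib wc by (auto simp: S_def)
      fix \<gamma> \<beta> assume g: "\<gamma> \<in> \<tau> ` S (Suc j)" and be: "\<beta> \<in> S j"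
      have gf: "\<gamma> \<in> fibre y" using g \<tau> s_fib wc by (auto simp: S_def)
      have bf: "\<beta> \<in> fibre y" using be S(2) by blast
      obtain u where u: "u \<in> words_of F j" "\<beta> = e (A.word_prod a u)" using be by (auto simp: S_def)
      note l = loop_defined(1)[OF x wc[OF u(1)] y(2)]
      have "germ_range \<beta> = app (loop x n (A.word_prod a u)) y" using germ_range_germ[OF l] u(2) by (simp add: e_def)
      then have "generic (germ_range \<beta>)" using generic_app[OF y(1) l] by simp
      then show "j_map T (germ_div \<gamma> \<beta>) = 0"
        using singular_vanishes_over_generic[OF T] germ_div_props(1)[OF gf bf] by (simp add: fibre_def)
    qed
    also have "\<dots> \<le> \<epsilon>\<^sup>2 * (\<epsilon>\<^sup>2) ^ j" using Suc by (intro mult_left_mono) auto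
    finally show ?case by simp
  qed
  show ?thesis
  proof (rule A.character_growth_bound[OF \<psi> F aH])
    fix u u' assume u: "u \<in> words_of F k" "u' \<in> words_of F k" and eq: "e (A.word_prod a u) = e (A.word_prod a u')"
    show "\<psi> (A.word_prod a u) = \<psi> (A.word_prod a u')" by (rule cl[OF u eq[unfolded e_def]])
  next
    show "(\<Sum>\<eta>\<in>(\<lambda>u. e (A.word_prod a u)) ` words_of F k.
      (cmod (\<Sum>u\<in>words_of F k. if e (A.word_prod a u) = \<eta> then (\<Prod>i\<leftarrow>u. c i) else 0))\<^sup>2) \<le> (\<epsilon>\<^sup>2) ^ k"
      using bound[OF order_refl] unfolding S_def \<Xi>_def co_def .
  qed
qed

text \<open>
  The function is \<open>\<Prod> (1 - q)\<close>, each term being spread over the cylinder of the prefix of length \<open>M\<close>.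
  Over a generic path in the cylinder some \<open>q\<close> is trivial and the product vanishes; at \<open>x\<close> the character
  \<open>\<psi>\<close> detects it.
\<close>

lemma product_on_cylinder:
  assumes fin: "finite (arcs E)" and count: "countable words" and x: "x \<in> inf_paths"
    and \<psi>: "comm_group.unit_character (G (vertex_at x n)) H \<psi>"
    and triv: "trivial_at x n x \<subseteq> H" "\<And>g. g \<in> trivial_at x n x \<Longrightarrow> \<psi> g = 1"
    and Q: "finite Q" "Q \<subseteq> H" "\<And>q. q \<in> Q \<Longrightarrow> \<psi> q \<noteq> 1"
    and M: "n \<le> M" "\<And>y. generic y \<Longrightarrow> y \<in> nbhd M x \<Longrightarrow> Q \<inter> trivial_at x n y \<noteq> {}"
  obtains f where "f \<in> alg_singular_ideal" "f \<noteq> (\<lambda>_. 0)"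
proof -
  let ?G = "G (vertex_at x n)"
  have v: "vertex_at x n \<in> verts E" using vertex_at_verts[OF x] .
  interpret A: comm_group ?G by (rule fibre_group[OF v])
  have sub: "subgroup H ?G" using \<psi> by (simp add: A.unit_character_def)
  note Hc = subgroup.mem_carrier[OF sub]
  obtain qs where qs: "set qs = Q" using Q(1) finite_list by blast
  define L where "L = A.annihilator qs"
  have LH: "g \<in> H" if "(c, g) \<in> set L" for c g
    using A.annihilator_subgroup[OF sub _ that[unfolded L_def]] qs Q(2) by blast
  define Z where "Z g = basic (loop x n g) M x" for g
  have MN: "nbhd M x \<subseteq> nbhd n x" by (rule nbhd_antimono[OF M(1)])
  have ok: "basic_ok (loop x n g) M x" if "g \<in> carrier ?G" for g
    using loop_defined(1)[OF x that] MN x by (auto simp: basic_ok_def)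
  define f where "f = (\<lambda>\<gamma>. \<Sum>(c, g)\<leftarrow>L. c * indicator (Z g) \<gamma> :: complex)"
  have st: "f \<in> steinberg"
    unfolding f_def
  proof (rule steinberg_sum_list)
    fix c g assume "(c, g) \<in> set L"
    then show "compact_open_bisection (Z g)"
      unfolding Z_def by (rule compact_open_bisection_basic[OF fin ok[OF Hc[OF LH]]])
  qed
  have f_out: "f (germ s y) = 0" if s: "defined_at s y" and y: "y \<notin> nbhd M x" for s y
  proof -
    have "f (germ s y) = (\<Sum>(c, g)\<leftarrow>L. 0)"
      unfolding f_def
    proof (rule arg_cong[where f = sum_list], rule map_cong[OF HOL.refl])
      fix p assume p: "p \<in> set L"
      obtain c g where cg: "p = (c, g)" by (cases p)
      have "germ s y \<notin> Z g"
        unfolding Z_def using germ_in_basic[OF ok[OF Hc[OF LH]] s] p cg y by blast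
      then show "(case p of (c, g) \<Rightarrow> c * indicator (Z g) (germ s y)) = (case p of (c, g) \<Rightarrow> 0)" by (simp add: cg)
    qed
    also have "\<dots> = 0" by (induction L) auto
    finally show ?thesis .
  qed
  have f_in: "f (germ s y) = (\<Sum>(c, g)\<leftarrow>L. if germ (loop x n g) y = germ s y then c else 0)"
    if s: "defined_at s y" and y: "y \<in> nbhd M x" for s y
    unfolding f_def
  proof (rule arg_cong[where f = sum_list], rule map_cong[OF HOL.refl])
    fix p assume p: "p \<in> set L"
    obtain c g where cg: "p = (c, g)" by (cases p)
    have gc: "g \<in> carrier ?G" using Hc[OF LH] p cg by blast
    have yn: "y \<in> nbhd n x" using y MN by blast
    have "germ s y \<in> Z g \<longleftrightarrow> germ (loop x n g) y = germ s y"
      unfolding Z_def germ_in_basic[OF ok[OF gc] s] germ_eq_iff[OF loop_defined(1)[OF x gc yn] s]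
      using y agree_sym by blast
    then show "(case p of (c, g) \<Rightarrow> c * indicator (Z g) (germ s y)) = (case p of (c, g) \<Rightarrow> if germ (loop x n g) y = germ s y then c else 0)"
      by (simp add: cg)
  qed
  have "f \<in> alg_singular_ideal"
  proof (rule alg_singularI[OF count st])
    fix \<gamma> assume g: "\<gamma> \<in> germs" and gen: "generic (germ_source \<gamma>)"
    obtain s y where s: "defined_at s y" "\<gamma> = germ s y" using g germs_cases by blast
    have y: "generic y" using gen s germ_source_germ[OF s(1)] by simp
    show "f \<gamma> = 0"
    proof (cases "y \<in> nbhd M x")
      case False
      then show ?thesis using f_out[OF s(1)] s(2) by simp
    next
      case True
      then have yn: "y \<in> nbhd n x" using MN by blast
      obtain q where q: "q \<in> Q" "q \<in> trivial_at x n y" using M(2)[OF y True] by blast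
      have "(\<Sum>(c, g)\<leftarrow>A.annihilator qs. if germ (loop x n g) y = germ s y then c else 0) = 0"
      proof (rule A.annihilator_vanishes[OF trivial_at_subgroup[OF x yn] germ_loop_eq_iff[OF x _ _ yn] _ _ q(2)])
        show "set qs \<subseteq> carrier ?G" using qs Q(2) Hc by blast
        show "q \<in> set qs" using q qs by blast
      qed
      then show ?thesis using f_in[OF s(1) True] s(2) by (simp add: L_def)
    qed
  qed
  moreover have "f \<noteq> (\<lambda>_. 0)"
  proof -
    have cls: "\<psi> g = \<psi> h" if gh: "g \<in> H" "h \<in> H" "germ (loop x n g) x = germ (loop x n h) x" for g h
    proof -
      note c = Hc[OF gh(1)] Hc[OF gh(2)]
      have tr: "inv\<^bsub>?G\<^esub> g \<otimes>\<^bsub>?G\<^esub> h \<in> trivial_at x n x" using germ_loop_eq_iff[OF x c nbhd_self[OF x]] gh(3) by simp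
      have "g \<otimes>\<^bsub>?G\<^esub> (inv\<^bsub>?G\<^esub> g \<otimes>\<^bsub>?G\<^esub> h) = h" using c v by (simp flip: G_assoc)
      then have "\<psi> h = \<psi> g * \<psi> (inv\<^bsub>?G\<^esub> g \<otimes>\<^bsub>?G\<^esub> h)"
        using \<psi> gh(1) triv(1) tr unfolding A.unit_character_def by (metis subsetD)
      then show ?thesis using triv(2)[OF tr] by simp
    qed
    have qH: "set qs \<subseteq> H" using qs Q(2) by simp
    obtain \<eta> where \<eta>: "(\<Sum>(c, g)\<leftarrow>L. if germ (loop x n g) x = \<eta> then c else 0) \<noteq> 0"
      unfolding L_def
    proof (rule A.annihilator_nonzero[OF \<psi> qH, where e = "\<lambda>g. germ (loop x n g) x"])
      show "\<psi> q \<noteq> 1" if "q \<in> set qs" for q using Q(3) that qs by blast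
    qed (rule cls)
    have "\<exists>c g. (c, g) \<in> set L \<and> germ (loop x n g) x = \<eta>"
    proof (rule ccontr)
      assume no: "\<nexists>c g. (c, g) \<in> set L \<and> germ (loop x n g) x = \<eta>"
      have "(\<Sum>(c, g)\<leftarrow>L. if germ (loop x n g) x = \<eta> then c else 0) = (\<Sum>(c, g)\<leftarrow>L. 0)"
        using no by (intro arg_cong[where f = sum_list] map_cong[OF HOL.refl]) auto
      also have "\<dots> = 0" by (induction L) auto
      finally show False using \<eta> by simp
    qed
    then obtain c g where g: "(c, g) \<in> set L" "germ (loop x n g) x = \<eta>" by blast
    have "f \<eta> \<noteq> 0"
      using f_in[OF loop_defined(1)[OF x Hc[OF LH[OF g(1)]] nbhd_self[OF x]] nbhd_self[OF x]] \<eta> g(2) by simp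
    then show ?thesis by auto
  qed
  ultimately show thesis by (rule that)
qed

text \<open>
  The exponent \<open>k\<close> is chosen first. It involves only finitely many products of the \<open>a i\<close>, so there is a
  cylinder on which the local description of \<open>b\<close> holds for all of them.
\<close>

theorem singular_imp_alg_singular:
  assumes fin: "finite (arcs E)" and count: "countable words"
    and T: "T \<in> singular_ideal" "T \<noteq> zero_family"
  obtains f where "f \<in> alg_singular_ideal" "f \<noteq> (\<lambda>_. 0)"
proof -
  have TC: "T \<in> Cstar_red" using T by (simp add: singular_ideal_def)
  note Tb = Cstar_bounded[OF TC]
  obtain \<gamma> where \<gamma>: "\<gamma> \<in> germs" "j_map T \<gamma> \<noteq> 0" using Cstar_eq_zero[OF TC] T(2) by blast
  define \<epsilon> where "\<epsilon> = cmod (j_map T \<gamma>) / 3"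
  have \<epsilon>: "\<epsilon> > 0" using \<gamma>(2) by (simp add: \<epsilon>_def)
  obtain b where b: "b \<in> steinberg" "dist_le T (reg_family b) \<epsilon>" using TC \<epsilon> unfolding Cstar_red_def by blast
  have big: "2 * \<epsilon> \<le> cmod (b \<gamma>)"
  proof -
    have "cmod (j_map T \<gamma>) \<le> cmod (b \<gamma>) + cmod (j_map T \<gamma> - b \<gamma>)"
      using norm_triangle_ineq[of "b \<gamma>" "j_map T \<gamma> - b \<gamma>"] by simp
    moreover have "cmod (j_map T \<gamma>) = 3 * \<epsilon>" by (simp add: \<epsilon>_def)
    ultimately show ?thesis using j_map_dist[OF Tb b \<gamma>(1)] by linarith
  qed
  obtain t x where t: "defined_at t x" "\<gamma> = germ t x" using \<gamma>(1) germs_cases by blast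
  have x: "x \<in> inf_paths" using t defined_atD by blast
  obtain n and F :: "('v, 'e, 'g) germ set set" and c a where n: "basic_ok t n x" and F: "finite F"
    and a: "\<And>i. i \<in> F \<Longrightarrow> a i \<in> stab x n"
    and near: "\<And>h. h \<in> stab x n \<Longrightarrow> \<exists>N. \<forall>z\<in>nbhd N x. z \<in> nbhd n x \<longrightarrow> b (germ (t @ loop x n h) z)
      = (\<Sum>i\<in>F. if germ (loop x n h) z = germ (loop x n (a i)) z then c i else 0)"
    by (rule steinberg_near_point[OF b(1) t(1)]) (rule that)
  let ?G = "G (vertex_at x n)"
  have v: "vertex_at x n \<in> verts E" using vertex_at_verts[OF x] .
  interpret A: comm_group ?G by (rule fibre_group[OF v])
  note xn = nbhd_self[OF x, of n]
  have ac: "a i \<in> carrier ?G" if "i \<in> F" for i using a[OF that] by (simp add: stab_def)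
  have one_stab: "\<one>\<^bsub>?G\<^esub> \<in> stab x n" using subgroup.one_closed[OF stab_subgroup[OF x]] .
  have b_eq: "b \<gamma> = (\<Sum>i\<in>{i\<in>F. a i \<in> trivial_at x n x}. c i)"
  proof -
    have \<gamma>_eq: "germ (t @ loop x n \<one>\<^bsub>?G\<^esub>) x = \<gamma>"
      using germ_eq_iff[OF twisted_loop(1)[OF x n xn A.one_closed] t(1)] loop_one(2)[OF x xn t(1)] t(2) by simp
    obtain N where N: "\<forall>z\<in>nbhd N x. z \<in> nbhd n x \<longrightarrow> b (germ (t @ loop x n \<one>\<^bsub>?G\<^esub>) z)
      = (\<Sum>i\<in>F. if germ (loop x n \<one>\<^bsub>?G\<^esub>) z = germ (loop x n (a i)) z then c i else 0)"
      using near[OF one_stab] by (rule exE)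
    have "b \<gamma> = (\<Sum>i\<in>F. if germ (loop x n \<one>\<^bsub>?G\<^esub>) x = germ (loop x n (a i)) x then c i else 0)"
      using mp[OF bspec[OF N nbhd_self[OF x]] xn] unfolding \<gamma>_eq .
    also have "\<dots> = (\<Sum>i\<in>F. if a i \<in> trivial_at x n x then c i else 0)"
      using germ_loop_eq_iff[OF x A.one_closed ac xn] ac by (intro sum.cong) auto
    also have "\<dots> = (\<Sum>i\<in>{i\<in>F. a i \<in> trivial_at x n x}. c i)" by (rule sum.inter_filter[OF F, symmetric])
    finally show ?thesis .
  qed
  obtain H \<psi> where \<psi>: "A.unit_character H \<psi>" and triv: "trivial_at x n x \<subseteq> H" "\<And>g. g \<in> trivial_at x n x \<Longrightarrow> \<psi> g = 1"
    and aH: "\<And>i. i \<in> F \<Longrightarrow> a i \<in> H" and dom: "cmod (\<Sum>i\<in>{i\<in>F. a i \<in> trivial_at x n x}. c i) \<le> cmod (\<Sum>i\<in>F. c i * \<psi> (a i))"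
    by (rule A.dominating_character[OF trivial_at_subgroup[OF x xn] F, where x = a and c = c], erule ac) (rule that)
  have sub: "subgroup H ?G" using \<psi> by (simp add: A.unit_character_def)
  have large: "2 * \<epsilon> \<le> cmod (\<Sum>i\<in>F. c i * \<psi> (a i))" using big dom b_eq by simp
  \<comment> \<open>For this \<open>k\<close> the bound of \<open>generic_character_bound\<close> is smaller than \<open>(2 * \<epsilon>) ^ (2 * k)\<close>.\<close>
  obtain k where k: "real (k + 1) ^ card F < 4 ^ k" using polynomial_less_exponential by blast
  define U where "U = {u. set u \<subseteq> F \<and> length u \<le> k}"
  have U: "finite U" unfolding U_def by (rule finite_lists_length_le[OF F])
  have wU: "words_of F j \<subseteq> U" if "j \<le> k" for j using that by (auto simp: U_def words_of_def)
  let ?w = "A.word_prod a"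
  have w_stab: "?w u \<in> stab x n" and wH: "?w u \<in> H" if "u \<in> U" for u
    using A.word_prod_subgroup[OF stab_subgroup[OF x], of F a u] A.word_prod_subgroup[OF sub, of F a u] that a aH
    by (auto simp: U_def)
  have wc: "?w u \<in> carrier ?G" if "u \<in> U" for u using w_stab[OF that] by (simp add: stab_def)
  have "\<exists>M. \<forall>y\<in>nbhd M x. \<forall>p\<in>U \<times> U. y \<in> nbhd n x \<longrightarrow>
      b (germ_div (germ (t @ loop x n (?w (snd p))) y) (germ (loop x n (?w (fst p))) y))
      = (\<Sum>i\<in>F. if germ (loop x n (?w (snd p))) y = germ (loop x n (a i \<otimes>\<^bsub>?G\<^esub> ?w (fst p))) y then c i else 0)"
  proof (rule finite_common_nbhd)
    show "finite (U \<times> U)" using U by simp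
    fix p assume "p \<in> U \<times> U"
    then have p: "fst p \<in> U" "snd p \<in> U" by auto
    show "\<exists>M. \<forall>y\<in>nbhd M x. y \<in> nbhd n x \<longrightarrow>
      b (germ_div (germ (t @ loop x n (?w (snd p))) y) (germ (loop x n (?w (fst p))) y))
      = (\<Sum>i\<in>F. if germ (loop x n (?w (snd p))) y = germ (loop x n (a i \<otimes>\<^bsub>?G\<^esub> ?w (fst p))) y then c i else 0)"
      by (rule matrix_near_point[OF x n a near w_stab[OF p(1)] w_stab[OF p(2)]])
  qed
  then obtain M0 where M0: "\<And>y p. y \<in> nbhd M0 x \<Longrightarrow> p \<in> U \<times> U \<Longrightarrow> y \<in> nbhd n x \<Longrightarrow>
      b (germ_div (germ (t @ loop x n (?w (snd p))) y) (germ (loop x n (?w (fst p))) y))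
      = (\<Sum>i\<in>F. if germ (loop x n (?w (snd p))) y = germ (loop x n (a i \<otimes>\<^bsub>?G\<^esub> ?w (fst p))) y then c i else 0)"
    by blast
  define M where "M = max M0 n"
  \<comment> \<open>The elements that could identify two terms of \<open>\<phi>\<^sup>k\<close> on which \<open>\<psi>\<close> differs.\<close>
  define Q where "Q = {q \<in> (\<lambda>(u, u'). inv\<^bsub>?G\<^esub> (?w u) \<otimes>\<^bsub>?G\<^esub> ?w u') ` (U \<times> U). \<psi> q \<noteq> 1}"
  have Q: "finite Q" "Q \<subseteq> H" "\<And>q. q \<in> Q \<Longrightarrow> \<psi> q \<noteq> 1"
    using U wH subgroup.m_closed[OF sub] subgroup.m_inv_closed[OF sub] by (auto simp: Q_def)
  have meets: "Q \<inter> trivial_at x n y \<noteq> {}" if y: "generic y" "y \<in> nbhd M x" for y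
  proof
    assume empty: "Q \<inter> trivial_at x n y = {}"
    have yM: "y \<in> nbhd M0 x" "y \<in> nbhd n x"
      using y(2) nbhd_antimono[of M0 M x] nbhd_antimono[of n M x] by (auto simp: M_def)
    have "cmod (\<Sum>i\<in>F. c i * \<psi> (a i)) ^ (2 * k) \<le> real (k + 1) ^ card F * (\<epsilon>\<^sup>2) ^ k"
    proof (rule generic_character_bound[OF T(1) b x n F ac y(1) yM(2) _ \<psi> aH])
      fix j u u' assume j: "j < k" and u: "u \<in> words_of F j" "u' \<in> words_of F (Suc j)"
      have "(u, u') \<in> U \<times> U" using wU[of j] wU[of "Suc j"] j u by auto
      from M0[OF yM(1) this yM(2)]
      show "b (germ_div (germ (t @ loop x n (?w u')) y) (germ (loop x n (?w u)) y))
        = (\<Sum>i\<in>F. if germ (loop x n (?w u')) y = germ (loop x n (?w (i # u))) y then c i else 0)" by simp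
    next
      fix u u' assume u: "u \<in> words_of F k" "u' \<in> words_of F k" and eq: "germ (loop x n (?w u)) y = germ (loop x n (?w u')) y"
      have uU: "u \<in> U" "u' \<in> U" using wU[of k] u by auto
      let ?q = "inv\<^bsub>?G\<^esub> (?w u) \<otimes>\<^bsub>?G\<^esub> ?w u'"
      have "?q \<in> trivial_at x n y" using germ_loop_eq_iff[OF x wc[OF uU(1)] wc[OF uU(2)] yM(2)] eq by simp
      moreover have "?q \<in> (\<lambda>(u, u'). inv\<^bsub>?G\<^esub> (?w u) \<otimes>\<^bsub>?G\<^esub> ?w u') ` (U \<times> U)" using uU by auto
      ultimately have q1: "\<psi> ?q = 1" using empty by (auto simp: Q_def)
      have qH: "?q \<in> H" using subgroup.m_closed[OF sub subgroup.m_inv_closed[OF sub wH[OF uU(1)]] wH[OF uU(2)]] .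
      have "?w u \<otimes>\<^bsub>?G\<^esub> ?q = ?w u'" using wc uU v by (simp flip: G_assoc)
      then have "\<psi> (?w u') = \<psi> (?w u) * \<psi> ?q" using \<psi> wH[OF uU(1)] qH unfolding A.unit_character_def by metis
      then show "\<psi> (?w u) = \<psi> (?w u')" using q1 by simp
    qed
    also have "\<dots> < 4 ^ k * (\<epsilon>\<^sup>2) ^ k" using k \<epsilon> by (intro mult_strict_right_mono) auto
    also have "\<dots> = (2 * \<epsilon>) ^ (2 * k)" by (simp add: power_mult power_mult_distrib)
    also have "\<dots> \<le> cmod (\<Sum>i\<in>F. c i * \<psi> (a i)) ^ (2 * k)" using large \<epsilon> by (intro power_mono) auto
    finally show False by simp
  qed
  have "n \<le> M" by (simp add: M_def)
  from product_on_cylinder[OF fin count x \<psi> triv Q this meets]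
  show thesis using that by blast
qed

lemma countable_words:
  assumes "countable (arcs E)" "countable (verts E)" "\<And>v. v \<in> verts E \<Longrightarrow> countable (carrier (G v))"
  shows "countable words"
proof -
  have eq: "{Elt v g | v g. v \<in> verts E \<and> g \<in> carrier (G v)} = (\<Union>v\<in>verts E. Elt v ` carrier (G v))" by auto
  have "countable {Elt v g | v g. v \<in> verts E \<and> g \<in> carrier (G v)}"
    unfolding eq using assms by (intro countable_UN countable_image) auto
  then have "countable gens" unfolding gens_def using assms by simp
  then have "countable (lists gens)" by (rule countable_lists)
  moreover have "words \<subseteq> lists gens" unfolding words_def by auto
  ultimately show ?thesis by (rule countable_subset[rotated])
qed

lemma alg_singular_imp_singular:
  assumes f: "f \<in> alg_singular_ideal" shows "reg_family f \<in> singular_ideal"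
proof -
  have st: "f \<in> steinberg" and int: "germ_top interior_of supp f = {}" using f by (auto simp: alg_singular_ideal_def)
  have "supp (j_map (reg_family f)) = supp f" using j_map_reg_family[OF st] by (auto simp: supp_def)
  then show ?thesis using reg_family_Cstar[OF st] int by (simp add: singular_ideal_def)
qed

lemma steinberg_outside: "f \<in> steinberg \<Longrightarrow> \<gamma> \<notin> germs \<Longrightarrow> f \<gamma> = 0"
proof -
  assume f: "f \<in> steinberg" and g: "\<gamma> \<notin> germs"
  obtain F c where F: "f = (\<lambda>\<gamma>. \<Sum>B\<in>F. c B * indicator B \<gamma>)" "\<forall>B\<in>F. compact_open_bisection B"
    using f unfolding steinberg_def by blast
  have "\<gamma> \<notin> B" if "B \<in> F" for B
    using F(2) that g unfolding compact_open_bisection_def openin_germ_top_iff by blast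
  then show "f \<gamma> = 0" unfolding F(1) by (intro sum.neutral) auto
qed

lemma reg_family_zero: "reg_family (\<lambda>_. 0) = zero_family"
proof -
  have "reg (\<lambda>_. 0) x \<xi> = (\<lambda>_. 0)" for x \<xi> by (auto simp: reg_def)
  then show ?thesis by (simp add: reg_family_def zero_family_def)
qed

lemma zero_alg_singular: "(\<lambda>_. 0) \<in> alg_singular_ideal"
  using steinberg_zero by (simp add: alg_singular_ideal_def supp_def)

theorem singular_ideal_trivial_iff:
  assumes fin: "finite (arcs E)" and count: "countable words"
  shows "singular_ideal = {zero_family} \<longleftrightarrow> alg_singular_ideal = {\<lambda>_. 0}"
proof
  assume J: "singular_ideal = {zero_family}"
  have "f = (\<lambda>_. 0)" if f: "f \<in> alg_singular_ideal" for f
  proof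
    fix \<gamma>
    have st: "f \<in> steinberg" using f by (simp add: alg_singular_ideal_def)
    have eq: "reg_family f = reg_family (\<lambda>_. 0)" using alg_singular_imp_singular[OF f] J by (simp add: reg_family_zero)
    show "f \<gamma> = 0"
    proof (cases "\<gamma> \<in> germs")
      case True
      then show ?thesis using j_map_reg_family[OF st True] j_map_reg_family[OF steinberg_zero True] eq by simp
    next
      case False
      then show ?thesis by (rule steinberg_outside[OF st])
    qed
  qed
  then show "alg_singular_ideal = {\<lambda>_. 0}" using zero_alg_singular by blast
next
  assume J: "alg_singular_ideal = {\<lambda>_. 0}"
  have "T = zero_family" if "T \<in> singular_ideal" for T
    using singular_imp_alg_singular[OF fin count that] J by blast
  moreover have "zero_family \<in> singular_ideal"
    using alg_singular_imp_singular[OF zero_alg_singular] by (simp add: reg_family_zero)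
  ultimately show "singular_ideal = {zero_family}" by blast
qed

end

theorem theorem3p3:
  fixes E :: "('v, 'e) pre_digraph"
    and G :: "'v \<Rightarrow> 'g monoid"
    and act :: "'v \<Rightarrow> 'g \<Rightarrow> 'e list \<Rightarrow> 'e list"
    and sec :: "'g \<Rightarrow> 'e \<Rightarrow> 'g"
  assumes "fin_digraph E"
    and "\<forall>v\<in>verts E. in_arcs E v \<noteq> {}"
    and "self_similar_bundle E G act sec"
    and "\<forall>v\<in>verts E. countable (carrier (G v))"
  shows "self_similar_bundle.singular_ideal E G act sec
           = {self_similar_bundle.zero_family E G act sec}
     \<longleftrightarrow> self_similar_bundle.alg_singular_ideal E G act sec = {\<lambda>_. 0}"
proof -
  interpret self_similar_bundle E G act sec by fact
  interpret fin_digraph E by fact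
  have "countable words"
    by (rule countable_words) (use assms(4) in \<open>auto intro: countable_finite\<close>)
  then show ?thesis by (intro singular_ideal_trivial_iff) simp_all
qed

end
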